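(* The simplified extended bracket (arrow polynomial) $\mathcal{A}[K]$ is a polynomial in $A, A^{-1}$ and the graphical variables $K_{n}$ (of which finitely many appear for any given virtual knot or link). $\mathcal{A}[K]$ is a regular isotopy invariant of virtual knots and links. The normalized version $$\mathcal{W}[K]=(-A^{3})^{-wr(K)}\mathcal{A}[K]$$ is an invariant of virtual isotopy. If we set $A=1$ and $d=-A^{2}-A^{-2}=-2$, then the resulting specialization $$\mathcal{F}[K]=\mathcal{A}[K](A=1)$$ is an invariant of flat virtual knots and links.
   Context: Virtual links. An (oriented) virtual link diagram is a generic immersion of finitely many oriented circles in the plane in which each double point is either a classical crossing (with over/under information) or a virtual crossing. Virtual isotopy is generated by planar isotopy, the classical Reidemeister moves I, II, III, and detour moves: a segment containing only consecutive virtual crossings may be replaced by any other generic segment with the same endpoints all of whose crossings are virtual. Regular isotopy omits the first (classical) Reidemeister move. The writhe $wr(K)$ is the sum of the signs of the classical crossings. A flat virtual link diagram is a virtual link diagram whose classical crossings are replaced by flat crossings (undecorated double points); flat virtual links are flat diagrams modulo planar isotopy, the flat Reidemeister moves I, II, III (ignoring over/under information) and detour moves. That $\mathcal{F}[K]$ is an invariant of flat virtual links means it depends only on the flat virtual isotopy class of the diagram obtained from $K$ by forgetting over/under information. Arrow polynomial. Let $K$ be an oriented virtual link diagram. A state $S$ is obtained by choosing at each classical crossing either the oriented smoothing (joining incoming ends to outgoing ends compatibly with orientation) or the disoriented smoothing (joining the two outgoing ends by one arc and the two incoming ends by another; each of these two arcs carries a cusp where the orientation changes, the two cusps having their apexes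 facing each other). At a positive crossing the oriented smoothing has weight $A$ and the disoriented one weight $A^{-1}$; at a negative crossing the oriented smoothing has weight $A^{-1}$ and the disoriented one weight $A$. $\langle K|S\rangle$ is the product of the weights, $\|S\|$ is the number of loops (circle graphs) of $S$, and $d=-A^{2}-A^{-2}$. The pairing of the two cusps of a disoriented smoothing is forgotten, so a state is a disjoint union of circle graphs (loops) with cusps, taken up to planar isotopy and virtual detour moves. Each cusp is encoded by an arrow tangent to the loop, by the convention that a cusp pointing upward in the plane receives an arrow from left to right (and correspondingly for all rotations of the plane). Two cusps adjacent on a loop cancel (are both deleted) exactly when their arrows point in the same direction along the loop (equivalently, when their insides, i.e. their acute angles, lie on the same side of the segment connecting them); no cancellation is allowed when the arrows are opposed. After all cancellations each loop has a reduced form with an even number $2n$ of cusps whose arrows alternate in direction. Such a loop with $n\ge1$ is denoted by the commuting variable $K_{n}$, and a loop that reduces to one without cusps contributes $1$. $\mathcal{V}[S]$ is the product, over the loops of $S$, of these contributions. Then $$\mathcal{A}[K]=\sum_{S}\langle K|S\rangle\, d^{\|S\|-1}\,\mathcal{V}[S],$$ the sum over all states $S$ of $K$.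
   Formalization: F[K] itself changes sign under the flat Reidemeister move I (circle: 1, one-kink circle: -1), so the last claim is proved as: F is invariant under flat II, III, detours and planar isotopy, and (-1)^(number of flat crossings) F[K] is invariant under all flat moves. *)

theory Defs
  imports "HOL-Analysis.Analysis" "HOL-Library.Poly_Mapping"
begin

section \<open>Flat virtual and virtual link diagrams\<close>

text \<open>
  A diagram is a generic immersion of class C1 of the circles \<open>{i} \<times> S\<^sup>1\<close>, \<open>i < n\<close>, in the plane;
  the unit circle has its counterclockwise orientation. Some of the double points are
  marked as (flat or classical) crossings, and all the others are virtual crossings.
  A link diagram also records which of the two points of the circles lying over a classical
  crossing belongs to the overpassing strand. The value of \<open>curve\<close> is irrelevant outside
  \<open>circle_points\<close>.
\<close>

record flat_diagram =
  ncomp :: nat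
  curve :: "nat \<Rightarrow> complex \<Rightarrow> complex"
  crossings :: "complex set"

record link_diagram = flat_diagram +
  over :: "(nat \<times> complex) set"

definition flat :: "link_diagram \<Rightarrow> flat_diagram" where
  "flat D = flat_diagram.truncate D"

definition circle_points :: "('a) flat_diagram_scheme \<Rightarrow> (nat \<times> complex) set" where
  "circle_points D = {..<ncomp D} \<times> sphere 0 1"

definition pt :: "('a) flat_diagram_scheme \<Rightarrow> nat \<times> complex \<Rightarrow> complex" where
  "pt D p = curve D (fst p) (snd p)"

definition vel :: "('a) flat_diagram_scheme \<Rightarrow> nat \<times> complex \<Rightarrow> complex" where
  "vel D p = vector_derivative (\<lambda>\<theta>. curve D (fst p) (snd p * cis \<theta>)) (at 0)"

definition cross2 :: "complex \<Rightarrow> complex \<Rightarrow> real" where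
  "cross2 u v = Re u * Im v - Im u * Re v"

definition fiber :: "('a) flat_diagram_scheme \<Rightarrow> complex \<Rightarrow> (nat \<times> complex) set" where
  "fiber D z = {p \<in> circle_points D. pt D p = z}"

definition double_points :: "('a) flat_diagram_scheme \<Rightarrow> complex set" where
  "double_points D = {z. \<exists>p \<in> fiber D z. \<exists>q \<in> fiber D z. p \<noteq> q}"

definition immersed :: "('a) flat_diagram_scheme \<Rightarrow> bool" where
  "immersed D \<longleftrightarrow>
     (\<forall>i < ncomp D. (\<lambda>\<theta>. curve D i (cis \<theta>)) C1_differentiable_on UNIV) \<and>
     (\<forall>p \<in> circle_points D. vel D p \<noteq> 0)"

definition generic :: "('a) flat_diagram_scheme \<Rightarrow> bool" where
  "generic D \<longleftrightarrow>
     finite (double_points D) \<and>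
     (\<forall>z. finite (fiber D z) \<and> card (fiber D z) \<le> 2) \<and>
     (\<forall>p \<in> circle_points D. \<forall>q \<in> circle_points D.
        p \<noteq> q \<and> pt D p = pt D q \<longrightarrow> cross2 (vel D p) (vel D q) \<noteq> 0)"

definition is_flat_diagram :: "('a) flat_diagram_scheme \<Rightarrow> bool" where
  "is_flat_diagram D \<longleftrightarrow>
     1 \<le> ncomp D \<and> immersed D \<and> generic D \<and> crossings D \<subseteq> double_points D"

definition crossing_points :: "('a) flat_diagram_scheme \<Rightarrow> (nat \<times> complex) set" where
  "crossing_points D = {p \<in> circle_points D. pt D p \<in> crossings D}"

definition is_link_diagram :: "link_diagram \<Rightarrow> bool" where
  "is_link_diagram D \<longleftrightarrow>
     is_flat_diagram D \<and> over D \<subseteq> crossing_points D \<and>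
     (\<forall>z \<in> crossings D. \<exists>!p. p \<in> fiber D z \<and> p \<in> over D)"

definition partner :: "('a) flat_diagram_scheme \<Rightarrow> nat \<times> complex \<Rightarrow> nat \<times> complex" where
  "partner D p = (THE q. q \<in> circle_points D \<and> q \<noteq> p \<and> pt D q = pt D p)"

definition over_point :: "link_diagram \<Rightarrow> complex \<Rightarrow> nat \<times> complex" where
  "over_point D z = (THE p. p \<in> fiber D z \<and> p \<in> over D)"

text \<open>
  A crossing is positive if the overpassing direction has to be turned counterclockwise
  (by less than a half-turn) to obtain the underpassing one.
\<close>

definition crossing_sign :: "link_diagram \<Rightarrow> complex \<Rightarrow> int" where
  "crossing_sign D z =
     (let p = over_point D z in if 0 < cross2 (vel D p) (vel D (partner D p)) then 1 else -1)"

definition writhe :: "link_diagram \<Rightarrow> int" where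
  "writhe D = (\<Sum>z \<in> crossings D. crossing_sign D z)"


section \<open>Isotopy\<close>

subsection \<open>Planar isotopy\<close>

definition plane_isotopy :: "(real \<Rightarrow> complex \<Rightarrow> complex) \<Rightarrow> bool" where
  "plane_isotopy H \<longleftrightarrow>
     H 0 = id \<and> (\<forall>t \<in> {0..1}. bij (H t)) \<and>
     continuous_on ({0..1} \<times> UNIV) (\<lambda>(t, z). H t z) \<and>
     (\<exists>H'. (\<forall>t \<in> {0..1}. \<forall>z. (H t has_derivative H' t z) (at z) \<and> bij (H' t z)) \<and>
           (\<forall>v. continuous_on ({0..1} \<times> UNIV) (\<lambda>(t, z). H' t z v)))"

text \<open>
  Components are neither ordered nor parametrized: \<open>\<Phi>\<close> is an orientation-preserving
  diffeomorphism of \<open>{..<n} \<times> S\<^sup>1\<close>, given by a permutation of the components and a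
  lift to the line of a diffeomorphism of each circle.
\<close>

definition reparametrization :: "nat \<Rightarrow> (nat \<times> complex \<Rightarrow> nat \<times> complex) \<Rightarrow> bool" where
  "reparametrization n \<Phi> \<longleftrightarrow>
     (\<exists>\<pi> \<rho>. bij_betw \<pi> {..<n} {..<n} \<and>
        (\<forall>i < n. \<rho> i C1_differentiable_on UNIV \<and>
           (\<forall>\<theta>::real. 0 < vector_derivative (\<rho> i) (at \<theta>) \<and>
              \<rho> i (\<theta> + 2 * pi) = \<rho> i \<theta> + 2 * pi \<and>
              \<Phi> (i, cis \<theta>) = (\<pi> i, cis (\<rho> i \<theta>)))))"

definition flat_planar_isotopy ::
  "('a) flat_diagram_scheme \<Rightarrow> ('a) flat_diagram_scheme \<Rightarrow> (nat \<times> complex \<Rightarrow> nat \<times> complex) \<Rightarrow> bool"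
where
  "flat_planar_isotopy D D' \<Phi> \<longleftrightarrow>
     ncomp D' = ncomp D \<and> reparametrization (ncomp D) \<Phi> \<and>
     (\<exists>H. plane_isotopy H \<and>
        (\<forall>p \<in> circle_points D'. pt D' p = H 1 (pt D (\<Phi> p))) \<and>
        crossings D' = H 1 ` crossings D)"

definition planar_isotopy :: "link_diagram \<Rightarrow> link_diagram \<Rightarrow> bool" where
  "planar_isotopy D D' \<longleftrightarrow>
     (\<exists>\<Phi>. flat_planar_isotopy D D' \<Phi> \<and> over D' = {p \<in> circle_points D'. \<Phi> p \<in> over D})"

subsection \<open>Detour moves\<close>

definition is_segment :: "nat \<Rightarrow> (real \<Rightarrow> nat \<times> complex) \<Rightarrow> bool" where
  "is_segment n s \<longleftrightarrow>
     continuous_on {-1..1} s \<and> inj_on s {-1..1} \<and> s ` {-1..1} \<subseteq> {..<n} \<times> sphere 0 1"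

text \<open>
  The segment \<open>s\<close> may be moved arbitrarily, as long as it meets no classical crossing
  before and after; genericity of the new position is part of the requirement, made below,
  that the result be a diagram. Its endpoints are fixed by continuity.
\<close>

definition flat_detour :: "('a) flat_diagram_scheme \<Rightarrow> ('a) flat_diagram_scheme \<Rightarrow> bool" where
  "flat_detour D D' \<longleftrightarrow>
     ncomp D' = ncomp D \<and> crossings D' = crossings D \<and>
     (\<exists>s. is_segment (ncomp D) s \<and>
        (\<forall>x \<in> {-1..1}. pt D (s x) \<notin> crossings D \<and> pt D' (s x) \<notin> crossings D') \<and>
        (\<forall>p \<in> circle_points D - s ` {-1..1}. pt D' p = pt D p))"

definition detour :: "link_diagram \<Rightarrow> link_diagram \<Rightarrow> bool" where
  "detour D D' \<longleftrightarrow> flat_detour D D' \<and> over D' = over D"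

subsection \<open>Reidemeister moves\<close>

text \<open>
  Up to planar isotopy each Reidemeister move takes place in the square \<open>box\<close>, and each
  side of the moves II and III (and the trivial side of the move I) consists there of
  graphs of functions over the interval from -1 to 1: the \<open>k\<close>-th strand,
  parametrized by the first coordinate, is \<open>s k\<close> and is the graph of \<open>F k\<close>. It may be
  oriented in either direction.
\<close>

definition box :: "complex set" where
  "box = {z. \<bar>Re z\<bar> \<le> 1 \<and> \<bar>Im z\<bar> \<le> 1}"

definition strand_points :: "nat \<Rightarrow> (nat \<Rightarrow> real \<Rightarrow> nat \<times> complex) \<Rightarrow> (nat \<times> complex) set" where
  "strand_points m s = (\<Union>k<m. s k ` {-1..1})"

definition graph_strands ::
  "('a) flat_diagram_scheme \<Rightarrow> nat \<Rightarrow> (nat \<Rightarrow> real \<Rightarrow> nat \<times> complex) \<Rightarrow> (nat \<Rightarrow> real \<Rightarrow> real) \<Rightarrow> bool"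
where
  "graph_strands D m s F \<longleftrightarrow>
     (\<forall>k < m. is_segment (ncomp D) (s k) \<and> F k differentiable_on {-1..1} \<and>
        (\<forall>x \<in> {-1..1}. \<bar>F k x\<bar> < 1 \<and> pt D (s k x) = Complex x (F k x))) \<and>
     inj_on (\<lambda>(k, x). s k x) ({..<m} \<times> {-1..1})"

text \<open>
  Outside of the strands the two diagrams agree and do not meet the box.
\<close>

definition agree_off_strands ::
  "('a) flat_diagram_scheme \<Rightarrow> ('a) flat_diagram_scheme \<Rightarrow> nat \<Rightarrow> (nat \<Rightarrow> real \<Rightarrow> nat \<times> complex) \<Rightarrow> bool"
where
  "agree_off_strands D D' m s \<longleftrightarrow>
     ncomp D' = ncomp D \<and>
     (\<forall>p \<in> circle_points D - strand_points m s. pt D' p = pt D p \<and> pt D p \<notin> box)"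

text \<open>
  Move I, creating a kink in a single strand; \<open>s 0 u\<close> and \<open>s 0 v\<close> are the two points
  lying over the new crossing.
\<close>

definition flat_R1 ::
  "('a) flat_diagram_scheme \<Rightarrow> ('a) flat_diagram_scheme \<Rightarrow>
   (nat \<Rightarrow> real \<Rightarrow> nat \<times> complex) \<Rightarrow> real \<Rightarrow> real \<Rightarrow> bool"
where
  "flat_R1 D D' s u v \<longleftrightarrow>
     (\<exists>F. graph_strands D 1 s F) \<and> agree_off_strands D D' 1 s \<and>
     (\<forall>x \<in> {-1<..<1}. pt D' (s 0 x) \<in> interior box) \<and>
     {(x, y). -1 \<le> x \<and> x < y \<and> y \<le> 1 \<and> pt D' (s 0 x) = pt D' (s 0 y)} = {(u, v)} \<and>
     crossings D' = insert (pt D' (s 0 u)) (crossings D)"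

text \<open>
  Move II, creating two crossings, lying over \<open>u\<close> and \<open>v\<close>, of the two strands.
\<close>

definition flat_R2 ::
  "('a) flat_diagram_scheme \<Rightarrow> ('a) flat_diagram_scheme \<Rightarrow>
   (nat \<Rightarrow> real \<Rightarrow> nat \<times> complex) \<Rightarrow> real \<Rightarrow> real \<Rightarrow> bool"
where
  "flat_R2 D D' s u v \<longleftrightarrow>
     (\<exists>F F'. graph_strands D 2 s F \<and> graph_strands D' 2 s F' \<and>
        (\<forall>x \<in> {-1..1}. F 0 x < F 1 x) \<and>
        u < v \<and> {x \<in> {-1..1}. F' 0 x = F' 1 x} = {u, v}) \<and>
     agree_off_strands D D' 2 s \<and>
     crossings D' = {pt D' (s 0 u), pt D' (s 0 v)} \<union> crossings D"

text \<open>
  Move III; the strands \<open>k\<close> and \<open>l\<close> (for \<open>k < l < 3\<close>) cross over \<open>x k l\<close> before and over \<open>y k l\<close>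
  after the move.
\<close>

definition flat_R3 ::
  "('a) flat_diagram_scheme \<Rightarrow> ('a) flat_diagram_scheme \<Rightarrow>
   (nat \<Rightarrow> real \<Rightarrow> nat \<times> complex) \<Rightarrow> (nat \<Rightarrow> nat \<Rightarrow> real) \<Rightarrow> (nat \<Rightarrow> nat \<Rightarrow> real) \<Rightarrow> bool"
where
  "flat_R3 D D' s x y \<longleftrightarrow>
     (\<exists>F F'. graph_strands D 3 s F \<and> graph_strands D' 3 s F' \<and>
        F 0 (-1) < F 1 (-1) \<and> F 1 (-1) < F 2 (-1) \<and>
        (\<forall>l < 3. \<forall>k < l. {r \<in> {-1..1}. F k r = F l r} = {x k l} \<and>
                         {r \<in> {-1..1}. F' k r = F' l r} = {y k l}) \<and>
        x 0 1 < x 0 2 \<and> x 0 2 < x 1 2 \<and> y 1 2 < y 0 2 \<and> y 0 2 < y 0 1) \<and>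
     agree_off_strands D D' 3 s \<and>
     (\<forall>l < 3. \<forall>k < l. pt D (s k (x k l)) \<in> crossings D \<and> pt D' (s k (y k l)) \<in> crossings D') \<and>
     crossings D' - box = crossings D - box"

definition R1 :: "link_diagram \<Rightarrow> link_diagram \<Rightarrow> bool" where
  "R1 D D' \<longleftrightarrow>
     (\<exists>s u v. flat_R1 D D' s u v \<and>
        (over D' = insert (s 0 u) (over D) \<or> over D' = insert (s 0 v) (over D)))"

definition R2 :: "link_diagram \<Rightarrow> link_diagram \<Rightarrow> bool" where
  "R2 D D' \<longleftrightarrow>
     (\<exists>s u v. flat_R2 D D' s u v \<and> (\<exists>k < 2. over D' = {s k u, s k v} \<union> over D))"

text \<open>For move III, \<open>h\<close> gives the heights of the three strands.\<close>

definition R3 :: "link_diagram \<Rightarrow> link_diagram \<Rightarrow> bool" where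
  "R3 D D' \<longleftrightarrow>
     (\<exists>s x y h. flat_R3 D D' s x y \<and> inj_on (h :: nat \<Rightarrow> nat) {..<3} \<and>
        (\<forall>l < 3. \<forall>k < l.
           (s k (x k l) \<in> over D \<longleftrightarrow> h l < h k) \<and> (s l (x k l) \<in> over D \<longleftrightarrow> h k < h l) \<and>
           (s k (y k l) \<in> over D' \<longleftrightarrow> h l < h k) \<and> (s l (y k l) \<in> over D' \<longleftrightarrow> h k < h l)) \<and>
        over D' - strand_points 3 s = over D - strand_points 3 s)"

subsection \<open>The generated equivalence relations\<close>

definition regular_isotopic :: "link_diagram \<Rightarrow> link_diagram \<Rightarrow> bool" where
  "regular_isotopic = equivclp (\<lambda>D D'. is_link_diagram D \<and> is_link_diagram D' \<and>
     (planar_isotopy D D' \<or> detour D D' \<or> R2 D D' \<or> R3 D D'))"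

definition virtually_isotopic :: "link_diagram \<Rightarrow> link_diagram \<Rightarrow> bool" where
  "virtually_isotopic = equivclp (\<lambda>D D'. is_link_diagram D \<and> is_link_diagram D' \<and>
     (planar_isotopy D D' \<or> detour D D' \<or> R1 D D' \<or> R2 D D' \<or> R3 D D'))"

definition flat_regular_isotopic :: "flat_diagram \<Rightarrow> flat_diagram \<Rightarrow> bool" where
  "flat_regular_isotopic = equivclp (\<lambda>D D'. is_flat_diagram D \<and> is_flat_diagram D' \<and>
     ((\<exists>\<Phi>. flat_planar_isotopy D D' \<Phi>) \<or> flat_detour D D' \<or>
      (\<exists>s u v. flat_R2 D D' s u v) \<or> (\<exists>s x y. flat_R3 D D' s x y)))"

definition flat_isotopic :: "flat_diagram \<Rightarrow> flat_diagram \<Rightarrow> bool" where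
  "flat_isotopic = equivclp (\<lambda>D D'. is_flat_diagram D \<and> is_flat_diagram D' \<and>
     ((\<exists>\<Phi>. flat_planar_isotopy D D' \<Phi>) \<or> flat_detour D D' \<or>
      (\<exists>s u v. flat_R1 D D' s u v) \<or>
      (\<exists>s u v. flat_R2 D D' s u v) \<or> (\<exists>s x y. flat_R3 D D' s x y)))"


section \<open>States\<close>

text \<open>
  A state is given by the set \<open>S\<close> of the crossings that receive the disoriented smoothing.

  An end is a pair of a point \<open>p\<close> over a crossing and a truth value: \<open>(p, True)\<close> is the
  outgoing and \<open>(p, False)\<close> the incoming end at \<open>p\<close>. The arcs of the diagram between
  successive crossing points join an outgoing end to an incoming one; the smoothings join the
  ends at the crossings.
\<close>

type_synonym end_pt = "(nat \<times> complex) \<times> bool"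

definition ends :: "('a) flat_diagram_scheme \<Rightarrow> end_pt set" where
  "ends D = crossing_points D \<times> UNIV"

definition travel :: "nat \<times> complex \<Rightarrow> real \<Rightarrow> nat \<times> complex" where
  "travel p \<theta> = (fst p, snd p * cis \<theta>)"

definition next_point :: "('a) flat_diagram_scheme \<Rightarrow> nat \<times> complex \<Rightarrow> nat \<times> complex" where
  "next_point D p = travel p (LEAST \<theta>. 0 < \<theta> \<and> travel p \<theta> \<in> crossing_points D)"

fun arc_end :: "('a) flat_diagram_scheme \<Rightarrow> end_pt \<Rightarrow> end_pt" where
  "arc_end D (p, True) = (next_point D p, False)"
| "arc_end D (p, False) = (inv_into (crossing_points D) (next_point D) p, True)"

fun joined_end :: "('a) flat_diagram_scheme \<Rightarrow> complex set \<Rightarrow> end_pt \<Rightarrow> end_pt" where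
  "joined_end D S (p, b) = (partner D p, if pt D p \<in> S then b else \<not> b)"

definition same_loop :: "('a) flat_diagram_scheme \<Rightarrow> complex set \<Rightarrow> (end_pt \<times> end_pt) set" where
  "same_loop D S =
     {(x, y). equivclp (\<lambda>a b. a \<in> ends D \<and> (b = arc_end D a \<or> b = joined_end D S a)) x y}"

text \<open>
  Loops of the state that run through some crossing, as sets of ends. The circles without
  crossings are the remaining loops.
\<close>

definition loops :: "('a) flat_diagram_scheme \<Rightarrow> complex set \<Rightarrow> end_pt set set" where
  "loops D S = ends D // same_loop D S"

definition free_circles :: "('a) flat_diagram_scheme \<Rightarrow> nat set" where
  "free_circles D = {i. i < ncomp D \<and> crossing_points D \<inter> ({i} \<times> UNIV) = {}}"

definition num_loops :: "('a) flat_diagram_scheme \<Rightarrow> complex set \<Rightarrow> nat" where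
  "num_loops D S = card (loops D S) + card (free_circles D)"

subsection \<open>Cusps\<close>

text \<open>
  The direction in which the diagram leaves the crossing along an end. A cusp formed by
  two ends has these directions as directions of its two legs. When the apex points upward, the
  legs point downward, and the first leg is the left one iff \<open>cross2\<close> of the two leg directions
  is positive. So \<open>cusp\<close> tells whether the arrow points from the first end to the second.
\<close>

fun leg :: "('a) flat_diagram_scheme \<Rightarrow> end_pt \<Rightarrow> complex" where
  "leg D (p, b) = (if b then vel D p else - vel D p)"

definition cusp :: "('a) flat_diagram_scheme \<Rightarrow> complex set \<Rightarrow> end_pt \<Rightarrow> bool list" where
  "cusp D S x =
     (if pt D (fst x) \<in> S then [0 < cross2 (leg D x) (leg D (joined_end D S x))] else [])"

text \<open>
  Traversal of a loop, starting along the arc at the end \<open>x\<close>: each step runs along an arc and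
  then through the smoothing reached. The result lists, for the cusps met, whether their arrow
  agrees with the direction of traversal.
\<close>

definition step :: "('a) flat_diagram_scheme \<Rightarrow> complex set \<Rightarrow> end_pt \<Rightarrow> end_pt" where
  "step D S x = joined_end D S (arc_end D x)"

definition cusp_word :: "('a) flat_diagram_scheme \<Rightarrow> complex set \<Rightarrow> end_pt \<Rightarrow> bool list" where
  "cusp_word D S x =
     concat (map (\<lambda>k. cusp D S (arc_end D ((step D S ^^ k) x)))
                 [0..<(LEAST m. 0 < m \<and> (step D S ^^ m) x = x)])"

definition cusp_cancel :: "bool list \<Rightarrow> bool list \<Rightarrow> bool" where
  "cusp_cancel w w' \<longleftrightarrow> (\<exists>k b. rotate k w = b # b # w')"

definition cusp_reduced :: "bool list \<Rightarrow> bool" where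
  "cusp_reduced w \<longleftrightarrow> \<not> (\<exists>w'. cusp_cancel w w')"

text \<open>The number \<open>n\<close> such that the reduced form of the loop \<open>c\<close> has \<open>2n\<close> cusps.\<close>

definition loop_index :: "('a) flat_diagram_scheme \<Rightarrow> complex set \<Rightarrow> end_pt set \<Rightarrow> nat" where
  "loop_index D S c =
     (THE n. \<exists>x \<in> c. \<exists>w. cusp_cancel\<^sup>*\<^sup>* (cusp_word D S x) w \<and> cusp_reduced w \<and> length w = 2 * n)"


section \<open>The arrow polynomial\<close>

text \<open>
  Laurent polynomials in \<open>A\<close> with integer coefficients, and polynomials over them in the
  variables \<open>K\<^sub>n\<close>: a monomial is a finitely supported function assigning to \<open>n\<close> the
  exponent of \<open>K\<^sub>n\<close>.
\<close>

type_synonym laurent = "int \<Rightarrow>\<^sub>0 int"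
type_synonym arrow_poly = "(nat \<Rightarrow>\<^sub>0 nat) \<Rightarrow>\<^sub>0 laurent"

definition A_pow :: "int \<Rightarrow> arrow_poly" where
  "A_pow k = Poly_Mapping.single 0 (Poly_Mapping.single k 1)"

definition loop_value :: arrow_poly where
  "loop_value = - A_pow 2 - A_pow (-2)"

definition K_var :: "nat \<Rightarrow> arrow_poly" where
  "K_var n = (if n = 0 then 1 else Poly_Mapping.single (Poly_Mapping.single n 1) 1)"

definition K_indices :: "arrow_poly \<Rightarrow> nat set" where
  "K_indices p = (\<Union>m \<in> Poly_Mapping.keys p. Poly_Mapping.keys m)"

definition state_weight :: "link_diagram \<Rightarrow> complex set \<Rightarrow> arrow_poly" where
  "state_weight D S =
     (\<Prod>z \<in> crossings D. A_pow (if z \<in> S then - crossing_sign D z else crossing_sign D z))"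

definition state_vars :: "('a) flat_diagram_scheme \<Rightarrow> complex set \<Rightarrow> arrow_poly" where
  "state_vars D S = (\<Prod>c \<in> loops D S. K_var (loop_index D S c))"

definition arrow_polynomial :: "link_diagram \<Rightarrow> arrow_poly" where
  "arrow_polynomial D =
     (\<Sum>S \<in> Pow (crossings D).
        state_weight D S * loop_value ^ (num_loops D S - 1) * state_vars D S)"

text \<open>The power of \<open>- A\<^sup>3\<close> with exponent an integer; \<open>- A_pow (-3)\<close> is the inverse.\<close>

definition neg_A3_powi :: "int \<Rightarrow> arrow_poly" where
  "neg_A3_powi k = (if 0 \<le> k then (- A_pow 3) ^ nat k else (- A_pow (-3)) ^ nat (- k))"

definition normalized_arrow_polynomial :: "link_diagram \<Rightarrow> arrow_poly" where
  "normalized_arrow_polynomial D = neg_A3_powi (- writhe D) * arrow_polynomial D"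

text \<open>The substitution \<open>A = 1\<close>, which sends \<open>loop_value\<close> to -2.\<close>

definition laurent_at_one :: "laurent \<Rightarrow> int" where
  "laurent_at_one c = (\<Sum>k \<in> Poly_Mapping.keys c. Poly_Mapping.lookup c k)"

definition at_A_one :: "arrow_poly \<Rightarrow> ((nat \<Rightarrow>\<^sub>0 nat) \<Rightarrow>\<^sub>0 int)" where
  "at_A_one p = Poly_Mapping.map laurent_at_one p"

text \<open>
  As \<open>- A\<^sup>3\<close> becomes -1, adding a kink to a diagram changes the sign of the specialization.
  Exact invariance under the flat move I therefore needs the sign given by the parity of the
  number of crossings, which is the parity of the writhe.
\<close>

definition flat_arrow_polynomial :: "link_diagram \<Rightarrow> ((nat \<Rightarrow>\<^sub>0 nat) \<Rightarrow>\<^sub>0 int)" where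
  "flat_arrow_polynomial D = at_A_one (arrow_polynomial D)"

end

theory Submission
  imports Defs
begin

text \<open>
  A state of a diagram is generated by two involutions of the set of ends at the crossings: one runs along the arcs of the
  diagram, and the other passes through the smoothings. The first idea is a formula for the variable that a loop
  contributes. Reading the cusps along a loop, cancelling neighbours with arrows in the same direction does not change the
  alternating sum of the arrows, and in a reduced loop all terms of this sum agree. So twice the index of the loop is the
  absolute value of the alternating sum (\<open>alt_sum_reduced\<close>, \<open>cusp_cancels_invariant\<close>). Because the orientation of the
  diagram along the loop is reversed at every cusp, the alternating sum is half the total change, along the joins of the
  loop, of a function \<open>\<Theta>\<close> on the ends that jumps by 2 at the cusps; such a function is called a potential here, and the total
  change its holonomy (\<open>loop_index_hol\<close>). All contributions of a state are thus collected in the product \<open>loops_eval\<close> over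
  its loops.

  The second idea is that a potential may be altered by a constant at each crossing. In each Reidemeister move it can be
  chosen so that it is constant along the arcs inside the box, and so that it has the same values on the outer ends before
  and after the move. A loop inside the box then has holonomy 0 and contributes the factor \<open>d\<close>, and a path through the box
  can be replaced by a single join of its end points (\<open>loops_eval_contracted\<close>, \<open>tangle_eval\<close>). So each state of the box
  becomes a power of \<open>d\<close> times a matching of the outer ends, as for the Kauffman bracket, although loops may leave the box
  and carry cusps outside. The matchings are found by computation with finite lists. What remains for the three moves are
  identities between the weights: the factor \<open>A_pow \<sigma> * d + A_pow (- \<sigma>) = - A_pow (3 * \<sigma>)\<close> of a kink of sign \<open>\<sigma>\<close>, which the normalization
  compensates, the cancellation of three states in the second move, and the Yang-Baxter relation in the third one
  (\<open>bracket_R1\<close>, \<open>bracket_R2\<close>, \<open>bracket_R3\<close>).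

  The geometric input is the following. The sign of the pair of velocities at a crossing determines the arrows of the
  cusps and the sign of the crossing. For two strands that are graphs over the same interval it depends only on the
  directions of the strands and on which of them passes upward (\<open>eps_graphs\<close>). A planar isotopy preserves these signs,
  because its Jacobian determinant stays positive, and also the cyclic orders of the crossing points on the circles; a
  detour does not touch the crossings at all. A state sum is determined by these combinatorial data and the number of circles without
  crossings (\<open>bracket_iso\<close>).

  All this is carried out for a state sum \<open>bracket\<close> over an arbitrary commutative ring with arbitrary weights. The
  equations are proved after multiplication by the loop value \<open>d\<close>, since a state with \<open>n\<close> loops has the factor
  \<open>d\<close> to the power \<open>n - 1\<close>; in both applications \<open>d\<close> is a nonzero element of an integral domain and can be cancelled. With
  the weights given by the crossing signs one obtains the arrow polynomial. At \<open>A = 1\<close> all weights are 1 and \<open>d = -2\<close>; the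
  hypotheses on the weights hold without any reference to over and under, and a kink changes the sign of the state sum and
  the parity of the number of crossings.
\<close>

section \<open>Closed curves generated by two involutions\<close>

definition orb :: "('a \<Rightarrow> 'a) \<Rightarrow> 'a \<Rightarrow> 'a set" where
  "orb f x = range (\<lambda>n. (f ^^ n) x)"

text \<open>
  A state is traversed by alternating two involutions: \<open>a\<close> runs along an arc to its other end, and \<open>j\<close> passes
  through the smoothing reached there.
\<close>

definition turn :: "('a \<Rightarrow> 'a) \<Rightarrow> ('a \<Rightarrow> 'a) \<Rightarrow> 'a \<Rightarrow> 'a" where
  "turn a j x = j (a x)"

text \<open>
  The \<open>turn\<close>-orbit of \<open>x\<close> contains only every second end met by the traversal, namely those left along arcs; the
  orbit of \<open>a x\<close>, which is the traversal in the opposite direction, contains the others.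
\<close>

definition loop :: "('a \<Rightarrow> 'a) \<Rightarrow> ('a \<Rightarrow> 'a) \<Rightarrow> 'a \<Rightarrow> 'a set" where
  "loop a j x = orb (turn a j) x \<union> orb (turn a j) (a x)"

text \<open>
  The total change of \<open>\<Theta>\<close> along the joins of a loop. As \<open>\<Theta>\<close> returns to its initial value, this is also minus the
  total change along the arcs, which is how it is written here.
\<close>

definition hol :: "('a \<Rightarrow> 'a) \<Rightarrow> ('a \<Rightarrow> 'a) \<Rightarrow> ('a \<Rightarrow> int) \<Rightarrow> 'a \<Rightarrow> int" where
  "hol a j \<Theta> x = (\<Sum>y \<in> orb (turn a j) x. \<Theta> y - \<Theta> (a y))"

text \<open>
  The contribution of a family of loops when a loop of holonomy \<open>h\<close> counts as \<open>\<kappa> \<bar>h\<bar>\<close>. The absolute value makes this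
  independent of the direction of traversal, so that any end of the loop may be used to compute \<open>h\<close>.
\<close>

definition loops_eval ::
  "(int \<Rightarrow> 'r) \<Rightarrow> 'a set \<Rightarrow> ('a \<Rightarrow> 'a) \<Rightarrow> ('a \<Rightarrow> 'a) \<Rightarrow> ('a \<Rightarrow> int) \<Rightarrow> 'r::comm_ring_1" where
  "loops_eval \<kappa> E a j \<Theta> = (\<Prod>c \<in> loop a j ` E. \<kappa> \<bar>hol a j \<Theta> (SOME x. x \<in> c)\<bar>)"

locale loop_system =
  fixes E :: "'a set" and a j :: "'a \<Rightarrow> 'a"
  assumes fin: "finite E"
    and a_in: "x \<in> E \<Longrightarrow> a x \<in> E" and a_a: "x \<in> E \<Longrightarrow> a (a x) = x"
    and j_in: "x \<in> E \<Longrightarrow> j x \<in> E" and j_j: "x \<in> E \<Longrightarrow> j (j x) = x"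
begin

abbreviation st where "st \<equiv> turn a j"

lemma st_in: "x \<in> E \<Longrightarrow> st x \<in> E"
  by (simp add: turn_def a_in j_in)

lemma st_pow_in: "x \<in> E \<Longrightarrow> (st ^^ n) x \<in> E"
  by (induction n) (simp_all add: st_in)

lemma st_inj: "inj_on st E"
  by (rule inj_on_inverseI[where g = "\<lambda>x. a (j x)"]) (simp add: turn_def a_in a_a j_j)

lemma st_pow_inj: "x \<in> E \<Longrightarrow> y \<in> E \<Longrightarrow> (st ^^ n) x = (st ^^ n) y \<Longrightarrow> x = y"
proof (induction n)
  case (Suc n)
  then have "st ((st ^^ n) x) = st ((st ^^ n) y)" by simp
  then have "(st ^^ n) x = (st ^^ n) y" using inj_onD[OF st_inj] st_pow_in Suc.prems by blast
  then show ?case using Suc by blast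
qed simp

lemma orb_sub: "x \<in> E \<Longrightarrow> orb st x \<subseteq> E"
  using st_pow_in by (auto simp: orb_def)

lemma finite_orb: "x \<in> E \<Longrightarrow> finite (orb st x)"
  using finite_subset[OF orb_sub fin] .

lemma period_exists:
  assumes "x \<in> E" shows "\<exists>m>0. (st ^^ m) x = x"
proof -
  have "\<not> inj (\<lambda>n. (st ^^ n) x)"
  proof
    assume "inj (\<lambda>n. (st ^^ n) x)"
    then have "finite (UNIV :: nat set)"
      using finite_orb[OF assms] unfolding orb_def by (rule finite_imageD[rotated])
    then show False by simp
  qed
  then obtain p' q' where pq': "p' \<noteq> q'" "(st ^^ p') x = (st ^^ q') x" by (auto simp: inj_def)
  obtain p q where "p < q" and pq: "(st ^^ p) x = (st ^^ q) x"
    using pq' by (cases p' q' rule: linorder_cases) (auto intro: that[of p' q'] that[of q' p'] sym)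
  have "(st ^^ q) x = (st ^^ (p + (q - p))) x" using \<open>p < q\<close> by simp
  also have "\<dots> = (st ^^ p) ((st ^^ (q - p)) x)" by (simp only: funpow_add o_apply)
  finally have "(st ^^ p) ((st ^^ (q - p)) x) = (st ^^ p) x" using pq by simp
  then have "(st ^^ (q - p)) x = x" using st_pow_inj assms st_pow_in by blast
  then show ?thesis using \<open>p < q\<close> by (intro exI[of _ "q - p"]) simp
qed

lemma orb_self: "x \<in> orb f x"
  by (auto simp: orb_def intro: range_eqI[of _ _ 0])

lemma orb_step: "y \<in> orb f x \<Longrightarrow> f y \<in> orb f x"
  by (auto simp: orb_def intro: range_eqI[of _ _ "Suc n" for n])

lemma orb_least: "x \<in> X \<Longrightarrow> (\<And>y. y \<in> X \<Longrightarrow> f y \<in> X) \<Longrightarrow> orb f x \<subseteq> X"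
proof -
  assume *: "x \<in> X" "\<And>y. y \<in> X \<Longrightarrow> f y \<in> X"
  have "(f ^^ n) x \<in> X" for n by (induction n) (auto simp: *)
  then show ?thesis by (auto simp: orb_def)
qed

lemma orb_eq:
  assumes "x \<in> E" "y \<in> orb st x" shows "orb st y = orb st x"
proof
  show "orb st y \<subseteq> orb st x" by (rule orb_least[OF assms(2)]) (rule orb_step)
  obtain n where n: "y = (st ^^ n) x" using assms by (auto simp: orb_def)
  obtain m where m: "m > 0" "(st ^^ m) x = x" using period_exists assms by blast
  have mk: "(st ^^ (m * k)) x = x" for k
  proof (induction k)
    case (Suc k)
    have "(st ^^ (m * Suc k)) x = (st ^^ m) ((st ^^ (m * k)) x)"
      by (simp only: mult_Suc_right funpow_add o_apply)
    then show ?case using Suc m by simp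
  qed simp
  have "(st ^^ (m * n - n)) y = (st ^^ (m * n - n + n)) x"
    by (simp only: n funpow_add o_apply)
  also have "m * n - n + n = m * n" using m by (cases m) auto
  finally have "(st ^^ (m * n - n)) y = x" by (simp only: mk)
  then have "x \<in> orb st y" by (auto simp: orb_def)
  then show "orb st x \<subseteq> orb st y" by (rule orb_least) (rule orb_step)
qed

lemma st_orb: assumes "x \<in> E" shows "st ` orb st x = orb st x"
proof (rule endo_inj_surj)
  show "finite (orb st x)" by (rule finite_orb) fact
  show "st ` orb st x \<subseteq> orb st x" using orb_step[of _ st x] by blast
  show "inj_on st (orb st x)" using st_inj orb_sub[OF assms] by (rule inj_on_subset)
qed

text \<open>
  Conjugation by \<open>a\<close> turns \<open>j \<circ> a\<close> into its inverse \<open>a \<circ> j\<close>, and on a finite set a permutation and its inverse have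
  the same orbits.
\<close>

lemma orb_flip: assumes "x \<in> E" shows "orb st (a x) = a ` orb st x"
proof -
  have sub: "orb st (a x) \<subseteq> a ` orb st x" if "x \<in> E" for x
  proof (rule orb_least)
    show "a x \<in> a ` orb st x" by (intro imageI orb_self)
    fix y assume "y \<in> a ` orb st x"
    then obtain w where w: "y = a w" "w \<in> orb st x" by blast
    then obtain v where v: "w = st v" "v \<in> orb st x" using st_orb[OF \<open>x \<in> E\<close>] by blast
    then have "st y = a v" using w v orb_sub[OF \<open>x \<in> E\<close>] by (auto simp: turn_def a_a j_j a_in j_in)
    then show "st y \<in> a ` orb st x" using v by blast
  qed
  have "a ` orb st x \<subseteq> a ` a ` orb st (a x)"
    using image_mono[OF sub[of "a x"]] assms by (simp add: a_in a_a)
  also have "\<dots> = orb st (a x)"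
    using orb_sub[of "a x"] assms a_in a_a by (force simp: image_image)
  finally show ?thesis using sub[OF assms] by blast
qed

lemma loop_alt: "x \<in> E \<Longrightarrow> loop a j x = orb st x \<union> a ` orb st x"
  by (simp add: loop_def orb_flip)

lemma loop_self: "x \<in> loop a j x"
  by (simp add: loop_def orb_self)

lemma loop_sub: "x \<in> E \<Longrightarrow> loop a j x \<subseteq> E"
  using orb_sub a_in by (auto simp: loop_def)

lemma loop_eq: assumes "x \<in> E" "y \<in> loop a j x" shows "loop a j y = loop a j x"
proof -
  consider "y \<in> orb st x" | "y \<in> orb st (a x)" using assms by (auto simp: loop_def)
  then show ?thesis
  proof cases
    case 1
    have "y \<in> E" using 1 orb_sub assms by blast
    have "orb st y = orb st x" using 1 assms orb_eq by blast
    then show ?thesis using loop_alt \<open>y \<in> E\<close> assms by simp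
  next
    case 2
    have "y \<in> E" using 2 orb_sub assms a_in by blast
    have "orb st y = orb st (a x)" using 2 assms orb_eq a_in by blast
    then show ?thesis using loop_alt[of y] loop_def[of a j x] orb_flip[of "a x"] \<open>y \<in> E\<close> assms
      by (auto simp: a_in a_a)
  qed
qed

lemma loop_a: "x \<in> E \<Longrightarrow> a x \<in> loop a j x"
  by (simp add: loop_def orb_self)

lemma loop_j: assumes "x \<in> E" shows "j x \<in> loop a j x"
proof -
  have "st (a x) \<in> orb st (a x)" by (intro orb_step orb_self)
  then show ?thesis using assms by (simp add: loop_def turn_def a_a)
qed

lemma loop_closed: "x \<in> E \<Longrightarrow> y \<in> loop a j x \<Longrightarrow> a y \<in> loop a j x \<and> j y \<in> loop a j x"
  using loop_a[of y] loop_j[of y] loop_eq[of x y] loop_sub[of x] by auto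

lemma loop_least:
  assumes "x \<in> E" "x \<in> X" "\<And>y. y \<in> X \<Longrightarrow> a y \<in> X \<and> j y \<in> X" shows "loop a j x \<subseteq> X"
  unfolding loop_def using assms by (intro Un_least orb_least) (auto simp: turn_def)

text \<open>
  Another starting point on the orbit does not change the sum, and starting at \<open>a x\<close> reverses all its signs.
\<close>

lemma hol_eq: assumes "x \<in> E" "y \<in> loop a j x" shows "\<bar>hol a j \<Theta> y\<bar> = \<bar>hol a j \<Theta> x\<bar>"
proof -
  consider "y \<in> orb st x" | "y \<in> orb st (a x)" using assms by (auto simp: loop_def)
  then show ?thesis
  proof cases
    case 1
    then show ?thesis using assms orb_eq by (simp add: hol_def)
  next
    case 2
    have "inj_on a (orb st x)" using orb_sub[OF assms(1)] a_a by (metis inj_on_def subsetD)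
    then have "hol a j \<Theta> (a x) = (\<Sum>y\<in>orb st x. \<Theta> (a y) - \<Theta> (a (a y)))"
      by (simp add: hol_def orb_flip[OF assms(1)] sum.reindex o_def)
    also have "\<dots> = (\<Sum>y\<in>orb st x. - (\<Theta> y - \<Theta> (a y)))"
      using orb_sub[OF assms(1)] by (intro sum.cong) (auto simp: a_a)
    also have "\<dots> = - hol a j \<Theta> x" unfolding hol_def by (rule sum_negf)
    finally show ?thesis using 2 orb_eq[of "a x" y] a_in assms by (simp add: hol_def)
  qed
qed

lemma hol_some: "x \<in> E \<Longrightarrow> \<bar>hol a j \<Theta> (SOME y. y \<in> loop a j x)\<bar> = \<bar>hol a j \<Theta> x\<bar>"
  by (rule hol_eq) (auto intro: someI loop_self)

end

lemma loop_system_swap: "loop_system E a j \<Longrightarrow> loop_system E j a"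
  by (simp add: loop_system_def)

lemma loop_system_cong:
  assumes "loop_system E a j" "\<And>x. x \<in> E \<Longrightarrow> a' x = a x" "\<And>x. x \<in> E \<Longrightarrow> j' x = j x"
  shows "loop_system E a' j'"
  using assms by (simp add: loop_system_def)

lemma loops_eval_iso:
  assumes S: "loop_system E a j" and T: "loop_system E' a' j'"
    and inj: "inj_on \<tau> E" and img: "\<tau> ` E = E'"
    and a: "\<And>x. x \<in> E \<Longrightarrow> a' (\<tau> x) = \<tau> (a x)" and j: "\<And>x. x \<in> E \<Longrightarrow> j' (\<tau> x) = \<tau> (j x)"
    and \<Theta>: "\<And>x. x \<in> E \<Longrightarrow> \<Theta>' (\<tau> x) = \<Theta> x"
  shows "loops_eval \<kappa> E' a' j' \<Theta>' = loops_eval \<kappa> E a j \<Theta>"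
proof -
  interpret S: loop_system E a j by fact
  interpret T: loop_system E' a' j' by fact
  have orb: "orb T.st (\<tau> x) = \<tau> ` orb S.st x" if "x \<in> E" for x
  proof -
    have "(T.st ^^ n) (\<tau> x) = \<tau> ((S.st ^^ n) x)" for n
    proof (induction n)
      case (Suc n)
      have "(S.st ^^ n) x \<in> E" using S.st_pow_in that by blast
      then have "T.st (\<tau> ((S.st ^^ n) x)) = \<tau> (S.st ((S.st ^^ n) x))" by (simp add: turn_def a j S.a_in)
      then show ?case using Suc by simp
    qed simp
    then show ?thesis by (auto simp: orb_def)
  qed
  have loop: "loop a' j' (\<tau> x) = \<tau> ` loop a j x" if "x \<in> E" for x
    using that by (simp add: loop_def orb a S.a_in image_Un)
  have hol: "hol a' j' \<Theta>' (\<tau> x) = hol a j \<Theta> x" if "x \<in> E" for x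
    unfolding hol_def orb[OF that]
    using S.orb_sub[OF that] inj_on_subset[OF inj S.orb_sub[OF that]]
    by (auto simp: sum.reindex \<Theta> a S.a_in intro!: sum.cong)
  have "loop a' j' ` E' = image \<tau> ` (loop a j ` E)"
    unfolding img[symmetric] image_image using loop by (rule image_cong[OF refl])
  moreover have "inj_on (image \<tau>) (loop a j ` E)"
    using inj_on_image_eq_iff[OF inj] S.loop_sub by (intro inj_onI) (metis imageE)
  ultimately have "loops_eval \<kappa> E' a' j' \<Theta>'
      = (\<Prod>c\<in>loop a j ` E. \<kappa> \<bar>hol a' j' \<Theta>' (SOME x. x \<in> \<tau> ` c)\<bar>)"
    by (simp add: loops_eval_def prod.reindex)
  also have "\<dots> = loops_eval \<kappa> E a j \<Theta>"
    unfolding loops_eval_def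
  proof (intro prod.cong refl)
    fix c assume "c \<in> loop a j ` E"
    then obtain x where x: "x \<in> E" "c = loop a j x" by blast
    have "\<tau> x \<in> E'" using x img by blast
    from T.hol_some[OF this] show "\<kappa> \<bar>hol a' j' \<Theta>' (SOME x. x \<in> \<tau> ` c)\<bar> = \<kappa> \<bar>hol a j \<Theta> (SOME x. x \<in> c)\<bar>"
      using S.hol_some[OF x(1)] x by (simp add: loop hol)
  qed
  finally show ?thesis .
qed

lemma loops_eval_cong:
  assumes "loop_system E a j"
    and "\<And>x. x \<in> E \<Longrightarrow> a' x = a x" "\<And>x. x \<in> E \<Longrightarrow> j' x = j x" "\<And>x. x \<in> E \<Longrightarrow> \<Theta>' x = \<Theta> x"
  shows "loops_eval \<kappa> E a' j' \<Theta>' = loops_eval \<kappa> E a j \<Theta>"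
  by (rule loops_eval_iso[OF assms(1) loop_system_cong[OF assms(1,2,3)], where \<tau> = id])
    (simp_all add: assms)

text \<open>
  Summing the changes of \<open>\<Theta>\<close> along the joins instead of the arcs only changes the sign of the holonomy.
\<close>

lemma loops_eval_swap:
  assumes "loop_system E a j"
  shows "loops_eval \<kappa> E j a \<Theta> = loops_eval \<kappa> E a j \<Theta>"
proof -
  interpret S: loop_system E a j by fact
  interpret T: loop_system E j a by (rule loop_system_swap) fact
  have loop: "loop j a x = loop a j x" if "x \<in> E" for x
  proof
    show "loop j a x \<subseteq> loop a j x"
      by (rule T.loop_least[OF that S.loop_self]) (use S.loop_closed[OF that] in blast)
    show "loop a j x \<subseteq> loop j a x"
      by (rule S.loop_least[OF that T.loop_self]) (use T.loop_closed[OF that] in blast)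
  qed
  have orb: "orb T.st (a x) = a ` orb S.st x" if "x \<in> E" for x
  proof -
    have "(T.st ^^ n) (a x) = a ((S.st ^^ n) x)" for n
      by (induction n) (simp_all add: turn_def)
    then show ?thesis by (auto simp: orb_def)
  qed
  have hol: "\<bar>hol j a \<Theta> x\<bar> = \<bar>hol a j \<Theta> x\<bar>" if x: "x \<in> E" for x
  proof -
    have sub: "orb S.st x \<subseteq> E" using S.orb_sub x by blast
    have "inj_on a (orb S.st x)" using sub S.a_a by (metis inj_on_def subsetD)
    then have "hol j a \<Theta> (a x) = (\<Sum>y\<in>orb S.st x. \<Theta> (a y) - \<Theta> (S.st y))"
      by (simp add: hol_def orb x sum.reindex o_def turn_def)
    also have "\<dots> = (\<Sum>y\<in>orb S.st x. \<Theta> (a y)) - sum \<Theta> (S.st ` orb S.st x)"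
      using inj_on_subset[OF S.st_inj sub] by (simp add: sum_subtractf sum.reindex)
    also have "\<dots> = - hol a j \<Theta> x"
      by (simp only: S.st_orb[OF x]) (simp add: hol_def sum_subtractf)
    finally show ?thesis using T.hol_eq[OF x, of "a x" \<Theta>] T.loop_j[OF x] by simp
  qed
  have im: "loop j a ` E = loop a j ` E" using loop by (simp cong: image_cong)
  show ?thesis unfolding loops_eval_def im
  proof (intro prod.cong refl)
    fix c assume "c \<in> loop a j ` E"
    then obtain x where x: "x \<in> E" "c = loop a j x" by blast
    then have "(SOME x. x \<in> c) \<in> c" using S.loop_self by (metis someI)
    then have "(SOME x. x \<in> c) \<in> E" using x S.loop_sub by blast
    then show "\<kappa> \<bar>hol j a \<Theta> (SOME x. x \<in> c)\<bar> = \<kappa> \<bar>hol a j \<Theta> (SOME x. x \<in> c)\<bar>"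
      by (simp only: hol)
  qed
qed

section \<open>Contraction of tangles\<close>

text \<open>
  A path entering a region by the join at \<open>z\<close> runs through the ends in \<open>I\<close>, alternately along joins and arcs, until it
  reaches an end outside of \<open>I\<close>.
\<close>

inductive thread :: "('a \<Rightarrow> 'a) \<Rightarrow> ('a \<Rightarrow> 'a) \<Rightarrow> 'a set \<Rightarrow> 'a \<Rightarrow> 'a \<Rightarrow> bool" for a j I where
  exit: "j z \<notin> I \<Longrightarrow> thread a j I z (j z)"
| pass: "j z \<in> I \<Longrightarrow> thread a j I (a (j z)) w \<Longrightarrow> thread a j I z w"

lemma thread_det: "thread a j I z w \<Longrightarrow> thread a j I z v \<Longrightarrow> v = w"
proof (induction arbitrary: v rule: thread.induct)
  case (exit z)
  from exit(2,1) show ?case by cases auto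
next
  case (pass z w)
  from pass(4,1) have "thread a j I (a (j z)) v" by cases auto
  then show ?case by (rule pass.IH)
qed

text \<open>
  The set \<open>I\<close> consists of the ends of some arcs along which \<open>\<Theta>\<close> is constant. Forgetting these arcs leaves the ends
  outside of \<open>I\<close>, with a new join \<open>j'\<close> that follows the threads through \<open>I\<close>.
\<close>

locale contraction = loop_system E a j for E :: "'a set" and a j +
  fixes I :: "'a set" and \<Theta> :: "'a \<Rightarrow> int" and j' :: "'a \<Rightarrow> 'a"
  assumes I_sub: "I \<subseteq> E" and I_a: "x \<in> I \<Longrightarrow> a x \<in> I"
    and flat: "x \<in> I \<Longrightarrow> \<Theta> (a x) = \<Theta> x"
    and return: "z \<in> E - I \<Longrightarrow> thread a j I z (j' z)"
begin

lemma out_a: "x \<in> E - I \<Longrightarrow> a x \<in> E - I"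
  using I_a a_in a_a by (metis DiffD1 DiffD2 DiffI)

lemma thread_out: "thread a j I z w \<Longrightarrow> z \<in> E \<Longrightarrow> w \<in> E - I"
  by (induction rule: thread.induct) (auto simp: j_in a_in)

lemma thread_back:
  assumes "z \<in> E"
  shows "z \<notin> I \<Longrightarrow> thread a j I (j z) z"
    and "z \<in> I \<Longrightarrow> thread a j I (a z) v \<Longrightarrow> thread a j I (j z) v"
   apply (rule thread.exit[of j "j z" I a, unfolded j_j[OF assms]], assumption)
  apply (rule thread.pass[of j "j z" I a v, unfolded j_j[OF assms]], assumption+)
  done

text \<open>
  Threads can be run through backwards. The statement about an inner starting point is the one that the induction needs:
  from there the reversed thread continues beyond \<open>z\<close>.
\<close>

lemma thread_rev:
  "thread a j I z w \<Longrightarrow> z \<in> E \<Longrightarrow>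
    (z \<notin> I \<longrightarrow> thread a j I w z) \<and> (z \<in> I \<longrightarrow> (\<forall>v. thread a j I (a z) v \<longrightarrow> thread a j I w v))"
proof (induction rule: thread.induct)
  case (exit z)
  then show ?case using thread_back[of z] by simp
next
  case (pass z w)
  have E: "a (j z) \<in> E" "a (j z) \<in> I" "a (a (j z)) = j z"
    using pass.hyps pass.prems I_a by (simp_all add: a_in j_in a_a)
  have IH: "thread a j I (j z) v \<Longrightarrow> thread a j I w v" for v
    using pass.IH E by simp
  show ?case
    using thread_back[OF pass.prems] IH by simp
qed

lemma thread_steps:
  "thread a j I z w \<Longrightarrow> \<exists>n. (st ^^ n) (j z) = w \<and> (\<forall>k<n. (st ^^ k) (j z) \<in> I)"
proof (induction rule: thread.induct)
  case (exit z)
  then show ?case by (intro exI[of _ 0]) simp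
next
  case (pass z w)
  then obtain n where n: "(st ^^ n) (j (a (j z))) = w" "\<forall>k<n. (st ^^ k) (j (a (j z))) \<in> I" by blast
  have *: "(st ^^ Suc k) (j z) = (st ^^ k) (j (a (j z)))" for k
    by (simp add: funpow_Suc_right turn_def del: funpow.simps)
  show ?case
  proof (intro exI[of _ "Suc n"] conjI allI impI)
    show "(st ^^ Suc n) (j z) = w" using n * by simp
    fix k assume "k < Suc n"
    then show "(st ^^ k) (j z) \<in> I" using n(2) pass(1) by (cases k) (auto simp only: * funpow_0 Suc_less_eq)
  qed
qed

lemma contracted: "loop_system (E - I) a j'"
proof
  show "finite (E - I)" using fin by simp
  fix x assume x: "x \<in> E - I"
  then show "a x \<in> E - I" "a (a x) = x" using out_a a_a by auto
  show j': "j' x \<in> E - I" using thread_out[OF return[OF x]] x by blast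
  have "thread a j I (j' x) x" using thread_rev[OF return[OF x]] x by blast
  then show "j' (j' x) = x" using thread_det return[OF j'] by metis
qed

sublocale C: loop_system "E - I" a j' by (rule contracted)

lemma return_steps:
  assumes "x \<in> E - I"
  obtains n where "(st ^^ Suc n) x = C.st x" "\<And>k. k < n \<Longrightarrow> (st ^^ Suc k) x \<in> I"
proof -
  have *: "(st ^^ Suc k) x = (st ^^ k) (j (a x))" for k
    by (simp add: funpow_Suc_right turn_def del: funpow.simps)
  show ?thesis using thread_steps[OF return[OF out_a[OF assms]]] that
    unfolding * turn_def by blast
qed

text \<open>
  The new \<open>turn\<close> is the first return of the old one to the complement of \<open>I\<close>.
\<close>

lemma orb_contracted: assumes "x \<in> E - I" shows "orb C.st x = orb st x - I"
proof
  have step: "C.st y \<in> orb st x" if y: "y \<in> E - I" "y \<in> orb st x" for y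
  proof -
    obtain n where "(st ^^ Suc n) y = C.st y" using return_steps y by metis
    then have "C.st y \<in> orb st y" unfolding orb_def by (metis rangeI)
    then show ?thesis using orb_eq[of x y] y assms by blast
  qed
  have "orb C.st x \<subseteq> orb st x \<inter> (E - I)"
    by (rule orb_least) (use assms step C.st_in orb_self in auto)
  then show "orb C.st x \<subseteq> orb st x - I" by blast
  have "(st ^^ m) y \<in> E - I \<Longrightarrow> y \<in> E - I \<Longrightarrow> (st ^^ m) y \<in> orb C.st y" for m y
  proof (induction m arbitrary: y rule: less_induct)
    case (less m)
    obtain n where n: "(st ^^ Suc n) y = C.st y" "\<And>k. k < n \<Longrightarrow> (st ^^ Suc k) y \<in> I"
      using return_steps less by metis
    show ?case
    proof (cases m)
      case 0
      then show ?thesis using orb_self by simp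
    next
      case (Suc l)
      have "\<not> l < n" using n(2)[of l] less.prems Suc by blast
      then have "(st ^^ m) y = (st ^^ (l - n)) ((st ^^ Suc n) y)"
        using Suc by (simp only: funpow_add[THEN fun_cong, unfolded o_apply, symmetric]) simp
      also have "\<dots> = (st ^^ (l - n)) (C.st y)" using n by simp
      finally have eq: "(st ^^ m) y = (st ^^ (l - n)) (C.st y)" .
      then have "(st ^^ m) y \<in> orb C.st (C.st y)"
        using less.IH[of "l - n" "C.st y"] less.prems Suc C.st_in by auto
      then show ?thesis using C.orb_eq[of y "C.st y"] orb_step[OF orb_self] less.prems by metis
    qed
  qed
  then show "orb st x - I \<subseteq> orb C.st x"
    using assms orb_sub[of x] by (force simp: orb_def)
qed

lemma loop_contracted: "x \<in> E - I \<Longrightarrow> loop a j' x = loop a j x - I"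
  using orb_contracted out_a by (simp add: loop_def Un_Diff)

text \<open>
  The arcs that are forgotten contribute nothing, because \<open>\<Theta>\<close> is constant along them.
\<close>

lemma hol_contracted: assumes "x \<in> E - I" shows "hol a j' \<Theta> x = hol a j \<Theta> x"
  unfolding hol_def orb_contracted[OF assms]
  by (rule sum.mono_neutral_left) (use assms finite_orb[of x] flat in auto)

lemma hol_inner: assumes "x \<in> E" "loop a j x \<subseteq> I" shows "hol a j \<Theta> x = 0"
  using assms unfolding hol_def loop_def by (intro sum.neutral) (auto simp: flat)

text \<open>
  A loop either leaves \<open>I\<close> and survives with its holonomy, or it stays inside, where its holonomy vanishes; the loops of
  the second kind contribute the power of \<open>\<kappa> 0\<close>.
\<close>

lemma loops_eval_contracted:
  "loops_eval \<kappa> E a j \<Theta> =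
     \<kappa> 0 ^ card {c \<in> loop a j ` E. c \<subseteq> I} * loops_eval \<kappa> (E - I) a j' \<Theta>"
proof -
  let ?v = "\<lambda>c. \<kappa> \<bar>hol a j \<Theta> (SOME x. x \<in> c)\<bar>"
  let ?In = "{c \<in> loop a j ` E. c \<subseteq> I}"
  have split: "loop a j ` E = ?In \<union> loop a j ` (E - I)"
  proof
    show "loop a j ` E \<subseteq> ?In \<union> loop a j ` (E - I)"
    proof
      fix c assume "c \<in> loop a j ` E"
      then obtain x where x: "x \<in> E" "c = loop a j x" by blast
      show "c \<in> ?In \<union> loop a j ` (E - I)"
      proof (cases "c \<subseteq> I")
        case False
        then obtain y where "y \<in> c" "y \<notin> I" by blast
        then have "y \<in> E - I" "c = loop a j y" using x loop_sub[of x] loop_eq[of x y] by auto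
        then show ?thesis by blast
      qed (use x in blast)
    qed
  qed auto
  have "loops_eval \<kappa> E a j \<Theta> = prod ?v (?In \<union> loop a j ` (E - I))"
    unfolding loops_eval_def by (rule prod.cong) (use split in auto)
  also have "\<dots> = prod ?v ?In * prod ?v (loop a j ` (E - I))"
    by (rule prod.union_disjoint) (use fin loop_self in auto)
  also have "prod ?v ?In = \<kappa> 0 ^ card ?In"
  proof -
    have "prod ?v ?In = (\<Prod>c\<in>?In. \<kappa> 0)"
    proof (rule prod.cong[OF refl])
      fix c assume "c \<in> ?In"
      then obtain x where x: "x \<in> E" "c = loop a j x" "c \<subseteq> I" by blast
      then show "?v c = \<kappa> 0" using hol_some[of x \<Theta>] hol_inner[of x] by simp
    qed
    then show ?thesis by simp
  qed
  also have "prod ?v (loop a j ` (E - I)) = loops_eval \<kappa> (E - I) a j' \<Theta>"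
  proof -
    have im: "loop a j' ` (E - I) = (\<lambda>c. c - I) ` (loop a j ` (E - I))"
      unfolding image_image by (rule image_cong[OF refl]) (rule loop_contracted)
    have inj: "inj_on (\<lambda>c. c - I) (loop a j ` (E - I))"
    proof (rule inj_onI)
      fix c c' assume "c \<in> loop a j ` (E - I)" "c' \<in> loop a j ` (E - I)" and eq: "c - I = c' - I"
      then obtain x x' where x: "x \<in> E - I" "c = loop a j x" "x' \<in> E - I" "c' = loop a j x'" by blast
      then have "x \<in> loop a j x'" using eq loop_self[of x] by blast
      then show "c = c'" using x loop_eq[of x' x] by blast
    qed
    have "loops_eval \<kappa> (E - I) a j' \<Theta> =
        (\<Prod>c\<in>loop a j ` (E - I). \<kappa> \<bar>hol a j' \<Theta> (SOME x. x \<in> c - I)\<bar>)"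
      unfolding loops_eval_def im by (simp add: prod.reindex[OF inj])
    also have "\<dots> = prod ?v (loop a j ` (E - I))"
    proof (rule prod.cong[OF refl])
      fix c assume "c \<in> loop a j ` (E - I)"
      then obtain x where x: "x \<in> E - I" "c = loop a j x" by blast
      then have "\<bar>hol a j' \<Theta> (SOME y. y \<in> c - I)\<bar> = \<bar>hol a j' \<Theta> x\<bar>"
        using C.hol_some[of x \<Theta>] loop_contracted by simp
      also have "\<dots> = \<bar>hol a j \<Theta> (SOME y. y \<in> c)\<bar>"
        using hol_contracted x hol_some[of x \<Theta>] by simp
      finally show "\<kappa> \<bar>hol a j' \<Theta> (SOME y. y \<in> c - I)\<bar> = ?v c" by simp
    qed
    finally show ?thesis by simp
  qed
  finally show ?thesis .
qed

lemma thread_loop: "thread a j I z w \<Longrightarrow> z \<in> E \<Longrightarrow> w \<in> loop a j z"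
proof (induction rule: thread.induct)
  case (exit z)
  then show ?case using loop_j by blast
next
  case (pass z w)
  have "j z \<in> E" using pass j_in by blast
  have "loop a j (a (j z)) = loop a j z"
    using loop_eq[of z "j z"] loop_j[of z] loop_eq[of "j z" "a (j z)"] loop_a[of "j z"] pass.prems \<open>j z \<in> E\<close> by simp
  then show ?case using pass a_in \<open>j z \<in> E\<close> by simp
qed

end

subsection \<open>Numbered tangles\<close>

text \<open>
  A matching of numbers, given by a list of pairs; a number that occurs in no pair is its own image.
\<close>

fun wire :: "(nat \<times> nat) list \<Rightarrow> nat \<Rightarrow> nat" where
  "wire [] n = n"
| "wire ((x, y) # ps) n = (if n = x then y else if n = y then x else wire ps n)"

text \<open>
  The end of the thread that starts at the label \<open>n\<close>; the first argument bounds the number of steps, so that the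
  function is total and can be evaluated.
\<close>

fun follow :: "nat \<Rightarrow> (nat \<times> nat) list \<Rightarrow> (nat \<times> nat) list \<Rightarrow> nat \<Rightarrow> nat option" where
  "follow 0 as ps n = None"
| "follow (Suc f) as ps n =
     (let m = wire ps n in if wire as m = m then Some m else follow f as ps (wire as m))"

definition rewire :: "(nat \<Rightarrow> 'a) \<Rightarrow> nat \<Rightarrow> (nat \<times> nat) list \<Rightarrow> ('a \<Rightarrow> 'a) \<Rightarrow> 'a \<Rightarrow> 'a" where
  "rewire e N ps j x = (if x \<in> e ` {..<N} then e (wire ps (inv_into {..<N} e x)) else j x)"

text \<open>
  A decidable certificate about a tangle with \<open>N\<close> numbered ends, inner arcs \<open>as\<close> and joins \<open>ps\<close>: the threads from outer
  ends are those of the matching \<open>m\<close>, and the inner ends not met by them form one closed loop \<open>cyc\<close>, or none if \<open>cyc\<close> is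
  empty. All local computations with states reduce to evaluating it on explicit lists.
\<close>

definition contracts_to ::
  "nat \<Rightarrow> (nat \<times> nat) list \<Rightarrow> (nat \<times> nat) list \<Rightarrow> (nat \<times> nat) list \<Rightarrow> nat list \<Rightarrow> bool" where
  "contracts_to N as ps m cyc \<longleftrightarrow>
     list_all (\<lambda>n. wire ps n < N \<and> wire ps (wire ps n) = n \<and> wire as n < N \<and> wire as (wire as n) = n \<and>
       (if wire as n = n then follow N as ps n = Some (wire m n)
        else follow N as ps n \<noteq> None \<or> n \<in> set cyc)) [0..<N] \<and>
     list_all (\<lambda>n. wire as n \<noteq> n \<and> n < N \<and> wire as n \<in> set cyc \<and> wire ps n \<in> set cyc) cyc \<and>
     successively (\<lambda>x y. y = wire as x \<or> y = wire ps x) cyc"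

definition inner_ends :: "(nat \<Rightarrow> 'a) \<Rightarrow> nat \<Rightarrow> (nat \<times> nat) list \<Rightarrow> 'a set" where
  "inner_ends e N as = e ` {n. n < N \<and> wire as n \<noteq> n}"

lemma rewire_label: "inj_on e {..<N} \<Longrightarrow> n < N \<Longrightarrow> rewire e N ps j (e n) = e (wire ps n)"
  by (simp add: rewire_def)

lemma rewire_other: "x \<notin> e ` {..<N} \<Longrightarrow> rewire e N ps j x = j x"
  by (simp add: rewire_def)

text \<open>
  This transfers a certificate to any system of loops that contains the tangle: replacing the joins of the tangle by the
  matching \<open>m\<close> costs one factor \<open>\<kappa> 0\<close> for the closed loop, if there is one.
\<close>

lemma tangle_eval:
  assumes sys: "loop_system E a (rewire e N ps j)"
    and inj: "inj_on e {..<N}" and sub: "e ` {..<N} \<subseteq> E"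
    and arcs: "\<And>n. n < N \<Longrightarrow> wire as n \<noteq> n \<Longrightarrow> a (e n) = e (wire as n) \<and> \<Theta> (e (wire as n)) = \<Theta> (e n)"
    and chk: "contracts_to N as ps m cyc"
  shows "loops_eval \<kappa> E a (rewire e N ps j) \<Theta> = \<kappa> 0 ^ (if cyc = [] then 0 else 1) *
           loops_eval \<kappa> (E - inner_ends e N as) a (rewire e N m j) \<Theta>"
    and "loop_system (E - inner_ends e N as) a (rewire e N m j)"
proof -
  define I where "I = inner_ends e N as"
  define J where "J = rewire e N ps j"
  have chk1: "wire ps n < N" "wire ps (wire ps n) = n" "wire as n < N" "wire as (wire as n) = n"
    "wire as n = n \<Longrightarrow> follow N as ps n = Some (wire m n)"
    "wire as n \<noteq> n \<Longrightarrow> follow N as ps n \<noteq> None \<or> n \<in> set cyc" if "n < N" for n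
    using chk that by (auto simp: contracts_to_def list_all_iff split: if_splits)
  have chk2: "wire as n \<noteq> n" "n < N" "wire as n \<in> set cyc" "wire ps n \<in> set cyc" if "n \<in> set cyc" for n
    using chk that by (auto simp: contracts_to_def list_all_iff)
  interpret S: loop_system E a J unfolding J_def by (rule sys)
  have Je: "J (e n) = e (wire ps n)" if "n < N" for n
    unfolding J_def by (rule rewire_label[OF inj that])
  have Ie: "e n \<in> I \<longleftrightarrow> wire as n \<noteq> n" if "n < N" for n
    using that inj_onD[OF inj] by (auto simp: I_def inner_ends_def)
  have I_sub: "I \<subseteq> E" using sub by (auto simp: I_def inner_ends_def)
  have I_a: "a x \<in> I \<and> \<Theta> (a x) = \<Theta> x" if "x \<in> I" for x
  proof -
    obtain n where n: "x = e n" "n < N" "wire as n \<noteq> n" using \<open>x \<in> I\<close> by (auto simp: I_def inner_ends_def)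
    then show ?thesis using arcs[of n] Ie[of "wire as n"] chk1(3,4)[of n] by auto
  qed
  \<comment> \<open>The computed threads are threads of the system of loops.\<close>
  have thr: "follow f as ps n = Some k \<Longrightarrow> n < N \<Longrightarrow> thread a J I (e n) (e k)" for f n k
  proof (induction f arbitrary: n)
    case (Suc f)
    have w: "wire ps n < N" using chk1 Suc by blast
    show ?case
    proof (cases "wire as (wire ps n) = wire ps n")
      case True
      then have "J (e n) \<notin> I" "e k = J (e n)" using Suc Ie[OF w] Je by (auto simp: Let_def)
      then show ?thesis using thread.exit[of J "e n" I a] by simp
    next
      case False
      then have "J (e n) \<in> I" using Ie[OF w] Je Suc by simp
      moreover have "thread a J I (a (J (e n))) (e k)"
        using Suc.IH[of "wire as (wire ps n)"] Suc.prems False Je arcs[OF w False] chk1(3)[OF w]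
        by (simp add: Let_def)
      ultimately show ?thesis by (rule thread.pass)
    qed
  qed simp
  have ret: "thread a J I z (rewire e N m j z)" if z: "z \<in> E - I" for z
  proof (cases "z \<in> e ` {..<N}")
    case True
    then obtain n where n: "z = e n" "n < N" by auto
    then have "follow N as ps n = Some (wire m n)" using z Ie chk1(5)[of n] by auto
    then show ?thesis using thr n by (simp add: rewire_label[OF inj])
  next
    case False
    have "J z \<notin> I"
    proof
      assume "J z \<in> I"
      then obtain n where n: "J z = e n" "n < N" by (auto simp: I_def inner_ends_def)
      then have "z = e (wire ps n)" using S.j_j[of z] z Je by auto
      then show False using False chk1(1) n by blast
    qed
    then have "thread a J I z (J z)" by (rule thread.exit)
    then show ?thesis using False by (simp add: J_def rewire_other)
  qed
  interpret C: contraction E a J I \<Theta> "rewire e N m j"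
    by unfold_locales (use I_sub I_a ret in auto)
  have inner: "\<exists>n \<in> set cyc. c = loop a J (e n)" if c: "c \<in> loop a J ` E" "c \<subseteq> I" for c
  proof -
    obtain x where x: "x \<in> E" "c = loop a J x" using c by blast
    then have "x \<in> I" using c S.loop_self[of x] by blast
    then obtain n where n: "x = e n" "n < N" "wire as n \<noteq> n" by (auto simp: I_def inner_ends_def)
    have "follow N as ps n = None"
    proof (rule ccontr)
      assume "follow N as ps n \<noteq> None"
      then obtain k where "thread a J I (e n) (e k)" using thr n by blast
      then have "e k \<in> c" "e k \<notin> I" using C.thread_loop C.thread_out n x by auto
      then show False using c by blast
    qed
    then show ?thesis using chk1(6)[of n] n x by blast
  qed
  have "card {c \<in> loop a J ` E. c \<subseteq> I} = (if cyc = [] then 0 else 1)"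
  proof (cases cyc)
    case Nil
    then have "{c \<in> loop a J ` E. c \<subseteq> I} = {}" using inner by auto
    then show ?thesis by (simp only: Nil) simp
  next
    case (Cons n0 cs)
    have n0: "n0 < N" "e n0 \<in> E" using chk2[of n0] Cons sub by auto
    have cyc_in: "loop a J (e n) = loop a J (e n0)" if "n \<in> set cyc" for n
    proof -
      have lp: "loop a J (e y) = loop a J (e x)" if "x \<in> set cyc" "y = wire as x \<or> y = wire ps x" for x y
      proof -
        have x: "x < N" "wire as x \<noteq> x" "e x \<in> E" using chk2 that sub by auto
        have "a (e x) = e (wire as x)" "J (e x) = e (wire ps x)" using Je[OF x(1)] arcs[OF x(1,2)] by simp_all
        then have "e y \<in> loop a J (e x)" using that(2) S.loop_a[OF x(3)] S.loop_j[OF x(3)] by auto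
        then show ?thesis by (rule S.loop_eq[OF x(3)])
      qed
      have "successively (\<lambda>x y. y = wire as x \<or> y = wire ps x) (k # ks) \<Longrightarrow> set (k # ks) \<subseteq> set cyc \<Longrightarrow>
        n \<in> set (k # ks) \<Longrightarrow> loop a J (e n) = loop a J (e k)" for k ks n
      proof (induction ks arbitrary: k)
        case (Cons l ks)
        show ?case
        proof (cases "n = k")
          case False
          then have "loop a J (e n) = loop a J (e l)" using Cons by auto
          then show ?thesis using lp[of k l] Cons.prems by auto
        qed simp
      qed simp
      from this[of n0 cs n] show ?thesis using chk that Cons by (auto simp: contracts_to_def)
    qed
    have "loop a J (e n0) \<subseteq> e ` set cyc"
    proof (rule S.loop_least[OF n0(2)])
      show "e n0 \<in> e ` set cyc" using Cons by simp
      fix y assume "y \<in> e ` set cyc"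
      then obtain n where n: "y = e n" "n \<in> set cyc" by blast
      show "a y \<in> e ` set cyc \<and> J y \<in> e ` set cyc"
        using arcs[of n] Je[of n] chk2[OF n(2)] n by auto
    qed
    also have "\<dots> \<subseteq> I" using chk2 Ie by auto
    finally have "{c \<in> loop a J ` E. c \<subseteq> I} = {loop a J (e n0)}"
      using inner cyc_in n0 by auto
    then show ?thesis using Cons by simp
  qed
  then show "loops_eval \<kappa> E a (rewire e N ps j) \<Theta> = \<kappa> 0 ^ (if cyc = [] then 0 else 1) *
      loops_eval \<kappa> (E - inner_ends e N as) a (rewire e N m j) \<Theta>"
    using C.loops_eval_contracted[of \<kappa>] by (simp only: J_def I_def)
  show "loop_system (E - inner_ends e N as) a (rewire e N m j)"
    using C.contracted by (simp only: I_def)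
qed

subsection \<open>The tangles of the Reidemeister moves\<close>

text \<open>
  The two smoothings of a crossing of two strands with left ends \<open>kL\<close>, \<open>lL\<close> and right ends \<open>kR\<close>, \<open>lR\<close>. They are
  distinguished by their shape: \<open>True\<close> joins left ends to right ends. Which one is the oriented smoothing depends on the
  directions of the strands.
\<close>

definition smooth :: "bool \<Rightarrow> nat \<Rightarrow> nat \<Rightarrow> nat \<Rightarrow> nat \<Rightarrow> (nat \<times> nat) list" where
  "smooth s kL kR lL lR = (if s then [(kL, lR), (lL, kR)] else [(kL, lL), (kR, lR)])"

text \<open>
  The first case is the straight strand, with two marks in place of the crossing; the others are the two smoothings of a
  kink.
\<close>

lemma contracts_R1:
  "contracts_to 4 [(1, 2)] [(0, 1), (2, 3)] [(0, 3)] []"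
  "contracts_to 4 [(1, 2)] [(0, 3), (2, 1)] [(0, 3)] [1, 2]"
  "contracts_to 4 [(1, 2)] [(0, 2), (1, 3)] [(0, 3)] []"
  by code_simp+

text \<open>
  Two strands without crossings, with marks in place of the crossings, and the four states of two strands that cross twice:
  one of them is the identity tangle, and one has a closed loop.
\<close>

lemma contracts_R2:
  "contracts_to 8 [(1, 2), (5, 6)] [(0, 1), (2, 3), (4, 5), (6, 7)] [(0, 3), (4, 7)] []"
  "contracts_to 8 [(1, 2), (5, 6)] (smooth True 0 1 4 5 @ smooth True 6 7 2 3) [(0, 3), (4, 7)] []"
  "contracts_to 8 [(1, 2), (5, 6)] (smooth True 0 1 4 5 @ smooth False 6 7 2 3) [(0, 4), (3, 7)] []"
  "contracts_to 8 [(1, 2), (5, 6)] (smooth False 0 1 4 5 @ smooth True 6 7 2 3) [(0, 4), (3, 7)] []"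
  "contracts_to 8 [(1, 2), (5, 6)] (smooth False 0 1 4 5 @ smooth False 6 7 2 3) [(0, 4), (3, 7)] [1, 2, 6, 5]"
  by code_simp+

text \<open>
  Three strands, each with four marks: its two end points and its two crossings. The ends on the strand \<open>k\<close> have the
  numbers from \<open>8 * k\<close> on, from left to right.
\<close>

definition R3_arcs :: "(nat \<times> nat) list" where
  "R3_arcs = [(1, 2), (3, 4), (5, 6), (9, 10), (11, 12), (13, 14), (17, 18), (19, 20), (21, 22)]"

definition R3_marks :: "(nat \<times> nat) list" where
  "R3_marks = [(0, 1), (6, 7), (8, 9), (14, 15), (16, 17), (22, 23)]"

definition R3_before :: "bool \<Rightarrow> bool \<Rightarrow> bool \<Rightarrow> (nat \<times> nat) list" where
  "R3_before s01 s02 s12 =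
     smooth s01 2 3 10 11 @ smooth s02 4 5 18 19 @ smooth s12 12 13 20 21 @ R3_marks"

definition R3_after :: "bool \<Rightarrow> bool \<Rightarrow> bool \<Rightarrow> (nat \<times> nat) list" where
  "R3_after s01 s02 s12 =
     smooth s01 4 5 12 13 @ smooth s02 2 3 20 21 @ smooth s12 10 11 18 19 @ R3_marks"

text \<open>
  Five matchings of the outer ends, named after the elements of the Temperley-Lieb algebra with three strands. The strand
  that is the lowest on the left is the highest on the right, so the identity joins the left end 0 of the strand 0 to the
  right end 23 of the strand 2.
\<close>

definition TL_1 :: "(nat \<times> nat) list" where "TL_1 = [(0, 23), (8, 15), (16, 7)]"
definition TL_e1 :: "(nat \<times> nat) list" where "TL_e1 = [(0, 8), (23, 15), (16, 7)]"
definition TL_e2 :: "(nat \<times> nat) list" where "TL_e2 = [(8, 16), (15, 7), (0, 23)]"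
definition TL_e1e2 :: "(nat \<times> nat) list" where "TL_e1e2 = [(0, 8), (15, 7), (16, 23)]"
definition TL_e2e1 :: "(nat \<times> nat) list" where "TL_e2e1 = [(8, 16), (23, 15), (0, 7)]"

text \<open>All states are planar tangles without crossings, and one of them has a loop in addition.\<close>

lemma contracts_R3_before:
  "contracts_to 24 R3_arcs (R3_before True True True) TL_1 []"
  "contracts_to 24 R3_arcs (R3_before True True False) TL_e1 []"
  "contracts_to 24 R3_arcs (R3_before True False True) TL_e2 []"
  "contracts_to 24 R3_arcs (R3_before True False False) TL_e2e1 []"
  "contracts_to 24 R3_arcs (R3_before False True True) TL_e1 []"
  "contracts_to 24 R3_arcs (R3_before False True False) TL_e1 [3, 4, 19, 20, 12, 11]"
  "contracts_to 24 R3_arcs (R3_before False False True) TL_e1e2 []"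
  "contracts_to 24 R3_arcs (R3_before False False False) TL_e1 []"
  by code_simp+

lemma contracts_R3_after:
  "contracts_to 24 R3_arcs (R3_after True True True) TL_1 []"
  "contracts_to 24 R3_arcs (R3_after False True True) TL_e2 []"
  "contracts_to 24 R3_arcs (R3_after True False True) TL_e1 []"
  "contracts_to 24 R3_arcs (R3_after False False True) TL_e1e2 []"
  "contracts_to 24 R3_arcs (R3_after True True False) TL_e2 []"
  "contracts_to 24 R3_arcs (R3_after False True False) TL_e2 [11, 12, 4, 3, 20, 19]"
  "contracts_to 24 R3_arcs (R3_after True False False) TL_e2e1 []"
  "contracts_to 24 R3_arcs (R3_after False False False) TL_e2 []"
  by code_simp+

section \<open>Marked points on oriented circles\<close>

lemma fst_travel [simp]: "fst (travel p t) = fst p"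
  and snd_travel: "snd (travel p t) = snd p * cis t"
  by (simp_all add: travel_def)

lemma travel_0 [simp]: "travel p 0 = p"
  by (simp add: travel_def)

lemma travel_travel: "travel (travel p s) t = travel p (s + t)"
  by (simp add: travel_def mult.assoc cis_mult)

lemma travel_2pi [simp]: "travel p (2 * pi) = p"
  by (simp add: travel_def)

definition circles :: "nat \<Rightarrow> (nat \<times> complex) set" where
  "circles n = {..<n} \<times> sphere 0 1"

lemma travel_circles [simp]: "travel p t \<in> circles n \<longleftrightarrow> p \<in> circles n"
  by (cases p) (auto simp: circles_def travel_def norm_mult)

lemma travel_inj:
  assumes "p \<in> circles n" "travel p s = travel p t" "\<bar>s - t\<bar> < 2 * pi" shows "s = t"
proof -
  have "snd p \<noteq> 0" using assms(1) by (auto simp: circles_def)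
  then have eq: "cis s = cis t" using assms(2) by (simp add: travel_def)
  have "cos (s - t) = Re (cis s * cnj (cis t))" by (simp add: cos_diff)
  also have "\<dots> = 1" by (simp add: eq complex_norm_square[symmetric] flip: complex_norm_square)
  finally have "cos (s - t) = 1" .
  then obtain k :: int where k: "s - t = k * 2 * pi" using cos_one_2pi_int by auto
  have "\<bar>real_of_int k\<bar> * (2 * pi) < 1 * (2 * pi)" using assms(3) k by (simp add: abs_mult)
  then have "\<bar>real_of_int k\<bar> < 1" by (simp add: mult_less_cancel_right)
  then have "k = 0" by linarith
  then show ?thesis using k by simp
qed

lemma circles_travel:
  assumes "p \<in> circles n" "q \<in> circles n" "fst p = fst q"
  obtains t where "0 \<le> t" "t < 2 * pi" "q = travel p t"
proof -
  have n: "norm (snd p) = 1" "norm (snd q) = 1" using assms by (auto simp: circles_def)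
  define z where "z = snd q / snd p"
  have "norm z = 1" by (simp add: z_def norm_divide n)
  then obtain t where t: "0 \<le> t" "t < 2 * pi" "z = cis t"
    by (metis complex_unimodular_polar cis.ctr complex_eq_iff cis.simps complex.sel)
  have "snd p \<noteq> 0" using n by auto
  then have "snd q = snd p * cis t" using t by (simp add: z_def[symmetric] flip: t(3)) (simp add: z_def)
  then have "q = travel p t" using assms(3) by (simp add: travel_def prod_eq_iff)
  then show ?thesis using that t by blast
qed

definition succ :: "(nat \<times> complex) set \<Rightarrow> nat \<times> complex \<Rightarrow> nat \<times> complex" where
  "succ M p = travel p (LEAST t. 0 < t \<and> travel p t \<in> M)"

lemma succ_eqI:
  assumes "0 < t" "travel p t \<in> M" "\<And>s. 0 < s \<Longrightarrow> s < t \<Longrightarrow> travel p s \<notin> M"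
  shows "succ M p = travel p t"
proof -
  have "(LEAST t. 0 < t \<and> travel p t \<in> M) = t"
    using assms by (intro Least_equality) (auto simp: not_less[symmetric])
  then show ?thesis by (simp add: succ_def)
qed

locale marking =
  fixes n :: nat and M :: "(nat \<times> complex) set"
  assumes fin_M: "finite M" and M_sub: "M \<subseteq> circles n"
begin

text \<open>
  If \<open>p\<close> is the only mark on its circle, the next mark is \<open>p\<close> itself, after a full turn.
\<close>

lemma succ_obtain:
  assumes "p \<in> M"
  obtains t where "0 < t" "t \<le> 2 * pi" "travel p t \<in> M"
    "\<And>s. 0 < s \<Longrightarrow> s < t \<Longrightarrow> travel p s \<notin> M" "succ M p = travel p t"
proof -
  let ?T = "{t. 0 < t \<and> t \<le> 2 * pi \<and> travel p t \<in> M}"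
  have "inj_on (travel p) ?T"
    using travel_inj[of p n] assms M_sub by (auto simp: inj_on_def)
  moreover have "finite (travel p ` ?T)" by (rule finite_subset[OF _ fin_M]) auto
  ultimately have fin: "finite ?T" using finite_imageD by blast
  have ne: "2 * pi \<in> ?T" using assms by simp
  define t where "t = Min ?T"
  have t: "t \<in> ?T" unfolding t_def by (rule Min_in) (use fin ne in auto)
  have least: "travel p s \<notin> M" if "0 < s" "s < t" for s
  proof
    assume "travel p s \<in> M"
    then have "s \<in> ?T" using that t by simp
    then have "t \<le> s" unfolding t_def using fin by (rule Min_le[rotated])
    then show False using that by simp
  qed
  show ?thesis
    by (rule that[of t]) (use t least succ_eqI[of t p M] in auto)
qed

lemma succ_in: "p \<in> M \<Longrightarrow> succ M p \<in> M"
  by (metis succ_obtain)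

lemma fst_succ [simp]: "fst (succ M p) = fst p"
  by (simp add: succ_def)

text \<open>
  If two marks had the same successor at different distances, the nearer mark would lie between the farther one and that
  successor.
\<close>

lemma succ_inj: "inj_on (succ M) M"
proof (rule inj_onI)
  have *: "t \<le> s \<longrightarrow> s \<le> t"
    if "p \<in> M" "q \<in> M" "travel p s = travel q t" "\<And>r. 0 < r \<Longrightarrow> r < s \<Longrightarrow> travel p r \<notin> M" "0 < t"
    for p q s t
  proof (rule impI, rule ccontr)
    assume "t \<le> s" "\<not> s \<le> t"
    have "travel p (s - t) = travel (travel p s) (- t)" by (simp add: travel_travel)
    also have "\<dots> = q" by (simp add: that(3) travel_travel)
    finally show False using that(2) that(4)[of "s - t"] \<open>0 < t\<close> \<open>\<not> s \<le> t\<close> by simp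
  qed
  fix p q assume pq: "p \<in> M" "q \<in> M" "succ M p = succ M q"
  obtain s where s: "0 < s" "succ M p = travel p s" "\<And>r. 0 < r \<Longrightarrow> r < s \<Longrightarrow> travel p r \<notin> M"
    by (rule succ_obtain[OF pq(1)]) blast
  obtain t where t: "0 < t" "succ M q = travel q t" "\<And>r. 0 < r \<Longrightarrow> r < t \<Longrightarrow> travel q r \<notin> M"
    by (rule succ_obtain[OF pq(2)]) blast
  have eq: "travel p s = travel q t" using pq s t by simp
  have "s = t" using *[OF pq(1,2) eq s(3) t(1)] *[OF pq(2,1) eq[symmetric] t(3) s(1)] by linarith
  have "p = travel (travel p s) (- s)" by (simp add: travel_travel)
  also have "\<dots> = travel (travel q t) (- t)" by (simp only: eq) (simp only: \<open>s = t\<close>)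
  also have "\<dots> = q" by (simp add: travel_travel)
  finally show "p = q" .
qed

lemma succ_image: "succ M ` M = M"
  by (rule endo_inj_surj[OF fin_M _ succ_inj]) (use succ_in in auto)

end

text \<open>
  The arcs between successive marks; an end \<open>(p, True)\<close> points in the direction of the circle.
\<close>

fun arc_map :: "(nat \<times> complex) set \<Rightarrow> end_pt \<Rightarrow> end_pt" where
  "arc_map M (p, True) = (succ M p, False)"
| "arc_map M (p, False) = (inv_into M (succ M) p, True)"

context marking
begin

lemma arc_eqI:
  assumes "p \<in> M" "succ M p = q" shows "arc_map M (p, True) = (q, False)" "arc_map M (q, False) = (p, True)"
  using assms inv_into_f_f[OF succ_inj assms(1)] by auto

lemma arc_cases:
  assumes "x \<in> M \<times> UNIV"
  obtains p where "p \<in> M" "x = (p, True)" | p where "p \<in> M" "x = (succ M p, False)"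
proof -
  obtain q b where x: "x = (q, b)" "q \<in> M" using assms by auto
  then obtain p where "p \<in> M" "q = succ M p" using succ_image by blast
  then show ?thesis using that x by (cases b) auto
qed

lemma arc_in: "x \<in> M \<times> UNIV \<Longrightarrow> arc_map M x \<in> M \<times> UNIV"
  by (erule arc_cases) (simp_all add: inv_into_f_f[OF succ_inj] succ_in)

lemma arc_arc: "x \<in> M \<times> UNIV \<Longrightarrow> arc_map M (arc_map M x) = x"
  by (erule arc_cases) (simp_all add: inv_into_f_f[OF succ_inj])

lemma snd_arc: "snd (arc_map M x) = (\<not> snd x)"
  by (cases "(M, x)" rule: arc_map.cases) auto

end

lemma succ_remove:
  assumes "marking n (insert p M)" "p \<notin> M" "x \<in> M"
  shows "succ M x = (if succ (insert p M) x = p then succ (insert p M) p else succ (insert p M) x)"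
proof -
  let ?M = "insert p M"
  interpret marking n ?M by fact
  have inj: "succ ?M p = p \<Longrightarrow> succ ?M x = p \<Longrightarrow> False"
    using inj_onD[OF succ_inj, of x p] assms by auto
  obtain t where t: "0 < t" "travel x t \<in> ?M" "succ ?M x = travel x t"
    "\<And>s. 0 < s \<Longrightarrow> s < t \<Longrightarrow> travel x s \<notin> ?M"
    using succ_obtain[of x] assms(3) by (metis insertI2)
  show ?thesis
  proof (cases "travel x t = p")
    case False
    then show ?thesis using t by (subst succ_eqI[of t]) auto
  next
    case True
    obtain u where u: "0 < u" "travel p u \<in> ?M" "succ ?M p = travel p u"
      "\<And>s. 0 < s \<Longrightarrow> s < u \<Longrightarrow> travel p s \<notin> ?M"
      using succ_obtain[of p] by (metis insertI1)
    have tr: "travel x (t + r) = travel p r" for r using True by (simp add: travel_travel[symmetric])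
    have "travel p u \<noteq> p" using inj u t True by auto
    then have "succ M x = travel x (t + u)"
    proof (intro succ_eqI)
      fix s assume s: "0 < s" "s < t + u"
      consider "s < t" | "s = t" | "t < s" by linarith
      then show "travel x s \<notin> M"
      proof cases
        case 3
        then show ?thesis using u(4)[of "s - t"] tr[of "s - t"] s by auto
      qed (use t s True assms in auto)
    qed (use t u in \<open>auto simp: tr\<close>)
    then show ?thesis using t u True by (simp add: tr)
  qed
qed

lemma succ_fixed_iff:
  assumes "marking n (insert p M)" "p \<notin> M"
  shows "succ (insert p M) p = p \<longleftrightarrow> M \<inter> {fst p} \<times> UNIV = {}"
proof -
  let ?M = "insert p M"
  interpret marking n ?M by fact
  obtain u where u: "0 < u" "u \<le> 2 * pi" "travel p u \<in> ?M" "succ ?M p = travel p u"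
    "\<And>s. 0 < s \<Longrightarrow> s < u \<Longrightarrow> travel p s \<notin> ?M"
    using succ_obtain[of p] by (metis insertI1)
  have p: "p \<in> circles n" using M_sub by simp
  show ?thesis
  proof
    assume fixed: "succ ?M p = p"
    have "u = 2 * pi"
    proof (rule ccontr)
      assume "u \<noteq> 2 * pi"
      then show False using travel_inj[OF p, of u 0] u fixed by simp
    qed
    show "M \<inter> {fst p} \<times> UNIV = {}"
    proof (rule ccontr)
      assume "M \<inter> {fst p} \<times> UNIV \<noteq> {}"
      then obtain b where "(fst p, b) \<in> M" by auto
      then obtain q where q: "q \<in> M" "fst q = fst p" by (metis fst_conv)
      then obtain t where t: "0 \<le> t" "t < 2 * pi" "q = travel p t"
        using circles_travel[of p n q] p M_sub by (metis insertI2 subsetD)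
      have "t \<noteq> 0" using t q assms(2) by auto
      then show False using u(5)[of t] t q \<open>u = 2 * pi\<close> by auto
    qed
  next
    assume "M \<inter> {fst p} \<times> UNIV = {}"
    then show "succ ?M p = p" using succ_in[of p] fst_succ[of p] by (cases "succ ?M p") auto
  qed
qed

definition unmarked :: "nat \<Rightarrow> (nat \<times> complex) set \<Rightarrow> nat set" where
  "unmarked n M = {i. i < n \<and> M \<inter> ({i} \<times> UNIV) = {}}"

text \<open>
  An additional mark that carries a straight join only subdivides an arc. On a circle without other marks it
  creates a loop of holonomy zero, and the circle is no longer unmarked; so the product of both factors does not change.
\<close>

lemma eval_insert_mark:
  assumes mk: "marking n (insert p M)" and p: "p \<notin> M"
    and sys: "loop_system (insert p M \<times> UNIV) (arc_map (insert p M)) j"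
    and straight: "\<And>b. j (p, b) = (p, \<not> b)" and flat: "\<Theta> (p, True) = \<Theta> (p, False)"
  shows "\<kappa> 0 ^ card (unmarked n (insert p M)) * loops_eval \<kappa> (insert p M \<times> UNIV) (arc_map (insert p M)) j \<Theta> =
         \<kappa> 0 ^ card (unmarked n M) * loops_eval \<kappa> (M \<times> UNIV) (arc_map M) j \<Theta>"
proof -
  let ?M = "insert p M" and ?I = "{p} \<times> (UNIV :: bool set)"
  interpret M': marking n ?M by fact
  interpret M: marking n M using M'.fin_M M'.M_sub by unfold_locales auto
  interpret S: loop_system "?M \<times> UNIV" "arc_map ?M" j by fact
  have E: "?M \<times> UNIV - ?I = M \<times> UNIV" using p by auto
  have jp: "x \<in> ?I \<longleftrightarrow> j x \<in> ?I" if "x \<in> ?M \<times> UNIV" for x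
  proof -
    have *: "x \<in> ?I \<Longrightarrow> j x \<in> ?I" for x using straight by auto
    show ?thesis using *[of x] *[of "j x"] S.j_j[OF that] by auto
  qed
  \<comment> \<open>Exchanging joins and arcs changes neither the loops nor the absolute values of the holonomy.\<close>
  interpret T: loop_system "?M \<times> UNIV" j "arc_map ?M" by (rule loop_system_swap) fact
  have succ: "succ M x = (if succ ?M x = p then succ ?M p else succ ?M x)" if "x \<in> M" for x
    by (rule succ_remove[OF mk p that])
  have ret: "thread j (arc_map ?M) ?I z (arc_map M z)" if z: "z \<in> ?M \<times> UNIV - ?I" for z
  proof -
    obtain x b where x: "z = (x, b)" "x \<in> M" using z by auto
    show ?thesis
    proof (cases b)
      case True
      show ?thesis
      proof (cases "succ ?M x = p")
        case False
        then show ?thesis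
          using thread.exit[of "arc_map ?M" z ?I j] x True succ[OF x(2)] by simp
      next
        case eq: True
        have ne: "succ ?M p \<noteq> p" using inj_onD[OF M'.succ_inj, of x p] eq x p by auto
        have "thread j (arc_map ?M) ?I (p, True) (arc_map ?M (p, True))"
          by (rule thread.exit) (use ne in auto)
        then have "thread j (arc_map ?M) ?I z (arc_map ?M (p, True))"
          using thread.pass[of "arc_map ?M" z ?I j "arc_map ?M (p, True)"] eq x True straight by simp
        then show ?thesis using x True eq succ[OF x(2)] by simp
      qed
    next
      case False
      define y where "y = inv_into M (succ M) x"
      have y: "y \<in> M" "succ M y = x"
        unfolding y_def using x M.succ_image inv_into_into[of x "succ M" M] f_inv_into_f[of x "succ M" M] by auto
      have yx: "arc_map M z = (y, True)" using x False by (simp add: y_def)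
      have a: "arc_map ?M (succ ?M w, False) = (w, True)" if "w \<in> ?M" for w
        using M'.arc_eqI[OF that refl] by blast
      show ?thesis
      proof (cases "succ ?M y = p")
        case F: False
        then have "x = succ ?M y" using y succ by auto
        then have "arc_map ?M z = (y, True)" using a[of y] y x False by simp
        then show ?thesis using thread.exit[of "arc_map ?M" z ?I j] yx y p by auto
      next
        case T: True
        then have "x = succ ?M p" using y succ by auto
        then have z: "arc_map ?M z = (p, True)" using a[of p] x False by simp
        have ap: "arc_map ?M (p, False) = (y, True)" using a[of y] y T by simp
        then have "thread j (arc_map ?M) ?I (p, False) (y, True)"
          using thread.exit[of "arc_map ?M" "(p, False)" ?I j, unfolded ap] y p by blast
        then have "thread j (arc_map ?M) ?I z (y, True)"
          using thread.pass[of "arc_map ?M" z ?I j "(y, True)", unfolded z] straight[of True] by simp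
        then show ?thesis using yx by simp
      qed
    qed
  qed
  \<comment> \<open>The straight joins at \<open>p\<close> are what is forgotten, so joins and arcs exchange their roles.\<close>
  interpret C: contraction "?M \<times> UNIV" j "arc_map ?M" ?I \<Theta> "arc_map M"
  proof unfold_locales
    fix x assume "x \<in> ?I"
    then show "\<Theta> (j x) = \<Theta> x" using straight flat by (cases "snd x") auto
  qed (use straight ret in auto)
  have ev: "loops_eval \<kappa> (?M \<times> UNIV) (arc_map ?M) j \<Theta> =
    \<kappa> 0 ^ card {c \<in> loop j (arc_map ?M) ` (?M \<times> UNIV). c \<subseteq> ?I} * loops_eval \<kappa> (M \<times> UNIV) (arc_map M) j \<Theta>"
    using C.loops_eval_contracted[of \<kappa>] loops_eval_swap[OF sys, of \<kappa> \<Theta>]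
      loops_eval_swap[OF C.contracted, of \<kappa> \<Theta>] by (simp only: E)
  have lp: "c = loop j (arc_map ?M) (p, True)" 
    if c: "c \<in> loop j (arc_map ?M) ` (?M \<times> UNIV)" "c \<subseteq> ?I" for c
  proof -
    obtain x where x: "x \<in> ?M \<times> UNIV" "c = loop j (arc_map ?M) x" using c(1) by blast
    then have "x \<in> ?I" using subsetD[OF c(2), of x] T.loop_self[of x] by simp
    then have "(p, True) \<in> {x, j x}" using straight by (cases x) auto
    then have "(p, True) \<in> loop j (arc_map ?M) x" using T.loop_self[of x] T.loop_a[OF x(1)] by auto
    then show ?thesis using T.loop_eq[OF x(1)] x by simp
  qed
  show ?thesis
  proof (cases "M \<inter> {fst p} \<times> UNIV = {}")
    case True
    then have fx: "succ ?M p = p" using succ_fixed_iff[OF mk p] by blast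
    have "loop j (arc_map ?M) (p, True) \<subseteq> ?I"
    proof (rule T.loop_least)
      fix y assume "y \<in> ?I"
      moreover have "arc_map ?M (p, True) = (p, False)" "arc_map ?M (p, False) = (p, True)"
        using M'.arc_eqI[of p p] fx by auto
      ultimately show "j y \<in> ?I \<and> arc_map ?M y \<in> ?I" using straight by (cases y; cases "snd y") auto
    qed auto
    then have "{c \<in> loop j (arc_map ?M) ` (?M \<times> UNIV). c \<subseteq> ?I} = {loop j (arc_map ?M) (p, True)}"
      using lp by auto
    then have "card {c \<in> loop j (arc_map ?M) ` (?M \<times> UNIV). c \<subseteq> ?I} = 1" by simp
    moreover have "unmarked n M = insert (fst p) (unmarked n ?M)" "fst p \<notin> unmarked n ?M"
      using True M'.M_sub by (auto simp: unmarked_def circles_def)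
    then have "card (unmarked n M) = Suc (card (unmarked n ?M))"
      by (simp add: unmarked_def)
    ultimately show ?thesis using ev by simp
  next
    case False
    then have fx: "succ ?M p \<noteq> p" using succ_fixed_iff[OF mk p] by blast
    have "\<not> loop j (arc_map ?M) (p, True) \<subseteq> ?I"
      using T.loop_j[of "(p, True)"] fx by auto
    then have "\<not> c \<subseteq> ?I" if "c \<in> loop j (arc_map ?M) ` (?M \<times> UNIV)" for c
      using lp[OF that] by metis
    then have "{c \<in> loop j (arc_map ?M) ` (?M \<times> UNIV). c \<subseteq> ?I} = {}" by blast
    moreover have "unmarked n M = unmarked n ?M"
      using False by (auto simp: unmarked_def)
    ultimately show ?thesis using ev by (simp only:) simp
  qed
qed

text \<open>
  This makes it possible to compare two diagrams on a common set of marks, with straight joins where only one of them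
  has a crossing.
\<close>

lemma eval_add_marks:
  assumes mk: "marking n M'" and sub: "M \<subseteq> M'"
    and sys: "\<And>N. M \<subseteq> N \<Longrightarrow> N \<subseteq> M' \<Longrightarrow> loop_system (N \<times> UNIV) (arc_map N) j"
    and straight: "\<And>p b. p \<in> M' - M \<Longrightarrow> j (p, b) = (p, \<not> b)"
    and flat: "\<And>p. p \<in> M' - M \<Longrightarrow> \<Theta> (p, True) = \<Theta> (p, False)"
  shows "\<kappa> 0 ^ card (unmarked n M') * loops_eval \<kappa> (M' \<times> UNIV) (arc_map M') j \<Theta> =
         \<kappa> 0 ^ card (unmarked n M) * loops_eval \<kappa> (M \<times> UNIV) (arc_map M) j \<Theta>"
proof -
  let ?v = "\<lambda>N. \<kappa> 0 ^ card (unmarked n N) * loops_eval \<kappa> (N \<times> UNIV) (arc_map N) j \<Theta>"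
  interpret marking n M' by fact
  have "N \<subseteq> M' - M \<Longrightarrow> ?v (M \<union> N) = ?v M" if "finite N" for N
    using that
  proof induction
    case (insert p N)
    have mk': "marking n (insert p (M \<union> N))"
      using fin_M M_sub insert.prems sub by unfold_locales (auto intro: finite_subset)
    have "?v (insert p (M \<union> N)) = ?v (M \<union> N)"
      by (rule eval_insert_mark[OF mk']) (use insert sub straight flat in \<open>auto intro!: sys\<close>)
    then show ?case using insert by simp
  qed simp
  from this[of "M' - M"] show ?thesis using fin_M sub by (simp add: Un_absorb1)
qed

section \<open>States as loop systems\<close>

subsection \<open>Cusp words\<close>

definition sgnb :: "bool \<Rightarrow> int" where
  "sgnb b = (if b then 1 else -1)"

lemma sgnb_simps [simp]: "sgnb True = 1" "sgnb False = -1" "sgnb (\<not> b) = - sgnb b" "sgnb b * sgnb b = 1"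
  "sgnb b * (sgnb b * x) = x"
  by (simp_all add: sgnb_def)

text \<open>
  Equal neighbours cancel in the alternating sum, exactly as cusps with arrows in the same direction do.
\<close>

primrec alt_sum :: "bool list \<Rightarrow> int" where
  "alt_sum [] = 0"
| "alt_sum (b # w) = sgnb b - alt_sum w"

lemma alt_sum_append: "alt_sum (v @ w) = alt_sum v + (-1) ^ length v * alt_sum w"
  by (induction v) auto

lemma alt_sum_rotate1: "even (length w) \<Longrightarrow> \<bar>alt_sum (rotate1 w)\<bar> = \<bar>alt_sum w\<bar>"
  by (cases w) (auto simp: alt_sum_append)

lemma alt_sum_rotate: "even (length w) \<Longrightarrow> \<bar>alt_sum (rotate k w)\<bar> = \<bar>alt_sum w\<bar>"
  by (induction k) (simp_all add: alt_sum_rotate1)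

lemma cusp_cancel_invariant:
  assumes "cusp_cancel w w'" "even (length w)"
  shows "length w = length w' + 2" "\<bar>alt_sum w'\<bar> = \<bar>alt_sum w\<bar>"
proof -
  obtain k b where k: "rotate k w = b # b # w'" using assms by (auto simp: cusp_cancel_def)
  have "length w = length (rotate k w)" by simp
  also have "\<dots> = length w' + 2" unfolding k by simp
  finally show "length w = length w' + 2" .
  show "\<bar>alt_sum w'\<bar> = \<bar>alt_sum w\<bar>" using alt_sum_rotate[OF assms(2), of k] by (simp add: k)
qed

lemma cusp_cancels_invariant:
  assumes "cusp_cancel\<^sup>*\<^sup>* w w'" "even (length w)"
  shows "even (length w') \<and> \<bar>alt_sum w'\<bar> = \<bar>alt_sum w\<bar>"
  using assms
proof (induction rule: rtranclp_induct)
  case (step v u)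
  then show ?case using cusp_cancel_invariant[of v u] by simp
qed simp

lemma alt_sum_alternating: "distinct_adj (b # w) \<Longrightarrow> alt_sum (b # w) = sgnb b * int (length (b # w))"
proof (induction w arbitrary: b)
  case (Cons c w)
  then have "alt_sum (c # w) = sgnb c * int (length (c # w))" "b = (\<not> c)" by auto
  then show ?case by (simp add: algebra_simps)
qed simp

text \<open>
  In a cyclically reduced word the letters alternate, so that no terms of the sum cancel. Rotations serve only to expose
  two equal neighbours at the beginning.
\<close>

lemma alt_sum_reduced: assumes "cusp_reduced w" shows "\<bar>alt_sum w\<bar> = int (length w)"
proof -
  have "distinct_adj w"
    unfolding distinct_adj_conv_nth
  proof (intro allI impI notI)
    fix i assume i: "Suc i < length w" "w ! i = w ! Suc i"
    have "rotate i w = drop i w @ take i w" using i by (simp add: rotate_drop_take)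
    also have "drop i w = w ! i # w ! i # drop (Suc (Suc i)) w"
      using i Cons_nth_drop_Suc[of i w] Cons_nth_drop_Suc[of "Suc i" w] by simp
    finally have "cusp_cancel w (drop (Suc (Suc i)) w @ take i w)"
      unfolding cusp_cancel_def by (intro exI[of _ i] exI[of _ "w ! i"]) simp
    then show False using assms by (auto simp: cusp_reduced_def)
  qed
  then show ?thesis using alt_sum_alternating by (cases w) (auto simp: abs_mult sgnb_def)
qed

lemma cusp_reduction_exists: "even (length w) \<Longrightarrow> \<exists>v. cusp_cancel\<^sup>*\<^sup>* w v \<and> cusp_reduced v"
proof (induction "length w" arbitrary: w rule: less_induct)
  case less
  show ?case
  proof (cases "cusp_reduced w")
    case False
    then obtain w' where w': "cusp_cancel w w'" by (auto simp: cusp_reduced_def)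
    from cusp_cancel_invariant(1)[OF w' less(2)] less obtain v where "cusp_cancel\<^sup>*\<^sup>* w' v" "cusp_reduced v"
      by (metis add.commute even_add even_numeral less_add_same_cancel2 zero_less_numeral)
    then show ?thesis using w' by (metis converse_rtranclp_into_rtranclp)
  qed auto
qed

text \<open>
  The traversal of a loop in \<open>cusp_word\<close> stops at the first return, so it meets each element of the orbit once.
\<close>

lemma (in loop_system) hol_period:
  assumes "x \<in> E"
  defines "m \<equiv> LEAST m. 0 < m \<and> (st ^^ m) x = x"
  shows "0 < m" "(st ^^ m) x = x"
    "hol a j \<Theta> x = (\<Sum>k<m. \<Theta> ((st ^^ k) x) - \<Theta> (a ((st ^^ k) x)))"
proof -
  have m: "0 < m \<and> (st ^^ m) x = x"
    unfolding m_def by (rule LeastI_ex) (use period_exists assms in blast)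
  then show "0 < m" "(st ^^ m) x = x" by auto
  have least: "\<not> (0 < k \<and> (st ^^ k) x = x)" if "k < m" for k
    using that not_less_Least unfolding m_def by blast
  have inj: "inj_on (\<lambda>k. (st ^^ k) x) {..<m}"
  proof (rule inj_onI)
    have *: "\<not> k < l" if "l < m" "(st ^^ k) x = (st ^^ l) x" for k l
    proof
      assume "k < l"
      have "(st ^^ k) ((st ^^ (l - k)) x) = (st ^^ (k + (l - k))) x" by (simp only: funpow_add o_apply)
      also have "\<dots> = (st ^^ k) x" using that \<open>k < l\<close> by simp
      finally have "(st ^^ (l - k)) x = x" using st_pow_inj assms st_pow_in by blast
      moreover have "l - k < m" using that by linarith
      ultimately show False using least[of "l - k"] \<open>k < l\<close> by simp
    qed
    fix k l assume "k \<in> {..<m}" "l \<in> {..<m}" "(st ^^ k) x = (st ^^ l) x"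
    then show "k = l" using *[of k l] *[of l k] by auto
  qed
  have "orb st x \<subseteq> (\<lambda>k. (st ^^ k) x) ` {..<m}"
  proof (rule orb_least)
    show "x \<in> (\<lambda>k. (st ^^ k) x) ` {..<m}" using m by (intro image_eqI[of _ _ 0]) auto
    fix y assume "y \<in> (\<lambda>k. (st ^^ k) x) ` {..<m}"
    then obtain k where k: "k < m" "y = (st ^^ k) x" by auto
    then have "st y = (st ^^ (if Suc k = m then 0 else Suc k)) x" using m by auto
    moreover have "(if Suc k = m then 0 else Suc k) \<in> {..<m}" using k m by auto
    ultimately show "st y \<in> (\<lambda>k. (st ^^ k) x) ` {..<m}" by (rule image_eqI)
  qed
  then have "orb st x = (\<lambda>k. (st ^^ k) x) ` {..<m}" by (auto simp: orb_def)
  then show "hol a j \<Theta> x = (\<Sum>k<m. \<Theta> ((st ^^ k) x) - \<Theta> (a ((st ^^ k) x)))"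
    by (simp add: hol_def sum.reindex[OF inj])
qed

subsection \<open>Diagrams\<close>

lemma circle_points_eq: "circle_points D = circles (ncomp D)"
  by (simp add: circle_points_def circles_def)

lemma next_point_eq: "next_point D = succ (crossing_points D)"
  by (simp add: fun_eq_iff next_point_def succ_def)

lemma arc_end_eq: "arc_end D = arc_map (crossing_points D)"
proof
  show "arc_end D x = arc_map (crossing_points D) x" for x
    by (cases "(D, x)" rule: arc_end.cases) (auto simp: next_point_eq)
qed

text \<open>
  The sign of the pair of velocities, defined for a point over any double point, without reference to over and under. For
  an overpassing point it is the crossing sign.
\<close>

definition eps :: "('a) flat_diagram_scheme \<Rightarrow> nat \<times> complex \<Rightarrow> int" where
  "eps D p = (if 0 < cross2 (vel D p) (vel D (partner D p)) then 1 else -1)"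

definition mark_join :: "('a) flat_diagram_scheme \<Rightarrow> complex set \<Rightarrow> end_pt \<Rightarrow> end_pt" where
  "mark_join D S x = (if fst x \<in> crossing_points D then joined_end D S x else (fst x, \<not> snd x))"

text \<open>
  At a crossing, \<open>\<Theta>\<close> must jump by \<open>-2\<close> or \<open>2\<close> along the joins of the disoriented smoothing, according to the arrow of the
  cusp, and be constant along those of the oriented smoothing; this determines its four values up to the constant \<open>c\<close>.
  The constants can be chosen independently at all crossings, since values along arcs are not restricted.
\<close>

definition potential ::
  "('a) flat_diagram_scheme \<Rightarrow> (nat \<times> complex) set \<Rightarrow> (end_pt \<Rightarrow> int) \<Rightarrow> bool" where
  "potential D M \<Theta> \<longleftrightarrow>
     (\<forall>p \<in> crossing_points D. \<exists>c. \<forall>b. \<Theta> (p, b) = sgnb b * eps D p + c \<and>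
        \<Theta> (partner D p, b) = - (sgnb b * eps D p) + c) \<and>
     (\<forall>p \<in> M - crossing_points D. \<Theta> (p, True) = \<Theta> (p, False))"

lemma cross2_minus [simp]: "cross2 (- u) (- v) = cross2 u v"
  by (simp add: cross2_def)

lemma cross2_swap: "cross2 v u = - cross2 u v"
  by (simp add: cross2_def)

locale flat_diag =
  fixes D :: "('a) flat_diagram_scheme"
  assumes D: "is_flat_diagram D"
begin

abbreviation "CP \<equiv> crossing_points D"

lemma finite_crossings: "finite (crossings D)"
  using D finite_subset by (auto simp: is_flat_diagram_def generic_def)

lemma finite_fiber: "finite (fiber D z)"
  and card_fiber: "card (fiber D z) \<le> 2"
  using D by (auto simp: is_flat_diagram_def generic_def)

lemma finite_CP: "finite CP"
proof -
  have "CP \<subseteq> (\<Union>z\<in>crossings D. fiber D z)" by (auto simp: crossing_points_def fiber_def)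
  then show ?thesis using finite_crossings finite_fiber finite_subset by blast
qed

lemma CP_circles: "CP \<subseteq> circles (ncomp D)"
  by (auto simp: crossing_points_def circle_points_eq)

lemma marking_CP: "marking (ncomp D) CP"
  using finite_CP CP_circles by unfold_locales

lemma partner_unique:
  assumes "p \<in> circle_points D" "q \<in> circle_points D" "q \<noteq> p" "pt D q = pt D p"
  shows "partner D p = q"
  unfolding partner_def
proof (rule the_equality)
  fix r assume r: "r \<in> circle_points D \<and> r \<noteq> p \<and> pt D r = pt D p"
  show "r = q"
  proof (rule ccontr)
    assume "r \<noteq> q"
    then have "card {p, q, r} = 3" using assms r by auto
    moreover have "{p, q, r} \<subseteq> fiber D (pt D p)" using assms r by (auto simp: fiber_def)
    ultimately show False using card_fiber[of "pt D p"] card_mono[OF finite_fiber, of "{p, q, r}" "pt D p"] by simp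
  qed
qed (use assms in auto)

lemma partner:
  assumes "p \<in> CP"
  shows "partner D p \<in> CP" "partner D p \<noteq> p" "pt D (partner D p) = pt D p" "partner D (partner D p) = p"
proof -
  have p: "p \<in> circle_points D" "pt D p \<in> crossings D" using assms by (auto simp: crossing_points_def)
  then have "pt D p \<in> double_points D" using D by (auto simp: is_flat_diagram_def)
  then obtain q where q: "q \<in> circle_points D" "q \<noteq> p" "pt D q = pt D p"
    by (auto simp: double_points_def fiber_def)
  have eq: "partner D p = q" by (rule partner_unique) (use p q in auto)
  show "partner D p \<in> CP" "partner D p \<noteq> p" "pt D (partner D p) = pt D p"
    using p q unfolding eq by (auto simp: crossing_points_def)
  show "partner D (partner D p) = p"
    unfolding eq by (rule partner_unique) (use p q in auto)
qed

lemma eps_partner: assumes "p \<in> CP" shows "eps D (partner D p) = - eps D p"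
proof -
  have "cross2 (vel D p) (vel D (partner D p)) \<noteq> 0"
    using D partner[OF assms] assms by (auto simp: is_flat_diagram_def generic_def crossing_points_def)
  then show ?thesis using cross2_swap[of "vel D p" "vel D (partner D p)"]
    by (auto simp: eps_def partner[OF assms])
qed

lemma mark_join_eq:
  "p \<in> CP \<Longrightarrow> mark_join D S (p, b) = (partner D p, if pt D p \<in> S then b else \<not> b)"
  "p \<notin> CP \<Longrightarrow> mark_join D S (p, b) = (p, \<not> b)"
  by (simp_all add: mark_join_def)

lemma state_system:
  assumes "marking n M" "CP \<subseteq> M" shows "loop_system (M \<times> UNIV) (arc_map M) (mark_join D S)"
proof -
  interpret marking n M by fact
  show ?thesis
  proof
    show "finite (M \<times> (UNIV :: bool set))" using fin_M by simp
    fix x assume x: "x \<in> M \<times> (UNIV :: bool set)"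
    then show "arc_map M x \<in> M \<times> UNIV" "arc_map M (arc_map M x) = x" by (rule arc_in arc_arc)+
    obtain p b where pb: "x = (p, b)" "p \<in> M" using x by auto
    show "mark_join D S x \<in> M \<times> UNIV" "mark_join D S (mark_join D S x) = x"
      using pb assms(2) partner[of p] by (cases "p \<in> CP"; auto simp: mark_join_eq)+
  qed
qed

text \<open>
  The direction of the jump is that of the arrow of the cusp, relative to the orientation of the diagram.
\<close>

lemma join_step:
  assumes "potential D M \<Theta>" "p \<in> CP"
  shows "\<Theta> (joined_end D S (p, b)) - \<Theta> (p, b) = (if pt D p \<in> S then - 2 * sgnb b * eps D p else 0)"
proof -
  obtain c where c: "\<And>b. \<Theta> (p, b) = sgnb b * eps D p + c \<and> \<Theta> (partner D p, b) = - (sgnb b * eps D p) + c"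
    using assms unfolding potential_def by blast
  show ?thesis
  proof (cases "pt D p \<in> S")
    case True
    then show ?thesis using c[of b] by simp
  next
    case False
    then show ?thesis using c[of b] c[of "\<not> b"] by simp
  qed
qed

end

locale diagram_state = flat_diag D for D :: "('a) flat_diagram_scheme" +
  fixes S :: "complex set"
begin

abbreviation "arcs \<equiv> arc_map CP"
abbreviation "joins \<equiv> mark_join D S"

sublocale L: loop_system "ends D" arcs joins
  unfolding ends_def by (rule state_system[OF marking_CP]) simp

sublocale mk: marking "ncomp D" CP by (rule marking_CP)

lemma joins_eq: "x \<in> ends D \<Longrightarrow> joins x = joined_end D S x"
  by (auto simp: mark_join_def ends_def)

lemma step_eq: "x \<in> ends D \<Longrightarrow> step D S x = L.st x"
  using L.a_in[of x] by (simp add: step_def turn_def arc_end_eq joins_eq)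

lemma step_pow: "x \<in> ends D \<Longrightarrow> (step D S ^^ k) x = (L.st ^^ k) x"
proof (induction k)
  case (Suc k)
  then show ?case using step_eq[OF L.st_pow_in[OF Suc.prems]] by simp
qed simp

text \<open>
  The equivalence classes generated by arcs and joins are the orbits of the traversal in both directions.
\<close>

lemma same_loop_class: assumes "x \<in> ends D" shows "same_loop D S `` {x} = loop arcs joins x"
proof
  let ?R = "\<lambda>a b. a \<in> ends D \<and> (b = arc_end D a \<or> b = joined_end D S a)"
  have R: "?R y z \<longleftrightarrow> y \<in> ends D \<and> (z = arcs y \<or> z = joins y)" for y z
    by (cases "y \<in> ends D") (simp_all add: arc_end_eq joins_eq)
  show "loop arcs joins x \<subseteq> same_loop D S `` {x}"
  proof -
    have "loop arcs joins x \<subseteq> {y \<in> ends D. equivclp ?R x y}"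
    proof (rule L.loop_least[OF assms])
      fix y assume y: "y \<in> {y \<in> ends D. equivclp ?R x y}"
      have "equivclp ?R y (arcs y)" "equivclp ?R y (joins y)"
        using y by (auto intro!: r_into_equivclp simp: R)
      then show "arcs y \<in> {y \<in> ends D. equivclp ?R x y} \<and> joins y \<in> {y \<in> ends D. equivclp ?R x y}"
        using y L.a_in L.j_in equivclp_trans[of ?R x y] by blast
    qed (use assms in auto)
    then show ?thesis by (auto simp: same_loop_def)
  qed
  show "same_loop D S `` {x} \<subseteq> loop arcs joins x"
  proof
    fix y assume "y \<in> same_loop D S `` {x}"
    then have "equivclp ?R x y" by (simp add: same_loop_def)
    then show "y \<in> loop arcs joins x"
    proof (induction rule: equivclp_induct)
      case base
      show ?case by (rule L.loop_self)
    next
      case (step y z)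
      have y: "y \<in> ends D" using step(3) L.loop_sub[OF assms] by blast
      from step(2) consider "z = arcs y \<or> z = joins y" | "z \<in> ends D" "y = arcs z \<or> y = joins z"
        unfolding R by blast
      then have "z = arcs y \<or> z = joins y" using L.a_a[of z] L.j_j[of z] by cases auto
      then show ?case using L.loop_closed[OF assms step(3)] by auto
    qed
  qed
qed

lemma loops_eq: "loops D S = loop arcs joins ` ends D"
  using same_loop_class by (auto simp: loops_def quotient_def)

text \<open>
  The orientation of the diagram along the traversal is reversed at each cusp. So the sign with which an arrow enters the
  alternating sum is the one that relates the direction of traversal to the orientation, and the sum becomes a sum of
  jumps of the potential.
\<close>

lemma cusp_word_sum:
  assumes "x \<in> ends D" "potential D M \<Theta>"
  defines "w \<equiv> \<lambda>n. concat (map (\<lambda>k. cusp D S (arcs ((L.st ^^ k) x))) [0..<n])"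
  shows "(-1) ^ length (w n) = sgnb (snd ((L.st ^^ n) x)) * sgnb (snd x) \<and>
    2 * sgnb (snd x) * alt_sum (w n) = (\<Sum>k<n. \<Theta> ((L.st ^^ Suc k) x) - \<Theta> (arcs ((L.st ^^ k) x)))"
proof (induction n)
  case 0
  show ?case by (simp add: w_def)
next
  case (Suc n)
  define y where "y = (L.st ^^ n) x"
  have y: "y \<in> ends D" unfolding y_def using assms L.st_pow_in by blast
  obtain p where p: "arcs y = (p, \<not> snd y)" using mk.snd_arc[of y] by (cases "arcs y") auto
  have pc: "p \<in> CP" using L.a_in[OF y] p by (auto simp: ends_def)
  have yn: "(L.st ^^ Suc n) x = joined_end D S (p, \<not> snd y)"
    using joins_eq[OF L.a_in[OF y]] by (simp only: funpow.simps o_apply turn_def flip: y_def) (simp only: p)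
  have wS: "w (Suc n) = w n @ cusp D S (p, \<not> snd y)" by (simp add: w_def p flip: y_def)
  have IH: "(-1) ^ length (w n) = sgnb (snd y) * sgnb (snd x)"
    "2 * sgnb (snd x) * alt_sum (w n) = (\<Sum>k<n. \<Theta> ((L.st ^^ Suc k) x) - \<Theta> (arcs ((L.st ^^ k) x)))"
    using Suc by (simp_all add: y_def)
  have diff: "(\<Sum>k<Suc n. \<Theta> ((L.st ^^ Suc k) x) - \<Theta> (arcs ((L.st ^^ k) x))) =
    2 * sgnb (snd x) * alt_sum (w n) + (if pt D p \<in> S then 2 * sgnb (snd y) * eps D p else 0)"
    using join_step[OF assms(2) pc, of S "\<not> snd y"] unfolding sum.lessThan_Suc IH(2)[symmetric] yn
    by (simp add: p flip: y_def)
  show ?case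
  proof (cases "pt D p \<in> S")
    case True
    define b where "b = (0 < cross2 (vel D p) (vel D (partner D p)))"
    have b: "sgnb b = eps D p" by (simp add: b_def eps_def sgnb_def)
    have "cusp D S (p, \<not> snd y) = [b]"
      using True by (auto simp: cusp_def b_def)
    then have w: "w (Suc n) = w n @ [b]" using wS by simp
    have "2 * sgnb (snd x) * alt_sum (w (Suc n)) =
      2 * sgnb (snd x) * alt_sum (w n) + 2 * (sgnb (snd x) * (sgnb (snd y) * sgnb (snd x) * eps D p))"
      unfolding w alt_sum_append IH(1) by (simp add: b algebra_simps)
    also have "sgnb (snd x) * (sgnb (snd y) * sgnb (snd x) * eps D p) = sgnb (snd y) * eps D p"
      by (simp add: sgnb_def)
    finally show ?thesis using True IH(1) unfolding diff yn by (simp add: w)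
  next
    case False
    then show ?thesis using wS IH(1) unfolding diff yn by (simp add: cusp_def)
  qed
qed

lemma cusp_word_alt:
  assumes "x \<in> ends D" "potential D M \<Theta>"
  shows "even (length (cusp_word D S x)) \<and> 2 * \<bar>alt_sum (cusp_word D S x)\<bar> = \<bar>hol arcs joins \<Theta> x\<bar>"
proof -
  define m where "m = (LEAST m. 0 < m \<and> (L.st ^^ m) x = x)"
  note m = L.hol_period[OF assms(1), folded m_def]
  have w: "cusp_word D S x = concat (map (\<lambda>k. cusp D S (arcs ((L.st ^^ k) x))) [0..<m])"
    by (simp add: cusp_word_def step_pow[OF assms(1)] m_def arc_end_eq)
  note * = cusp_word_sum[OF assms, of m, folded w]
  have ev: "even (length (cusp_word D S x))"
    using * m(2) by (metis sgnb_simps(4) minus_one_power_iff zero_neq_one neg_equal_zero one_neq_neg_one)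
  have "(\<Sum>k<m. \<Theta> ((L.st ^^ Suc k) x) - \<Theta> ((L.st ^^ k) x)) = 0"
    using m(2) by (simp add: sum_lessThan_telescope[of "\<lambda>k. \<Theta> ((L.st ^^ k) x)"] del: funpow.simps)
  then have "hol arcs joins \<Theta> x = (\<Sum>k<m. \<Theta> ((L.st ^^ Suc k) x) - \<Theta> (arcs ((L.st ^^ k) x)))"
    unfolding m(3) sum_subtractf by simp
  then have "hol arcs joins \<Theta> x = 2 * sgnb (snd x) * alt_sum (cusp_word D S x)" using * by simp
  then show ?thesis using ev by (auto simp: abs_mult sgnb_def)
qed

text \<open>
  The index of a loop is a quarter of its holonomy: the alternating sum of its cusps is invariant under cancellation and
  equal to the length \<open>2 * n\<close> at the end, and each cusp counts twice in the holonomy.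
\<close>

lemma loop_index_hol:
  assumes "x \<in> ends D" "potential D M \<Theta>"
  shows "loop_index D S (loop arcs joins x) = nat \<bar>hol arcs joins \<Theta> x\<bar> div 4"
proof -
  have red: "4 * int n = \<bar>hol arcs joins \<Theta> x\<bar>"
    if "y \<in> loop arcs joins x" "cusp_cancel\<^sup>*\<^sup>* (cusp_word D S y) w" "cusp_reduced w" "length w = 2 * n" for y w n
  proof -
    have y: "y \<in> ends D" using that L.loop_sub assms by blast
    have "\<bar>alt_sum w\<bar> = \<bar>alt_sum (cusp_word D S y)\<bar>"
      using cusp_cancels_invariant[OF that(2)] cusp_word_alt[OF y assms(2)] by simp
    then show ?thesis
      using cusp_word_alt[OF y assms(2)] L.hol_eq[OF assms(1) that(1), of \<Theta>] alt_sum_reduced[OF that(3)] that(4)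
      by simp
  qed
  obtain w where w: "cusp_cancel\<^sup>*\<^sup>* (cusp_word D S x) w" "cusp_reduced w"
    using cusp_reduction_exists cusp_word_alt[OF assms] by blast
  have "even (length w)" using cusp_cancels_invariant[OF w(1)] cusp_word_alt[OF assms] by simp
  then obtain n where n: "length w = 2 * n" by (rule evenE)
  have "loop_index D S (loop arcs joins x) = n"
    unfolding loop_index_def
  proof (rule the_equality)
    show "\<exists>y\<in>loop arcs joins x. \<exists>w. cusp_cancel\<^sup>*\<^sup>* (cusp_word D S y) w \<and> cusp_reduced w \<and> length w = 2 * n"
      using w n L.loop_self by blast
    fix k assume "\<exists>y\<in>loop arcs joins x. \<exists>w. cusp_cancel\<^sup>*\<^sup>* (cusp_word D S y) w \<and> cusp_reduced w \<and> length w = 2 * k"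
    then have "4 * int k = \<bar>hol arcs joins \<Theta> x\<bar>" using red by blast
    then show "k = n" using red[OF L.loop_self w n] by simp
  qed
  then show ?thesis using red[OF L.loop_self w n] by simp
qed

text \<open>
  Each loop of index \<open>n\<close> counts \<open>d * K n\<close>. Since \<open>K 0 = 1\<close>, marks and circles without crossings can be treated like
  other loops.
\<close>

lemma state_value:
  fixes d :: "'r::comm_ring_1"
  assumes M: "marking (ncomp D) M" "CP \<subseteq> M" and pot: "potential D M \<Theta>" and K0: "K 0 = 1"
  shows "d ^ num_loops D S * (\<Prod>c\<in>loops D S. K (loop_index D S c)) =
    d ^ card (unmarked (ncomp D) M) * loops_eval (\<lambda>h. d * K (nat h div 4)) (M \<times> UNIV) (arc_map M) joins \<Theta>"
proof -
  let ?\<kappa> = "\<lambda>h. d * K (nat h div 4)"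
  have fin: "finite (loops D S)" unfolding loops_eq using L.fin by simp
  have "(\<Prod>c\<in>loops D S. ?\<kappa> \<bar>hol arcs joins \<Theta> (SOME x. x \<in> c)\<bar>) = (\<Prod>c\<in>loops D S. d * K (loop_index D S c))"
  proof (rule prod.cong[OF refl])
    fix c assume "c \<in> loops D S"
    then obtain x where x: "x \<in> ends D" "c = loop arcs joins x" by (auto simp: loops_eq)
    then show "?\<kappa> \<bar>hol arcs joins \<Theta> (SOME x. x \<in> c)\<bar> = d * K (loop_index D S c)"
      using loop_index_hol[OF x(1) pot] L.hol_some[OF x(1), of \<Theta>] by simp
  qed
  also have "\<dots> = d ^ card (loops D S) * (\<Prod>c\<in>loops D S. K (loop_index D S c))"
    by (simp add: prod.distrib)
  finally have "loops_eval ?\<kappa> (CP \<times> UNIV) arcs joins \<Theta> =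
    d ^ card (loops D S) * (\<Prod>c\<in>loops D S. K (loop_index D S c))"
    by (simp add: loops_eval_def loops_eq ends_def)
  then have "d ^ num_loops D S * (\<Prod>c\<in>loops D S. K (loop_index D S c)) =
    ?\<kappa> 0 ^ card (unmarked (ncomp D) CP) * loops_eval ?\<kappa> (CP \<times> UNIV) arcs joins \<Theta>"
    by (simp add: num_loops_def free_circles_def unmarked_def power_add mult_ac K0)
  also have "\<dots> = ?\<kappa> 0 ^ card (unmarked (ncomp D) M) * loops_eval ?\<kappa> (M \<times> UNIV) (arc_map M) joins \<Theta>"
  proof (rule eval_add_marks[OF M, symmetric])
    fix N assume N: "CP \<subseteq> N" "N \<subseteq> M"
    have "marking (ncomp D) N" using M(1) N(2) by (auto simp: marking_def intro: finite_subset)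
    then show "loop_system (N \<times> UNIV) (arc_map N) joins" using N(1) by (rule state_system)
  qed (use pot in \<open>auto simp: mark_join_def potential_def\<close>)
  finally show ?thesis by (simp add: K0)
qed

end

section \<open>Segments of circles\<close>

abbreviation sg :: "bool \<Rightarrow> real" where
  "sg b \<equiv> real_of_int (sgnb b)"

lemma sg_cases: "sg b = 1 \<or> sg b = -1"
  by (cases b) auto

text \<open>A segment is connected, so it lies on one circle, and there a continuous argument exists.\<close>

lemma segment_lift:
  assumes "is_segment n s"
  obtains i \<theta> where "i < n" "continuous_on {-1..1} \<theta>" "\<And>x. x \<in> {-1..1} \<Longrightarrow> s x = (i, cis (\<theta> x))"
proof -
  have cont: "continuous_on {-1..1} s" and sub: "s ` {-1..1} \<subseteq> {..<n} \<times> sphere 0 1"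
    using assms by (auto simp: is_segment_def)
  have c1: "connected ((\<lambda>x. fst (s x)) ` {-1..1})"
    by (rule connected_continuous_image) (use cont in \<open>auto intro: continuous_intros\<close>)
  have const: "fst (s x) = fst (s 0)" if "x \<in> {-1..1}" for x
  proof (rule ccontr)
    assume ne: "fst (s x) \<noteq> fst (s 0)"
    have "{fst (s 0)} \<inter> (\<lambda>x. fst (s x)) ` {-1..1} = {} \<or> - {fst (s 0)} \<inter> (\<lambda>x. fst (s x)) ` {-1..1} = {}"
      by (rule connectedD[OF c1]) (auto simp: open_discrete)
    moreover have "fst (s 0) \<in> (\<lambda>x. fst (s x)) ` {-1..1}" by (rule image_eqI[of _ _ 0]) auto
    moreover have "fst (s x) \<in> (\<lambda>x. fst (s x)) ` {-1..1}" using that by (rule imageI)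
    ultimately show False using ne by blast
  qed
  have nz: "cmod (snd (s x)) = 1" if "x \<in> {-1..1}" for x using sub that by (auto simp: image_subset_iff mem_Times_iff)
  obtain g where g: "continuous_on {-1..1} g" "\<And>x. x \<in> {-1..1} \<Longrightarrow> snd (s x) = exp (g x)"
  proof (rule continuous_logarithm_on_contractible[of "{-1..1::real}" "\<lambda>x. snd (s x)"])
    show "continuous_on {-1..1} (\<lambda>x. snd (s x))" using cont by (intro continuous_intros)
    show "contractible {-1..1::real}" by (intro convex_imp_contractible convex_real_interval)
    show "snd (s z) \<noteq> 0" if "z \<in> {-1..1}" for z using nz[OF that] by auto
  qed blast
  show ?thesis
  proof (rule that[of "fst (s 0)" "\<lambda>x. Im (g x)"])
    show "fst (s 0) < n" using sub by (auto simp: image_subset_iff mem_Times_iff)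
    show "continuous_on {-1..1} (\<lambda>x. Im (g x))" using g by (intro continuous_intros)
    fix x :: real assume x: "x \<in> {-1..1}"
    have "exp (Re (g x)) = 1" using nz[OF x] g(2)[OF x] by simp
    then have "snd (s x) = cis (Im (g x))" using g(2)[OF x] by (simp add: exp_eq_polar)
    then show "s x = (fst (s 0), cis (Im (g x)))" using const[OF x] by (simp add: prod_eq_iff)
  qed
qed

text \<open>
  A parametrized segment, run through in the direction of the circle (\<open>b\<close>) or against it;
  \<open>\<tau> x\<close> is the angle between its initial point on the circle and its point \<open>s x\<close>.
\<close>

locale oriented_segment =
  fixes n :: nat and s :: "real \<Rightarrow> nat \<times> complex" and b :: bool and \<tau> :: "real \<Rightarrow> real"
  assumes seg: "is_segment n s"
    and cont: "continuous_on {-1..1} \<tau>"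
    and s_eq: "x \<in> {-1..1} \<Longrightarrow> s x = travel (s (- sg b)) (\<tau> x)"
    and start: "\<tau> (- sg b) = 0" and stop: "\<tau> (sg b) < 2 * pi"
    and mono: "x \<in> {-1..1} \<Longrightarrow> y \<in> {-1..1} \<Longrightarrow> sg b * x < sg b * y \<Longrightarrow> \<tau> x < \<tau> y"

text \<open>
  A continuous injective function on an interval is monotone; this gives the direction. The total angle is less than a
  full turn, again by injectivity.
\<close>

lemma orient_segment:
  assumes seg: "is_segment n s"
  obtains b \<tau> where "oriented_segment n s b \<tau>"
proof -
  obtain i \<theta> where i: "i < n" and cont: "continuous_on {-1..1} \<theta>"
    and s: "\<And>x. x \<in> {-1..1} \<Longrightarrow> s x = (i, cis (\<theta> x))" by (rule segment_lift[OF seg]) blast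
  have inj_s: "inj_on s {-1..1}" using seg by (simp add: is_segment_def)
  have inj: "inj_on \<theta> {-1..1}"
  proof (rule inj_onI)
    fix x y :: real assume xy: "x \<in> {-1..1}" "y \<in> {-1..1}" "\<theta> x = \<theta> y"
    then have "s x = s y" using s by simp
    then show "x = y" using inj_onD[OF inj_s] xy by blast
  qed
  then consider "strict_mono_on {-1..1} \<theta>" | "strict_antimono_on {-1..1} \<theta>"
    using injective_eq_monotone_map[of "{-1..1}" \<theta>] cont by (auto simp: is_interval_cc)
  then obtain b where mono: "\<And>x y. x \<in> {-1..1} \<Longrightarrow> y \<in> {-1..1} \<Longrightarrow> sg b * x < sg b * y \<Longrightarrow> \<theta> x < \<theta> y"
  proof cases
    case 1
    show ?thesis by (rule that[of True]) (use 1 in \<open>auto simp: monotone_on_def\<close>)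
  next
    case 2
    show ?thesis by (rule that[of False]) (use 2 in \<open>auto simp: monotone_on_def\<close>)
  qed
  define \<tau> where "\<tau> = (\<lambda>x. \<theta> x - \<theta> (- sg b))"
  have mem: "- sg b \<in> {-1..1}" "sg b \<in> {-1..1}" using sg_cases[of b] by auto
  have ct: "continuous_on {-1..1} \<tau>" unfolding \<tau>_def using cont by (intro continuous_intros)
  have "\<tau> (sg b) < 2 * pi"
  proof (rule ccontr)
    assume "\<not> \<tau> (sg b) < 2 * pi"
    then have ge: "2 * pi \<le> \<tau> (sg b)" by simp
    have z: "\<tau> (- sg b) = 0" by (simp add: \<tau>_def)
    have "\<exists>x. x \<in> {-1..1} \<and> \<tau> x = 2 * pi"
    proof (cases b)
      case True
      then show ?thesis using IVT'[of \<tau> "-1" "2 * pi" 1] ge z ct by auto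
    next
      case False
      then show ?thesis using IVT2'[of \<tau> 1 "2 * pi" "-1"] ge z ct by auto
    qed
    then obtain x where x: "x \<in> {-1..1}" "\<tau> x = 2 * pi" by blast
    have "\<theta> x = \<theta> (- sg b) + 2 * pi" using x(2) by (simp add: \<tau>_def)
    then have "cis (\<theta> x) = cis (\<theta> (- sg b)) * cis (2 * pi)" by (simp only: cis_mult)
    then have "cis (\<theta> x) = cis (\<theta> (- sg b))" by simp
    then have "s x = s (- sg b)" using s x mem by simp
    then have "x = - sg b" using inj_onD[OF inj_s] x mem by blast
    then show False using x by (simp add: \<tau>_def)
  qed
  moreover have "s x = travel (s (- sg b)) (\<tau> x)" if "x \<in> {-1..1}" for x
    using s[OF that] s[OF mem(1)] by (simp add: travel_def \<tau>_def cis_mult)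
  ultimately have "oriented_segment n s b \<tau>"
    using seg ct mono by unfold_locales (auto simp: \<tau>_def)
  then show ?thesis by (rule that)
qed

context oriented_segment
begin

lemma ends_mem [simp]: "- sg b \<in> {-1..1}" "sg b \<in> {-1..1}"
  using sg_cases[of b] by auto

lemma s_circles: "x \<in> {-1..1} \<Longrightarrow> s x \<in> circles n"
  using seg by (auto simp: is_segment_def circles_def)

lemma \<tau>_range: assumes "x \<in> {-1..1}" shows "0 \<le> \<tau> x" "\<tau> x \<le> \<tau> (sg b)"
proof -
  have "x = - sg b \<or> sg b * (- sg b) < sg b * x" "x = sg b \<or> sg b * x < sg b * sg b"
    using assms sg_cases[of b] by auto
  then show "0 \<le> \<tau> x" "\<tau> x \<le> \<tau> (sg b)"
    using mono[OF ends_mem(1) assms] mono[OF assms ends_mem(2)] start by fastforce+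
qed

lemma length_pos: "0 < \<tau> (sg b)"
  using mono[of "- sg b" "sg b"] start sg_cases[of b] by auto

lemma \<tau>_mono_iff:
  assumes "x \<in> {-1..1}" "y \<in> {-1..1}" shows "\<tau> x < \<tau> y \<longleftrightarrow> sg b * x < sg b * y"
proof -
  have "x = y \<or> sg b * x < sg b * y \<or> sg b * y < sg b * x" using sg_cases[of b] by auto
  then show ?thesis using mono[OF assms] mono[OF assms(2,1)] by auto
qed

lemma \<tau>_onto: assumes "0 \<le> t" "t \<le> \<tau> (sg b)" obtains x where "x \<in> {-1..1}" "\<tau> x = t"
proof (cases b)
  case True
  then show ?thesis using IVT'[of \<tau> "-1" t 1] assms cont start that by auto
next
  case False
  then show ?thesis using IVT2'[of \<tau> 1 t "-1"] assms cont start that by auto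
qed

lemma travel_s:
  assumes "x \<in> {-1..1}" "y \<in> {-1..1}" shows "travel (s x) (\<tau> y - \<tau> x) = s y"
  using s_eq[OF assms(1)] s_eq[OF assms(2)] by (simp add: travel_travel)

lemma succ_along:
  assumes xy: "x \<in> {-1..1}" "y \<in> {-1..1}" "sg b * x < sg b * y" and y: "s y \<in> M"
    and none: "\<And>z. z \<in> {-1..1} \<Longrightarrow> sg b * x < sg b * z \<Longrightarrow> sg b * z < sg b * y \<Longrightarrow> s z \<notin> M"
  shows "succ M (s x) = s y"
proof -
  have "succ M (s x) = travel (s x) (\<tau> y - \<tau> x)"
  proof (rule succ_eqI)
    show "0 < \<tau> y - \<tau> x" using mono[OF xy] by simp
    show "travel (s x) (\<tau> y - \<tau> x) \<in> M" using travel_s xy y by simp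
    fix t assume t: "0 < t" "t < \<tau> y - \<tau> x"
    obtain z where z: "z \<in> {-1..1}" "\<tau> z = \<tau> x + t"
      using \<tau>_onto[of "\<tau> x + t"] t \<tau>_range[OF xy(1)] \<tau>_range[OF xy(2)] by auto
    then have "travel (s x) t = s z" using travel_s[OF xy(1) z(1)] by simp
    moreover have "s z \<notin> M"
      using none[OF z(1)] \<tau>_mono_iff[OF xy(1) z(1)] \<tau>_mono_iff[OF z(1) xy(2)] z t by auto
    ultimately show "travel (s x) t \<notin> M" by simp
  qed
  then show ?thesis using travel_s xy by simp
qed

text \<open>The end \<open>(s x, b)\<close> faces right and \<open>(s x, \<not> b)\<close> faces left.\<close>

lemma arc_along:
  assumes M: "marking m M" and xy: "x \<in> {-1..1}" "y \<in> {-1..1}" "x < y" "s x \<in> M" "s y \<in> M"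
    and none: "\<And>z. x < z \<Longrightarrow> z < y \<Longrightarrow> s z \<notin> M"
  shows "arc_map M (s x, b) = (s y, \<not> b)" "arc_map M (s y, \<not> b) = (s x, b)"
proof -
  interpret marking m M by fact
  have "arc_map M (s x, b) = (s y, \<not> b) \<and> arc_map M (s y, \<not> b) = (s x, b)"
  proof (cases b)
    case True
    have "succ M (s x) = s y" by (rule succ_along) (use xy none True in auto)
    then show ?thesis using arc_eqI[OF xy(4)] True by simp
  next
    case False
    have "succ M (s y) = s x" by (rule succ_along) (use xy none False in auto)
    then show ?thesis using arc_eqI[OF xy(5)] False by simp
  qed
  then show "arc_map M (s x, b) = (s y, \<not> b)" "arc_map M (s y, \<not> b) = (s x, b)" by auto
qed

text \<open>
  The segment is a proper closed arc of its circle, so a motion away from it leaves it at once at either end.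
\<close>

lemma leave_segment:
  assumes "e \<in> {-1, 1}"
  obtains u where "eventually (\<lambda>t. travel (s e) (u * t) \<notin> s ` {-1..1}) (at_right 0)"
proof -
  define L where "L = \<tau> (sg b)"
  define u where "u = (if e = sg b then 1 else -1 :: real)"
  have e: "e = sg b \<or> e = - sg b" using assms sg_cases[of b] by auto
  have "travel (s e) (u * t) \<notin> s ` {-1..1}" if t: "0 < t" "t < 2 * pi - L" for t
  proof
    assume "travel (s e) (u * t) \<in> s ` {-1..1}"
    then obtain x where x: "x \<in> {-1..1}" "travel (s e) (u * t) = s x" by auto
    have "e \<in> {-1..1}" using assms by auto
    then have "travel (s e) (u * t) = travel (s e) (\<tau> x - \<tau> e)" using travel_s[of e x] x by simp
    moreover have "\<bar>u * t - (\<tau> x - \<tau> e)\<bar> < 2 * pi"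
      using e start \<tau>_range[OF x(1)] t by (auto simp: u_def L_def)
    ultimately have "u * t = \<tau> x - \<tau> e"
      using travel_inj[of "s e" n] s_circles \<open>e \<in> {-1..1}\<close> by blast
    then show False using e start \<tau>_range[OF x(1)] t by (auto simp: u_def split: if_splits)
  qed
  moreover have "0 < 2 * pi - L" using stop by (simp add: L_def)
  then have "eventually (\<lambda>t. t \<in> {0<..<2 * pi - L}) (at_right 0)"
    by (rule eventually_at_right_real)
  ultimately have "eventually (\<lambda>t. travel (s e) (u * t) \<notin> s ` {-1..1}) (at_right 0)"
    by - (erule eventually_mono, simp)
  then show ?thesis by (rule that)
qed

end

section \<open>Velocities\<close>

lemma continuous_travel: "continuous_on UNIV (travel p)"
  unfolding travel_def by (intro continuous_intros)

lemma eventually_travel_outside: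
  assumes "closed K" "p \<notin> K" shows "eventually (\<lambda>t. travel p t \<notin> K) (nhds 0)"
proof -
  have "open (travel p -` (- K))"
    using assms(1) continuous_travel by (intro open_vimage) auto
  moreover have "0 \<in> travel p -` (- K)" using assms by simp
  ultimately show ?thesis unfolding eventually_nhds by blast
qed

context flat_diag
begin

lemma pt_travel_derivative:
  assumes "p \<in> circle_points D"
  shows "((\<lambda>t. pt D (travel p t)) has_vector_derivative vel D p) (at 0)"
    and "continuous_on UNIV (\<lambda>t. pt D (travel p t))"
proof -
  obtain i w where p: "p = (i, w)" "i < ncomp D" "cmod w = 1" using assms by (auto simp: circle_points_def)
  obtain \<phi> where "w = cis \<phi>" using p(3) by (metis complex_unimodular_polar cis.ctr complex_eq_iff complex.sel)
  have eq: "(\<lambda>t. pt D (travel p t)) = (\<lambda>\<theta>. curve D i (cis \<theta>)) \<circ> (\<lambda>t. \<phi> + t)"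
    by (auto simp: pt_def travel_def p \<open>w = cis \<phi>\<close> cis_mult)
  have "(\<lambda>\<theta>. curve D i (cis \<theta>)) differentiable at \<theta>" for \<theta>
    using D p by (auto simp: is_flat_diagram_def immersed_def C1_differentiable_on_eq)
  then have diff: "(\<lambda>t. pt D (travel p t)) differentiable at t" for t
    unfolding eq by (intro differentiable_chain_at) auto
  show "((\<lambda>t. pt D (travel p t)) has_vector_derivative vel D p) (at 0)"
    using diff[of 0] unfolding vector_derivative_works by (simp add: vel_def pt_def travel_def)
  show "continuous_on UNIV (\<lambda>t. pt D (travel p t))"
    using diff by (auto intro!: continuous_at_imp_continuous_on differentiable_imp_continuous_within)
qed

lemma vel_nonzero: "p \<in> circle_points D \<Longrightarrow> vel D p \<noteq> 0"
  using D by (auto simp: is_flat_diagram_def immersed_def)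

end

lemma vel_agree:
  assumes "closed K" "p \<in> circle_points D - K" "ncomp D' = ncomp D"
    and "\<And>q. q \<in> circle_points D - K \<Longrightarrow> pt D' q = pt D q"
  shows "vel D' p = vel D p"
proof -
  have "eventually (\<lambda>t. travel p t \<notin> K) (nhds 0)"
    using assms by (intro eventually_travel_outside) auto
  then have "eventually (\<lambda>t. t \<in> UNIV \<longrightarrow> pt D' (travel p t) = pt D (travel p t)) (nhds 0)"
    by eventually_elim (use assms in \<open>auto simp: circle_points_eq\<close>)
  then have "vector_derivative (\<lambda>t. pt D' (travel p t)) (at 0) = vector_derivative (\<lambda>t. pt D (travel p t)) (at 0)"
    by (rule vector_derivative_cong_eq) auto
  then show ?thesis by (simp add: vel_def pt_def travel_def)
qed

text \<open>
  Both diagrams are continuous and agree outside of the strands, which accumulates at the end points of each strand.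
\<close>

lemma strand_ends_agree:
  assumes D: "is_flat_diagram D" "is_flat_diagram D'"
    and agree: "agree_off_strands D D' m s"
    and segs: "\<And>k. k < m \<Longrightarrow> is_segment (ncomp D) (s k)"
    and inj: "inj_on (\<lambda>(k, x). s k x) ({..<m} \<times> {-1..1})"
    and k: "k < m" and e: "e \<in> {-1, 1}"
  shows "pt D' (s k e) = pt D (s k e)"
proof -
  interpret D: flat_diag D using D by unfold_locales
  interpret D': flat_diag D' using D by unfold_locales
  obtain b \<tau> where "oriented_segment (ncomp D) (s k) b \<tau>" by (rule orient_segment[OF segs[OF k]])
  then interpret oriented_segment "ncomp D" "s k" b \<tau> .
  have n: "ncomp D' = ncomp D" using agree by (simp add: agree_off_strands_def)
  let ?p = "s k e" and ?K = "\<Union>l\<in>{..<m} - {k}. s l ` {-1..1}"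
  have e1: "e \<in> {-1..1}" using e by auto
  have p: "?p \<in> circles (ncomp D)" using s_circles e1 by blast
  have "closed ?K"
  proof (intro closed_UN ballI)
    fix l assume "l \<in> {..<m} - {k}"
    then have "is_segment (ncomp D) (s l)" using segs by auto
    then show "closed (s l ` {-1..1})"
      by (intro compact_imp_closed compact_continuous_image) (auto simp: is_segment_def)
  qed auto
  moreover have "?p \<notin> ?K"
  proof
    assume "?p \<in> ?K"
    then obtain l x where "l < m" "l \<noteq> k" "x \<in> {-1..1}" "?p = s l x" by blast
    then show False using inj_onD[OF inj, of "(k, e)" "(l, x)"] k e1 by simp
  qed
  \<comment> \<open>The other strands are closed and stay at a positive distance; the strand itself is left in one direction.\<close>
  ultimately have out: "eventually (\<lambda>t. travel ?p t \<notin> ?K) (nhds 0)" by (rule eventually_travel_outside)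
  obtain u where u: "eventually (\<lambda>t. travel ?p (u * t) \<notin> s k ` {-1..1}) (at_right 0)"
    by (rule leave_segment[OF e])
  have lim: "((\<lambda>t. u * t) \<longlongrightarrow> 0) (at_right 0)"
    using tendsto_mult[OF tendsto_const[of u] tendsto_ident_at[of 0 "{0<..}"]] by simp
  have "eventually (\<lambda>t. travel ?p (u * t) \<notin> ?K) (at_right 0)"
    using out lim by (rule eventually_compose_filterlim)
  with u have "eventually (\<lambda>t. travel ?p (u * t) \<notin> strand_points m s) (at_right 0)"
    by eventually_elim (auto simp: strand_points_def)
  then have "eventually (\<lambda>t. pt D' (travel ?p (u * t)) - pt D (travel ?p (u * t)) = 0) (at_right 0)"
    by eventually_elim (use agree p in \<open>auto simp: agree_off_strands_def circle_points_eq\<close>)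
  then have 0: "((\<lambda>t. pt D' (travel ?p (u * t)) - pt D (travel ?p (u * t))) \<longlongrightarrow> 0) (at_right 0)"
    by (rule tendsto_eventually)
  have "((\<lambda>t. pt D' (travel ?p (u * t)) - pt D (travel ?p (u * t))) \<longlongrightarrow> pt D' ?p - pt D ?p) (at_right 0)"
  proof (rule tendsto_diff)
    have "isCont (\<lambda>t. pt D (travel ?p t)) 0" "isCont (\<lambda>t. pt D' (travel ?p t)) 0"
      using D.pt_travel_derivative(2)[of ?p] D'.pt_travel_derivative(2)[of ?p] p n
      by (auto simp: circle_points_eq continuous_on_eq_continuous_at)
    then show "((\<lambda>t. pt D' (travel ?p (u * t))) \<longlongrightarrow> pt D' ?p) (at_right 0)"
      "((\<lambda>t. pt D (travel ?p (u * t))) \<longlongrightarrow> pt D ?p) (at_right 0)"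
      using isCont_tendsto_compose[OF _ lim] by fastforce+
  qed
  from tendsto_unique[OF _ this 0] show ?thesis by simp
qed

text \<open>
  If the first coordinate had velocity 0, then so would the second one, as \<open>F\<close> is differentiable; but the curve is immersed.
\<close>

lemma (in flat_diag) vel_graph:
  assumes os: "oriented_segment (ncomp D) s b \<tau>" and F: "F differentiable_on {-1..1}"
    and graph: "\<And>y. y \<in> {-1..1} \<Longrightarrow> pt D (s y) = Complex y (F y)" and x: "x \<in> {-1..1}"
  obtains c f where "0 < sg b * c" "(F has_real_derivative f) (at x within {-1..1})"
    "vel D (s x) = Complex c (c * f)"
proof -
  interpret oriented_segment "ncomp D" s b \<tau> by (rule os)
  define g where "g = (\<lambda>t. pt D (travel (s x) t))"
  define v where "v = vel D (s x)"
  define \<alpha> \<beta> where "\<alpha> = - \<tau> x" and "\<beta> = \<tau> (sg b) - \<tau> x"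
  have cp: "s x \<in> circle_points D" using s_circles[OF x] by (simp add: circle_points_eq)
  have gv: "(g has_vector_derivative v) (at 0)"
    unfolding g_def v_def using pt_travel_derivative(1)[OF cp] .
  then have gR: "((\<lambda>t. Re (g t)) has_real_derivative Re v) (at 0 within {\<alpha>..\<beta>})"
    and gI: "((\<lambda>t. Im (g t)) has_real_derivative Im v) (at 0 within {\<alpha>..\<beta>})"
    using has_vector_derivative_at_within[OF gv, of "{\<alpha>..\<beta>}"]
    by (auto simp: has_vector_derivative_complex_iff)
  have gs: "g (\<tau> y - \<tau> x) = Complex y (F y)" if "y \<in> {-1..1}" for y
    using graph[OF that] travel_s[OF x that] by (simp add: g_def)
  have onto: "\<exists>y\<in>{-1..1}. t = \<tau> y - \<tau> x" if "t \<in> {\<alpha>..\<beta>}" for t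
  proof -
    have "0 \<le> \<tau> x + t" "\<tau> x + t \<le> \<tau> (sg b)" using that by (auto simp: \<alpha>_def \<beta>_def)
    then obtain y where "y \<in> {-1..1}" "\<tau> y = \<tau> x + t" by (rule \<tau>_onto)
    then show ?thesis by (intro bexI[of _ y]) auto
  qed
  have ab: "\<alpha> < \<beta>" "0 \<in> {\<alpha>..\<beta>}" using length_pos \<tau>_range[OF x] by (auto simp: \<alpha>_def \<beta>_def)
  have g0: "Re (g 0) = x" using gs[OF x] by simp
  obtain f where f: "(F has_real_derivative f) (at x within {-1..1})"
    using F[unfolded differentiable_on_def real_differentiable_def] x by blast
  have im: "(\<lambda>t. Re (g t)) ` {\<alpha>..\<beta>} \<subseteq> {-1..1}"
  proof
    fix r assume "r \<in> (\<lambda>t. Re (g t)) ` {\<alpha>..\<beta>}"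
    then obtain t where t: "t \<in> {\<alpha>..\<beta>}" "r = Re (g t)" by blast
    from onto[OF t(1)] obtain y where "y \<in> {-1..1}" "t = \<tau> y - \<tau> x" by blast
    then show "r \<in> {-1..1}" using gs[of y] t(2) by simp
  qed
  have "(F has_real_derivative f) (at (Re (g 0)) within (\<lambda>t. Re (g t)) ` {\<alpha>..\<beta>})"
    unfolding g0 using f im by (rule DERIV_subset)
  from DERIV_image_chain[OF this gR]
  have "((\<lambda>t. F (Re (g t))) has_real_derivative f * Re v) (at 0 within {\<alpha>..\<beta>})" by (simp add: o_def)
  moreover have "F (Re (g t)) = Im (g t)" if "t \<in> {\<alpha>..\<beta>}" for t
    using onto[OF that] gs by auto
  ultimately have "((\<lambda>t. Im (g t)) has_real_derivative f * Re v) (at 0 within {\<alpha>..\<beta>})"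
    using ab(2) by (auto intro: has_field_derivative_transform_within[where d = 1])
  then have eq: "Im v = f * Re v"
    using gI vector_derivative_unique_within_closed_interval[OF ab(1), of 0 "\<lambda>t. Im (g t)" "Im v" "f * Re v"] ab(2)
    by (simp add: has_real_derivative_iff_has_vector_derivative)
  have nz: "Re v \<noteq> 0"
    using vel_nonzero[OF cp] eq by (auto simp: v_def[symmetric] complex_eq_iff)
  define \<phi> where "\<phi> = (\<lambda>t. sg b * Re (g t))"
  have \<phi>: "(\<phi> has_real_derivative sg b * Re v) (at 0 within {\<alpha>..\<beta>})"
    unfolding \<phi>_def using gR by (rule DERIV_cmult)
  have inc: "\<phi> t < \<phi> t'" 
    if tt: "t \<in> {\<alpha>..\<beta>}" "t' \<in> {\<alpha>..\<beta>}" "t < t'" for t t'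
  proof -
    obtain y y' where y: "y \<in> {-1..1}" "t = \<tau> y - \<tau> x" "y' \<in> {-1..1}" "t' = \<tau> y' - \<tau> x"
      using onto[OF tt(1)] onto[OF tt(2)] by blast
    then show ?thesis using \<tau>_mono_iff[of y y'] tt gs by (simp add: \<phi>_def)
  qed
  have "0 < sg b * Re v"
  proof (rule ccontr)
    assume "\<not> 0 < sg b * Re v"
    moreover have "sg b * Re v \<noteq> 0" using nz sg_cases[of b] by auto
    ultimately have neg: "sg b * Re v < 0" by linarith
    show False
    proof (cases "0 < \<beta>")
      case True
      obtain d where d: "d > 0" "\<And>h. h > 0 \<Longrightarrow> 0 + h \<in> {\<alpha>..\<beta>} \<Longrightarrow> h < d \<Longrightarrow> \<phi> (0 + h) < \<phi> 0"
        using has_real_derivative_neg_dec_right[OF \<phi> neg] by blast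
      define h where "h = min \<beta> (d / 2)"
      have "h > 0" "h < d" "h \<in> {\<alpha>..\<beta>}" using True d ab by (auto simp: h_def)
      then show False using d(2)[of h] inc[of 0 h] ab by simp
    next
      case False
      then have "\<alpha> < 0" "\<beta> = 0" using ab by auto
      obtain d where d: "d > 0" "\<And>h. h > 0 \<Longrightarrow> 0 - h \<in> {\<alpha>..\<beta>} \<Longrightarrow> h < d \<Longrightarrow> \<phi> 0 < \<phi> (0 - h)"
        using has_real_derivative_neg_dec_left[OF \<phi> neg] by blast
      define h where "h = min (- \<alpha>) (d / 2)"
      have "h > 0" "h < d" "- h \<in> {\<alpha>..\<beta>}" using \<open>\<alpha> < 0\<close> d ab by (auto simp: h_def)
      then show False using d(2)[of h] inc[of "- h" 0] ab by simp
    qed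
  qed
  then show ?thesis using f eq by (intro that[of "Re v" f]) (auto simp: v_def[symmetric] complex_eq_iff)
qed

text \<open>
  If the graph of \<open>F\<close> crosses the graph of \<open>G\<close> from below to above, then it has the larger slope, as the crossing is
  transverse; so the sign of the pair of velocities depends only on the directions of the two strands.
\<close>

lemma (in flat_diag) eps_graphs:
  assumes os: "oriented_segment (ncomp D) s b \<tau>" "oriented_segment (ncomp D) s' b' \<tau>'"
    and FG: "F differentiable_on {-1..1}" "G differentiable_on {-1..1}"
    and graph: "\<And>y. y \<in> {-1..1} \<Longrightarrow> pt D (s y) = Complex y (F y)"
      "\<And>y. y \<in> {-1..1} \<Longrightarrow> pt D (s' y) = Complex y (G y)"
    and x: "x \<in> {-1..1}" "F x = G x" "s x \<noteq> s' x"
    and side: "(\<exists>r\<ge>-1. r < x \<and> (\<forall>y. r < y \<longrightarrow> y < x \<longrightarrow> F y < G y)) \<or>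
      (\<exists>r\<le>1. x < r \<and> (\<forall>y. x < y \<longrightarrow> y < r \<longrightarrow> G y < F y))"
  shows "partner D (s x) = s' x" "partner D (s' x) = s x"
    "eps D (s x) = - (sgnb b * sgnb b')" "eps D (s' x) = sgnb b * sgnb b'"
proof -
  interpret o1: oriented_segment "ncomp D" s b \<tau> by (rule os)
  interpret o2: oriented_segment "ncomp D" s' b' \<tau>' by (rule os)
  have cp: "s x \<in> circle_points D" "s' x \<in> circle_points D"
    using o1.s_circles o2.s_circles x by (auto simp: circle_points_eq)
  have pts: "pt D (s x) = pt D (s' x)" using graph x by simp
  show pa: "partner D (s x) = s' x" "partner D (s' x) = s x"
    using partner_unique cp pts x(3) by auto
  obtain c f where c: "0 < sg b * c" "(F has_real_derivative f) (at x within {-1..1})"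
    "vel D (s x) = Complex c (c * f)"
    using vel_graph[OF os(1) FG(1) graph(1) x(1)] by blast
  obtain c' f' where c': "0 < sg b' * c'" "(G has_real_derivative f') (at x within {-1..1})"
    "vel D (s' x) = Complex c' (c' * f')"
    using vel_graph[OF os(2) FG(2) graph(2) x(1)] by blast
  have nz: "cross2 (vel D (s x)) (vel D (s' x)) \<noteq> 0"
    using D cp pts x(3) by (auto simp: is_flat_diagram_def generic_def)
  have cr: "cross2 (vel D (s x)) (vel D (s' x)) = (c * c') * (f' - f)"
    by (simp add: cross2_def c c' algebra_simps)
  have cr': "cross2 (vel D (s' x)) (vel D (s x)) = - ((c * c') * (f' - f))"
    using cross2_swap[of "vel D (s x)" "vel D (s' x)"] cr by simp
  have "f' - f < 0"
  proof (rule ccontr)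
    assume "\<not> f' - f < 0"
    then have pos: "0 < f' - f" using nz cr by auto
    have "((\<lambda>y. G y - F y) has_real_derivative f' - f) (at x within {-1..1})"
      using c'(2) c(2) by (rule DERIV_diff)
    note der = this
    from side show False
    proof (elim disjE exE conjE)
      fix r assume r: "-1 \<le> r" "r < x" "\<forall>y. r < y \<longrightarrow> y < x \<longrightarrow> F y < G y"
      obtain d where d: "d > 0" "\<And>h. h > 0 \<Longrightarrow> x - h \<in> {-1..1} \<Longrightarrow> h < d \<Longrightarrow> G (x - h) - F (x - h) < G x - F x"
        using has_real_derivative_pos_inc_left[OF der pos] by blast
      define h where "h = min (d / 2) ((x - r) / 2)"
      have "h > 0" "h < d" "r < x - h" using d r by (auto simp: h_def min_def field_simps)
      then show False using d(2)[of h] r(1) r(3)[rule_format, of "x - h"] x by auto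
    next
      fix r assume r: "r \<le> 1" "x < r" "\<forall>y. x < y \<longrightarrow> y < r \<longrightarrow> G y < F y"
      obtain d where d: "d > 0" "\<And>h. h > 0 \<Longrightarrow> x + h \<in> {-1..1} \<Longrightarrow> h < d \<Longrightarrow> G x - F x < G (x + h) - F (x + h)"
        using has_real_derivative_pos_inc_right[OF der pos] by blast
      define h where "h = min (d / 2) ((r - x) / 2)"
      have "h > 0" "h < d" "x + h < r" using d r by (auto simp: h_def min_def field_simps)
      then show False using d(2)[of h] r(1) r(3)[rule_format, of "x + h"] x by auto
    qed
  qed
  moreover have "0 < c * c' \<longleftrightarrow> b = b'" "c * c' < 0 \<longleftrightarrow> b \<noteq> b'"
    using c(1) c'(1) by (cases b; cases b'; auto simp: mult_less_0_iff zero_less_mult_iff)+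
  ultimately have "(0 < cross2 (vel D (s x)) (vel D (s' x))) \<longleftrightarrow> b \<noteq> b'"
    "(0 < cross2 (vel D (s' x)) (vel D (s x))) \<longleftrightarrow> b = b'"
    unfolding cr cr'
    by (simp_all only: neg_0_less_iff_less zero_less_mult_iff[of "c * c'"] mult_less_0_iff[of "c * c'"]) auto
  then show "eps D (s x) = - (sgnb b * sgnb b')" "eps D (s' x) = sgnb b * sgnb b'"
    unfolding eps_def pa by (auto simp: sgnb_def)
qed

section \<open>The state sum\<close>

definition weight :: "(complex \<Rightarrow> 'r) \<Rightarrow> (complex \<Rightarrow> 'r) \<Rightarrow> complex set \<Rightarrow> complex set \<Rightarrow> 'r::comm_ring_1" where
  "weight \<alpha> \<beta> C S = (\<Prod>z\<in>C. if z \<in> S then \<beta> z else \<alpha> z)"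

text \<open>
  The state sum with arbitrary weights \<open>\<alpha> z\<close>, \<open>\<beta> z\<close> of the two smoothings, loop value \<open>d\<close> and variables \<open>K n\<close>. This
  covers both the arrow polynomial and its specialization, and no over and under information enters it except through the
  weights.
\<close>

definition bracket ::
  "(complex \<Rightarrow> 'r) \<Rightarrow> (complex \<Rightarrow> 'r) \<Rightarrow> 'r \<Rightarrow> (nat \<Rightarrow> 'r) \<Rightarrow> ('a) flat_diagram_scheme \<Rightarrow> 'r::comm_ring_1" where
  "bracket \<alpha> \<beta> d K D = (\<Sum>S \<in> Pow (crossings D).
     weight \<alpha> \<beta> (crossings D) S * d ^ (num_loops D S - 1) * (\<Prod>c\<in>loops D S. K (loop_index D S c)))"

lemma weight_cong:
  "(\<And>z. z \<in> C \<Longrightarrow> \<alpha> z = \<alpha>' z) \<Longrightarrow> (\<And>z. z \<in> C \<Longrightarrow> \<beta> z = \<beta>' z) \<Longrightarrow> weight \<alpha> \<beta> C S = weight \<alpha>' \<beta>' C S"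
  unfolding weight_def by (rule prod.cong) auto

lemma bracket_cong:
  assumes "\<And>z. z \<in> crossings D \<Longrightarrow> \<alpha> z = \<alpha>' z" "\<And>z. z \<in> crossings D \<Longrightarrow> \<beta> z = \<beta>' z"
  shows "bracket \<alpha> \<beta> d K D = bracket \<alpha>' \<beta>' d K D"
  unfolding bracket_def using weight_cong[OF assms] by simp

context flat_diag
begin

text \<open>Every circle either has a crossing point, which lies on a loop, or is free.\<close>

lemma num_loops_pos: "num_loops D S > 0"
proof -
  interpret diagram_state D S by unfold_locales
  have n: "0 < ncomp D" using D by (auto simp: is_flat_diagram_def)
  have fin: "finite (loops D S)" "finite (free_circles D)"
    using L.fin by (auto simp: loops_eq free_circles_def)
  show ?thesis
  proof (cases "0 \<in> free_circles D")
    case True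
    then have "card (free_circles D) > 0" using fin by (auto simp: card_gt_0_iff)
    then show ?thesis by (simp add: num_loops_def)
  next
    case False
    then have "ends D \<noteq> {}" using n by (auto simp: free_circles_def ends_def)
    then have "card (loops D S) > 0" using fin by (auto simp: card_gt_0_iff loops_eq)
    then show ?thesis by (simp add: num_loops_def)
  qed
qed

lemma sum_Pow_union:
  assumes "C0 \<inter> N = {}"
  shows "(\<Sum>S\<in>Pow (C0 \<union> N). f S) = (\<Sum>S0\<in>Pow C0. \<Sum>T\<in>Pow N. f (S0 \<union> T))"
proof -
  have "(\<Sum>S\<in>Pow (C0 \<union> N). f S) = (\<Sum>(S0, T)\<in>Pow C0 \<times> Pow N. f (S0 \<union> T))"
    by (rule sum.reindex_bij_witness[where i = "\<lambda>(S0, T). S0 \<union> T" and j = "\<lambda>S. (S \<inter> C0, S \<inter> N)"])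
      (use assms in \<open>auto intro!: arg_cong[of _ _ f]\<close>)
  then show ?thesis by (simp add: sum.cartesian_product)
qed

text \<open>
  The factor \<open>d\<close> on the left compensates for the exponent \<open>num_loops D S - 1\<close>. Splitting the crossings into those far from
  and those near a move turns the sum over states into a sum of tangle contributions.
\<close>

lemma bracket_marked:
  fixes d :: "'r::comm_ring_1"
  assumes M: "marking (ncomp D) M" "CP \<subseteq> M" and pot: "potential D M \<Theta>" and K0: "K 0 = 1"
    and C: "crossings D = C0 \<union> N" "C0 \<inter> N = {}"
  shows "d * bracket \<alpha> \<beta> d K D = (\<Sum>S0\<in>Pow C0. weight \<alpha> \<beta> C0 S0 * d ^ card (unmarked (ncomp D) M) *
    (\<Sum>T\<in>Pow N. weight \<alpha> \<beta> N T *
       loops_eval (\<lambda>h. d * K (nat h div 4)) (M \<times> UNIV) (arc_map M) (mark_join D (S0 \<union> T)) \<Theta>))"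
proof -
  let ?ev = "\<lambda>S. loops_eval (\<lambda>h. d * K (nat h div 4)) (M \<times> UNIV) (arc_map M) (mark_join D S) \<Theta>"
  let ?u = "d ^ card (unmarked (ncomp D) M)"
  have "d * bracket \<alpha> \<beta> d K D = (\<Sum>S\<in>Pow (crossings D). weight \<alpha> \<beta> (crossings D) S * (?u * ?ev S))"
    unfolding bracket_def sum_distrib_left
  proof (rule sum.cong[OF refl])
    fix S
    interpret diagram_state D S by unfold_locales
    have dd: "d * d ^ (num_loops D S - 1) = d ^ num_loops D S"
      using num_loops_pos[of S] by (simp flip: power_Suc)
    have ac: "d * (w * x * y) = w * ((d * x) * y)" for w x y by (simp add: mult_ac)
    show "d * (weight \<alpha> \<beta> (crossings D) S * d ^ (num_loops D S - 1) * (\<Prod>c\<in>loops D S. K (loop_index D S c)))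
      = weight \<alpha> \<beta> (crossings D) S * (?u * ?ev S)"
      unfolding state_value[where K = K, OF M pot K0, symmetric] ac dd by (rule refl)
  qed
  also have "\<dots> = (\<Sum>S0\<in>Pow C0. \<Sum>T\<in>Pow N. weight \<alpha> \<beta> (C0 \<union> N) (S0 \<union> T) * (?u * ?ev (S0 \<union> T)))"
    unfolding C(1) by (rule sum_Pow_union) (rule C(2))
  also have "\<dots> = (\<Sum>S0\<in>Pow C0. weight \<alpha> \<beta> C0 S0 * ?u * (\<Sum>T\<in>Pow N. weight \<alpha> \<beta> N T * ?ev (S0 \<union> T)))"
  proof (rule sum.cong[OF refl])
    fix S0 assume S0: "S0 \<in> Pow C0"
    have "weight \<alpha> \<beta> (C0 \<union> N) (S0 \<union> T) = weight \<alpha> \<beta> C0 S0 * weight \<alpha> \<beta> N T" if "T \<in> Pow N" for T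
    proof -
      have "weight \<alpha> \<beta> (C0 \<union> N) (S0 \<union> T) = weight \<alpha> \<beta> C0 (S0 \<union> T) * weight \<alpha> \<beta> N (S0 \<union> T)"
        unfolding weight_def by (rule prod.union_disjoint) (use C finite_crossings in auto)
      also have "weight \<alpha> \<beta> C0 (S0 \<union> T) = weight \<alpha> \<beta> C0 S0"
        unfolding weight_def by (rule prod.cong) (use C that in auto)
      also have "weight \<alpha> \<beta> N (S0 \<union> T) = weight \<alpha> \<beta> N T"
        unfolding weight_def by (rule prod.cong) (use C S0 in auto)
      finally show ?thesis .
    qed
    then show "(\<Sum>T\<in>Pow N. weight \<alpha> \<beta> (C0 \<union> N) (S0 \<union> T) * (?u * ?ev (S0 \<union> T))) =
      weight \<alpha> \<beta> C0 S0 * ?u * (\<Sum>T\<in>Pow N. weight \<alpha> \<beta> N T * ?ev (S0 \<union> T))"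
      by (simp add: sum_distrib_left mult_ac)
  qed
  finally show ?thesis .
qed

lemma canonical_potential: "potential D CP (\<lambda>(p, b). sgnb b * eps D p)"
  by (auto simp: potential_def eps_partner)

end

section \<open>Isomorphic diagrams\<close>

text \<open>
  The state sum is a combinatorial invariant: it depends on the diagram only through the cyclic order of the crossing
  points on the circles, their pairing, the signs \<open>eps\<close> and the number of circles without crossings.
\<close>

lemma bracket_iso:
  fixes d :: "'r::comm_ring_1"
  assumes D: "is_flat_diagram D" "is_flat_diagram D'" and K0: "K 0 = 1"
    and bij: "bij_betw \<phi> (crossing_points D') (crossing_points D)"
    and succ: "\<And>p. p \<in> crossing_points D' \<Longrightarrow> succ (crossing_points D) (\<phi> p) = \<phi> (succ (crossing_points D') p)"
    and partner: "\<And>p. p \<in> crossing_points D' \<Longrightarrow> partner D (\<phi> p) = \<phi> (partner D' p)"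
    and eps: "\<And>p. p \<in> crossing_points D' \<Longrightarrow> eps D (\<phi> p) = eps D' p"
    and h: "inj_on h (crossings D)" "crossings D' = h ` crossings D"
      "\<And>p. p \<in> crossing_points D' \<Longrightarrow> pt D' p = h (pt D (\<phi> p))"
    and free: "card (unmarked (ncomp D') (crossing_points D')) = card (unmarked (ncomp D) (crossing_points D))"
    and \<alpha>\<beta>: "\<And>z. z \<in> crossings D \<Longrightarrow> \<alpha>' (h z) = \<alpha> z" "\<And>z. z \<in> crossings D \<Longrightarrow> \<beta>' (h z) = \<beta> z"
  shows "d * bracket \<alpha>' \<beta>' d K D' = d * bracket \<alpha> \<beta> d K D"
proof -
  interpret D: flat_diag D using D by unfold_locales
  interpret D': flat_diag D' using D by unfold_locales
  let ?\<kappa> = "\<lambda>h. d * K (nat h div 4)"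
  let ?\<tau> = "\<lambda>(p, b). (\<phi> p, b)"
  let ?\<Theta> = "\<lambda>(p, b). sgnb b * eps D p" and ?\<Theta>' = "\<lambda>(p, b). sgnb b * eps D' p"
  let ?ev = "\<lambda>S. loops_eval ?\<kappa> (D.CP \<times> UNIV) (arc_map D.CP) (mark_join D S) ?\<Theta>"
  let ?ev' = "\<lambda>S. loops_eval ?\<kappa> (D'.CP \<times> UNIV) (arc_map D'.CP) (mark_join D' S) ?\<Theta>'"
  have \<phi>: "\<phi> p \<in> D.CP" if "p \<in> D'.CP" for p using bij_betwE[OF bij] that by blast
  have cp: "pt D p \<in> crossings D" if "p \<in> D.CP" for p using that by (simp add: crossing_points_def)
  have ev: "?ev S = ?ev' (h ` S)" if S: "S \<subseteq> crossings D" for S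
  proof (rule loops_eval_iso)
    show "loop_system (D'.CP \<times> UNIV) (arc_map D'.CP) (mark_join D' (h ` S))"
      by (rule D'.state_system[OF D'.marking_CP]) simp
    show "loop_system (D.CP \<times> UNIV) (arc_map D.CP) (mark_join D S)"
      by (rule D.state_system[OF D.marking_CP]) simp
    show "inj_on ?\<tau> (D'.CP \<times> UNIV)" using bij by (auto simp: bij_betw_def inj_on_def)
    show "?\<tau> ` (D'.CP \<times> UNIV) = D.CP \<times> UNIV" using bij by (force simp: bij_betw_def image_def)
    fix x assume x: "x \<in> D'.CP \<times> (UNIV :: bool set)"
    interpret mk: marking "ncomp D" D.CP by (rule D.marking_CP)
    interpret mk': marking "ncomp D'" D'.CP by (rule D'.marking_CP)
    show "arc_map D.CP (?\<tau> x) = ?\<tau> (arc_map D'.CP x)"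
    proof (rule mk'.arc_cases[OF x])
      fix p assume "p \<in> D'.CP" "x = (p, True)"
      then show ?thesis using succ by simp
    next
      fix p assume p: "p \<in> D'.CP" "x = (succ D'.CP p, False)"
      then show ?thesis
        using mk'.arc_eqI(2)[OF p(1) refl] mk.arc_eqI(2)[OF \<phi>[OF p(1)] succ[OF p(1)]] by simp
    qed
    obtain p b where pb: "x = (p, b)" "p \<in> D'.CP" using x by auto
    have "pt D' p \<in> h ` S \<longleftrightarrow> pt D (\<phi> p) \<in> S"
      using h(3)[OF pb(2)] inj_on_image_mem_iff[OF h(1) cp[OF \<phi>[OF pb(2)]] S] by simp
    then show "mark_join D S (?\<tau> x) = ?\<tau> (mark_join D' (h ` S) x)"
      using pb \<phi> partner by (simp add: D.mark_join_eq D'.mark_join_eq)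
    show "?\<Theta> (?\<tau> x) = ?\<Theta>' x" using pb eps by simp
  qed
  have w: "weight \<alpha>' \<beta>' (crossings D') (h ` S) = weight \<alpha> \<beta> (crossings D) S" if S: "S \<subseteq> crossings D" for S
    unfolding weight_def h(2) prod.reindex[OF h(1)] o_def
    by (rule prod.cong[OF refl]) (use \<alpha>\<beta> inj_on_image_mem_iff[OF h(1) _ S] in simp)
  let ?f = "\<lambda>S. weight \<alpha> \<beta> (crossings D) S * d ^ card (unmarked (ncomp D) D.CP) * ?ev S"
  let ?f' = "\<lambda>S. weight \<alpha>' \<beta>' (crossings D') S * d ^ card (unmarked (ncomp D') D'.CP) * ?ev' S"
  have "d * bracket \<alpha>' \<beta>' d K D' = (\<Sum>S\<in>Pow (crossings D'). ?f' S)"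
    using D'.bracket_marked[where K = K, OF D'.marking_CP subset_refl D'.canonical_potential K0, of "crossings D'" "{}" d \<alpha>' \<beta>']
    by (simp add: weight_def)
  also have "\<dots> = (\<Sum>S\<in>image h ` Pow (crossings D). ?f' S)"
    unfolding h(2) image_Pow_surj[OF refl] by (rule refl)
  also have "\<dots> = (\<Sum>S\<in>Pow (crossings D). ?f' (h ` S))"
    by (rule sum.reindex[unfolded o_def]) (rule inj_on_image_Pow[OF h(1)])
  also have "\<dots> = (\<Sum>S\<in>Pow (crossings D). ?f S)"
    by (rule sum.cong[OF refl]) (simp add: ev w free)
  also have "\<dots> = d * bracket \<alpha> \<beta> d K D"
    using D.bracket_marked[where K = K, OF D.marking_CP subset_refl D.canonical_potential K0, of "crossings D" "{}" d \<alpha> \<beta>]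
    by (simp add: weight_def)
  finally show ?thesis .
qed

subsection \<open>Detours\<close>

text \<open>
  A detour changes only points that lie over no crossing, before and after; near a crossing point nothing moves.
\<close>

lemma detour_data:
  assumes D: "is_flat_diagram D" "is_flat_diagram D'" and move: "flat_detour D D'"
  shows "crossing_points D' = crossing_points D"
    and "\<And>z. z \<in> crossings D \<Longrightarrow> fiber D' z = fiber D z"
    and "\<And>p. p \<in> crossing_points D \<Longrightarrow> pt D' p = pt D p \<and> partner D' p = partner D p \<and> eps D' p = eps D p"
proof -
  interpret D: flat_diag D using D by unfold_locales
  interpret D': flat_diag D' using D by unfold_locales
  obtain s where n: "ncomp D' = ncomp D" and cr: "crossings D' = crossings D"
    and seg: "is_segment (ncomp D) s"
    and on: "\<And>x. x \<in> {-1..1} \<Longrightarrow> pt D (s x) \<notin> crossings D \<and> pt D' (s x) \<notin> crossings D'"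
    and off: "\<And>p. p \<in> circle_points D - s ` {-1..1} \<Longrightarrow> pt D' p = pt D p"
    using move unfolding flat_detour_def by blast
  have cc: "circle_points D' = circle_points D" using n by (simp add: circle_points_def)
  have eq: "pt D' p \<in> crossings D \<and> pt D' p = z \<longleftrightarrow> pt D p \<in> crossings D \<and> pt D p = z"
    if "p \<in> circle_points D" for p z
    using on off[of p] that cr by (cases "p \<in> s ` {-1..1}") auto
  show fib: "fiber D' z = fiber D z" if "z \<in> crossings D" for z
    unfolding fiber_def cc using eq that by blast
  show CP: "crossing_points D' = crossing_points D"
    unfolding crossing_points_def cc cr using eq by blast
  have "compact (s ` {-1..1})"
    using seg by (intro compact_continuous_image) (auto simp: is_segment_def)
  then have cl: "closed (s ` {-1..1})" by (rule compact_imp_closed)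
  have out: "p \<in> circle_points D - s ` {-1..1}" if "p \<in> crossing_points D" for p
    using on that by (auto simp: crossing_points_def)
  fix p assume p: "p \<in> crossing_points D"
  have ptp: "pt D' p = pt D p" using off out[OF p] by blast
  have q: "partner D p \<in> crossing_points D" using D.partner p by blast
  have pa: "partner D' p = partner D p"
    by (rule D'.partner_unique) (use D.partner[OF p] p q off[OF out[OF q]] ptp cc in \<open>auto simp: crossing_points_def\<close>)
  have "vel D' p = vel D p" if "p \<in> crossing_points D" for p
    by (rule vel_agree[OF cl out[OF that] n off])
  then show "pt D' p = pt D p \<and> partner D' p = partner D p \<and> eps D' p = eps D p"
    using ptp pa p q by (simp add: eps_def)
qed

lemma bracket_detour:
  fixes d :: "'r::comm_ring_1"
  assumes D: "is_flat_diagram D" "is_flat_diagram D'" and move: "flat_detour D D'" and K0: "K 0 = 1"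
  shows "d * bracket \<alpha> \<beta> d K D' = d * bracket \<alpha> \<beta> d K D"
proof (rule bracket_iso[where K = K and \<phi> = id and h = id, OF D K0])
  note data = detour_data[OF D move]
  show "bij_betw id (crossing_points D') (crossing_points D)" using data by simp
  show "card (unmarked (ncomp D') (crossing_points D')) = card (unmarked (ncomp D) (crossing_points D))"
    using data move by (simp add: flat_detour_def)
qed (use detour_data[OF D move] move in \<open>auto simp: flat_detour_def\<close>)

subsection \<open>Planar isotopy\<close>

lemma cross2_linear:
  assumes "linear L" shows "cross2 (L u) (L v) = cross2 (L 1) (L \<i>) * cross2 u v"
proof -
  have "L z = Re z *\<^sub>R L 1 + Im z *\<^sub>R L \<i>" for z
  proof -
    have "z = Re z *\<^sub>R 1 + Im z *\<^sub>R \<i>" by (simp add: complex_eq_iff)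
    then have "L z = L (Re z *\<^sub>R 1 + Im z *\<^sub>R \<i>)" by simp
    then show ?thesis by (simp only: linear_add[OF assms] linear_scale[OF assms])
  qed
  note * = this
  show ?thesis unfolding *[of u] *[of v] by (simp add: cross2_def algebra_simps)
qed

lemma cross2_bij_nonzero:
  assumes "linear L" "bij L" shows "cross2 (L 1) (L \<i>) \<noteq> 0"
proof
  assume 0: "cross2 (L 1) (L \<i>) = 0"
  have "cross2 (L (inv L 1)) (L (inv L \<i>)) = 0" using cross2_linear[OF assms(1)] 0 by simp
  then show False using assms(2) by (simp add: cross2_def bij_is_surj surj_f_inv_f)
qed

text \<open>The Jacobian determinant is positive at time 0 and never vanishes, so it is positive at time 1.\<close>

lemma plane_isotopy_orientation:
  assumes "plane_isotopy H"
  obtains L where "\<And>z. (H 1 has_derivative L z) (at z)" "\<And>z u v. 0 < cross2 (L z u) (L z v) \<longleftrightarrow> 0 < cross2 u v"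
proof -
  obtain H' where H: "H 0 = id"
    and der: "\<And>t z. t \<in> {0..1} \<Longrightarrow> (H t has_derivative H' t z) (at z) \<and> bij (H' t z)"
    and cont: "\<And>v. continuous_on ({0..1} \<times> UNIV) (\<lambda>(t, z). H' t z v)"
    using assms unfolding plane_isotopy_def by blast
  have "0 < cross2 (H' 1 z 1) (H' 1 z \<i>)" for z
  proof (rule ccontr)
    \<comment> \<open>The Jacobian determinant along the isotopy.\<close>
    define f where "f = (\<lambda>t. cross2 (H' t z 1) (H' t z \<i>))"
    assume "\<not> 0 < cross2 (H' 1 z 1) (H' 1 z \<i>)"
    then have f1: "f 1 \<le> 0" by (simp add: f_def)
    have "(id has_derivative H' 0 z) (at z)" using der[of 0 z] H by simp
    then have "H' 0 z = id" using has_derivative_unique has_derivative_id by (metis id_def)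
    then have f0: "f 0 = 1" by (simp add: f_def cross2_def)
    have c: "continuous_on {0..1} (\<lambda>t. H' t z v)" for v
    proof -
      have "continuous_on {0..1} (\<lambda>t. (\<lambda>(t, z). H' t z v) (t, z))"
        by (rule continuous_on_compose2[OF cont]) (auto intro: continuous_intros)
      then show ?thesis by simp
    qed
    have "continuous_on {0..1} f"
      unfolding f_def cross2_def by (intro continuous_intros c)
    then obtain t where t: "0 \<le> t" "t \<le> 1" "f t = 0" using IVT2'[of f 1 0 0] f0 f1 by auto
    then have "linear (H' t z)" "bij (H' t z)" using der[of t z] by (auto intro: has_derivative_linear)
    then show False using cross2_bij_nonzero t by (auto simp: f_def)
  qed
  then have pos: "0 < cross2 (H' 1 z 1) (H' 1 z \<i>)" for z .
  have lin: "linear (H' 1 z)" for z using der[of 1 z] by (auto intro: has_derivative_linear)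
  show ?thesis
  proof (rule that[of "H' 1"])
    show "(H 1 has_derivative H' 1 z) (at z)" for z using der[of 1 z] by simp
    show "0 < cross2 (H' 1 z u) (H' 1 z v) \<longleftrightarrow> 0 < cross2 u v" for z u v
      unfolding cross2_linear[OF lin, of z u v] using pos[of z] by (auto simp: zero_less_mult_iff)
  qed
qed

locale reparam =
  fixes n :: nat and \<Phi> :: "nat \<times> complex \<Rightarrow> nat \<times> complex"
  assumes rep: "reparametrization n \<Phi>"
begin

text \<open>
  In the coordinates given by angles from \<open>p\<close> and from its image, the reparametrization is an increasing
  diffeomorphism \<open>\<sigma>\<close> of the line that commutes with full turns.
\<close>

lemma along:
  assumes p: "p \<in> circles n"
  obtains \<sigma> c where "\<And>t. \<Phi> (travel p t) = travel (\<Phi> p) (\<sigma> t)" "\<sigma> 0 = 0" "\<sigma> (2 * pi) = 2 * pi"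
    "\<And>s t. s < t \<Longrightarrow> \<sigma> s < \<sigma> t" "continuous_on UNIV \<sigma>" "(\<sigma> has_real_derivative c) (at 0)" "0 < c"
proof -
  obtain \<pi> \<rho> where \<rho>: "\<And>i. i < n \<Longrightarrow> \<rho> i C1_differentiable_on UNIV"
    "\<And>i \<theta>. i < n \<Longrightarrow> 0 < vector_derivative (\<rho> i) (at \<theta>) \<and> \<rho> i (\<theta> + 2 * pi) = \<rho> i \<theta> + 2 * pi \<and>
              \<Phi> (i, cis \<theta>) = (\<pi> i, cis (\<rho> i \<theta>))"
    using rep unfolding reparametrization_def by blast
  obtain i w where iw: "p = (i, w)" "i < n" "cmod w = 1" using p by (auto simp: circles_def)
  obtain \<theta> where w: "w = cis \<theta>" using iw(3) by (metis complex_unimodular_polar cis.ctr complex_eq_iff complex.sel)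
  define \<sigma> where "\<sigma> = (\<lambda>t. \<rho> i (\<theta> + t) - \<rho> i \<theta>)"
  have der: "(\<rho> i has_real_derivative vector_derivative (\<rho> i) (at x)) (at x)" for x
  proof -
    have "\<rho> i differentiable at x" using \<rho>(1)[OF iw(2)] by (auto simp: C1_differentiable_on_eq)
    then show ?thesis by (simp add: has_real_derivative_iff_has_vector_derivative flip: vector_derivative_works)
  qed
  have s: "(\<sigma> has_real_derivative vector_derivative (\<rho> i) (at (\<theta> + t))) (at t)" for t
    unfolding \<sigma>_def by (auto intro!: derivative_eq_intros DERIV_chain'[OF _ der])
  show ?thesis
  proof (rule that)
    show "\<Phi> (travel p t) = travel (\<Phi> p) (\<sigma> t)" for t
      using \<rho>(2)[OF iw(2), of "\<theta> + t"] \<rho>(2)[OF iw(2), of \<theta>]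
      by (simp add: iw(1) w travel_def \<sigma>_def cis_mult)
    show "\<sigma> 0 = 0" "\<sigma> (2 * pi) = 2 * pi" using \<rho>(2)[OF iw(2), of \<theta>] by (auto simp: \<sigma>_def)
    show "\<sigma> x < \<sigma> y" if "x < y" for x y
      using that by (rule DERIV_pos_imp_increasing) (use s \<rho>(2)[OF iw(2)] in blast)
    show "continuous_on UNIV \<sigma>" using s by (auto intro!: continuous_at_imp_continuous_on DERIV_isCont)
    show "(\<sigma> has_real_derivative vector_derivative (\<rho> i) (at (\<theta> + 0))) (at 0)" by (rule s)
    show "0 < vector_derivative (\<rho> i) (at (\<theta> + 0))" using \<rho>(2)[OF iw(2)] by blast
  qed
qed

lemma fst_eq: "p \<in> circles n \<Longrightarrow> q \<in> circles n \<Longrightarrow> fst (\<Phi> p) = fst (\<Phi> q) \<longleftrightarrow> fst p = fst q"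
proof -
  obtain \<pi> \<rho> where \<pi>: "bij_betw \<pi> {..<n} {..<n}"
    "\<And>i \<theta>. i < n \<Longrightarrow> \<Phi> (i, cis \<theta>) = (\<pi> i, cis (\<rho> i \<theta>))"
    using rep unfolding reparametrization_def by blast
  have f: "fst (\<Phi> p) = \<pi> (fst p) \<and> fst p < n" if p: "p \<in> circles n" for p
  proof -
    obtain i w where iw: "p = (i, w)" "i < n" "cmod w = 1" using p by (auto simp: circles_def)
    obtain \<theta> where w: "w = cis \<theta>" using iw(3) by (metis complex_unimodular_polar cis.ctr complex_eq_iff complex.sel)
    show ?thesis using \<pi>(2)[OF iw(2), of \<theta>] iw w by simp
  qed
  assume "p \<in> circles n" "q \<in> circles n"
  then show ?thesis using f[of p] f[of q] inj_onD[OF bij_betw_imp_inj_on[OF \<pi>(1)]] by auto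
qed

lemma component:
  obtains \<pi> where "bij_betw \<pi> {..<n} {..<n}" "\<And>p. p \<in> circles n \<Longrightarrow> fst (\<Phi> p) = \<pi> (fst p)"
    "\<And>p. p \<in> circles n \<Longrightarrow> \<Phi> p \<in> circles n"
proof -
  obtain \<pi> \<rho> where \<pi>: "bij_betw \<pi> {..<n} {..<n}"
    "\<And>i \<theta>. i < n \<Longrightarrow> \<Phi> (i, cis \<theta>) = (\<pi> i, cis (\<rho> i \<theta>))"
    using rep unfolding reparametrization_def by blast
  have f: "fst (\<Phi> p) = \<pi> (fst p) \<and> \<Phi> p \<in> circles n" if p: "p \<in> circles n" for p
  proof -
    obtain i w where iw: "p = (i, w)" "i < n" "cmod w = 1" using p by (auto simp: circles_def)
    obtain \<theta> where w: "w = cis \<theta>" using iw(3) by (metis complex_unimodular_polar cis.ctr complex_eq_iff complex.sel)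
    have "\<pi> i < n" using bij_betwE[OF \<pi>(1)] iw by auto
    then show ?thesis using \<pi>(2)[OF iw(2), of \<theta>] iw w by (simp add: circles_def)
  qed
  then show ?thesis using \<pi>(1) by (intro that[of \<pi>]) auto
qed

lemma bij: "bij_betw \<Phi> (circles n) (circles n)"
proof -
  obtain \<pi> where \<pi>: "bij_betw \<pi> {..<n} {..<n}" "\<And>p. p \<in> circles n \<Longrightarrow> fst (\<Phi> p) = \<pi> (fst p)"
    "\<And>p. p \<in> circles n \<Longrightarrow> \<Phi> p \<in> circles n" by (rule component) blast
  have inj: "inj_on \<Phi> (circles n)"
  proof (rule inj_onI)
    fix p q assume pq: "p \<in> circles n" "q \<in> circles n" "\<Phi> p = \<Phi> q"
    then have "fst p = fst q" using fst_eq by metis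
    then obtain t where t: "0 \<le> t" "t < 2 * pi" "q = travel p t" using circles_travel[OF pq(1,2)] by blast
    obtain \<sigma> where \<sigma>: "\<And>t. \<Phi> (travel p t) = travel (\<Phi> p) (\<sigma> t)" "\<sigma> 0 = 0" "\<sigma> (2 * pi) = 2 * pi"
      "\<And>s t. s < t \<Longrightarrow> \<sigma> s < \<sigma> t" using along[OF pq(1)] by metis
    show "p = q"
    proof (cases "t = 0")
      case False
      then have "0 < \<sigma> t" "\<sigma> t < 2 * pi" using \<sigma>(4)[of 0 t] \<sigma>(4)[of t "2 * pi"] \<sigma>(2,3) t by auto
      moreover have "travel (\<Phi> p) (\<sigma> t) = travel (\<Phi> p) 0" using \<sigma>(1)[of t] t pq by simp
      ultimately have False using travel_inj[OF \<pi>(3)[OF pq(1)], of "\<sigma> t" 0] by simp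
      then show ?thesis by simp
    qed (use t in simp)
  qed
  have "q \<in> \<Phi> ` circles n" if q: "q \<in> circles n" for q
  proof -
    have "fst q \<in> \<pi> ` {..<n}" using q \<pi>(1) by (auto simp: bij_betw_def circles_def)
    then obtain i where i: "i < n" "fst q = \<pi> i" by auto
    define p where "p = (i, 1 :: complex)"
    have p: "p \<in> circles n" using i by (simp add: p_def circles_def)
    have "fst (\<Phi> p) = fst q" using \<pi>(2)[OF p] i by (simp add: p_def)
    then obtain t where t: "0 \<le> t" "t < 2 * pi" "q = travel (\<Phi> p) t"
      using circles_travel[OF \<pi>(3)[OF p] q] by blast
    obtain \<sigma> where \<sigma>: "\<And>t. \<Phi> (travel p t) = travel (\<Phi> p) (\<sigma> t)" "\<sigma> 0 = 0" "\<sigma> (2 * pi) = 2 * pi"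
      "continuous_on UNIV \<sigma>" using along[OF p] by metis
    have "continuous_on {0..2 * pi} \<sigma>" by (rule continuous_on_subset[OF \<sigma>(4)]) auto
    then obtain r where "\<sigma> r = t" using IVT'[of \<sigma> 0 t "2 * pi"] t \<sigma>(2,3) by auto
    then have "q = \<Phi> (travel p r)" using \<sigma>(1) t by simp
    then show ?thesis using p by (intro image_eqI[of _ _ "travel p r"]) auto
  qed
  then show ?thesis using inj \<pi>(3) by (auto simp: bij_betw_def)
qed

text \<open>An increasing change of the angle preserves the order of the marks.\<close>

lemma succ_transport:
  assumes M: "marking n M" and M': "marking n M'" and iff: "\<And>p. p \<in> circles n \<Longrightarrow> \<Phi> p \<in> M \<longleftrightarrow> p \<in> M'"
    and p: "p \<in> M'"
  shows "succ M (\<Phi> p) = \<Phi> (succ M' p)"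
proof -
  interpret M': marking n M' by fact
  have pc: "p \<in> circles n" using p M'.M_sub by blast
  obtain \<sigma> where \<sigma>: "\<And>t. \<Phi> (travel p t) = travel (\<Phi> p) (\<sigma> t)" "\<sigma> 0 = 0"
    "\<And>s t. s < t \<Longrightarrow> \<sigma> s < \<sigma> t" "continuous_on UNIV \<sigma>" using along[OF pc] by metis
  obtain t where t: "0 < t" "travel p t \<in> M'" "succ M' p = travel p t"
    "\<And>s. 0 < s \<Longrightarrow> s < t \<Longrightarrow> travel p s \<notin> M'"
    using M'.succ_obtain[OF p] by metis
  have "succ M (\<Phi> p) = travel (\<Phi> p) (\<sigma> t)"
  proof (rule succ_eqI)
    show "0 < \<sigma> t" using \<sigma>(2,3) t(1) by metis
    show "travel (\<Phi> p) (\<sigma> t) \<in> M" using iff[of "travel p t"] t(2) pc \<sigma>(1)[of t] by simp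
    fix r assume r: "0 < r" "r < \<sigma> t"
    have "continuous_on {0..t} \<sigma>" by (rule continuous_on_subset[OF \<sigma>(4)]) auto
    then obtain x where x: "0 \<le> x" "x \<le> t" "\<sigma> x = r" using IVT'[of \<sigma> 0 r t] r \<sigma>(2) t by auto
    then have "0 < x" "x < t" using r \<sigma>(2) by (auto simp: less_le)
    then have "travel p x \<notin> M'" using t by blast
    then show "travel (\<Phi> p) r \<notin> M" using iff[of "travel p x"] pc \<sigma>(1)[of x] x by simp
  qed
  then show ?thesis using \<sigma>(1) t by simp
qed

end

text \<open>
  All combinatorial data are transported by \<open>\<Phi>\<close>: the cyclic order because \<open>\<Phi>\<close> preserves the orientation of circles, and
  the signs because the isotopy preserves the orientation of the plane.
\<close>

lemma isotopy_data:
  assumes D: "is_flat_diagram D" "is_flat_diagram D'" and move: "flat_planar_isotopy D D' \<Phi>"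
  obtains h where "bij h" "crossings D' = h ` crossings D"
    "\<And>p. p \<in> circle_points D' \<Longrightarrow> pt D' p = h (pt D (\<Phi> p))"
    "bij_betw \<Phi> (circle_points D') (circle_points D)"
    "bij_betw \<Phi> (crossing_points D') (crossing_points D)"
    "\<And>p. p \<in> crossing_points D' \<Longrightarrow> succ (crossing_points D) (\<Phi> p) = \<Phi> (succ (crossing_points D') p)"
    "\<And>p. p \<in> crossing_points D' \<Longrightarrow> partner D (\<Phi> p) = \<Phi> (partner D' p)"
    "\<And>p. p \<in> crossing_points D' \<Longrightarrow> eps D (\<Phi> p) = eps D' p"
    "card (unmarked (ncomp D') (crossing_points D')) = card (unmarked (ncomp D) (crossing_points D))"
proof -
  interpret D: flat_diag D using D by unfold_locales
  interpret D': flat_diag D' using D by unfold_locales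
  obtain H where n: "ncomp D' = ncomp D" and rep: "reparametrization (ncomp D) \<Phi>" and H: "plane_isotopy H"
    and pt: "\<And>p. p \<in> circle_points D' \<Longrightarrow> pt D' p = H 1 (pt D (\<Phi> p))" and cr: "crossings D' = H 1 ` crossings D"
    using move unfolding flat_planar_isotopy_def by blast
  interpret R: reparam "ncomp D" \<Phi> using rep by unfold_locales
  have bijH: "bij (H 1)" using H by (auto simp: plane_isotopy_def)
  have cc: "circle_points D' = circles (ncomp D)" "circle_points D = circles (ncomp D)"
    using n by (simp_all add: circle_points_eq)
  obtain \<pi> where \<pi>: "bij_betw \<pi> {..<ncomp D} {..<ncomp D}" "\<And>p. p \<in> circles (ncomp D) \<Longrightarrow> fst (\<Phi> p) = \<pi> (fst p)"
    "\<And>p. p \<in> circles (ncomp D) \<Longrightarrow> \<Phi> p \<in> circles (ncomp D)" by (rule R.component) blast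
  have iff: "\<Phi> p \<in> D.CP \<longleftrightarrow> p \<in> D'.CP" if "p \<in> circles (ncomp D)" for p
    using that pt[of p] \<pi>(3)[OF that] bij_is_inj[OF bijH]
    by (simp add: crossing_points_def cc cr inj_image_mem_iff)
  have bijCP: "bij_betw \<Phi> D'.CP D.CP"
  proof (rule bij_betw_imageI)
    show "inj_on \<Phi> D'.CP" using R.bij D'.CP_circles n by (auto simp: bij_betw_def intro: inj_on_subset)
    show "\<Phi> ` D'.CP = D.CP"
    proof
      show "\<Phi> ` D'.CP \<subseteq> D.CP" using iff D'.CP_circles n by auto
      show "D.CP \<subseteq> \<Phi> ` D'.CP"
      proof
        fix q assume q: "q \<in> D.CP"
        then have "q \<in> \<Phi> ` circles (ncomp D)" using D.CP_circles R.bij by (auto simp: bij_betw_def)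
        then show "q \<in> \<Phi> ` D'.CP" using iff q by blast
      qed
    qed
  qed
  have pa: "partner D (\<Phi> p) = \<Phi> (partner D' p)" if p: "p \<in> D'.CP" for p
  proof (rule D.partner_unique)
    have c: "p \<in> circles (ncomp D)" "partner D' p \<in> circles (ncomp D)" 
      using p D'.partner[OF p] D'.CP_circles n by auto
    then show "\<Phi> p \<in> circle_points D" "\<Phi> (partner D' p) \<in> circle_points D" using \<pi>(3) cc by auto
    show "\<Phi> (partner D' p) \<noteq> \<Phi> p"
      using c D'.partner[OF p] R.bij by (auto simp: bij_betw_def dest: inj_onD)
    have "H 1 (pt D (\<Phi> (partner D' p))) = H 1 (pt D (\<Phi> p))"
      using pt[of p] pt[of "partner D' p"] c cc D'.partner[OF p] by simp
    then show "pt D (\<Phi> (partner D' p)) = pt D (\<Phi> p)" using bij_is_inj[OF bijH] by (simp add: inj_eq)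
  qed
  obtain L where L: "\<And>z. (H 1 has_derivative L z) (at z)"
    "\<And>z u v. 0 < cross2 (L z u) (L z v) \<longleftrightarrow> 0 < cross2 u v"
    using plane_isotopy_orientation[OF H] by blast
  have vel: "\<exists>c>0. vel D' p = L (pt D (\<Phi> p)) (c *\<^sub>R vel D (\<Phi> p))" if p: "p \<in> circles (ncomp D)" for p
  proof -
    obtain \<sigma> c where \<sigma>: "\<And>t. \<Phi> (travel p t) = travel (\<Phi> p) (\<sigma> t)" "\<sigma> 0 = 0"
      "(\<sigma> has_real_derivative c) (at 0)" "0 < c" using R.along[OF p] by metis
    have "((\<lambda>t. pt D (travel (\<Phi> p) t)) has_vector_derivative vel D (\<Phi> p)) (at (\<sigma> 0))"
      using D.pt_travel_derivative(1)[of "\<Phi> p"] \<pi>(3)[OF p] cc \<sigma>(2) by simp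
    then have "(((\<lambda>t. pt D (travel (\<Phi> p) t)) \<circ> \<sigma>) has_vector_derivative c *\<^sub>R vel D (\<Phi> p)) (at 0)"
      using \<sigma>(3) by (intro vector_diff_chain_at) (simp_all add: has_real_derivative_iff_has_vector_derivative)
    then have "((\<lambda>t. pt D (travel (\<Phi> p) (\<sigma> t))) has_derivative (\<lambda>x. x *\<^sub>R c *\<^sub>R vel D (\<Phi> p))) (at 0)"
      by (simp add: has_vector_derivative_def o_def)
    moreover have "(H 1 has_derivative L (pt D (\<Phi> p))) (at (pt D (travel (\<Phi> p) (\<sigma> 0))))" using L(1) \<sigma>(2) by simp
    ultimately have "((\<lambda>t. H 1 (pt D (travel (\<Phi> p) (\<sigma> t)))) has_derivative
        (\<lambda>x. L (pt D (\<Phi> p)) (x *\<^sub>R c *\<^sub>R vel D (\<Phi> p)))) (at 0)"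
      by (rule has_derivative_compose)
    moreover have "linear (L (pt D (\<Phi> p)))" using L(1) by (rule has_derivative_linear)
    ultimately have "((\<lambda>t. H 1 (pt D (travel (\<Phi> p) (\<sigma> t)))) has_vector_derivative
        L (pt D (\<Phi> p)) (c *\<^sub>R vel D (\<Phi> p))) (at 0)"
      by (simp add: has_vector_derivative_def linear_scale)
    moreover have "H 1 (pt D (travel (\<Phi> p) (\<sigma> t))) = pt D' (travel p t)" for t
      using pt[of "travel p t"] p cc \<sigma>(1) by simp
    ultimately have "((\<lambda>t. pt D' (travel p t)) has_vector_derivative L (pt D (\<Phi> p)) (c *\<^sub>R vel D (\<Phi> p))) (at 0)"
      by simp
    moreover have "((\<lambda>t. pt D' (travel p t)) has_vector_derivative vel D' p) (at 0)"
      using D'.pt_travel_derivative(1)[of p] p cc by simp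
    ultimately show ?thesis using \<sigma>(4) vector_derivative_unique_at by blast
  qed
  have eps: "eps D (\<Phi> p) = eps D' p" if p: "p \<in> D'.CP" for p
  proof -
    let ?q = "partner D' p"
    have c: "p \<in> circles (ncomp D)" "?q \<in> circles (ncomp D)" 
      using p D'.partner[OF p] D'.CP_circles n by auto
    have z: "pt D (\<Phi> ?q) = pt D (\<Phi> p)"
      using D.partner(3)[of "\<Phi> p"] pa[OF p] iff[OF c(1)] p by simp
    obtain a where a: "a > 0" "vel D' p = L (pt D (\<Phi> p)) (a *\<^sub>R vel D (\<Phi> p))" using vel[OF c(1)] by blast
    obtain b where b: "b > 0" "vel D' ?q = L (pt D (\<Phi> p)) (b *\<^sub>R vel D (\<Phi> ?q))" using vel[OF c(2)] z by auto
    have "cross2 (a *\<^sub>R vel D (\<Phi> p)) (b *\<^sub>R vel D (\<Phi> ?q)) = (a * b) * cross2 (vel D (\<Phi> p)) (vel D (\<Phi> ?q))"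
      by (simp add: cross2_def algebra_simps)
    moreover have "0 < a * b" using a b by simp
    ultimately have "0 < cross2 (vel D' p) (vel D' ?q) \<longleftrightarrow> 0 < cross2 (vel D (\<Phi> p)) (vel D (\<Phi> ?q))"
      unfolding a b L(2) by (metis zero_less_mult_pos mult_pos_pos)
    then show ?thesis by (simp add: eps_def pa[OF p])
  qed
  have un: "unmarked (ncomp D) D.CP = \<pi> ` unmarked (ncomp D) D'.CP"
  proof -
    have m: "(D.CP \<inter> {\<pi> i} \<times> UNIV = {}) \<longleftrightarrow> (D'.CP \<inter> {i} \<times> UNIV = {})" if i: "i < ncomp D" for i
    proof -
      have "(\<exists>q\<in>D.CP. fst q = \<pi> i) \<longleftrightarrow> (\<exists>p\<in>D'.CP. fst (\<Phi> p) = \<pi> i)"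
        using bijCP unfolding bij_betw_def by (metis (no_types, lifting) imageE imageI)
      also have "\<dots> \<longleftrightarrow> (\<exists>p\<in>D'.CP. fst p = i)"
      proof -
        have "fst (\<Phi> p) = \<pi> i \<longleftrightarrow> fst p = i" if p: "p \<in> D'.CP" for p
        proof -
          have pc: "p \<in> circles (ncomp D)" using D'.CP_circles n p by auto
          then have "fst p < ncomp D" by (auto simp: circles_def)
          then show ?thesis
            using \<pi>(2)[OF pc] inj_on_eq_iff[OF bij_betw_imp_inj_on[OF \<pi>(1)], of "fst p" i] i by simp
        qed
        then show ?thesis by blast
      qed
      finally have ex: "(\<exists>q\<in>D.CP. fst q = \<pi> i) \<longleftrightarrow> (\<exists>p\<in>D'.CP. fst p = i)" .
      have *: "M \<inter> {c} \<times> UNIV = {} \<longleftrightarrow> \<not> (\<exists>q\<in>M. fst q = c)" for M :: "(nat \<times> complex) set" and c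
        by auto
      show ?thesis unfolding * ex by (rule refl)
    qed
    show ?thesis
    proof
      show "\<pi> ` unmarked (ncomp D) D'.CP \<subseteq> unmarked (ncomp D) D.CP"
        using m bij_betwE[OF \<pi>(1)] by (auto simp: unmarked_def)
      show "unmarked (ncomp D) D.CP \<subseteq> \<pi> ` unmarked (ncomp D) D'.CP"
      proof
        fix k assume k: "k \<in> unmarked (ncomp D) D.CP"
        then have "k \<in> \<pi> ` {..<ncomp D}" using \<pi>(1) by (auto simp: unmarked_def bij_betw_def)
        then obtain i where "i < ncomp D" "k = \<pi> i" by auto
        then show "k \<in> \<pi> ` unmarked (ncomp D) D'.CP" using k m[of i] by (auto simp: unmarked_def)
      qed
    qed
  qed
  have "card (\<pi> ` unmarked (ncomp D) D'.CP) = card (unmarked (ncomp D) D'.CP)"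
    using \<pi>(1) by (intro card_image inj_on_subset[OF bij_betw_imp_inj_on[OF \<pi>(1)]]) (auto simp: unmarked_def)
  then have card: "card (unmarked (ncomp D') D'.CP) = card (unmarked (ncomp D) D.CP)" using un n by simp
  have sc: "succ D.CP (\<Phi> p) = \<Phi> (succ D'.CP p)" if "p \<in> D'.CP" for p
    using R.succ_transport[OF D.marking_CP _ iff that] D'.marking_CP n by simp
  have bijC: "bij_betw \<Phi> (circle_points D') (circle_points D)" using R.bij cc by simp
  show ?thesis by (rule that[OF bijH cr pt bijC bijCP sc pa eps card])
qed

section \<open>Tangles of diagrams\<close>

subsection \<open>Numbering the ends on strands\<close>

text \<open>
  With \<open>w\<close> marks on each strand, the mark \<open>i\<close> of the strand \<open>k\<close> is \<open>s k (P (w * k + i))\<close>; its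
  left end has the number \<open>2 * w * k + 2 * i\<close>, and its right end the next one.
\<close>

definition strand_end ::
  "nat \<Rightarrow> (nat \<Rightarrow> real \<Rightarrow> nat \<times> complex) \<Rightarrow> (nat \<Rightarrow> bool) \<Rightarrow> (nat \<Rightarrow> real) \<Rightarrow> nat \<Rightarrow> end_pt" where
  "strand_end w s b P n = (s (n div (2 * w)) (P (n div 2)), odd n = b (n div (2 * w)))"

definition strand_marks :: "nat \<Rightarrow> nat \<Rightarrow> (nat \<Rightarrow> real \<Rightarrow> nat \<times> complex) \<Rightarrow> (nat \<Rightarrow> real) \<Rightarrow> (nat \<times> complex) set" where
  "strand_marks m w s P = {s k (P (w * k + i)) | k i. k < m \<and> i < w}"

definition labels :: "(nat \<times> nat) list \<Rightarrow> nat set" where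
  "labels ps = fst ` set ps \<union> snd ` set ps"

definition joins_pairs :: "('a \<Rightarrow> 'a) \<Rightarrow> (nat \<Rightarrow> 'a) \<Rightarrow> (nat \<times> nat) list \<Rightarrow> bool" where
  "joins_pairs J e ps \<longleftrightarrow> (\<forall>(x, y) \<in> set ps. J (e x) = e y \<and> J (e y) = e x)"

lemma joins_pairs_simps [simp]:
  "joins_pairs J e []"
  "joins_pairs J e ((x, y) # ps) \<longleftrightarrow> J (e x) = e y \<and> J (e y) = e x \<and> joins_pairs J e ps"
  "joins_pairs J e (ps @ qs) \<longleftrightarrow> joins_pairs J e ps \<and> joins_pairs J e qs"
  by (auto simp: joins_pairs_def)

lemma labels_simps [simp]:
  "labels [] = {}" "labels ((x, y) # ps) = {x, y} \<union> labels ps" "labels (ps @ qs) = labels ps \<union> labels qs"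
  "labels (smooth t kL kR lL lR) = {kL, kR, lL, lR}"
  by (auto simp: labels_def smooth_def)

lemma wire_pair: "n \<in> labels ps \<Longrightarrow> (n, wire ps n) \<in> set ps \<or> (wire ps n, n) \<in> set ps"
  by (induction ps n rule: wire.induct) auto

lemma wire_other: "n \<notin> labels ps \<Longrightarrow> wire ps n = n"
  by (induction ps n rule: wire.induct) auto

lemma joins_pairs_wire: "joins_pairs J e ps \<Longrightarrow> n \<in> labels ps \<Longrightarrow> J (e n) = e (wire ps n)"
  using wire_pair[of n ps] by (auto simp: joins_pairs_def)

lemma strand_point: "k < m \<Longrightarrow> x \<in> {-1..1} \<Longrightarrow> s k x \<in> strand_points m s"
  unfolding strand_points_def by blast

lemma strand_pointE:
  assumes "p \<in> strand_points m s" obtains k x where "k < m" "x \<in> {-1..1}" "p = s k x"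
  using assms unfolding strand_points_def by blast

lemma orient_strands:
  assumes "\<And>k. k < m \<Longrightarrow> is_segment n (s k)"
  obtains b \<tau> where "\<And>k. k < m \<Longrightarrow> oriented_segment n (s k) (b k) (\<tau> k)"
proof -
  have "\<exists>b \<tau>. k < m \<longrightarrow> oriented_segment n (s k) b \<tau>" for k
    using orient_segment[OF assms[of k]] by blast
  then show ?thesis using that by metis
qed

locale marked_strands =
  fixes nc m :: nat and s :: "nat \<Rightarrow> real \<Rightarrow> nat \<times> complex" and b :: "nat \<Rightarrow> bool"
    and \<tau> :: "nat \<Rightarrow> real \<Rightarrow> real" and w :: nat and P :: "nat \<Rightarrow> real"
  assumes os: "k < m \<Longrightarrow> oriented_segment nc (s k) (b k) (\<tau> k)"
    and strands_inj: "inj_on (\<lambda>(k, x). s k x) ({..<m} \<times> {-1..1})"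
    and P_mem: "k < m \<Longrightarrow> i < w \<Longrightarrow> P (w * k + i) \<in> {-1..1}"
    and P_step: "k < m \<Longrightarrow> Suc i < w \<Longrightarrow> P (w * k + i) < P (w * k + Suc i)"
begin

abbreviation "e \<equiv> strand_end w s b P"
abbreviation "marks \<equiv> strand_marks m w s P"

lemma P_mono: assumes "k < m" "j < w" shows "i < j \<Longrightarrow> P (w * k + i) < P (w * k + j)"
  using assms(2)
proof (induction j)
  case (Suc j)
  then show ?case using P_step[OF assms(1), of j] by (cases "i = j") auto
qed simp

lemma P_less: "k < m \<Longrightarrow> i < w \<Longrightarrow> j < w \<Longrightarrow> P (w * k + i) < P (w * k + j) \<longleftrightarrow> i < j"
  using P_mono[of k j i] P_mono[of k i j] by (cases i j rule: linorder_cases) auto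

lemma s_eq_iff:
  assumes "k < m" "l < m" "x \<in> {-1..1}" "y \<in> {-1..1}" shows "s k x = s l y \<longleftrightarrow> k = l \<and> x = y"
  using inj_onD[OF strands_inj, of "(k, x)" "(l, y)"] assms by auto

lemma e_left: "k < m \<Longrightarrow> i < w \<Longrightarrow> e (2 * w * k + 2 * i) = (s k (P (w * k + i)), \<not> b k)"
  and e_right: "k < m \<Longrightarrow> i < w \<Longrightarrow> e (2 * w * k + 2 * i + 1) = (s k (P (w * k + i)), b k)"
proof -
  assume i: "k < m" "i < w"
  have "(2 * w * k + 2 * i) div (2 * w) = k" "(2 * w * k + 2 * i + 1) div (2 * w) = k"
    using i by (auto intro!: div_nat_eqI simp: algebra_simps)
  moreover have "(2 * w * k + 2 * i) div 2 = w * k + i" "(2 * w * k + 2 * i + 1) div 2 = w * k + i" by auto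
  ultimately show "e (2 * w * k + 2 * i) = (s k (P (w * k + i)), \<not> b k)"
    "e (2 * w * k + 2 * i + 1) = (s k (P (w * k + i)), b k)"
    by (auto simp: strand_end_def)
qed

lemma label_cases:
  assumes "n < 2 * w * m"
  obtains k i where "k < m" "i < w" "n = 2 * w * k + 2 * i" | k i where "k < m" "i < w" "n = 2 * w * k + 2 * i + 1"
proof -
  define k r where "k = n div (2 * w)" and "r = n mod (2 * w)"
  have w: "0 < w" using assms by (cases w) auto
  have n: "n = 2 * w * k + r" by (simp add: k_def r_def)
  have "k < m" using assms w by (simp add: k_def less_mult_imp_div_less mult.commute)
  moreover have "r div 2 < w" using w by (simp add: r_def less_mult_imp_div_less mult.commute)
  moreover have "r = 2 * (r div 2) \<or> r = 2 * (r div 2) + 1" by presburger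
  ultimately show ?thesis using that n by (metis add.assoc)
qed

lemma inj_e: "inj_on e {..<2 * w * m}"
proof (rule inj_onI)
  have *: "k = k' \<and> i = i'" if "k < m" "i < w" "k' < m" "i' < w" "s k (P (w * k + i)) = s k' (P (w * k' + i'))"
    for k i k' i'
  proof -
    have "k = k' \<and> P (w * k + i) = P (w * k' + i')"
      using s_eq_iff[OF that(1,3) P_mem[OF that(1,2)] P_mem[OF that(3,4)]] that(5) by blast
    then have kk: "k = k'" "P (w * k + i) = P (w * k + i')" by auto
    have "\<not> i < i'" using P_less[OF that(1,2,4)] kk(2) by simp
    moreover have "\<not> i' < i" using P_less[OF that(1,4,2)] kk(2) by simp
    ultimately show ?thesis using kk(1) by simp
  qed
  fix n n' assume n: "n \<in> {..<2 * w * m}" "n' \<in> {..<2 * w * m}" "e n = e n'"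
  from n(1) have "n < 2 * w * m" by simp
  then show "n = n'"
  proof (rule label_cases)
    fix k i assume 1: "k < m" "i < w" "n = 2 * w * k + 2 * i"
    from n(2) have "n' < 2 * w * m" by simp
    then show ?thesis
    proof (rule label_cases)
      fix k' i' assume 2: "k' < m" "i' < w" "n' = 2 * w * k' + 2 * i'"
      have "s k (P (w * k + i)) = s k' (P (w * k' + i'))"
        using n(3) unfolding 1(3) 2(3) e_left[OF 1(1,2)] e_left[OF 2(1,2)] by simp
      then show ?thesis unfolding 1(3) 2(3) using *[OF 1(1,2) 2(1,2)] by simp
    next
      fix k' i' assume 2: "k' < m" "i' < w" "n' = 2 * w * k' + 2 * i' + 1"
      have "s k (P (w * k + i)) = s k' (P (w * k' + i'))" "b k = (\<not> b k')"
        using n(3) unfolding 1(3) 2(3) e_left[OF 1(1,2)] e_right[OF 2(1,2)] by auto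
      then show ?thesis using *[OF 1(1,2) 2(1,2)] by simp
    qed
  next
    fix k i assume 1: "k < m" "i < w" "n = 2 * w * k + 2 * i + 1"
    from n(2) have "n' < 2 * w * m" by simp
    then show ?thesis
    proof (rule label_cases)
      fix k' i' assume 2: "k' < m" "i' < w" "n' = 2 * w * k' + 2 * i'"
      have "s k (P (w * k + i)) = s k' (P (w * k' + i'))" "b k = (\<not> b k')"
        using n(3) unfolding 1(3) 2(3) e_right[OF 1(1,2)] e_left[OF 2(1,2)] by auto
      then show ?thesis using *[OF 1(1,2) 2(1,2)] by simp
    next
      fix k' i' assume 2: "k' < m" "i' < w" "n' = 2 * w * k' + 2 * i' + 1"
      have "s k (P (w * k + i)) = s k' (P (w * k' + i'))"
        using n(3) unfolding 1(3) 2(3) e_right[OF 1(1,2)] e_right[OF 2(1,2)] by simp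
      then show ?thesis unfolding 1(3) 2(3) using *[OF 1(1,2) 2(1,2)] by simp
    qed
  qed
qed

lemma label_less: "k < m \<Longrightarrow> i < w \<Longrightarrow> 2 * w * k + 2 * i + 1 < 2 * w * m"
proof -
  assume "k < m" "i < w"
  then have "2 * w * k + 2 * i + 1 < 2 * w * Suc k" by simp
  also have "\<dots> \<le> 2 * w * m" using \<open>k < m\<close> by (intro mult_le_mono2) simp
  finally show ?thesis .
qed

lemma e_image: "e ` {..<2 * w * m} = marks \<times> UNIV"
proof
  show "e ` {..<2 * w * m} \<subseteq> marks \<times> UNIV"
  proof
    fix x assume "x \<in> e ` {..<2 * w * m}"
    then obtain n where n: "n < 2 * w * m" "x = e n" by auto
    from n(1) show "x \<in> marks \<times> UNIV"
    proof (rule label_cases)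
      fix k i assume "k < m" "i < w" "n = 2 * w * k + 2 * i"
      then show ?thesis using n e_left by (auto simp: strand_marks_def)
    next
      fix k i assume *: "k < m" "i < w" "n = 2 * w * k + 2 * i + 1"
      then show ?thesis using n e_right[OF *(1,2)] by (auto simp: strand_marks_def)
    qed
  qed
  show "marks \<times> UNIV \<subseteq> e ` {..<2 * w * m}"
  proof
    fix x assume "x \<in> marks \<times> (UNIV :: bool set)"
    then obtain k i c where x: "x = (s k (P (w * k + i)), c)" "k < m" "i < w" by (auto simp: strand_marks_def)
    show "x \<in> e ` {..<2 * w * m}"
    proof (cases "c = b k")
      case True
      then show ?thesis using x e_right[OF x(2,3)] label_less[OF x(2,3)]
        by (intro image_eqI[of _ _ "2 * w * k + 2 * i + 1"]) auto
    next
      case False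
      then show ?thesis using x e_left[OF x(2,3)] label_less[OF x(2,3)]
        by (intro image_eqI[of _ _ "2 * w * k + 2 * i"]) auto
    qed
  qed
qed

lemma marks_strands: "marks \<subseteq> strand_points m s"
  using P_mem by (auto simp: strand_marks_def strand_points_def)

lemma strands_circles: "strand_points m s \<subseteq> circles nc"
  using oriented_segment.s_circles[OF os] by (auto simp: strand_points_def)

lemma finite_marks: "finite marks"
proof -
  have "marks = (\<lambda>(k, i). s k (P (w * k + i))) ` ({..<m} \<times> {..<w})" by (auto simp: strand_marks_def)
  then show ?thesis by simp
qed

lemma arc_e:
  assumes M: "marking nc M" "M \<inter> strand_points m s = marks" and k: "k < m" "Suc i < w"
  shows "arc_map M (e (2 * w * k + 2 * i + 1)) = e (2 * w * k + 2 * Suc i)"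
    "arc_map M (e (2 * w * k + 2 * Suc i)) = e (2 * w * k + 2 * i + 1)"
proof -
  interpret oriented_segment nc "s k" "b k" "\<tau> k" using os k by blast
  have i: "i < w" using k by simp
  have mk: "s k (P (w * k + l)) \<in> M" if "l < w" for l
    using that k M(2) by (auto simp: strand_marks_def)
  have none: "s k z \<notin> M" if z: "P (w * k + i) < z" "z < P (w * k + Suc i)" for z
  proof
    assume "s k z \<in> M"
    moreover have zz: "z \<in> {-1..1}" using z P_mem[OF k(1) i] P_mem[OF k] by auto
    moreover have "s k z \<in> strand_points m s" using k(1) zz by (rule strand_point)
    ultimately have "s k z \<in> marks" using M(2) by blast
    then obtain k' l where l: "s k z = s k' (P (w * k' + l))" "k' < m" "l < w" by (auto simp: strand_marks_def)
    then have "k' = k" "z = P (w * k + l)" using s_eq_iff[OF k(1) l(2) zz P_mem[OF l(2,3)]] by auto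
    then have "i < l" "l < Suc i" using P_less[OF k(1) i l(3)] P_less[OF k(1) l(3) k(2)] z by auto
    then show False by simp
  qed
  note arc = arc_along[OF M(1) P_mem[OF k(1) i] P_mem[OF k] P_step[OF k] mk[OF i] mk[OF k(2)] none]
  show "arc_map M (e (2 * w * k + 2 * i + 1)) = e (2 * w * k + 2 * Suc i)"
    "arc_map M (e (2 * w * k + 2 * Suc i)) = e (2 * w * k + 2 * i + 1)"
    unfolding e_right[OF k(1) i] e_left[OF k] using arc by auto
qed

end

subsection \<open>Changing a diagram inside the box\<close>

text \<open>
  What is common to all Reidemeister moves: the diagrams agree outside of \<open>m\<close> strands, and these strands stay in the box,
  which contains nothing else.
\<close>

locale local_move =
  fixes D D' :: "('a) flat_diagram_scheme" and m :: nat and s :: "nat \<Rightarrow> real \<Rightarrow> nat \<times> complex"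
  assumes flat_D: "is_flat_diagram D" and flat_D': "is_flat_diagram D'"
    and agree: "agree_off_strands D D' m s"
    and segs: "k < m \<Longrightarrow> is_segment (ncomp D) (s k)"
    and in_box: "k < m \<Longrightarrow> x \<in> {-1..1} \<Longrightarrow> pt D (s k x) \<in> box \<and> pt D' (s k x) \<in> box"
    and far_crossings: "crossings D' - box = crossings D - box"
begin

sublocale D: flat_diag D using flat_D by unfold_locales
sublocale D': flat_diag D' using flat_D' by unfold_locales

abbreviation "K \<equiv> strand_points m s"

lemma ncomp_eq: "ncomp D' = ncomp D"
  using agree by (simp add: agree_off_strands_def)

lemma circle_eq: "circle_points D' = circle_points D"
  by (simp add: circle_points_def ncomp_eq)

lemma K_circles: "K \<subseteq> circle_points D"
  using segs by (auto simp: strand_points_def is_segment_def circle_points_def)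

lemma closed_K: "closed K"
  unfolding strand_points_def
proof (intro closed_UN ballI)
  fix k assume "k \<in> {..<m}"
  then have "is_segment (ncomp D) (s k)" using segs by simp
  then show "closed (s k ` {-1..1})"
    by (intro compact_imp_closed compact_continuous_image) (auto simp: is_segment_def)
qed auto

lemma off: "p \<in> circle_points D - K \<Longrightarrow> pt D' p = pt D p \<and> pt D p \<notin> box"
  using agree by (auto simp: agree_off_strands_def)

lemma on: "p \<in> K \<Longrightarrow> pt D p \<in> box \<and> pt D' p \<in> box"
  using in_box by (auto simp: strand_points_def)

lemma sym: "local_move D' D m s"
proof
  show "agree_off_strands D' D m s" using agree circle_eq by (auto simp: agree_off_strands_def)
qed (use flat_D flat_D' segs in_box far_crossings ncomp_eq in auto)

lemma far_points: "crossing_points D' - K = crossing_points D - K"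
proof -
  have "pt D' p \<in> crossings D' \<longleftrightarrow> pt D p \<in> crossings D" if "p \<in> circle_points D - K" for p
  proof -
    have "pt D p \<in> crossings D' - box \<longleftrightarrow> pt D p \<in> crossings D - box" unfolding far_crossings by (rule refl)
    then show ?thesis using off[OF that] by simp
  qed
  then show ?thesis unfolding crossing_points_def circle_eq by blast
qed

text \<open>
  At a point outside of the strands nothing changes; in particular its partner also lies outside, since the strands stay in
  the box.
\<close>

lemma far:
  assumes p: "p \<in> crossing_points D - K"
  shows "pt D p \<in> crossings D - box" "pt D' p = pt D p" "partner D p \<in> crossing_points D - K"
    "partner D' p = partner D p" "eps D' p = eps D p"
proof -
  have out: "q \<in> circle_points D - K" if "q \<in> crossing_points D - K" for q
    using that by (auto simp: crossing_points_def)
  show 1: "pt D p \<in> crossings D - box" "pt D' p = pt D p"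
    using off[OF out[OF p]] p by (auto simp: crossing_points_def)
  have "partner D p \<notin> K"
    using on[of "partner D p"] D.partner(3)[of p] p 1 by auto
  then show 2: "partner D p \<in> crossing_points D - K"
    using D.partner(1)[of p] p by blast
  show 3: "partner D' p = partner D p"
    by (rule D'.partner_unique)
      (use 1 2 p D.partner[of p] off[OF out[OF 2]] circle_eq in \<open>auto simp: crossing_points_def\<close>)
  have "vel D' q = vel D q" if "q \<in> crossing_points D - K" for q
    by (rule vel_agree[OF closed_K out[OF that] ncomp_eq]) (use off in blast)
  then show "eps D' p = eps D p" using p 2 3 by (simp add: eps_def)
qed

lemma near_crossings: "crossings D \<inter> box = pt D ` (crossing_points D \<inter> K)"
proof
  show "crossings D \<inter> box \<subseteq> pt D ` (crossing_points D \<inter> K)"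
  proof
    fix z assume z: "z \<in> crossings D \<inter> box"
    then have "z \<in> double_points D" using flat_D by (auto simp: is_flat_diagram_def)
    then obtain p where p: "p \<in> circle_points D" "pt D p = z" by (auto simp: double_points_def fiber_def)
    then have "p \<in> K" using off[of p] z by blast
    then show "z \<in> pt D ` (crossing_points D \<inter> K)" using p z by (auto simp: crossing_points_def)
  qed
  show "pt D ` (crossing_points D \<inter> K) \<subseteq> crossings D \<inter> box"
    using on by (auto simp: crossing_points_def)
qed

lemma join_far:
  assumes "p \<in> crossing_points D - K" "T \<subseteq> box"
  shows "mark_join D (S \<union> T) (p, c) = mark_join D S (p, c)" "mark_join D' (S \<union> T) (p, c) = mark_join D S (p, c)"
proof -
  have "pt D p \<in> S \<union> T \<longleftrightarrow> pt D p \<in> S" using far(1)[OF assms(1)] assms(2) by blast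
  moreover have "p \<in> crossing_points D'" using far_points assms by blast
  ultimately show "mark_join D (S \<union> T) (p, c) = mark_join D S (p, c)" "mark_join D' (S \<union> T) (p, c) = mark_join D S (p, c)"
    using far[OF assms(1)] assms(1) by (simp_all add: mark_join_def)
qed

text \<open>
  A graph does not meet itself, so its crossing points lie over crossings with other strands, over the same first coordinate.
\<close>

lemma near_point:
  assumes graph: "\<And>k x. k < m \<Longrightarrow> x \<in> {-1..1} \<Longrightarrow> pt D (s k x) = Complex x (F k x)"
    and p: "p \<in> crossing_points D \<inter> K"
  obtains k l x where "k < m" "l < m" "k \<noteq> l" "x \<in> {-1..1}" "p = s k x" "F k x = F l x"
    "partner D p = s l x"
proof -
  have q: "partner D p \<in> crossing_points D" "pt D (partner D p) = pt D p" "partner D p \<noteq> p"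
    using D.partner p by auto
  have "partner D p \<in> K"
  proof (rule ccontr)
    assume "partner D p \<notin> K"
    then show False using far(1)[of "partner D p"] q on[of p] p by auto
  qed
  then obtain l y where l: "l < m" "y \<in> {-1..1}" "partner D p = s l y" by (rule strand_pointE)
  obtain k x where k: "k < m" "x \<in> {-1..1}" "p = s k x" using p by (auto elim: strand_pointE)
  have "pt D (s l y) = pt D (s k x)" 
    using q(2) by (simp only: l(3)[symmetric] k(3)[symmetric])
  then have "y = x \<and> F l y = F k x" unfolding graph[OF k(1,2)] graph[OF l(1,2)] complex.inject .
  then have "y = x" "F k x = F l x" by metis+
  moreover have "k \<noteq> l"
  proof
    assume "k = l"
    then have "partner D p = p" using l(3) \<open>y = x\<close> k(3) by metis
    then show False using q(3) by simp
  qed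
  ultimately show ?thesis using that[OF k(1) l(1) _ k(2,3)] l(3) by simp
qed

end

text \<open>
  All crossing points on the strands are among the marks. The remaining marks serve to give both sides of a move the same
  outer ends.
\<close>

locale tangle = local_move D D' m s + marked_strands "ncomp D" m s b \<tau> w P
  for D D' :: "('a) flat_diagram_scheme" and m s b \<tau> w P +
  assumes near: "crossing_points D \<inter> strand_points m s \<subseteq> strand_marks m w s P"
begin

abbreviation "N \<equiv> 2 * w * m"

definition all_marks :: "(nat \<times> complex) set" where
  "all_marks = (crossing_points D - K) \<union> marks"

lemma all_marks_marking: "marking (ncomp D) all_marks"
proof
  show "finite all_marks" unfolding all_marks_def using D.finite_CP finite_marks by blast
  show "all_marks \<subseteq> circles (ncomp D)"
    unfolding all_marks_def using D.CP_circles marks_strands strands_circles by blast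
qed

lemma CP_all_marks: "crossing_points D \<subseteq> all_marks"
  unfolding all_marks_def using near by blast

lemma all_marks_strands: "all_marks \<inter> K = marks"
  unfolding all_marks_def using marks_strands by blast

lemma labelled: "e ` {..<N} = (all_marks \<inter> K) \<times> UNIV"
  unfolding all_marks_strands by (rule e_image)

lemma arc_labels:
  assumes "k < m" "Suc i < w"
  shows "arc_map all_marks (e (2 * w * k + 2 * i + 1)) = e (2 * w * k + 2 * Suc i)"
    "arc_map all_marks (e (2 * w * k + 2 * Suc i)) = e (2 * w * k + 2 * i + 1)"
  using arc_e[OF all_marks_marking all_marks_strands assms] by auto

text \<open>
  The values \<open>\<theta> n\<close> at the numbered ends are prescribed; elsewhere the constants of the potential are 0.
\<close>

definition pot :: "(nat \<Rightarrow> int) \<Rightarrow> end_pt \<Rightarrow> int" where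
  "pot \<theta> x = (if x \<in> e ` {..<N} then \<theta> (inv_into {..<N} e x) else sgnb (snd x) * eps D (fst x))"

lemma pot_label: "n < N \<Longrightarrow> pot \<theta> (e n) = \<theta> n"
  using inv_into_f_f[OF inj_e] by (simp add: pot_def)

lemma pot_far: "fst x \<notin> K \<Longrightarrow> pot \<theta> x = sgnb (snd x) * eps D (fst x)"
  using labelled by (cases x) (auto simp: pot_def)

definition balanced :: "(end_pt \<Rightarrow> int) \<Rightarrow> nat \<times> complex \<Rightarrow> bool" where
  "balanced \<Theta> p \<longleftrightarrow> (\<exists>c. \<forall>b. \<Theta> (p, b) = sgnb b * eps D p + c \<and> \<Theta> (partner D p, b) = - (sgnb b * eps D p) + c)"

lemma pot_potential:
  assumes "\<And>p. p \<in> crossing_points D \<inter> K \<Longrightarrow> balanced (pot \<theta>) p"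
    and "\<And>p. p \<in> marks - crossing_points D \<Longrightarrow> pot \<theta> (p, True) = pot \<theta> (p, False)"
  shows "potential D all_marks (pot \<theta>)"
  unfolding potential_def
proof (intro conjI ballI)
  fix p assume p: "p \<in> crossing_points D"
  show "\<exists>c. \<forall>b. pot \<theta> (p, b) = sgnb b * eps D p + c \<and> pot \<theta> (partner D p, b) = - (sgnb b * eps D p) + c"
  proof (cases "p \<in> K")
    case True
    then show ?thesis using assms(1) p by (simp add: balanced_def)
  next
    case False
    then show ?thesis using far(3)[of p] p D.eps_partner[OF p] by (auto simp: pot_far)
  qed
next
  fix p assume "p \<in> all_marks - crossing_points D"
  then show "pot \<theta> (p, True) = pot \<theta> (p, False)" using assms(2) unfolding all_marks_def by blast
qed

text \<open>
  The condition for a potential at a crossing of two strands, in terms of the numbers of the four ends and independent of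
  the directions: \<open>p\<close> lies on a strand that crosses the strand of \<open>q\<close> from below to above.
\<close>

lemma crossing_balanced:
  assumes eq: "partner D p = q" "partner D q = p" "eps D p = - (sgnb bk * sgnb bl)" "eps D q = sgnb bk * sgnb bl"
    and e: "e kL = (p, \<not> bk)" "e kR = (p, bk)" "e lL = (q, \<not> bl)" "e lR = (q, bl)"
    and less: "kL < N" "kR < N" "lL < N" "lR < N"
    and \<theta>: "\<theta> kL = sgnb bl + c" "\<theta> kR = - sgnb bl + c" "\<theta> lL = - sgnb bk + c" "\<theta> lR = sgnb bk + c"
  shows "balanced (pot \<theta>) p" "balanced (pot \<theta>) q"
proof -
  have v: "pot \<theta> (p, \<not> bk) = sgnb bl + c" "pot \<theta> (p, bk) = - sgnb bl + c"
    "pot \<theta> (q, \<not> bl) = - sgnb bk + c" "pot \<theta> (q, bl) = sgnb bk + c"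
    using pot_label[of _ \<theta>] e less \<theta> by metis+
  have p: "pot \<theta> (p, b) = sgnb b * eps D p + c" for b
    using v(1,2) eq(3) by (cases b; cases bk; cases bl) auto
  have q: "pot \<theta> (q, b) = sgnb b * eps D q + c" for b
    using v(3,4) eq(4) by (cases b; cases bk; cases bl) auto
  show "balanced (pot \<theta>) p" "balanced (pot \<theta>) q"
    unfolding balanced_def eq(1,2) using p q eq(3,4) by (auto intro!: exI[of _ c])
qed

text \<open>
  For parallel strands the oriented smoothing joins left ends to right ends, and for antiparallel strands the disoriented
  one does.
\<close>

lemma crossing_joins:
  assumes p: "p \<in> crossing_points D" and eq: "partner D p = q"
    and e: "e kL = (p, \<not> bk)" "e kR = (p, bk)" "e lL = (q, \<not> bl)" "e lR = (q, bl)"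
  shows "joins_pairs (mark_join D S) e (smooth ((pt D p \<in> S) = (bk \<noteq> bl)) kL kR lL lR)"
proof -
  have q: "q \<in> crossing_points D" "partner D q = p" "pt D q = pt D p" using D.partner[OF p] eq by auto
  show ?thesis
    using p q eq by (cases "pt D p \<in> S"; cases bk; cases bl) (simp_all add: smooth_def e D.mark_join_eq)
qed

text \<open>
  The contribution of a state is unchanged, up to a factor for a closed loop, if the box is replaced by the matching of its
  outer ends. The potential is required to be constant along the inner arcs.
\<close>

lemma state_contraction:
  assumes joins: "joins_pairs (mark_join D (S \<union> T)) e ps" "{..<N} \<subseteq> labels ps" and T: "T \<subseteq> box"
    and arcs: "joins_pairs (arc_map all_marks) e as" "\<forall>(x, y)\<in>set as. \<theta> x = \<theta> y" "labels as \<subseteq> {..<N}"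
    and chk: "contracts_to N as ps r cyc"
  shows "loops_eval \<kappa> (all_marks \<times> UNIV) (arc_map all_marks) (mark_join D (S \<union> T)) (pot \<theta>) =
      \<kappa> 0 ^ (if cyc = [] then 0 else 1) *
      loops_eval \<kappa> (all_marks \<times> UNIV - inner_ends e N as) (arc_map all_marks) (rewire e N r (mark_join D S)) (pot \<theta>)"
    "loop_system (all_marks \<times> UNIV - inner_ends e N as) (arc_map all_marks) (rewire e N r (mark_join D S))"
proof -
  let ?J = "mark_join D (S \<union> T)" and ?R = "rewire e N ps (mark_join D S)"
  have eq: "?R x = ?J x" if x: "x \<in> all_marks \<times> UNIV" for x
  proof (cases "x \<in> e ` {..<N}")
    case True
    then obtain n where n: "n < N" "x = e n" by auto
    then show ?thesis using joins_pairs_wire[OF joins(1), of n] joins(2) rewire_label[OF inj_e, of n] by auto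
  next
    case False
    then have "fst x \<notin> K" using labelled x by (cases x) auto
    then have "fst x \<in> crossing_points D - K" using x marks_strands by (auto simp: all_marks_def)
    then have "?J x = mark_join D S x" using join_far(1)[of "fst x" T S "snd x"] T by simp
    then show ?thesis using False by (simp add: rewire_other)
  qed
  have sys: "loop_system (all_marks \<times> UNIV) (arc_map all_marks) ?J"
    by (rule D.state_system[OF all_marks_marking CP_all_marks])
  have sysR: "loop_system (all_marks \<times> UNIV) (arc_map all_marks) ?R"
    by (rule loop_system_cong[OF sys]) (use eq in auto)
  have ev: "loops_eval \<kappa> (all_marks \<times> UNIV) (arc_map all_marks) ?J (pot \<theta>) =
    loops_eval \<kappa> (all_marks \<times> UNIV) (arc_map all_marks) ?R (pot \<theta>)"
    by (rule loops_eval_cong[OF sys, symmetric]) (use eq in auto)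
  have sub: "e ` {..<N} \<subseteq> all_marks \<times> UNIV" using labelled by auto
  have ar: "arc_map all_marks (e n) = e (wire as n) \<and> pot \<theta> (e (wire as n)) = pot \<theta> (e n)"
    if n: "n < N" "wire as n \<noteq> n" for n
  proof -
    have l: "n \<in> labels as" using wire_other[of n as] n by blast
    note pr = wire_pair[OF l]
    then have "wire as n \<in> labels as" by (force simp: labels_def)
    then have "wire as n < N" using arcs(3) by auto
    moreover have "\<theta> (wire as n) = \<theta> n" using pr arcs(2) by fastforce
    ultimately show ?thesis using joins_pairs_wire[OF arcs(1) l] n by (simp add: pot_label)
  qed
  show "loops_eval \<kappa> (all_marks \<times> UNIV) (arc_map all_marks) ?J (pot \<theta>) =
      \<kappa> 0 ^ (if cyc = [] then 0 else 1) *
      loops_eval \<kappa> (all_marks \<times> UNIV - inner_ends e N as) (arc_map all_marks) (rewire e N r (mark_join D S)) (pot \<theta>)"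
    unfolding ev by (rule tangle_eval(1)[OF sysR inj_e sub ar chk])
  show "loop_system (all_marks \<times> UNIV - inner_ends e N as) (arc_map all_marks) (rewire e N r (mark_join D S))"
    by (rule tangle_eval(2)[OF sysR inj_e sub ar chk])
qed

end

section \<open>Invariance of the state sum under the Reidemeister moves\<close>

text \<open>Numbers of ends are numerals, and the rewriting of 1 to \<open>Suc 0\<close> would hide them.\<close>

declare One_nat_def [simp del]

subsection \<open>Comparing the two sides of a move\<close>

lemma succ_subset:
  assumes "marking n M" "N \<subseteq> M" "p \<in> M" "succ M p \<in> N"
  shows "succ N p = succ M p"
proof -
  interpret marking n M by fact
  obtain t where t: "0 < t" "travel p t \<in> M" "\<And>s. 0 < s \<Longrightarrow> s < t \<Longrightarrow> travel p s \<notin> M"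
    "succ M p = travel p t" by (rule succ_obtain[OF assms(3)]) blast
  have "succ N p = travel p t"
    by (rule succ_eqI) (use t assms in auto)
  then show ?thesis using t by simp
qed

text \<open>
  Marks that do not separate the ends in \<open>B\<close> from their partners can be removed. This shows that the arcs outside of the
  box are the same before and after the third move, where the inner marks differ.
\<close>

lemma arc_subset:
  assumes M: "marking n M" "N \<subseteq> M" and B: "B \<subseteq> N \<times> UNIV" "\<And>x. x \<in> B \<Longrightarrow> arc_map M x \<in> B" and x: "x \<in> B"
  shows "arc_map N x = arc_map M x"
proof -
  interpret M: marking n M by fact
  interpret N: marking n N using M M.fin_M M.M_sub by unfold_locales (auto intro: finite_subset)
  have out: "arc_map N (p, True) = arc_map M (p, True)" if "(p, True) \<in> B" for p
  proof -
    have "(succ M p, False) \<in> B" using B(2)[OF that] by simp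
    then have "succ M p \<in> N" "p \<in> M" using B(1) that M(2) by auto
    then show ?thesis using succ_subset[OF M] by simp
  qed
  obtain p c where pc: "x = (p, c)" by (cases x)
  show ?thesis
  proof (cases c)
    case True
    then show ?thesis using out pc x by simp
  next
    case False
    obtain q where q: "arc_map M x = (q, True)" using pc False by simp
    have B': "(q, True) \<in> B" using B(2)[OF x] q by simp
    have xM: "x \<in> M \<times> UNIV" using x B(1) M(2) by auto
    have "arc_map N (q, True) = x" using out[OF B'] M.arc_arc[OF xM] q by simp
    then show ?thesis using N.arc_arc[of "(q, True)"] B' B(1) q by auto
  qed
qed

locale tangle_pair = tangle D D' m s b \<tau> w P + after: tangle D' D m s b \<tau> w P'
  for D D' :: "('a) flat_diagram_scheme" and m s b \<tau> w P P'
begin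

lemma outer_set:
  "all_marks \<times> UNIV - inner_ends e N as = (crossing_points D - K) \<times> UNIV \<union> e ` {n. n < N \<and> wire as n = n}"
proof -
  have lab: "e ` {..<N} = marks \<times> UNIV" using labelled all_marks_strands by simp
  have far: "x \<notin> e ` {..<N}" if "x \<in> (crossing_points D - K) \<times> UNIV" for x
    unfolding lab using that marks_strands by auto
  have "all_marks \<times> UNIV = (crossing_points D - K) \<times> UNIV \<union> e ` {..<N}"
    unfolding lab all_marks_def by auto
  moreover have "inner_ends e N as = e ` {n. n < N \<and> wire as n \<noteq> n}" by (simp add: inner_ends_def)
  moreover have "e ` {..<N} - e ` {n. n < N \<and> wire as n \<noteq> n} = e ` {n. n < N \<and> wire as n = n}"
  proof -
    have "e ` ({..<N} - {n. n < N \<and> wire as n \<noteq> n}) = e ` {..<N} - e ` {n. n < N \<and> wire as n \<noteq> n}"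
      by (rule inj_on_image_set_diff[OF inj_e]) auto
    moreover have "{..<N} - {n. n < N \<and> wire as n \<noteq> n} = {n. n < N \<and> wire as n = n}" by auto
    ultimately show ?thesis by simp
  qed
  moreover have "e ` {n. n < N \<and> wire as n \<noteq> n} \<subseteq> e ` {..<N}" by auto
  ultimately show ?thesis using far by blast
qed

text \<open>
  Once the box has been replaced by a matching, both sides of a move are given by the same data: the ends outside of the
  strands and the outer ends of the tangle.
\<close>

lemma compare:
  assumes outer: "\<And>n. n < N \<Longrightarrow> wire as n = n \<Longrightarrow> e n = after.e n \<and> \<theta> n = \<theta>' n \<and> wire r n < N \<and> wire as (wire r n) = wire r n"
    and arcs: "\<And>x. x \<in> all_marks \<times> UNIV - inner_ends e N as \<Longrightarrow> arc_map after.all_marks x = arc_map all_marks x"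
    and sys: "loop_system (all_marks \<times> UNIV - inner_ends e N as) (arc_map all_marks) (rewire e N r (mark_join D S))"
  shows "loops_eval \<kappa> (after.all_marks \<times> UNIV - inner_ends after.e N as) (arc_map after.all_marks)
      (rewire after.e N r (mark_join D' S)) (after.pot \<theta>') =
    loops_eval \<kappa> (all_marks \<times> UNIV - inner_ends e N as) (arc_map all_marks) (rewire e N r (mark_join D S)) (pot \<theta>)"
proof -
  interpret pair': tangle_pair D' D m s b \<tau> w P' P ..
  let ?O = "all_marks \<times> UNIV - inner_ends e N as"
  have im: "after.e ` {n. n < N \<and> wire as n = n} = e ` {n. n < N \<and> wire as n = n}"
    using outer by (auto intro!: image_cong)
  have O: "after.all_marks \<times> UNIV - inner_ends after.e N as = ?O"
    unfolding outer_set pair'.outer_set im far_points by (rule refl)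
  show ?thesis unfolding O
  proof (rule loops_eval_cong[OF sys])
    fix x assume x: "x \<in> ?O"
    show "arc_map after.all_marks x = arc_map all_marks x" using arcs x by blast
    from x consider (cross) "x \<in> (crossing_points D - K) \<times> UNIV" | (lab) n where "n < N" "wire as n = n" "x = e n"
      unfolding outer_set by blast
    then have "rewire after.e N r (mark_join D' S) x = rewire e N r (mark_join D S) x \<and> after.pot \<theta>' x = pot \<theta> x"
    proof cases
      case cross
      then obtain p c where p: "x = (p, c)" "p \<in> crossing_points D - K" by auto
      have "x \<notin> e ` {..<N}" "x \<notin> after.e ` {..<N}" using labelled after.labelled p by auto
      then show ?thesis
        using p join_far(2)[OF p(2), of "{}" S c] far(5)[OF p(2)]
        by (simp add: rewire_other pot_far after.pot_far)
    next
      case lab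
      note o = outer[OF lab(1,2)]
      have "e (wire r n) = after.e (wire r n)" using outer[of "wire r n"] o by simp
      then show ?thesis
        using o lab rewire_label[OF inj_e lab(1), of r "mark_join D S"]
          rewire_label[OF after.inj_e lab(1), of r "mark_join D' S"]
          pot_label[OF lab(1), of \<theta>] after.pot_label[OF lab(1), of \<theta>'] by simp
    qed
    then show "rewire after.e N r (mark_join D' S) x = rewire e N r (mark_join D S) x" "after.pot \<theta>' x = pot \<theta> x"
      by auto
  qed
qed

lemma all_marks_eq: "P = P' \<Longrightarrow> after.all_marks = all_marks"
  unfolding all_marks_def after.all_marks_def far_points by simp

end

lemma sum_Pow_insert:
  assumes "finite N" "z \<notin> N"
  shows "(\<Sum>T\<in>Pow (insert z N). f T) = (\<Sum>T\<in>Pow N. f T + f (insert z T))"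
proof -
  have "(\<Sum>T\<in>Pow (insert z N). f T) = sum f (Pow N) + sum f (insert z ` Pow N)"
    unfolding Pow_insert by (rule sum.union_disjoint) (use assms in auto)
  also have "sum f (insert z ` Pow N) = (\<Sum>T\<in>Pow N. f (insert z T))"
    using assms by (intro sum.reindex[unfolded o_def]) (auto simp: inj_on_def)
  finally show ?thesis by (simp add: sum.distrib)
qed

lemma positive_until_zero:
  fixes f :: "real \<Rightarrow> real"
  assumes "continuous_on {-1..1} f" "a \<in> {-1..1}" "y \<in> {-1..1}" "0 < f a"
    and nz: "\<And>x. min a y \<le> x \<Longrightarrow> x \<le> max a y \<Longrightarrow> f x \<noteq> 0"
  shows "0 < f y"
proof (rule ccontr)
  assume "\<not> 0 < f y"
  then have fy: "f y \<le> 0" by simp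
  show False
  proof (cases "a \<le> y")
    case True
    have "continuous_on {a..y} f" by (rule continuous_on_subset[OF assms(1)]) (use assms in auto)
    then obtain x where "a \<le> x" "x \<le> y" "f x = 0" using IVT2'[of f y 0 a] fy assms(4) True by auto
    then show False using nz[of x] True by auto
  next
    case False
    have "continuous_on {y..a} f" by (rule continuous_on_subset[OF assms(1)]) (use assms in auto)
    then obtain x where "y \<le> x" "x \<le> a" "f x = 0" using IVT'[of f y 0 a] fy assms(4) False by auto
    then show False using nz[of x] False by auto
  qed
qed

lemma graph_in_box: "x \<in> {-1..1} \<Longrightarrow> \<bar>y\<bar> < 1 \<Longrightarrow> Complex x y \<in> box"
  by (auto simp: box_def)

lemma graph_strandsD:
  assumes "graph_strands D m s F" "k < m"
  shows "is_segment (ncomp D) (s k)" "F k differentiable_on {-1..1}"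
    "\<And>x. x \<in> {-1..1} \<Longrightarrow> \<bar>F k x\<bar> < 1 \<and> pt D (s k x) = Complex x (F k x)"
    "inj_on (\<lambda>(k, x). s k x) ({..<m} \<times> {-1..1})"
  using assms by (auto simp: graph_strands_def)

text \<open>
  The agreement of the graphs at the end points determines which of two graphs is above after the move.
\<close>

lemma graph_move:
  assumes D: "is_flat_diagram D" "is_flat_diagram D'" and agree: "agree_off_strands D D' m s"
    and g: "graph_strands D m s F" "graph_strands D' m s F'" and far: "crossings D' - box = crossings D - box"
  shows "local_move D D' m s" "k < m \<Longrightarrow> F' k (-1) = F k (-1)" "k < m \<Longrightarrow> F' k 1 = F k 1"
proof -
  note g1 = graph_strandsD[OF g(1)] and g2 = graph_strandsD[OF g(2)]
  show "local_move D D' m s"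
  proof
    show "pt D (s k x) \<in> box \<and> pt D' (s k x) \<in> box" if "k < m" "x \<in> {-1..1}" for k x
      using g1(3)[OF that] g2(3)[OF that] graph_in_box[OF that(2)] by simp
  qed (use D agree g1(1) far in auto)
  have "F' k e = F k e" if k: "k < m" and e: "e \<in> {-1, 1}" for k e
  proof -
    have "e \<in> {-1..1}" using e by auto
    moreover have "pt D' (s k e) = pt D (s k e)"
      using strand_ends_agree[OF D agree g1(1) g1(4)[OF k] k e] by blast
    ultimately show ?thesis using g1(3)[OF k] g2(3)[OF k] by simp
  qed
  then show "k < m \<Longrightarrow> F' k (-1) = F k (-1)" "k < m \<Longrightarrow> F' k 1 = F k 1" by auto
qed

subsection \<open>The first move\<close>

text \<open>
  The two points over the new crossing serve as marks on both sides of the move; before the move they carry straight joins.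
\<close>

lemma R1_data:
  assumes D: "is_flat_diagram D" "is_flat_diagram D'" and move: "flat_R1 D D' s u v"
  defines "P \<equiv> \<lambda>n. [u, v] ! n"
  obtains b \<tau> where "tangle_pair D D' 1 s b \<tau> 2 P P" "crossing_points D \<inter> strand_points 1 s = {}"
    "partner D' (s 0 u) = s 0 v" "s 0 u \<in> crossing_points D'" "s 0 v \<in> crossing_points D'"
    "crossing_points D' \<inter> strand_points 1 s \<subseteq> {s 0 u, s 0 v}"
    "pt D' (s 0 u) \<in> box" "crossings D' = insert (pt D' (s 0 u)) (crossings D)" "crossings D \<inter> box = {}"
proof -
  obtain F where g: "graph_strands D 1 s F" and agree: "agree_off_strands D D' 1 s"
    and int: "\<And>x. x \<in> {-1<..<1} \<Longrightarrow> pt D' (s 0 x) \<in> interior box"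
    and co: "{(x, y). -1 \<le> x \<and> x < y \<and> y \<le> 1 \<and> pt D' (s 0 x) = pt D' (s 0 y)} = {(u, v)}"
    and cr: "crossings D' = insert (pt D' (s 0 u)) (crossings D)"
    using move unfolding flat_R1_def by blast
  have "(u, v) \<in> {(x, y). -1 \<le> x \<and> x < y \<and> y \<le> 1 \<and> pt D' (s 0 x) = pt D' (s 0 y)}" unfolding co by simp
  then have uv: "-1 \<le> u" "u < v" "v \<le> 1" "pt D' (s 0 u) = pt D' (s 0 v)" by auto
  have co': "x = u \<and> y = v" if "-1 \<le> x" "x < y" "y \<le> 1" "pt D' (s 0 x) = pt D' (s 0 y)" for x y
  proof -
    have "(x, y) \<in> {(x, y). -1 \<le> x \<and> x < y \<and> y \<le> 1 \<and> pt D' (s 0 x) = pt D' (s 0 y)}" using that by simp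
    then show ?thesis unfolding co by simp
  qed
  note g' = graph_strandsD[OF g, of 0, simplified]
  have boxD: "pt D (s 0 x) \<in> box" if "x \<in> {-1..1}" for x
    using g'(3)[of x] that graph_in_box[of x "F 0 x"] by auto
  have boxD': "pt D' (s 0 x) \<in> box" if x: "x \<in> {-1..1}" for x
  proof (cases "x \<in> {-1<..<1}")
    case True
    then show ?thesis using int interior_subset by blast
  next
    case False
    then have "x \<in> {-1, 1}" using x by auto
    then have "pt D' (s 0 x) = pt D (s 0 x)"
      using strand_ends_agree[OF D agree _ _ _ , of 0 x] g'(1) graph_strandsD(4)[OF g, of 0] by simp
    then show ?thesis using boxD x by simp
  qed
  have z: "pt D' (s 0 u) \<in> box" using boxD' uv by simp
  interpret L: local_move D D' 1 s
    by unfold_locales (use D agree g'(1) boxD boxD' cr z in auto)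
  have near: "crossing_points D \<inter> L.K = {}"
  proof (rule ccontr)
    assume "crossing_points D \<inter> L.K \<noteq> {}"
    then obtain p where "p \<in> crossing_points D \<inter> L.K" by blast
    from L.near_point[OF _ this, of F] g'(3) show False by auto
  qed
  interpret L': local_move D' D 1 s by (rule L.sym)
  have su: "s 0 u \<in> L.K" "s 0 v \<in> L.K" using uv by (auto intro: strand_point)
  have ne: "s 0 u \<noteq> s 0 v" using inj_onD[OF graph_strandsD(4)[OF g, of 0], of "(0, u)" "(0, v)"] uv by auto
  have cp: "s 0 u \<in> circle_points D'" "s 0 v \<in> circle_points D'" using su L.K_circles L.circle_eq by auto
  have CP: "s 0 u \<in> crossing_points D'" "s 0 v \<in> crossing_points D'" using cp cr uv by (auto simp: crossing_points_def)
  have pa: "partner D' (s 0 u) = s 0 v"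
    by (rule L.D'.partner_unique) (use cp ne uv in auto)
  have near': "crossing_points D' \<inter> L.K \<subseteq> {s 0 u, s 0 v}"
  proof
    fix p assume p: "p \<in> crossing_points D' \<inter> L.K"
    then obtain x where x: "x \<in> {-1..1}" "p = s 0 x" by (auto elim: strand_pointE)
    have q: "partner D' p \<in> crossing_points D'" "partner D' p \<noteq> p" "pt D' (partner D' p) = pt D' p"
      using L.D'.partner[of p] p by auto
    have "partner D' p \<in> L.K"
    proof (rule ccontr)
      assume "partner D' p \<notin> L.K"
      then have "pt D' (partner D' p) \<notin> box" using q L'.far(1)[of "partner D' p"] by blast
      then show False using L.on[of p] p q by simp
    qed
    then obtain y where y: "y \<in> {-1..1}" "partner D' p = s 0 y" by (auto elim: strand_pointE)
    have "x < y \<or> y < x" using q x y by (metis linorder_neqE)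
    then show "p \<in> {s 0 u, s 0 v}" using co'[of x y] co'[of y x] x y q by auto
  qed
  obtain b \<tau> where b: "\<And>k. k < 1 \<Longrightarrow> oriented_segment (ncomp D) (s k) (b k) (\<tau> k)"
    using orient_strands[of 1 "ncomp D" s] g'(1) by auto
  have marks: "strand_marks 1 2 s P = {s 0 u, s 0 v}"
    by (auto simp: strand_marks_def P_def less_Suc_eq numeral_2_eq_2 intro: exI[of _ 0] exI[of _ 1])
  have P: "P (2 * k + i) \<in> {-1..1}" "Suc i < 2 \<Longrightarrow> P (2 * k + i) < P (2 * k + Suc i)" if "k < 1" "i < 2" for k i
    using that uv by (auto simp: P_def less_2_cases_iff)
  have "tangle_pair D D' 1 s b \<tau> 2 P P"
  proof (intro tangle_pair.intro tangle.intro)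
    show ms: "marked_strands (ncomp D) 1 s b \<tau> 2 P"
      by (rule marked_strands.intro) (use b graph_strandsD(4)[OF g, of 0] P in auto)
    show "marked_strands (ncomp D') 1 s b \<tau> 2 P" using ms L.ncomp_eq by simp
    show "local_move D D' 1 s" "local_move D' D 1 s" by (rule L.local_move_axioms L.sym)+
    show "tangle_axioms D 1 s 2 P" "tangle_axioms D' 1 s 2 P"
      using near near' by (auto simp: tangle_axioms_def marks)
  qed
  then show ?thesis
    by (rule that) (use near pa CP near' z cr L.near_crossings in auto)
qed

text \<open>
  In the state with left ends joined to right ends, a closed loop splits off, and the other state is a straight strand. For
  every direction of the strand the former is the oriented smoothing, so the factor is \<open>\<alpha> z * d + \<beta> z\<close>.
\<close>

lemma bracket_R1:
  fixes d :: "'r::comm_ring_1"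
  assumes D: "is_flat_diagram D" "is_flat_diagram D'" and move: "flat_R1 D D' s u v" and K0: "K 0 = 1"
  defines "z \<equiv> pt D' (s 0 u)"
  shows "d * bracket \<alpha> \<beta> d K D' = (\<alpha> z * d + \<beta> z) * (d * bracket \<alpha> \<beta> d K D)"
proof -
  define P where "P = (\<lambda>n. [u, v] ! n)"
  obtain b \<tau> where tp: "tangle_pair D D' 1 s b \<tau> 2 P P" and near: "crossing_points D \<inter> strand_points 1 s = {}"
    and pa: "partner D' (s 0 u) = s 0 v" and CP: "s 0 u \<in> crossing_points D'" "s 0 v \<in> crossing_points D'"
    and near': "crossing_points D' \<inter> strand_points 1 s \<subseteq> {s 0 u, s 0 v}"
    and z: "z \<in> box" "crossings D' = insert z (crossings D)" "crossings D \<inter> box = {}"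
    using R1_data[OF D move] unfolding P_def z_def by blast
  interpret T: tangle_pair D D' 1 s b \<tau> 2 P P by (rule tp)
  let ?\<kappa> = "\<lambda>h. d * K (nat h div 4)"
  define \<epsilon> where "\<epsilon> = eps D' (s 0 u)"
  \<comment> \<open>Before the move the strand has no cusps and the potential is constant on it. After the move it jumps at the crossing and is constant along the inner arc.\<close>
  define \<theta> where "\<theta> = (\<lambda>n. [- sgnb (b 0) * \<epsilon>, - sgnb (b 0) * \<epsilon>, - sgnb (b 0) * \<epsilon>, - sgnb (b 0) * \<epsilon>] ! n)"
  define \<theta>' where "\<theta>' = (\<lambda>n. [- sgnb (b 0) * \<epsilon>, sgnb (b 0) * \<epsilon>, sgnb (b 0) * \<epsilon>, - sgnb (b 0) * \<epsilon>] ! n)"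
  have e: "T.e 0 = (s 0 u, \<not> b 0)" "T.e 1 = (s 0 u, b 0)" "T.e 2 = (s 0 v, \<not> b 0)" "T.e 3 = (s 0 v, b 0)"
    by (simp_all add: strand_end_def P_def)
  have N: "T.N = 4" by simp
  have less4: "n < 4 \<longleftrightarrow> n = 0 \<or> n = 1 \<or> n = 2 \<or> n = 3" for n :: nat by auto
  have am: "T.after.all_marks = T.all_marks" by (rule T.all_marks_eq) simp
  have arcs: "joins_pairs (arc_map T.all_marks) T.e [(1, 2)]"
    using T.arc_labels[of 0 0] by (simp add: One_nat_def[symmetric])
  have sv: "eps D' (s 0 v) = - \<epsilon>" "partner D' (s 0 v) = s 0 u"
    using T.D'.eps_partner[OF CP(1)] T.D'.partner(4)[OF CP(1)] by (simp_all add: pa \<epsilon>_def)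
  have ptv: "pt D' (s 0 v) = z" using T.D'.partner(3)[OF CP(1)] by (simp add: pa z_def)
  have pot: "potential D T.all_marks (T.pot \<theta>)"
  proof (rule T.pot_potential)
    fix p assume "p \<in> T.marks - crossing_points D"
    then have "p = s 0 u \<or> p = s 0 v" by (auto simp: strand_marks_def P_def less_2_cases_iff)
    moreover have "T.pot \<theta> (s 0 u, b 0) = T.pot \<theta> (s 0 u, \<not> b 0)" "T.pot \<theta> (s 0 v, b 0) = T.pot \<theta> (s 0 v, \<not> b 0)"
      using T.pot_label[of _ \<theta>] by (simp_all flip: e add: \<theta>_def)
    ultimately show "T.pot \<theta> (p, True) = T.pot \<theta> (p, False)" by (cases "b 0") auto
  qed (use near in auto)
  have pot': "potential D' T.all_marks (T.after.pot \<theta>')"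
    unfolding am[symmetric]
  proof (rule T.after.pot_potential)
    have val: "T.after.pot \<theta>' (s 0 u, c) = sgnb c * \<epsilon>" "T.after.pot \<theta>' (s 0 v, c) = - (sgnb c * \<epsilon>)" for c
    proof -
      have "T.after.pot \<theta>' (s 0 u, b 0) = sgnb (b 0) * \<epsilon>" "T.after.pot \<theta>' (s 0 u, \<not> b 0) = - sgnb (b 0) * \<epsilon>"
        "T.after.pot \<theta>' (s 0 v, b 0) = - sgnb (b 0) * \<epsilon>" "T.after.pot \<theta>' (s 0 v, \<not> b 0) = sgnb (b 0) * \<epsilon>"
        using T.after.pot_label[of _ \<theta>'] by (simp_all flip: e add: \<theta>'_def)
      then show "T.after.pot \<theta>' (s 0 u, c) = sgnb c * \<epsilon>" "T.after.pot \<theta>' (s 0 v, c) = - (sgnb c * \<epsilon>)"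
        by (cases c; cases "b 0"; simp)+
    qed
    fix p assume "p \<in> crossing_points D' \<inter> strand_points 1 s"
    then have "p = s 0 u \<or> p = s 0 v" using near' by blast
    then show "T.after.balanced (T.after.pot \<theta>') p"
      by (auto simp: T.after.balanced_def val pa sv \<epsilon>_def[symmetric] intro!: exI[of _ 0])
  next
    fix p assume "p \<in> T.after.marks - crossing_points D'"
    then show "T.after.pot \<theta>' (p, True) = T.after.pot \<theta>' (p, False)"
      using CP by (auto simp: strand_marks_def P_def less_2_cases_iff)
  qed
  define W where "W = (\<lambda>S. loops_eval ?\<kappa> (T.all_marks \<times> UNIV - inner_ends T.e 4 [(1, 2)]) (arc_map T.all_marks)
    (rewire T.e 4 [(0, 3)] (mark_join D S)) (T.pot \<theta>))"
  have st: "loops_eval ?\<kappa> (T.all_marks \<times> UNIV) (arc_map T.all_marks) (mark_join D (S \<union> {})) (T.pot \<theta>) = W S"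
    and sys: "loop_system (T.all_marks \<times> UNIV - inner_ends T.e 4 [(1, 2)]) (arc_map T.all_marks)
      (rewire T.e 4 [(0, 3)] (mark_join D S))" for S
  proof -
    have marks: "s 0 u \<notin> crossing_points D" "s 0 v \<notin> crossing_points D"
      using near strand_point[of 0 1 u s] strand_point[of 0 1 v s] T.P_mem[of 0 0] T.P_mem[of 0 1]
      by (auto simp: P_def)
    have j: "joins_pairs (mark_join D (S \<union> {})) T.e [(0, 1), (2, 3)]"
      using marks by (simp add: e T.D.mark_join_eq)
    have sub: "{..<T.N} \<subseteq> labels [(0, 1), (2, 3)]" by (auto simp: less4)
    note c = T.state_contraction[OF j sub empty_subsetI arcs, of \<theta>, unfolded N, OF _ _ contracts_R1(1)]
    show "loops_eval ?\<kappa> (T.all_marks \<times> UNIV) (arc_map T.all_marks) (mark_join D (S \<union> {})) (T.pot \<theta>) = W S"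
      unfolding W_def by (subst c(1)) (auto simp: \<theta>_def)
    show "loop_system (T.all_marks \<times> UNIV - inner_ends T.e 4 [(1, 2)]) (arc_map T.all_marks)
      (rewire T.e 4 [(0, 3)] (mark_join D S))" by (rule c(2)) (auto simp: \<theta>_def)
  qed
  have cmp: "loops_eval ?\<kappa> (T.all_marks \<times> UNIV - inner_ends T.e 4 [(1, 2)]) (arc_map T.all_marks)
      (rewire T.e 4 [(0, 3)] (mark_join D' S)) (T.after.pot \<theta>') = W S" for S
    unfolding W_def
  proof (rule T.compare[of "[(1, 2)]" \<theta> \<theta>' "[(0, 3)]" S ?\<kappa>, unfolded am N])
    show "T.e n = T.e n \<and> \<theta> n = \<theta>' n \<and> wire [(0, 3)] n < 4 \<and> wire [(1, 2)] (wire [(0, 3)] n) = wire [(0, 3)] n"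
      if "n < 4" "wire [(1, 2)] n = n" for n
      using that by (auto simp: less4 \<theta>_def \<theta>'_def)
  qed (rule refl sys)+
  have flat': "\<forall>(x, y)\<in>set [(1, 2)]. \<theta>' x = \<theta>' y" by (simp add: \<theta>'_def)
  have lab: "labels [(1, 2)] \<subseteq> {..<4}" by simp
  have st': "loops_eval ?\<kappa> (T.all_marks \<times> UNIV) (arc_map T.all_marks) (mark_join D' (S \<union> T)) (T.after.pot \<theta>') =
      (if z \<in> T then W S else d * W S)" if S: "S \<subseteq> crossings D" and T: "T \<subseteq> {z}" for S T
  proof -
    have zS: "z \<notin> S" using S z by blast
    have T': "T \<subseteq> box" using T z by blast
    show ?thesis
    proof (cases "z \<in> T")
      case True
      have j: "joins_pairs (mark_join D' (S \<union> T)) T.e [(0, 2), (1, 3)]"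
        using True CP by (simp add: e T.D'.mark_join_eq pa sv ptv z_def[symmetric])
      have sub: "{..<T.N} \<subseteq> labels [(0, 2), (1, 3)]" by (auto simp: less4)
      note c = T.after.state_contraction(1)[where \<kappa> = ?\<kappa> and \<theta> = \<theta>', OF j sub T', unfolded am N, OF arcs flat' lab contracts_R1(3)]
      show ?thesis unfolding c cmp using True by simp
    next
      case False
      have j: "joins_pairs (mark_join D' (S \<union> T)) T.e [(0, 3), (2, 1)]"
        using False CP zS by (simp add: e T.D'.mark_join_eq pa sv ptv z_def[symmetric])
      have sub: "{..<T.N} \<subseteq> labels [(0, 3), (2, 1)]" by (auto simp: less4)
      note c = T.after.state_contraction(1)[where \<kappa> = ?\<kappa> and \<theta> = \<theta>', OF j sub T', unfolded am N, OF arcs flat' lab contracts_R1(2)]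
      show ?thesis unfolding c cmp using False by (simp add: K0)
    qed
  qed
  let ?u = "d ^ card (unmarked (ncomp D) T.all_marks)"
  have zn: "z \<notin> crossings D" using z by blast
  have mk': "marking (ncomp D') T.all_marks" "crossing_points D' \<subseteq> T.all_marks"
    using T.after.all_marks_marking T.after.CP_all_marks by (simp_all add: am)
  have "d * bracket \<alpha> \<beta> d K D = (\<Sum>S\<in>Pow (crossings D). weight \<alpha> \<beta> (crossings D) S * ?u * W S)"
    using T.D.bracket_marked[where K = K, OF T.all_marks_marking T.CP_all_marks pot K0, of "crossings D" "{}" d \<alpha> \<beta>] st
    by (simp add: weight_def)
  moreover have "d * bracket \<alpha> \<beta> d K D' = (\<Sum>S\<in>Pow (crossings D). weight \<alpha> \<beta> (crossings D) S * ?u *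
      ((\<alpha> z * d + \<beta> z) * W S))"
  proof -
    have "(\<Sum>T\<in>Pow {z}. weight \<alpha> \<beta> {z} T * (if z \<in> T then W S else d * W S)) = (\<alpha> z * d + \<beta> z) * W S" for S
      by (simp add: sum_Pow_insert weight_def algebra_simps)
    moreover have "(\<Sum>T\<in>Pow {z}. weight \<alpha> \<beta> {z} T * loops_eval ?\<kappa> (T.all_marks \<times> UNIV) (arc_map T.all_marks)
        (mark_join D' (S \<union> T)) (T.after.pot \<theta>')) = (\<Sum>T\<in>Pow {z}. weight \<alpha> \<beta> {z} T * (if z \<in> T then W S else d * W S))"
      if "S \<in> Pow (crossings D)" for S
      by (intro sum.cong refl arg_cong2[where f = "(*)"] st') (use that in auto)
    ultimately show ?thesis
      using T.D'.bracket_marked[where K = K, OF mk' pot' K0, of "crossings D" "{z}" d \<alpha> \<beta>] z(2) zn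
      by (simp add: T.ncomp_eq)
  qed
  ultimately show ?thesis by (simp add: sum_distrib_left mult_ac)
qed

subsection \<open>The second move\<close>

lemma less_two_iff: "n < 2 \<longleftrightarrow> n = 0 \<or> n = 1" for n :: nat
  by auto

lemma strand_marks_image:
  "strand_marks m w s P = (\<lambda>(k, i). s k (P (w * k + i))) ` ({..<m} \<times> {..<w})"
  by (auto simp: strand_marks_def)

lemma lessThan_two: "{..<2::nat} = {0, 1}"
  by auto

lemma continuous_graph: "F differentiable_on {-1..1::real} \<Longrightarrow> continuous_on {-1..1} (F :: real \<Rightarrow> real)"
  by (rule differentiable_imp_continuous_on)

text \<open>
  The graph of the strand 0 is below the other one at both end points, so it passes upward at the first crossing and
  downward at the second one, and the two signs are opposite.
\<close>

lemma R2_data: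
  assumes D: "is_flat_diagram D" "is_flat_diagram D'" and move: "flat_R2 D D' s u v"
  defines "P \<equiv> \<lambda>n. [u, v, u, v] ! n"
  obtains b \<tau> where "tangle_pair D D' 2 s b \<tau> 2 P P" "crossing_points D \<inter> strand_points 2 s = {}"
    "partner D' (s 0 u) = s 1 u" "partner D' (s 1 u) = s 0 u" "partner D' (s 0 v) = s 1 v" "partner D' (s 1 v) = s 0 v"
    "eps D' (s 0 u) = - (sgnb (b 0) * sgnb (b 1))" "eps D' (s 1 u) = sgnb (b 0) * sgnb (b 1)"
    "eps D' (s 1 v) = - (sgnb (b 0) * sgnb (b 1))" "eps D' (s 0 v) = sgnb (b 0) * sgnb (b 1)"
    "s 0 u \<in> crossing_points D'" "s 1 u \<in> crossing_points D'" "s 0 v \<in> crossing_points D'" "s 1 v \<in> crossing_points D'"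
    "crossing_points D' \<inter> strand_points 2 s \<subseteq> {s 0 u, s 1 u, s 0 v, s 1 v}"
    "pt D' (s 0 u) \<in> box" "pt D' (s 0 v) \<in> box" "pt D' (s 0 u) \<noteq> pt D' (s 0 v)"
    "crossings D' = {pt D' (s 0 u), pt D' (s 0 v)} \<union> crossings D" "crossings D \<inter> box = {}"
proof -
  note mv = move[unfolded flat_R2_def]
  have ex: "\<exists>F F'. graph_strands D 2 s F \<and> graph_strands D' 2 s F' \<and> (\<forall>x\<in>{-1..1}. F 0 x < F 1 x) \<and>
      u < v \<and> {x \<in> {-1..1}. F' 0 x = F' 1 x} = {u, v}"
    and agree: "agree_off_strands D D' 2 s"
    and cr: "crossings D' = {pt D' (s 0 u), pt D' (s 0 v)} \<union> crossings D"
    using conjunct1[OF mv] conjunct1[OF conjunct2[OF mv]] conjunct2[OF conjunct2[OF mv]] by this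
  from ex obtain F F' where g: "graph_strands D 2 s F" "graph_strands D' 2 s F'"
    and below': "\<forall>x\<in>{-1..1}. F 0 x < F 1 x" and uv: "u < v" "{x \<in> {-1..1}. F' 0 x = F' 1 x} = {u, v}"
    by (elim exE conjE) (rule that; assumption)
  have below: "F 0 x < F 1 x" if "x \<in> {-1..1}" for x using below' that by blast
  have "u \<in> {x \<in> {-1..1}. F' 0 x = F' 1 x}" "v \<in> {x \<in> {-1..1}. F' 0 x = F' 1 x}" unfolding uv(2) by auto
  then have u: "u \<in> {-1..1}" "F' 0 u = F' 1 u" and v: "v \<in> {-1..1}" "F' 0 v = F' 1 v" by auto
  have only: "x = u \<or> x = v" if "x \<in> {-1..1}" "F' 0 x = F' 1 x" for x
  proof -
    have "x \<in> {x \<in> {-1..1}. F' 0 x = F' 1 x}" using that by simp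
    then show ?thesis unfolding uv(2) by simp
  qed
  note g1 = graph_strandsD[OF g(1)] and g2 = graph_strandsD[OF g(2)]
  have z: "pt D' (s 0 u) \<in> box" "pt D' (s 0 v) \<in> box"
    using g2(3)[of 0 u] g2(3)[of 0 v] u v graph_in_box by auto
  have far: "crossings D' - box = crossings D - box" using cr z by auto
  interpret L: local_move D D' 2 s by (rule graph_move(1)[OF D agree g far])
  interpret L': local_move D' D 2 s by (rule L.sym)
  have ends: "F' k (-1) = F k (-1)" "F' k 1 = F k 1" if "k < 2" for k
    using graph_move(2,3)[OF D agree g far that] .
  obtain b \<tau> where b: "\<And>k. k < 2 \<Longrightarrow> oriented_segment (ncomp D) (s k) (b k) (\<tau> k)"
    using orient_strands[of 2 "ncomp D" s] g1(1) by blast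
  have b': "oriented_segment (ncomp D') (s k) (b k) (\<tau> k)" if "k < 2" for k
    using b[OF that] L.ncomp_eq by simp
  define f where "f = (\<lambda>x. F' 1 x - F' 0 x)"
  have cf: "continuous_on {-1..1} f"
    unfolding f_def using g2(2) by (intro continuous_on_diff continuous_graph) auto
  have f1: "0 < f (-1)" "0 < f 1" using ends below[of "-1"] below[of 1] by (auto simp: f_def)
  have u1: "-1 < u" and v1: "v < 1" using u v f1 by (auto simp: f_def less_le)
  have nz: "f x \<noteq> 0" if "x \<in> {-1..1}" "x \<noteq> u" "x \<noteq> v" for x
    using only[OF that(1)] that by (auto simp: f_def)
  have left: "F' 0 y < F' 1 y" if "-1 < y" "y < u" for y
  proof -
    have "0 < f y"
    proof (rule positive_until_zero[OF cf _ _ f1(1)])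
      fix x assume "min (-1) y \<le> x" "x \<le> max (-1) y"
      then have "-1 \<le> x" "x \<le> y" using that by auto
      then show "f x \<noteq> 0" by (intro nz) (use that u uv in auto)
    qed (use that u in auto)
    then show ?thesis by (simp add: f_def)
  qed
  have right: "F' 0 y < F' 1 y" if "v < y" "y < 1" for y
  proof -
    have "0 < f y"
    proof (rule positive_until_zero[OF cf _ _ f1(2)])
      fix x assume "min 1 y \<le> x" "x \<le> max 1 y"
      then have "y \<le> x" "x \<le> 1" using that by auto
      then show "f x \<noteq> 0" by (intro nz) (use that v uv in auto)
    qed (use that v in auto)
    then show ?thesis by (simp add: f_def)
  qed
  have gr: "pt D' (s k y) = Complex y (F' k y)" if "k < 2" "y \<in> {-1..1}" for k y using g2(3) that by blast
  have ne: "s 0 x \<noteq> s 1 x" "s 1 x \<noteq> s 0 x" if "x \<in> {-1..1}" for x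
    using inj_onD[OF g2(4)[of 0], of "(0, x)" "(1, x)"] that by auto
  have si: "(\<exists>r\<ge>-1. r < u \<and> (\<forall>y. r < y \<longrightarrow> y < u \<longrightarrow> F' 0 y < F' 1 y)) \<or>
      (\<exists>r\<le>1. u < r \<and> (\<forall>y. u < y \<longrightarrow> y < r \<longrightarrow> F' 1 y < F' 0 y))"
    using left u1 by (intro disjI1 exI[of _ "-1"]) auto
  have si': "(\<exists>r\<ge>-1. r < v \<and> (\<forall>y. r < y \<longrightarrow> y < v \<longrightarrow> F' 1 y < F' 0 y)) \<or>
      (\<exists>r\<le>1. v < r \<and> (\<forall>y. v < y \<longrightarrow> y < r \<longrightarrow> F' 0 y < F' 1 y))"
    using right v1 by (intro disjI2 exI[of _ 1]) auto
  note eu = L.D'.eps_graphs[OF b'[of 0] b'[of 1] g2(2)[of 0] g2(2)[of 1] gr[of 0] gr[of 1] u(1) u(2) ne(1)[OF u(1)] si]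
  note ev = L.D'.eps_graphs[OF b'[of 1] b'[of 0] g2(2)[of 1] g2(2)[of 0] gr[of 1] gr[of 0] v(1) v(2)[symmetric] ne(2)[OF v(1)] si']
  have K: "s k x \<in> L.K" if "k < 2" "x \<in> {-1..1}" for k x using that by (rule strand_point)
  have cp: "s k x \<in> circle_points D'" if "k < 2" "x \<in> {-1..1}" for k x
    using K[OF that] L.K_circles L.circle_eq by blast
  have same: "pt D' (s 1 u) = pt D' (s 0 u)" "pt D' (s 1 v) = pt D' (s 0 v)" using gr u v by auto
  have CP: "s 0 u \<in> crossing_points D'" "s 1 u \<in> crossing_points D'" "s 0 v \<in> crossing_points D'" "s 1 v \<in> crossing_points D'"
    using cp u v cr same by (auto simp: crossing_points_def)
  have near: "crossing_points D \<inter> L.K = {}"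
  proof (rule ccontr)
    assume "crossing_points D \<inter> L.K \<noteq> {}"
    then obtain p where p: "p \<in> crossing_points D \<inter> L.K" by blast
    obtain k l x where "k < 2" "l < 2" "k \<noteq> l" "x \<in> {-1..1}" "F k x = F l x"
      by (rule L.near_point[OF _ p, of F]) (use g1(3) in auto)
    then show False using below[of x] by (auto simp: less_two_iff)
  qed
  have near': "crossing_points D' \<inter> L.K \<subseteq> {s 0 u, s 1 u, s 0 v, s 1 v}"
  proof
    fix p assume p: "p \<in> crossing_points D' \<inter> L.K"
    obtain k l x where kl: "k < 2" "l < 2" "k \<noteq> l" "x \<in> {-1..1}" "p = s k x" "F' k x = F' l x"
      by (rule L'.near_point[OF _ p, of F']) (use g2(3) in auto)
    then have "F' 0 x = F' 1 x" by (auto simp: less_two_iff)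
    then show "p \<in> {s 0 u, s 1 u, s 0 v, s 1 v}" using only[OF kl(4)] kl by (auto simp: less_two_iff)
  qed
  have marks: "strand_marks 2 2 s P = {s 0 u, s 1 u, s 0 v, s 1 v}"
    unfolding strand_marks_image lessThan_two by (auto simp: P_def)
  have "tangle_pair D D' 2 s b \<tau> 2 P P"
  proof (intro tangle_pair.intro tangle.intro)
    show ms: "marked_strands (ncomp D) 2 s b \<tau> 2 P"
    proof (rule marked_strands.intro)
      show "P (2 * k + i) \<in> {-1..1}" if "k < 2" "i < 2" for k i
        using that u v by (auto simp: P_def less_two_iff)
      show "P (2 * k + i) < P (2 * k + Suc i)" if "k < 2" "Suc i < 2" for k i
        using that uv by (auto simp: P_def less_two_iff)
    qed (use b g1(4)[of 0] in auto)
    show "marked_strands (ncomp D') 2 s b \<tau> 2 P" using ms L.ncomp_eq by simp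
    show "local_move D D' 2 s" "local_move D' D 2 s" by (rule L.local_move_axioms L.sym)+
    show "tangle_axioms D 2 s 2 P" "tangle_axioms D' 2 s 2 P"
      using near near' by (auto simp: tangle_axioms_def marks)
  qed
  then show ?thesis
  proof (rule that)
    show "partner D' (s 0 u) = s 1 u" "partner D' (s 1 u) = s 0 u" "partner D' (s 0 v) = s 1 v" "partner D' (s 1 v) = s 0 v"
      using eu(1,2) ev(1,2) by auto
    show "eps D' (s 0 u) = - (sgnb (b 0) * sgnb (b 1))" "eps D' (s 1 u) = sgnb (b 0) * sgnb (b 1)"
      using eu(3,4) by auto
    show "eps D' (s 1 v) = - (sgnb (b 0) * sgnb (b 1))" "eps D' (s 0 v) = sgnb (b 0) * sgnb (b 1)"
      using ev(3,4) by (auto simp: mult.commute)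
    show "pt D' (s 0 u) \<noteq> pt D' (s 0 v)" using gr[of 0 u] gr[of 0 v] u v uv by auto
    show "crossings D \<inter> box = {}" unfolding L.near_crossings near by simp
  qed (use CP near near' z cr in auto)
qed

text \<open>
  Of the four states, one is the identity tangle, and the other three, one of them with a closed loop, are equal; the
  hypotheses on the weights say that the first has coefficient 1 and that the others cancel.
\<close>

lemma bracket_R2:
  fixes d :: "'r::comm_ring_1"
  assumes D: "is_flat_diagram D" "is_flat_diagram D'" and move: "flat_R2 D D' s u v" and K0: "K 0 = 1"
  defines "zu \<equiv> pt D' (s 0 u)" and "zv \<equiv> pt D' (s 0 v)"
  assumes w: "\<alpha> zu * \<alpha> zv = 1" "\<beta> zu * \<beta> zv = 1" "\<alpha> zu * \<beta> zv + \<beta> zu * \<alpha> zv + d = 0"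
  shows "d * bracket \<alpha> \<beta> d K D' = d * bracket \<alpha> \<beta> d K D"
proof -
  define P where "P = (\<lambda>n. [u, v, u, v] ! n)"
  obtain b \<tau> where tp: "tangle_pair D D' 2 s b \<tau> 2 P P" and near: "crossing_points D \<inter> strand_points 2 s = {}"
    and pa: "partner D' (s 0 u) = s 1 u" "partner D' (s 1 u) = s 0 u" "partner D' (s 0 v) = s 1 v" "partner D' (s 1 v) = s 0 v"
    and ep: "eps D' (s 0 u) = - (sgnb (b 0) * sgnb (b 1))" "eps D' (s 1 u) = sgnb (b 0) * sgnb (b 1)"
    "eps D' (s 1 v) = - (sgnb (b 0) * sgnb (b 1))" "eps D' (s 0 v) = sgnb (b 0) * sgnb (b 1)"
    and CP: "s 0 u \<in> crossing_points D'" "s 1 u \<in> crossing_points D'" "s 0 v \<in> crossing_points D'" "s 1 v \<in> crossing_points D'"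
    and near': "crossing_points D' \<inter> strand_points 2 s \<subseteq> {s 0 u, s 1 u, s 0 v, s 1 v}"
    and z: "zu \<in> box" "zv \<in> box" "zu \<noteq> zv" "crossings D' = {zu, zv} \<union> crossings D" "crossings D \<inter> box = {}"
    using R2_data[OF D move] unfolding P_def zu_def zv_def by metis
  interpret T: tangle_pair D D' 2 s b \<tau> 2 P P by (rule tp)
  let ?\<kappa> = "\<lambda>h. d * K (nat h div 4)"
  let ?as = "[(1, 2), (5, 6)] :: (nat \<times> nat) list"
  define o0 o1 where "o0 = sgnb (b 0)" and "o1 = sgnb (b 1)"
  \<comment> \<open>After the move the constants at both crossings are 0; the values at the outer ends determine the potential before the move.\<close>
  define \<theta> where "\<theta> = (\<lambda>n. [o1, o1, o1, o1, - o0, - o0, - o0, - o0] ! n)"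
  define \<theta>' where "\<theta>' = (\<lambda>n. [o1, - o1, - o1, o1, - o0, o0, o0, - o0] ! n)"
  have e: "T.e 0 = (s 0 u, \<not> b 0)" "T.e 1 = (s 0 u, b 0)" "T.e 2 = (s 0 v, \<not> b 0)" "T.e 3 = (s 0 v, b 0)"
    "T.e 4 = (s 1 u, \<not> b 1)" "T.e 5 = (s 1 u, b 1)" "T.e 6 = (s 1 v, \<not> b 1)" "T.e 7 = (s 1 v, b 1)"
    by (simp_all add: strand_end_def P_def)
  have N: "T.N = 8" by simp
  have less8: "n < 8 \<longleftrightarrow> n = 0 \<or> n = 1 \<or> n = 2 \<or> n = 3 \<or> n = 4 \<or> n = 5 \<or> n = 6 \<or> n = 7" for n :: nat by auto
  have am: "T.after.all_marks = T.all_marks" by (rule T.all_marks_eq) simp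
  have arcs: "joins_pairs (arc_map T.all_marks) T.e ?as"
    using T.arc_labels[of 0 0] T.arc_labels[of 1 0] by (simp add: One_nat_def[symmetric])
  have lab: "labels ?as \<subseteq> {..<8}" by simp
  have pts: "pt D' (s 0 u) = zu" "pt D' (s 1 v) = zv"
    using T.D'.partner(3)[OF CP(3)] by (simp_all add: pa zu_def zv_def)
  have mk: "T.marks = {s 0 u, s 1 u, s 0 v, s 1 v}"
    unfolding strand_marks_image lessThan_two by (auto simp: P_def)
  have pot: "potential D T.all_marks (T.pot \<theta>)"
  proof (rule T.pot_potential)
    fix p assume "p \<in> T.marks - crossing_points D"
    then have p: "p \<in> {s 0 u, s 1 u, s 0 v, s 1 v}" using mk by auto
    have "T.pot \<theta> (s 0 u, b 0) = o1 \<and> T.pot \<theta> (s 0 u, \<not> b 0) = o1 \<and> T.pot \<theta> (s 0 v, b 0) = o1 \<and> T.pot \<theta> (s 0 v, \<not> b 0) = o1 \<and>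
      T.pot \<theta> (s 1 u, b 1) = - o0 \<and> T.pot \<theta> (s 1 u, \<not> b 1) = - o0 \<and> T.pot \<theta> (s 1 v, b 1) = - o0 \<and> T.pot \<theta> (s 1 v, \<not> b 1) = - o0"
      using T.pot_label[of _ \<theta>] by (simp flip: e add: \<theta>_def)
    then show "T.pot \<theta> (p, True) = T.pot \<theta> (p, False)" using p by (cases "b 0"; cases "b 1") auto
  qed (use near in auto)
  have pot': "potential D' T.all_marks (T.after.pot \<theta>')"
    unfolding am[symmetric]
  proof (rule T.after.pot_potential)
    have bu: "T.after.balanced (T.after.pot \<theta>') (s 0 u)" "T.after.balanced (T.after.pot \<theta>') (s 1 u)"
      by (rule T.after.crossing_balanced[OF pa(1,2) ep(1,2) e(1,2,5,6), where c = 0];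
          simp add: \<theta>'_def o0_def o1_def)+
    \<comment> \<open>At the second crossing the strand 1 is the one that passes upward.\<close>
    have ep': "eps D' (s 1 v) = - (sgnb (b 1) * sgnb (b 0))" "eps D' (s 0 v) = sgnb (b 1) * sgnb (b 0)"
      using ep by (simp_all add: mult.commute)
    have bv: "T.after.balanced (T.after.pot \<theta>') (s 1 v)" "T.after.balanced (T.after.pot \<theta>') (s 0 v)"
      by (rule T.after.crossing_balanced[OF pa(4,3) ep' e(7,8,3,4), where c = 0];
          simp add: \<theta>'_def o0_def o1_def)+
    fix p assume "p \<in> crossing_points D' \<inter> strand_points 2 s"
    then show "T.after.balanced (T.after.pot \<theta>') p" using near' bu bv by blast
  next
    fix p assume "p \<in> T.after.marks - crossing_points D'"
    then show "T.after.pot \<theta>' (p, True) = T.after.pot \<theta>' (p, False)" using CP mk by auto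
  qed
  have flat: "\<forall>(x, y)\<in>set ?as. \<theta> x = \<theta> y" by (simp add: \<theta>_def)
  have flat': "\<forall>(x, y)\<in>set ?as. \<theta>' x = \<theta>' y" by (simp add: \<theta>'_def)
  define W where "W = (\<lambda>r S. loops_eval ?\<kappa> (T.all_marks \<times> UNIV - inner_ends T.e 8 ?as) (arc_map T.all_marks)
    (rewire T.e 8 r (mark_join D' S)) (T.after.pot \<theta>'))"
  have st: "loops_eval ?\<kappa> (T.all_marks \<times> UNIV) (arc_map T.all_marks) (mark_join D (S \<union> {})) (T.pot \<theta>) =
    W [(0, 3), (4, 7)] S" for S
  proof -
    have K: "{s 0 u, s 1 u, s 0 v, s 1 v} \<subseteq> T.K" using T.marks_strands mk by simp
    have j: "joins_pairs (mark_join D (S \<union> {})) T.e [(0, 1), (2, 3), (4, 5), (6, 7)]"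
    proof -
      have "s 0 u \<notin> crossing_points D" "s 1 u \<notin> crossing_points D" "s 0 v \<notin> crossing_points D" "s 1 v \<notin> crossing_points D"
        using near K by blast+
      then show ?thesis by (simp add: e T.D.mark_join_eq)
    qed
    have sub: "{..<T.N} \<subseteq> labels [(0, 1), (2, 3), (4, 5), (6, 7)]" by (auto simp: less8)
    note c = T.state_contraction[where \<theta> = \<theta>, OF j sub empty_subsetI, unfolded N, OF arcs flat lab contracts_R2(1)]
    have "loops_eval ?\<kappa> (T.all_marks \<times> UNIV) (arc_map T.all_marks) (mark_join D (S \<union> {})) (T.pot \<theta>) =
      loops_eval ?\<kappa> (T.all_marks \<times> UNIV - inner_ends T.e 8 ?as) (arc_map T.all_marks)
        (rewire T.e 8 [(0, 3), (4, 7)] (mark_join D S)) (T.pot \<theta>)"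
      using c(1)[where \<kappa> = ?\<kappa>] by simp
    also have "\<dots> = W [(0, 3), (4, 7)] S"
      unfolding W_def
    proof (rule T.compare[of ?as \<theta> \<theta>' "[(0, 3), (4, 7)]" S ?\<kappa>, unfolded am N, symmetric])
      show "T.e n = T.e n \<and> \<theta> n = \<theta>' n \<and> wire [(0, 3), (4, 7)] n < 8 \<and>
        wire ?as (wire [(0, 3), (4, 7)] n) = wire [(0, 3), (4, 7)] n" if "n < 8" "wire ?as n = n" for n
        using that by (auto simp: less8 \<theta>_def \<theta>'_def)
    qed (rule refl c(2))+
    finally show ?thesis .
  qed
  define f where "f = (b 0 \<noteq> b 1)"
  \<comment> \<open>The arguments tell whether left ends are joined to right ends at the two crossings.\<close>
  define V where "V = (\<lambda>t t' S. if t \<and> t' then W [(0, 3), (4, 7)] S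
    else if t \<or> t' then W [(0, 4), (3, 7)] S else d * W [(0, 4), (3, 7)] S)"
  have st': "loops_eval ?\<kappa> (T.all_marks \<times> UNIV) (arc_map T.all_marks) (mark_join D' (S \<union> T)) (T.after.pot \<theta>') =
      V ((zu \<in> T) = f) ((zv \<in> T) = f) S" if S: "S \<subseteq> crossings D" and T: "T \<subseteq> {zu, zv}" for S T
  proof -
    define t t' where "t = ((zu \<in> T) = f)" and "t' = ((zv \<in> T) = f)"
    have zS: "zu \<notin> S" "zv \<notin> S" using S z by auto
    have T': "T \<subseteq> box" using T z by blast
    have j1: "joins_pairs (mark_join D' (S \<union> T)) T.e (smooth t 0 1 4 5)"
      using T.after.crossing_joins[OF CP(1) pa(1) e(1,2,5,6), of "S \<union> T"] zS pts by (simp add: t_def f_def)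
    have ff: "(b 1 \<noteq> b 0) = f" by (auto simp: f_def)
    have j2: "joins_pairs (mark_join D' (S \<union> T)) T.e (smooth t' 6 7 2 3)"
      using T.after.crossing_joins[OF CP(4) pa(4) e(7,8,3,4), of "S \<union> T"] zS pts unfolding ff by (simp add: t'_def)
    have j: "joins_pairs (mark_join D' (S \<union> T)) T.e (smooth t 0 1 4 5 @ smooth t' 6 7 2 3)" using j1 j2 by simp
    have sub: "{..<T.N} \<subseteq> labels (smooth t 0 1 4 5 @ smooth t' 6 7 2 3)" by (auto simp: less8)
    note c = T.after.state_contraction(1)[where \<kappa> = ?\<kappa> and \<theta> = \<theta>', OF j sub T', unfolded am N, OF arcs flat' lab,
        folded W_def[THEN fun_cong, THEN fun_cong]]
    have "contracts_to 8 ?as (smooth t 0 1 4 5 @ smooth t' 6 7 2 3) (if t \<and> t' then [(0, 3), (4, 7)] else [(0, 4), (3, 7)])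
        (if t \<or> t' then [] else [1, 2, 6, 5])"
      using contracts_R2(2-5) by (cases t; cases t') simp_all
    from c[OF this] show ?thesis unfolding V_def W_def t_def[symmetric] t'_def[symmetric]
      by (cases t; cases t') (simp_all add: K0)
  qed
  let ?u = "d ^ card (unmarked (ncomp D) T.all_marks)"
  have zn: "crossings D \<inter> {zu, zv} = {}" "crossings D' = crossings D \<union> {zu, zv}" using z by auto
  have mk': "marking (ncomp D') T.all_marks" "crossing_points D' \<subseteq> T.all_marks"
    using T.after.all_marks_marking T.after.CP_all_marks by (simp_all add: am)
  have "d * bracket \<alpha> \<beta> d K D = (\<Sum>S\<in>Pow (crossings D). weight \<alpha> \<beta> (crossings D) S * ?u * W [(0, 3), (4, 7)] S)"
    using T.D.bracket_marked[where K = K, OF T.all_marks_marking T.CP_all_marks pot K0, of "crossings D" "{}" d \<alpha> \<beta>] st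
    by (simp add: weight_def)
  moreover have "d * bracket \<alpha> \<beta> d K D' = (\<Sum>S\<in>Pow (crossings D). weight \<alpha> \<beta> (crossings D) S * ?u * W [(0, 3), (4, 7)] S)"
  proof -
    have loc: "(\<Sum>T\<in>Pow {zu, zv}. weight \<alpha> \<beta> {zu, zv} T * loops_eval ?\<kappa> (T.all_marks \<times> UNIV) (arc_map T.all_marks)
        (mark_join D' (S \<union> T)) (T.after.pot \<theta>')) = W [(0, 3), (4, 7)] S" if S: "S \<in> Pow (crossings D)" for S
    proof -
      have "(\<Sum>T\<in>Pow {zu, zv}. weight \<alpha> \<beta> {zu, zv} T * loops_eval ?\<kappa> (T.all_marks \<times> UNIV) (arc_map T.all_marks)
          (mark_join D' (S \<union> T)) (T.after.pot \<theta>')) =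
        (\<Sum>T\<in>Pow {zu, zv}. weight \<alpha> \<beta> {zu, zv} T * V ((zu \<in> T) = f) ((zv \<in> T) = f) S)"
        by (intro sum.cong refl arg_cong2[where f = "(*)"] st') (use S in auto)
      also have "\<dots> = W [(0, 3), (4, 7)] S +
          (\<alpha> zu * \<beta> zv + \<beta> zu * \<alpha> zv + d) * W [(0, 4), (3, 7)] S"
      proof (cases f)
        case True
        have "(\<Sum>T\<in>Pow {zu, zv}. weight \<alpha> \<beta> {zu, zv} T * V ((zu \<in> T) = f) ((zv \<in> T) = f) S) =
          (\<beta> zu * \<beta> zv) * W [(0, 3), (4, 7)] S + (\<alpha> zu * \<beta> zv + \<beta> zu * \<alpha> zv + (\<alpha> zu * \<alpha> zv) * d) * W [(0, 4), (3, 7)] S"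
          using z(3) True by (simp add: sum_Pow_insert weight_def V_def algebra_simps)
        then show ?thesis unfolding w(1,2) by simp
      next
        case False
        have "(\<Sum>T\<in>Pow {zu, zv}. weight \<alpha> \<beta> {zu, zv} T * V ((zu \<in> T) = f) ((zv \<in> T) = f) S) =
          (\<alpha> zu * \<alpha> zv) * W [(0, 3), (4, 7)] S + (\<alpha> zu * \<beta> zv + \<beta> zu * \<alpha> zv + (\<beta> zu * \<beta> zv) * d) * W [(0, 4), (3, 7)] S"
          using z(3) False by (simp add: sum_Pow_insert weight_def V_def algebra_simps)
        then show ?thesis unfolding w(1,2) by simp
      qed
      finally show ?thesis unfolding w(3) by simp
    qed
    show ?thesis
      using T.D'.bracket_marked[where K = K, OF mk' pot' K0 zn(2,1), of d \<alpha> \<beta>] loc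
      by (simp add: T.ncomp_eq)
  qed
  ultimately show ?thesis by simp
qed

subsection \<open>The third move\<close>

text \<open>
  Strands that are graphs and cross pairwise exactly once. For \<open>k < l\<close> the strand \<open>k\<close> starts below the strand \<open>l\<close>, so it
  passes upward at their crossing, which determines the sign.
\<close>

lemma (in local_move) graph_crossings:
  assumes g: "graph_strands D m s F"
    and os: "\<And>k. k < m \<Longrightarrow> oriented_segment (ncomp D) (s k) (b k) (\<tau> k)"
    and order: "\<And>k l. k < l \<Longrightarrow> l < m \<Longrightarrow> F k (-1) < F l (-1)"
    and zero: "\<And>k l. k < l \<Longrightarrow> l < m \<Longrightarrow> {r \<in> {-1..1}. F k r = F l r} = {x k l}"
    and cr: "\<And>k l. k < l \<Longrightarrow> l < m \<Longrightarrow> pt D (s k (x k l)) \<in> crossings D"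
  shows "k < l \<Longrightarrow> l < m \<Longrightarrow> -1 < x k l \<and> x k l \<le> 1 \<and>
      partner D (s k (x k l)) = s l (x k l) \<and> partner D (s l (x k l)) = s k (x k l) \<and>
      eps D (s k (x k l)) = - (sgnb (b k) * sgnb (b l)) \<and> eps D (s l (x k l)) = sgnb (b k) * sgnb (b l) \<and>
      s k (x k l) \<in> crossing_points D \<and> s l (x k l) \<in> crossing_points D \<and>
      pt D (s l (x k l)) = pt D (s k (x k l)) \<and> Re (pt D (s k (x k l))) = x k l"
    and "p \<in> crossing_points D \<inter> strand_points m s \<Longrightarrow> \<exists>k l. k < l \<and> l < m \<and> (p = s k (x k l) \<or> p = s l (x k l))"
proof -
  note gs = graph_strandsD[OF g]
  have xm: "x k l \<in> {-1..1}" "F k (x k l) = F l (x k l)" if "k < l" "l < m" for k l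
  proof -
    have "x k l \<in> {r \<in> {-1..1}. F k r = F l r}" unfolding zero[OF that] by simp
    then show "x k l \<in> {-1..1}" "F k (x k l) = F l (x k l)" by auto
  qed
  have only: "r = x k l" if "k < l" "l < m" "r \<in> {-1..1}" "F k r = F l r" for k l r
  proof -
    have "r \<in> {r \<in> {-1..1}. F k r = F l r}" using that by simp
    then show ?thesis unfolding zero[OF that(1,2)] by simp
  qed
  have gr: "pt D (s k y) = Complex y (F k y)" if "k < m" "y \<in> {-1..1}" for k y using gs(3) that by blast
  {
    assume kl: "k < l" "l < m"
    then have km: "k < m" by simp
    note xx = xm[OF kl]
    have x1: "-1 < x k l" using xx order[OF kl] by (auto simp: less_le)
    \<comment> \<open>The difference has no zero before the crossing, so it keeps the sign that it has at the left end.\<close>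
    define f where "f = (\<lambda>y. F l y - F k y)"
    have cf: "continuous_on {-1..1} f"
      unfolding f_def using gs(2)[OF kl(2)] gs(2)[OF km] by (intro continuous_on_diff continuous_graph) auto
    have f1: "0 < f (-1)" using order[OF kl] by (simp add: f_def)
    have left: "F k y < F l y" if "-1 < y" "y < x k l" for y
    proof -
      have "0 < f y"
      proof (rule positive_until_zero[OF cf _ _ f1])
        fix r assume "min (-1) y \<le> r" "r \<le> max (-1) y"
        then have "-1 \<le> r" "r \<le> y" using that by auto
        then show "f r \<noteq> 0" using only[OF kl, of r] that xx by (auto simp: f_def)
      qed (use that xx in auto)
      then show ?thesis by (simp add: f_def)
    qed
    have ne: "s k (x k l) \<noteq> s l (x k l)"
      using inj_onD[OF gs(4)[OF km], of "(k, x k l)" "(l, x k l)"] xx kl by auto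
    have si: "(\<exists>r\<ge>-1. r < x k l \<and> (\<forall>y. r < y \<longrightarrow> y < x k l \<longrightarrow> F k y < F l y)) \<or>
        (\<exists>r\<le>1. x k l < r \<and> (\<forall>y. x k l < y \<longrightarrow> y < r \<longrightarrow> F l y < F k y))"
      using left x1 by (intro disjI1 exI[of _ "-1"]) auto
    note e = D.eps_graphs[OF os[OF km] os[OF kl(2)] gs(2)[OF km] gs(2)[OF kl(2)] gr[OF km] gr[OF kl(2)] xx ne si]
    have cp: "s k (x k l) \<in> circle_points D" "s l (x k l) \<in> circle_points D"
      using K_circles strand_point[OF km xx(1)] strand_point[OF kl(2) xx(1)] by auto
    have same: "pt D (s l (x k l)) = pt D (s k (x k l))" using gr[OF km xx(1)] gr[OF kl(2) xx(1)] xx(2) by simp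
    show "-1 < x k l \<and> x k l \<le> 1 \<and>
      partner D (s k (x k l)) = s l (x k l) \<and> partner D (s l (x k l)) = s k (x k l) \<and>
      eps D (s k (x k l)) = - (sgnb (b k) * sgnb (b l)) \<and> eps D (s l (x k l)) = sgnb (b k) * sgnb (b l) \<and>
      s k (x k l) \<in> crossing_points D \<and> s l (x k l) \<in> crossing_points D \<and>
      pt D (s l (x k l)) = pt D (s k (x k l)) \<and> Re (pt D (s k (x k l))) = x k l"
    proof (intro conjI)
      show "x k l \<le> 1" using xx(1) by simp
      show "s k (x k l) \<in> crossing_points D" "s l (x k l) \<in> crossing_points D"
        using cp cr[OF kl] same by (auto simp: crossing_points_def)
      show "Re (pt D (s k (x k l))) = x k l" using gr[OF km xx(1)] by simp
    qed (use x1 e same in auto)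
  }
  assume p: "p \<in> crossing_points D \<inter> strand_points m s"
  obtain k l r where kl: "k < m" "l < m" "k \<noteq> l" "r \<in> {-1..1}" "p = s k r" "F k r = F l r"
    by (rule near_point[OF _ p, of F]) (use gr in auto)
  show "\<exists>k l. k < l \<and> l < m \<and> (p = s k (x k l) \<or> p = s l (x k l))"
  proof (cases "k < l")
    case True
    then show ?thesis using only[OF True kl(2,4,6)] kl by blast
  next
    case False
    then have "l < k" using kl(3) by simp
    then show ?thesis using only[OF _ kl(1,4) kl(6)[symmetric]] kl by blast
  qed
qed

text \<open>
  The positions of the marks on the strands: end points and crossings, in the order in which they occur before the move.
  The order after the move is that of \<open>R3_pos'\<close>.
\<close>

definition R3_pos :: "(nat \<Rightarrow> nat \<Rightarrow> real) \<Rightarrow> nat \<Rightarrow> real" where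
  "R3_pos x n = [-1, x 0 1, x 0 2, 1, -1, x 0 1, x 1 2, 1, -1, x 0 2, x 1 2, 1] ! n"

definition R3_pos' :: "(nat \<Rightarrow> nat \<Rightarrow> real) \<Rightarrow> nat \<Rightarrow> real" where
  "R3_pos' y n = [-1, y 0 2, y 0 1, 1, -1, y 1 2, y 0 1, 1, -1, y 1 2, y 0 2, 1] ! n"

lemma less_three_iff: "n < 3 \<longleftrightarrow> n = 0 \<or> n = 1 \<or> n = 2" for n :: nat
  by auto

lemma lessThan_three: "{..<3::nat} = {0, 1, 2}" and lessThan_four: "{..<4::nat} = {0, 1, 2, 3}"
  by auto

lemma pairs_below_three: "k < l \<and> l < 3 \<longleftrightarrow> k = 0 \<and> l = 1 \<or> k = 0 \<and> l = 2 \<or> k = 1 \<and> l = 2" for k l :: nat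
  by auto

text \<open>The crossings of three strands: for \<open>k < l\<close>, strand \<open>k\<close> crosses strand \<open>l\<close> upward.\<close>

definition crossing_data ::
  "('a) flat_diagram_scheme \<Rightarrow> (nat \<Rightarrow> real \<Rightarrow> nat \<times> complex) \<Rightarrow> (nat \<Rightarrow> bool) \<Rightarrow> (nat \<Rightarrow> nat \<Rightarrow> real) \<Rightarrow> nat \<Rightarrow> nat \<Rightarrow> bool"
where
  "crossing_data D s b x k l \<longleftrightarrow>
     partner D (s k (x k l)) = s l (x k l) \<and> partner D (s l (x k l)) = s k (x k l) \<and>
     eps D (s k (x k l)) = - (sgnb (b k) * sgnb (b l)) \<and> eps D (s l (x k l)) = sgnb (b k) * sgnb (b l) \<and>
     s k (x k l) \<in> crossing_points D \<and> s l (x k l) \<in> crossing_points D \<and>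
     pt D (s l (x k l)) = pt D (s k (x k l)) \<and> Re (pt D (s k (x k l))) = x k l"

definition three_crossings ::
  "('a) flat_diagram_scheme \<Rightarrow> (nat \<Rightarrow> real \<Rightarrow> nat \<times> complex) \<Rightarrow> (nat \<Rightarrow> bool) \<Rightarrow> (nat \<Rightarrow> nat \<Rightarrow> real) \<Rightarrow> bool"
where
  "three_crossings D s b x \<longleftrightarrow>
     crossing_data D s b x 0 1 \<and> crossing_data D s b x 0 2 \<and> crossing_data D s b x 1 2 \<and>
     (\<forall>p \<in> crossing_points D \<inter> strand_points 3 s.
        p \<in> {s 0 (x 0 1), s 1 (x 0 1), s 0 (x 0 2), s 2 (x 0 2), s 1 (x 1 2), s 2 (x 1 2)}) \<and>
     x 0 1 \<noteq> x 0 2 \<and> x 0 1 \<noteq> x 1 2 \<and> x 0 2 \<noteq> x 1 2 \<and>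
     (\<forall>k < 3. \<forall>e \<in> {-1, 1}. s k e \<notin> crossing_points D)"

lemma R3_data:
  assumes D: "is_flat_diagram D" "is_flat_diagram D'" and move: "flat_R3 D D' s x y"
  obtains b \<tau> where "tangle_pair D D' 3 s b \<tau> 4 (R3_pos x) (R3_pos' y)"
    "three_crossings D s b x" "three_crossings D' s b y"
proof -
  note mv = move[unfolded flat_R3_def]
  have ex: "\<exists>F F'. graph_strands D 3 s F \<and> graph_strands D' 3 s F' \<and>
        F 0 (-1) < F 1 (-1) \<and> F 1 (-1) < F 2 (-1) \<and>
        (\<forall>l < 3. \<forall>k < l. {r \<in> {-1..1}. F k r = F l r} = {x k l} \<and>
                         {r \<in> {-1..1}. F' k r = F' l r} = {y k l}) \<and>
        x 0 1 < x 0 2 \<and> x 0 2 < x 1 2 \<and> y 1 2 < y 0 2 \<and> y 0 2 < y 0 1"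
    by (rule conjunct1[OF mv])
  have agree: "agree_off_strands D D' 3 s" by (rule conjunct1[OF conjunct2[OF mv]])
  have cr: "\<forall>l < 3. \<forall>k < l. pt D (s k (x k l)) \<in> crossings D \<and> pt D' (s k (y k l)) \<in> crossings D'"
    by (rule conjunct1[OF conjunct2[OF conjunct2[OF mv]]])
  have far: "crossings D' - box = crossings D - box" by (rule conjunct2[OF conjunct2[OF conjunct2[OF mv]]])
  from ex obtain F F' where g: "graph_strands D 3 s F" "graph_strands D' 3 s F'"
    and ord: "F 0 (-1) < F 1 (-1)" "F 1 (-1) < F 2 (-1)"
    and zz: "\<forall>l < 3. \<forall>k < l. {r \<in> {-1..1}. F k r = F l r} = {x k l} \<and>
                         {r \<in> {-1..1}. F' k r = F' l r} = {y k l}"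
    and xy: "x 0 1 < x 0 2" "x 0 2 < x 1 2" "y 1 2 < y 0 2" "y 0 2 < y 0 1"
    by (elim exE conjE) (rule that; assumption)
  note g1 = graph_strandsD[OF g(1)] and g2 = graph_strandsD[OF g(2)]
  interpret L: local_move D D' 3 s by (rule graph_move(1)[OF D agree g far])
  interpret L': local_move D' D 3 s by (rule L.sym)
  have ends: "F' k (-1) = F k (-1)" "F' k 1 = F k 1" if "k < 3" for k
    using graph_move(2,3)[OF D agree g far that] .
  obtain b \<tau> where b: "\<And>k. k < 3 \<Longrightarrow> oriented_segment (ncomp D) (s k) (b k) (\<tau> k)"
    using orient_strands[of 3 "ncomp D" s] g1(1) by blast
  have b': "oriented_segment (ncomp D') (s k) (b k) (\<tau> k)" if "k < 3" for k
    using b[OF that] L.ncomp_eq by simp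
  have order: "F k (-1) < F l (-1)" if "k < l" "l < 3" for k l
    using that pairs_below_three[of k l] ord by auto
  have order': "F' k (-1) < F' l (-1)" if "k < l" "l < 3" for k l
    using order[OF that] ends(1) that by simp
  have zero: "{r \<in> {-1..1}. F k r = F l r} = {x k l}" "{r \<in> {-1..1}. F' k r = F' l r} = {y k l}"
    if "k < l" "l < 3" for k l using zz that by blast+
  have crs: "pt D (s k (x k l)) \<in> crossings D" "pt D' (s k (y k l)) \<in> crossings D'" if "k < l" "l < 3" for k l
    using cr that by blast+
  note c = L.graph_crossings[OF g(1) b order zero(1) crs(1)]
  note c' = L'.graph_crossings[OF g(2) b' order' zero(2) crs(2)]
  have le: "x 1 2 \<le> 1" "-1 < x 0 1" "y 0 1 \<le> 1" "-1 < y 1 2"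
    using c(1)[of 1 2] c(1)[of 0 1] c'(1)[of 1 2] c'(1)[of 0 1] by auto
  \<comment> \<open>The two graphs that cross last before the move do so first after it, and all graphs keep their end points.\<close>
  have lt: "x 1 2 < 1" "y 0 1 < 1"
  proof -
    have z: "{r \<in> {-1..1}. F' 1 r = F' 2 r} = {y 1 2}" "{r \<in> {-1..1}. F 0 r = F 1 r} = {x 0 1}"
      by (rule zero; simp)+
    have "F' 1 1 \<noteq> F' 2 1"
    proof
      assume "F' 1 1 = F' 2 1"
      then have "1 \<in> {r \<in> {-1..1}. F' 1 r = F' 2 r}" by simp
      then have "1 = y 1 2" unfolding z(1) by simp
      then show False using xy le by auto
    qed
    moreover have "x 1 2 \<in> {r \<in> {-1..1}. F 1 r = F 2 r}" using zero(1)[of 1 2] by simp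
    ultimately show "x 1 2 < 1" using ends(2)[of 1] ends(2)[of 2] le by (auto simp: less_le)
    have "F 0 1 \<noteq> F 1 1"
    proof
      assume "F 0 1 = F 1 1"
      then have "1 \<in> {r \<in> {-1..1}. F 0 r = F 1 r}" by simp
      then have "1 = x 0 1" unfolding z(2) by simp
      then show False using xy le by auto
    qed
    moreover have "y 0 1 \<in> {r \<in> {-1..1}. F' 0 r = F' 1 r}" using zero(2)[of 0 1] by simp
    ultimately show "y 0 1 < 1" using ends(2)[of 0] ends(2)[of 1] le by (auto simp: less_le)
  qed
  have s_ne: "s k e \<noteq> s l r" if "k < 3" "l < 3" "e \<in> {-1, 1}" "-1 < r" "r < 1" for k l e r
    using inj_onD[OF g1(4)[of 0], of "(k, e)" "(l, r)"] that by auto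
  have near: "p \<in> {s 0 (x 0 1), s 1 (x 0 1), s 0 (x 0 2), s 2 (x 0 2), s 1 (x 1 2), s 2 (x 1 2)}"
    if p: "p \<in> crossing_points D \<inter> strand_points 3 s" for p
  proof -
    have "\<exists>k l. k < l \<and> l < 3 \<and> (p = s k (x k l) \<or> p = s l (x k l))" by (rule c(2)) (use p in auto)
    then obtain k l where "k < l \<and> l < 3" "p = s k (x k l) \<or> p = s l (x k l)" by blast
    then show ?thesis unfolding pairs_below_three by auto
  qed
  have near': "p \<in> {s 0 (y 0 1), s 1 (y 0 1), s 0 (y 0 2), s 2 (y 0 2), s 1 (y 1 2), s 2 (y 1 2)}"
    if p: "p \<in> crossing_points D' \<inter> strand_points 3 s" for p
  proof -
    have "\<exists>k l. k < l \<and> l < 3 \<and> (p = s k (y k l) \<or> p = s l (y k l))" by (rule c'(2)) (use p in auto)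
    then obtain k l where "k < l \<and> l < 3" "p = s k (y k l) \<or> p = s l (y k l)" by blast
    then show ?thesis unfolding pairs_below_three by auto
  qed
  have t: "three_crossings D s b x"
    unfolding three_crossings_def crossing_data_def
  proof (intro conjI ballI allI impI)
    fix k :: nat and e :: real assume k: "k < 3" "e \<in> {-1, 1}"
    then have "s k e \<in> strand_points 3 s" by (auto intro: strand_point)
    then show "s k e \<notin> crossing_points D"
      using near[of "s k e"] s_ne[OF k(1) _ k(2)] xy le lt by auto
  qed (use c(1)[of 0 1] c(1)[of 0 2] c(1)[of 1 2] near xy in auto)
  have t': "three_crossings D' s b y"
    unfolding three_crossings_def crossing_data_def
  proof (intro conjI ballI allI impI)
    fix k :: nat and e :: real assume k: "k < 3" "e \<in> {-1, 1}"
    then have "s k e \<in> strand_points 3 s" by (auto intro: strand_point)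
    then show "s k e \<notin> crossing_points D'"
      using near'[of "s k e"] s_ne[OF k(1) _ k(2)] xy le lt by auto
  qed (use c'(1)[of 0 1] c'(1)[of 0 2] c'(1)[of 1 2] near' xy in auto)
  have marks: "strand_marks 3 4 s (R3_pos x) \<supseteq> {s 0 (x 0 1), s 1 (x 0 1), s 0 (x 0 2), s 2 (x 0 2), s 1 (x 1 2), s 2 (x 1 2)}"
    "strand_marks 3 4 s (R3_pos' y) \<supseteq> {s 0 (y 0 1), s 1 (y 0 1), s 0 (y 0 2), s 2 (y 0 2), s 1 (y 1 2), s 2 (y 1 2)}"
    unfolding strand_marks_image lessThan_three lessThan_four by (auto simp: R3_pos_def R3_pos'_def)
  have less4: "i < 4 \<longleftrightarrow> i = 0 \<or> i = 1 \<or> i = 2 \<or> i = 3" "Suc i < 4 \<longleftrightarrow> i = 0 \<or> i = 1 \<or> i = 2" for i :: nat by auto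
  have "tangle_pair D D' 3 s b \<tau> 4 (R3_pos x) (R3_pos' y)"
  proof (intro tangle_pair.intro tangle.intro)
    show "marked_strands (ncomp D) 3 s b \<tau> 4 (R3_pos x)"
    proof (rule marked_strands.intro)
      show "R3_pos x (4 * k + i) \<in> {-1..1}" if "k < 3" "i < 4" for k i
        using that xy le lt by (auto simp: R3_pos_def less_three_iff less4)
      show "R3_pos x (4 * k + i) < R3_pos x (4 * k + Suc i)" if "k < 3" "Suc i < 4" for k i
        using that xy le lt by (auto simp: R3_pos_def less_three_iff less4)
    qed (use b g1(4)[of 0] in auto)
    show "marked_strands (ncomp D') 3 s b \<tau> 4 (R3_pos' y)"
    proof (rule marked_strands.intro)
      show "R3_pos' y (4 * k + i) \<in> {-1..1}" if "k < 3" "i < 4" for k i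
        using that xy le lt by (auto simp: R3_pos'_def less_three_iff less4)
      show "R3_pos' y (4 * k + i) < R3_pos' y (4 * k + Suc i)" if "k < 3" "Suc i < 4" for k i
        using that xy le lt by (auto simp: R3_pos'_def less_three_iff less4)
    qed (use b' g1(4)[of 0] in auto)
    show "local_move D D' 3 s" "local_move D' D 3 s" by (rule L.local_move_axioms L.sym)+
    show "tangle_axioms D 3 s 4 (R3_pos x)" "tangle_axioms D' 3 s 4 (R3_pos' y)"
      unfolding tangle_axioms_def
      by (rule subsetI, rule subsetD[OF marks(1)], rule near, assumption)
        (rule subsetI, rule subsetD[OF marks(2)], rule near', assumption)
  qed
  then show ?thesis using t t' by (rule that)
qed

lemma list_all_upt: "list_all P [0..<n] \<Longrightarrow> i < n \<Longrightarrow> P i"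
  by (simp add: list_all_iff)

lemma R3_outer: assumes "n < 24" "wire R3_arcs n = n" shows "n \<in> {0, 7, 8, 15, 16, 23}"
proof -
  have "list_all (\<lambda>n. wire R3_arcs n = n \<longrightarrow> n \<in> set [0, 7, 8, 15, 16, 23]) [0..<24]" by code_simp
  from list_all_upt[OF this assms(1)] show ?thesis using assms(2) by simp
qed

definition TL_diagrams :: "(nat \<times> nat) list list" where
  "TL_diagrams = [TL_1, TL_e1, TL_e2, TL_e1e2, TL_e2e1]"

lemma TL_outer:
  assumes "r \<in> set TL_diagrams" "n < 24" "wire R3_arcs n = n"
  shows "wire r n < 24 \<and> wire R3_arcs (wire r n) = wire r n"
proof -
  have "list_all (\<lambda>r. list_all (\<lambda>n. wire r n < 24 \<and> wire R3_arcs (wire r n) = wire r n) [0, 7, 8, 15, 16, 23]) TL_diagrams"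
    by code_simp
  then show ?thesis using assms(1) R3_outer[OF assms(2,3)] by (auto simp: list_all_iff)
qed

lemma R3_labels:
  "{..<24} \<subseteq> labels (R3_before t t' t'')" "{..<24} \<subseteq> labels (R3_after t t' t'')" "labels R3_arcs \<subseteq> {..<24}"
proof -
  have "list_all (\<lambda>n. n \<in> set [2, 3, 10, 11, 4, 5, 18, 19, 12, 13, 20, 21, 0, 1, 6, 7, 8, 9, 14, 15, 16, 17, 22, 23]) [0..<24]"
    by code_simp
  then have *: "{..<24} \<subseteq> {2, 3, 10, 11, 4, 5, 18, 19, 12, 13, 20, 21, 0, 1, 6, 7, 8, 9, 14, 15, 16, 17, 22, 23::nat}"
    by (auto simp only: list_all_iff list.set set_upt atLeastLessThan_iff lessThan_iff subset_iff)
  show "{..<24} \<subseteq> labels (R3_before t t' t'')" "{..<24} \<subseteq> labels (R3_after t t' t'')"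
    by (rule order_trans[OF *]; simp add: R3_before_def R3_after_def R3_marks_def)+
  show "labels R3_arcs \<subseteq> {..<24}" by (simp add: R3_arcs_def)
qed

text \<open>
  The values of the eight states on each side, as a function of the values of the five planar
  tangles without crossings: all are planar tangles, and one has a loop in addition.
\<close>

definition R3_value_before :: "'r::comm_ring_1 \<Rightarrow> ((nat \<times> nat) list \<Rightarrow> 'r) \<Rightarrow> bool \<Rightarrow> bool \<Rightarrow> bool \<Rightarrow> 'r" where
  "R3_value_before d W t01 t02 t12 =
     (if t01 then (if t02 then (if t12 then W TL_1 else W TL_e1) else (if t12 then W TL_e2 else W TL_e2e1))
      else (if t02 then (if t12 then W TL_e1 else d * W TL_e1) else (if t12 then W TL_e1e2 else W TL_e1)))"

definition R3_value_after :: "'r::comm_ring_1 \<Rightarrow> ((nat \<times> nat) list \<Rightarrow> 'r) \<Rightarrow> bool \<Rightarrow> bool \<Rightarrow> bool \<Rightarrow> 'r" where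
  "R3_value_after d W t01 t02 t12 =
     (if t12 then (if t02 then (if t01 then W TL_1 else W TL_e2) else (if t01 then W TL_e1 else W TL_e1e2))
      else (if t02 then (if t01 then W TL_e2 else d * W TL_e2) else (if t01 then W TL_e2e1 else W TL_e2)))"

lemma R3_value_before:
  assumes "\<And>r cyc. contracts_to 24 R3_arcs (R3_before t01 t02 t12) r cyc \<Longrightarrow> X = d ^ (if cyc = [] then 0 else 1) * W r"
  shows "X = R3_value_before d W t01 t02 t12"
  using assms[of TL_1 "[]"] assms[of TL_e1 "[]"] assms[of TL_e2 "[]"] assms[of TL_e1e2 "[]"] assms[of TL_e2e1 "[]"]
    assms[of TL_e1 "[3, 4, 19, 20, 12, 11]"] contracts_R3_before
  by (cases t01; cases t02; cases t12) (simp_all add: R3_value_before_def)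

lemma R3_value_after:
  assumes "\<And>r cyc. contracts_to 24 R3_arcs (R3_after t01 t02 t12) r cyc \<Longrightarrow> X = d ^ (if cyc = [] then 0 else 1) * W r"
  shows "X = R3_value_after d W t01 t02 t12"
  using assms[of TL_1 "[]"] assms[of TL_e1 "[]"] assms[of TL_e2 "[]"] assms[of TL_e1e2 "[]"] assms[of TL_e2e1 "[]"]
    assms[of TL_e2 "[11, 12, 4, 3, 20, 19]"] contracts_R3_after
  by (cases t01; cases t02; cases t12) (simp_all add: R3_value_after_def)

text \<open>
  The weight of the smoothing of shape \<open>t\<close>, where \<open>f\<close> tells that the strands are antiparallel, so that the shape \<open>True\<close> is
  disoriented.
\<close>

definition smoothing_weight :: "(complex \<Rightarrow> 'r) \<Rightarrow> (complex \<Rightarrow> 'r) \<Rightarrow> complex \<Rightarrow> bool \<Rightarrow> bool \<Rightarrow> 'r" where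
  "smoothing_weight \<alpha> \<beta> z f t = (if t = f then \<beta> z else \<alpha> z)"

lemma sum_three_states:
  assumes "z1 \<noteq> z2" "z1 \<noteq> z3" "z2 \<noteq> z3"
  shows "(\<Sum>T\<in>Pow {z1, z2, z3}. weight \<alpha> \<beta> {z1, z2, z3} T * V ((z1 \<in> T) = f1) ((z2 \<in> T) = f2) ((z3 \<in> T) = f3)) =
    (\<Sum>t1\<in>UNIV. \<Sum>t2\<in>UNIV. \<Sum>t3\<in>UNIV. smoothing_weight \<alpha> \<beta> z1 f1 t1 * smoothing_weight \<alpha> \<beta> z2 f2 t2 *
       smoothing_weight \<alpha> \<beta> z3 f3 t3 * V t1 t2 t3)"
  using assms
  by (cases f1; cases f2; cases f3)
    (simp_all add: sum_Pow_insert weight_def smoothing_weight_def UNIV_bool add_ac mult_ac)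

text \<open>
  The Yang-Baxter relation in the Temperley-Lieb algebra. After the five matchings are compared, it remains that the
  coefficients of \<open>TL_e1\<close> and \<open>TL_e2\<close> are exchanged, which is the hypothesis.
\<close>

lemma R3_identity:
  fixes a1 a2 a3 b1 b2 b3 d :: "'r::comm_ring_1"
  assumes "a1 * a2 * b3 + b1 * a2 * a3 + b1 * a2 * b3 * d + b1 * b2 * b3 = a1 * b2 * a3"
    and A: "A1 True = a1" "A1 False = b1" "A2 True = a2" "A2 False = b2" "A3 True = a3" "A3 False = b3"
  shows "(\<Sum>t1\<in>UNIV. \<Sum>t2\<in>UNIV. \<Sum>t3\<in>UNIV. A1 t1 * A2 t2 * A3 t3 * R3_value_before d W t1 t2 t3) =
    (\<Sum>t1\<in>UNIV. \<Sum>t2\<in>UNIV. \<Sum>t3\<in>UNIV. A1 t1 * A2 t2 * A3 t3 * R3_value_after d W t1 t2 t3)"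
proof -
  have l: "(\<Sum>t1\<in>UNIV. \<Sum>t2\<in>UNIV. \<Sum>t3\<in>UNIV. A1 t1 * A2 t2 * A3 t3 * R3_value_before d W t1 t2 t3) =
    a1 * a2 * a3 * W TL_1 + (a1 * a2 * b3 + b1 * a2 * a3 + b1 * a2 * b3 * d + b1 * b2 * b3) * W TL_e1 +
    a1 * b2 * a3 * W TL_e2 + a1 * b2 * b3 * W TL_e2e1 + b1 * b2 * a3 * W TL_e1e2"
    by (simp add: UNIV_bool A R3_value_before_def algebra_simps)
  have r: "(\<Sum>t1\<in>UNIV. \<Sum>t2\<in>UNIV. \<Sum>t3\<in>UNIV. A1 t1 * A2 t2 * A3 t3 * R3_value_after d W t1 t2 t3) =
    a1 * a2 * a3 * W TL_1 + a1 * b2 * a3 * W TL_e1 +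
    (a1 * a2 * b3 + b1 * a2 * a3 + b1 * a2 * b3 * d + b1 * b2 * b3) * W TL_e2 + a1 * b2 * b3 * W TL_e2e1 + b1 * b2 * a3 * W TL_e1e2"
    by (simp add: UNIV_bool A R3_value_after_def algebra_simps)
  show ?thesis unfolding l r assms(1) by (simp add: algebra_simps)
qed

lemma ex_pairs_below_three:
  "(\<exists>k l. k < l \<and> l < 3 \<and> Q k l) \<longleftrightarrow> Q 0 1 \<or> Q 0 2 \<or> Q 1 2" for Q :: "nat \<Rightarrow> nat \<Rightarrow> bool"
proof
  assume "\<exists>k l. k < l \<and> l < 3 \<and> Q k l"
  then obtain k l where "k < l \<and> l < 3" "Q k l" by iprover
  then show "Q 0 1 \<or> Q 0 2 \<or> Q 1 2" unfolding pairs_below_three by auto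
next
  have "0 < (1::nat) \<and> 1 < (3::nat)" "0 < (2::nat) \<and> 2 < (3::nat)" "1 < (2::nat) \<and> 2 < (3::nat)" by simp_all
  moreover assume "Q 0 1 \<or> Q 0 2 \<or> Q 1 2"
  ultimately show "\<exists>k l. k < l \<and> l < 3 \<and> Q k l" by iprover
qed

lemma all_pairs_below_three:
  "(\<forall>l < 3. \<forall>k < l. Q k l) \<longleftrightarrow> Q 0 1 \<and> Q 0 2 \<and> Q 1 2" for Q :: "nat \<Rightarrow> nat \<Rightarrow> bool"
proof -
  have "(\<forall>l < 3. \<forall>k < l. Q k l) \<longleftrightarrow> \<not> (\<exists>k l. k < l \<and> l < 3 \<and> \<not> Q k l)" by blast
  then show ?thesis unfolding ex_pairs_below_three by blast
qed

lemma ex_below_three: "(\<exists>k < 3. Q k) \<longleftrightarrow> Q 0 \<or> Q 1 \<or> Q 2"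
  and all_below_three: "(\<forall>k < 3. Q k) \<longleftrightarrow> Q 0 \<and> Q 1 \<and> Q 2" for Q :: "nat \<Rightarrow> bool"
  unfolding less_three_iff by auto

definition crossing_at ::
  "('a) flat_diagram_scheme \<Rightarrow> (nat \<Rightarrow> real \<Rightarrow> nat \<times> complex) \<Rightarrow> (nat \<Rightarrow> nat \<Rightarrow> real) \<Rightarrow> nat \<Rightarrow> nat \<Rightarrow> complex" where
  "crossing_at D s x k l = pt D (s k (x k l))"

text \<open>
  One side of the third move. The number \<open>L k l\<close> is that of the left end of the strand \<open>k\<close> at its crossing with the strand
  \<open>l\<close>, \<open>\<theta>\<close> gives the values of a potential on the numbered ends, and \<open>c k l\<close> is its constant at the crossing.
\<close>

locale three_strands = tangle D D' 3 s b \<tau> 4 P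
  for D D' :: "('a) flat_diagram_scheme" and s b \<tau> P +
  fixes x :: "nat \<Rightarrow> nat \<Rightarrow> real" and L :: "nat \<Rightarrow> nat \<Rightarrow> nat" and \<theta> :: "nat \<Rightarrow> int" and c :: "nat \<Rightarrow> nat \<Rightarrow> int"
  assumes cr: "three_crossings D s b x"
    and lab: "\<forall>l < 3. \<forall>k < l. L k l + 1 < 24 \<and> L l k + 1 < 24 \<and>
      e (L k l) = (s k (x k l), \<not> b k) \<and> e (L k l + 1) = (s k (x k l), b k) \<and>
      e (L l k) = (s l (x k l), \<not> b l) \<and> e (L l k + 1) = (s l (x k l), b l)"
    and th: "\<forall>l < 3. \<forall>k < l. \<theta> (L k l) = sgnb (b l) + c k l \<and> \<theta> (L k l + 1) = - sgnb (b l) + c k l \<and>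
      \<theta> (L l k) = - sgnb (b k) + c k l \<and> \<theta> (L l k + 1) = sgnb (b k) + c k l"
    and end_labels: "\<forall>k < 3. e (8 * k) = (s k (-1), \<not> b k) \<and> e (8 * k + 1) = (s k (-1), b k) \<and>
      e (8 * k + 6) = (s k 1, \<not> b k) \<and> e (8 * k + 7) = (s k 1, b k) \<and>
      \<theta> (8 * k) = \<theta> (8 * k + 1) \<and> \<theta> (8 * k + 6) = \<theta> (8 * k + 7)"
    and marks_ends: "\<forall>p \<in> marks - crossing_points D. \<exists>k < 3. p = s k (-1) \<or> p = s k 1"
    and flat: "\<forall>(i, j) \<in> set R3_arcs. \<theta> i = \<theta> j"
begin

abbreviation "z \<equiv> crossing_at D s x"
abbreviation "Z \<equiv> {z 0 1, z 0 2, z 1 2}"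

lemma cross: assumes "k < l" "l < 3"
  shows "partner D (s k (x k l)) = s l (x k l)" "partner D (s l (x k l)) = s k (x k l)"
    "eps D (s k (x k l)) = - (sgnb (b k) * sgnb (b l))" "eps D (s l (x k l)) = sgnb (b k) * sgnb (b l)"
    "s k (x k l) \<in> crossing_points D" "s l (x k l) \<in> crossing_points D"
    "pt D (s l (x k l)) = z k l" "Re (z k l) = x k l"
proof -
  have "crossing_data D s b x k l"
    using cr assms pairs_below_three[of k l] by (auto simp: three_crossings_def)
  then show "partner D (s k (x k l)) = s l (x k l)" "partner D (s l (x k l)) = s k (x k l)"
    "eps D (s k (x k l)) = - (sgnb (b k) * sgnb (b l))" "eps D (s l (x k l)) = sgnb (b k) * sgnb (b l)"
    "s k (x k l) \<in> crossing_points D" "s l (x k l) \<in> crossing_points D"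
    "pt D (s l (x k l)) = z k l" "Re (z k l) = x k l"
    by (simp_all add: crossing_data_def crossing_at_def)
qed

lemma near_cases:
  assumes "p \<in> crossing_points D \<inter> K" shows "\<exists>k l. k < l \<and> l < 3 \<and> (p = s k (x k l) \<or> p = s l (x k l))"
proof -
  have "p \<in> {s 0 (x 0 1), s 1 (x 0 1), s 0 (x 0 2), s 2 (x 0 2), s 1 (x 1 2), s 2 (x 1 2)}"
    using cr assms unfolding three_crossings_def by blast
  then show ?thesis unfolding ex_pairs_below_three by simp
qed

lemma potential: "potential D all_marks (pot \<theta>)"
proof (rule pot_potential)
  fix p assume "p \<in> crossing_points D \<inter> K"
  then obtain k l where kl: "k < l" "l < 3" "p = s k (x k l) \<or> p = s l (x k l)" using near_cases by blast
  note t = th[rule_format, OF kl(2,1)] and la = lab[rule_format, OF kl(2,1)] and cd = cross[OF kl(1,2)]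
  have "balanced (pot \<theta>) (s k (x k l))" "balanced (pot \<theta>) (s l (x k l))"
    by (rule crossing_balanced[where kL = "L k l" and kR = "L k l + 1" and lL = "L l k" and lR = "L l k + 1"
        and p = "s k (x k l)" and q = "s l (x k l)" and c = "c k l" and bk = "b k" and bl = "b l"]; use t la cd in simp)+
  then show "balanced (pot \<theta>) p" using kl(3) by blast
next
  fix p assume "p \<in> marks - crossing_points D"
  then obtain k where k: "k < 3" "p = s k (-1) \<or> p = s k 1" using marks_ends by blast
  note el = end_labels[rule_format, OF k(1)]
  have less: "8 * k < N" "8 * k + 1 < N" "8 * k + 6 < N" "8 * k + 7 < N" using k(1) by auto
  have "pot \<theta> (s k (-1), \<not> b k) = pot \<theta> (s k (-1), b k)" "pot \<theta> (s k 1, \<not> b k) = pot \<theta> (s k 1, b k)"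
    using less[THEN pot_label, of \<theta>] el by simp_all
  then show "pot \<theta> (p, True) = pot \<theta> (p, False)" using k(2) by (cases "b k") auto
qed

lemma Z_box: "crossings D \<inter> box = Z"
proof -
  have K: "s k (x k l) \<in> K \<and> s l (x k l) \<in> K" if "k < l" "l < 3" for k l
  proof -
    note la = lab[rule_format, OF that(2,1)]
    have "e (L k l) \<in> marks \<times> UNIV" "e (L l k) \<in> marks \<times> UNIV"
      unfolding e_image[symmetric] by (rule imageI, use la in simp)+
    then show ?thesis using la marks_strands by auto
  qed
  show ?thesis unfolding near_crossings
  proof
    show "pt D ` (crossing_points D \<inter> K) \<subseteq> Z"
    proof
      fix y assume "y \<in> pt D ` (crossing_points D \<inter> K)"
      then obtain p where p: "p \<in> crossing_points D \<inter> K" "y = pt D p" by blast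
      from near_cases[OF p(1)] obtain k l where kl: "k < l \<and> l < 3" "p = s k (x k l) \<or> p = s l (x k l)" by blast
      then have "y = z k l" using cross(7)[of k l] p(2) by (auto simp: crossing_at_def)
      then show "y \<in> Z" using kl(1) unfolding pairs_below_three by auto
    qed
    have "z k l \<in> pt D ` (crossing_points D \<inter> K)" if "k < l" "l < 3" for k l
      using cross(5)[OF that] K[OF that] by (auto simp: crossing_at_def)
    then show "Z \<subseteq> pt D ` (crossing_points D \<inter> K)" by auto
  qed
qed

lemma Z_distinct: "z 0 1 \<noteq> z 0 2" "z 0 1 \<noteq> z 1 2" "z 0 2 \<noteq> z 1 2"
  using cross(8)[of 0 1] cross(8)[of 0 2] cross(8)[of 1 2] cr unfolding three_crossings_def by auto

lemma arcs: "joins_pairs (arc_map all_marks) e R3_arcs"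
  using arc_labels[of 0 0] arc_labels[of 0 1] arc_labels[of 0 2] arc_labels[of 1 0] arc_labels[of 1 1] arc_labels[of 1 2]
    arc_labels[of 2 0] arc_labels[of 2 1] arc_labels[of 2 2]
  by (simp add: R3_arcs_def One_nat_def[symmetric])

lemma joins:
  assumes "S \<inter> Z = {}"
  shows "joins_pairs (mark_join D (S \<union> T)) e
    (smooth ((z 0 1 \<in> T) = (b 0 \<noteq> b 1)) (L 0 1) (L 0 1 + 1) (L 1 0) (L 1 0 + 1) @
     smooth ((z 0 2 \<in> T) = (b 0 \<noteq> b 2)) (L 0 2) (L 0 2 + 1) (L 2 0) (L 2 0 + 1) @
     smooth ((z 1 2 \<in> T) = (b 1 \<noteq> b 2)) (L 1 2) (L 1 2 + 1) (L 2 1) (L 2 1 + 1) @ R3_marks)"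
proof -
  have 1: "joins_pairs (mark_join D (S \<union> T)) e
      (smooth ((z k l \<in> T) = (b k \<noteq> b l)) (L k l) (L k l + 1) (L l k) (L l k + 1))" if kl: "k < l" "l < 3" for k l
  proof -
    note la = lab[rule_format, OF kl(2,1)]
    have "z k l \<in> Z" using kl pairs_below_three[of k l] by auto
    then have "z k l \<notin> S" using assms by blast
    then have "(pt D (s k (x k l)) \<in> S \<union> T) = (z k l \<in> T)" by (simp add: crossing_at_def)
    then show ?thesis
      using crossing_joins[OF cross(5)[OF kl] cross(1)[OF kl], of "L k l" "b k" "L k l + 1" "L l k" "b l" "L l k + 1" "S \<union> T"] la
      by simp
  qed
  have 2: "joins_pairs (mark_join D (S \<union> T)) e [(8 * k, 8 * k + 1), (8 * k + 6, 8 * k + 7)]" if k: "k < 3" for k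
  proof -
    have "s k (-1) \<notin> crossing_points D" "s k 1 \<notin> crossing_points D"
      using cr k unfolding three_crossings_def by auto
    then show ?thesis using end_labels[rule_format, OF k] by (simp add: D.mark_join_eq)
  qed
  show ?thesis
    using 1[of 0 1] 1[of 0 2] 1[of 1 2] 2[of 0] 2[of 1] 2[of 2] by (simp add: R3_marks_def)
qed

abbreviation "Outer \<equiv> all_marks \<times> UNIV - inner_ends e 24 R3_arcs"

definition side_value :: "(int \<Rightarrow> 'r::comm_ring_1) \<Rightarrow> complex set \<Rightarrow> (nat \<times> nat) list \<Rightarrow> 'r" where
  "side_value \<kappa> S r = loops_eval \<kappa> Outer (arc_map all_marks) (rewire e 24 r (mark_join D S)) (pot \<theta>)"

lemma contraction:
  assumes "S \<inter> Z = {}" "T \<subseteq> Z"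
    and lab24: "{..<24} \<subseteq> labels (smooth ((z 0 1 \<in> T) = (b 0 \<noteq> b 1)) (L 0 1) (L 0 1 + 1) (L 1 0) (L 1 0 + 1) @
     smooth ((z 0 2 \<in> T) = (b 0 \<noteq> b 2)) (L 0 2) (L 0 2 + 1) (L 2 0) (L 2 0 + 1) @
     smooth ((z 1 2 \<in> T) = (b 1 \<noteq> b 2)) (L 1 2) (L 1 2 + 1) (L 2 1) (L 2 1 + 1) @ R3_marks)"
    and chk: "contracts_to 24 R3_arcs (smooth ((z 0 1 \<in> T) = (b 0 \<noteq> b 1)) (L 0 1) (L 0 1 + 1) (L 1 0) (L 1 0 + 1) @
     smooth ((z 0 2 \<in> T) = (b 0 \<noteq> b 2)) (L 0 2) (L 0 2 + 1) (L 2 0) (L 2 0 + 1) @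
     smooth ((z 1 2 \<in> T) = (b 1 \<noteq> b 2)) (L 1 2) (L 1 2 + 1) (L 2 1) (L 2 1 + 1) @ R3_marks) r cyc"
  shows "loops_eval \<kappa> (all_marks \<times> UNIV) (arc_map all_marks) (mark_join D (S \<union> T)) (pot \<theta>) =
      \<kappa> 0 ^ (if cyc = [] then 0 else 1) * side_value \<kappa> S r"
    and "loop_system Outer (arc_map all_marks) (rewire e 24 r (mark_join D S))"
proof -
  have N: "N = 24" by simp
  have TB: "T \<subseteq> box" using assms(2) Z_box by blast
  note c = state_contraction[where \<theta> = \<theta>, OF joins[OF assms(1)] _ TB, unfolded N, OF lab24 arcs flat R3_labels(3) chk]
  show "loops_eval \<kappa> (all_marks \<times> UNIV) (arc_map all_marks) (mark_join D (S \<union> T)) (pot \<theta>) =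
      \<kappa> 0 ^ (if cyc = [] then 0 else 1) * side_value \<kappa> S r"
    "loop_system Outer (arc_map all_marks) (rewire e 24 r (mark_join D S))"
    unfolding side_value_def by (rule c)+
qed

lemma bracket_local:
  fixes d :: "'r::comm_ring_1"
  assumes K0: "\<K> 0 = 1"
    and V: "\<And>S T. S \<subseteq> crossings D - box \<Longrightarrow> T \<subseteq> Z \<Longrightarrow>
      loops_eval (\<lambda>h. d * \<K> (nat h div 4)) (all_marks \<times> UNIV) (arc_map all_marks) (mark_join D (S \<union> T)) (pot \<theta>) =
      V S ((z 0 1 \<in> T) = (b 0 \<noteq> b 1)) ((z 0 2 \<in> T) = (b 0 \<noteq> b 2)) ((z 1 2 \<in> T) = (b 1 \<noteq> b 2))"
  shows "d * bracket \<alpha> \<beta> d \<K> D = (\<Sum>S\<in>Pow (crossings D - box). weight \<alpha> \<beta> (crossings D - box) S *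
    d ^ card (unmarked (ncomp D) all_marks) *
    (\<Sum>t1\<in>UNIV. \<Sum>t2\<in>UNIV. \<Sum>t3\<in>UNIV. smoothing_weight \<alpha> \<beta> (z 0 1) (b 0 \<noteq> b 1) t1 *
       smoothing_weight \<alpha> \<beta> (z 0 2) (b 0 \<noteq> b 2) t2 * smoothing_weight \<alpha> \<beta> (z 1 2) (b 1 \<noteq> b 2) t3 * V S t1 t2 t3))"
proof -
  have C: "crossings D = (crossings D - box) \<union> Z" "(crossings D - box) \<inter> Z = {}" using Z_box by blast+
  have "(\<Sum>T\<in>Pow Z. weight \<alpha> \<beta> Z T * loops_eval (\<lambda>h. d * \<K> (nat h div 4)) (all_marks \<times> UNIV) (arc_map all_marks)
      (mark_join D (S \<union> T)) (pot \<theta>)) =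
    (\<Sum>t1\<in>UNIV. \<Sum>t2\<in>UNIV. \<Sum>t3\<in>UNIV. smoothing_weight \<alpha> \<beta> (z 0 1) (b 0 \<noteq> b 1) t1 *
       smoothing_weight \<alpha> \<beta> (z 0 2) (b 0 \<noteq> b 2) t2 * smoothing_weight \<alpha> \<beta> (z 1 2) (b 1 \<noteq> b 2) t3 * V S t1 t2 t3)"
    if S: "S \<in> Pow (crossings D - box)" for S
  proof -
    have "S \<subseteq> crossings D - box" using S by blast
    then have "(\<Sum>T\<in>Pow Z. weight \<alpha> \<beta> Z T * loops_eval (\<lambda>h. d * \<K> (nat h div 4)) (all_marks \<times> UNIV) (arc_map all_marks)
        (mark_join D (S \<union> T)) (pot \<theta>)) =
      (\<Sum>T\<in>Pow Z. weight \<alpha> \<beta> Z T *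
        V S ((z 0 1 \<in> T) = (b 0 \<noteq> b 1)) ((z 0 2 \<in> T) = (b 0 \<noteq> b 2)) ((z 1 2 \<in> T) = (b 1 \<noteq> b 2)))"
      by (intro sum.cong refl arg_cong2[where f = "(*)"] V) auto
    then show ?thesis unfolding sum_three_states[OF Z_distinct] .
  qed
  then show ?thesis
    using D.bracket_marked[where K = \<K>, OF all_marks_marking CP_all_marks potential K0 C, of d \<alpha> \<beta>] by simp
qed

end


lemma select_states:
  assumes "z1 \<noteq> z2" "z1 \<noteq> z3" "z2 \<noteq> z3"
  obtains T where "T \<subseteq> {z1, z2, z3}" "((z1 \<in> T) = f1) = t1" "((z2 \<in> T) = f2) = t2" "((z3 \<in> T) = f3) = t3"
proof -
  define T where "T = {z \<in> {z1, z2, z3}. (z = z1 \<longrightarrow> t1 = f1) \<and> (z = z2 \<longrightarrow> t2 = f2) \<and> (z = z3 \<longrightarrow> t3 = f3)}"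
  show ?thesis by (rule that[of T]) (use assms in \<open>auto simp: T_def\<close>)
qed

lemma (in marked_strands) marks_components: "fst ` marks = (\<lambda>k. fst (s k 1)) ` {k. k < m \<and> 0 < w}"
proof -
  have f: "fst (s k r) = fst (s k 1)" if k: "k < m" and r: "r \<in> {-1..1}" for k r
  proof -
    interpret os: oriented_segment nc "s k" "b k" "\<tau> k" by (rule os[OF k])
    have "fst (s k r) = fst (s k (- sg (b k)))" "fst (s k 1) = fst (s k (- sg (b k)))"
      using os.s_eq[of r] os.s_eq[of 1] r by (simp_all add: travel_def)
    then show ?thesis by simp
  qed
  show ?thesis
  proof
    show "fst ` marks \<subseteq> (\<lambda>k. fst (s k 1)) ` {k. k < m \<and> 0 < w}"
    proof
      fix i assume "i \<in> fst ` marks"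
      then obtain k j where k: "i = fst (s k (P (w * k + j)))" "k < m" "j < w" by (auto simp: strand_marks_def)
      from k(1) have "i = fst (s k 1)" unfolding f[OF k(2) P_mem[OF k(2,3)]] .
      then show "i \<in> (\<lambda>k. fst (s k 1)) ` {k. k < m \<and> 0 < w}" using k by (intro image_eqI[of _ _ k]) auto
    qed
    show "(\<lambda>k. fst (s k 1)) ` {k. k < m \<and> 0 < w} \<subseteq> fst ` marks"
    proof
      fix i assume "i \<in> (\<lambda>k. fst (s k 1)) ` {k. k < m \<and> 0 < w}"
      then obtain k where k: "i = fst (s k 1)" "k < m" "0 < w" by blast
      then have "s k (P (w * k + 0)) \<in> marks" unfolding strand_marks_def by blast
      moreover have "fst (s k (P (w * k + 0))) = i" using f[OF k(2) P_mem[OF k(2,3)]] k(1) by simp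
      ultimately show "i \<in> fst ` marks" by force
    qed
  qed
qed

lemma unmarked_fst: "unmarked n M = {..<n} - fst ` M"
  unfolding unmarked_def by force

text \<open>The positions of the marks differ, but every strand carries marks on both sides of the move.\<close>

lemma (in tangle_pair) unmarked_eq: "unmarked (ncomp D') after.all_marks = unmarked (ncomp D) all_marks"
  unfolding unmarked_fst all_marks_def after.all_marks_def image_Un marks_components after.marks_components
    ncomp_eq far_points by (rule refl)

text \<open>
  The numbers of the left ends at the crossings before the move; after the move they are given by \<open>R3_left'\<close>.
\<close>

definition R3_left :: "nat \<Rightarrow> nat \<Rightarrow> nat" where
  "R3_left k l = [0, 2, 4, 10, 0, 12, 18, 20, 0] ! (3 * k + l)"

definition R3_left' :: "nat \<Rightarrow> nat \<Rightarrow> nat" where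
  "R3_left' k l = [0, 4, 2, 12, 0, 10, 20, 18, 0] ! (3 * k + l)"

text \<open>
  Potentials that are constant along the inner arcs, where \<open>p\<close>, \<open>q\<close>, \<open>r\<close> are the directions of the strands 0, 1, 2. They
  are found by continuing from one crossing along inner arcs to the other two; the third inner arc between crossings then
  closes up. The constants at the first crossing are chosen such that both potentials agree on the outer ends.
\<close>

definition R3_pot :: "int \<Rightarrow> int \<Rightarrow> int \<Rightarrow> nat \<Rightarrow> int" where
  "R3_pot p q r n =
    [q, q, q, - q, - q, - q - 2 * r, - q - 2 * r, - q - 2 * r,
     - p, - p, - p, p, p, p - 2 * r, p - 2 * r, p - 2 * r,
     - p - q - r, - p - q - r, - p - q - r, p - q - r, p - q - r, p + q - r, p + q - r, p + q - r] ! n"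

definition R3_pot' :: "int \<Rightarrow> int \<Rightarrow> int \<Rightarrow> nat \<Rightarrow> int" where
  "R3_pot' p q r n =
    [q, q, q, q - 2 * r, q - 2 * r, - q - 2 * r, - q - 2 * r, - q - 2 * r,
     - p, - p, - p, - p - 2 * r, - p - 2 * r, p - 2 * r, p - 2 * r, p - 2 * r,
     - p - q - r, - p - q - r, - p - q - r, q - p - r, q - p - r, p + q - r, p + q - r, p + q - r] ! n"

definition R3_mean :: "int \<Rightarrow> int \<Rightarrow> int \<Rightarrow> nat \<Rightarrow> nat \<Rightarrow> int" where
  "R3_mean p q r k l = (if l = 1 then 0 else if k = 0 then - q - r else p - r)"

definition R3_mean' :: "int \<Rightarrow> int \<Rightarrow> int \<Rightarrow> nat \<Rightarrow> nat \<Rightarrow> int" where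
  "R3_mean' p q r k l = (if l = 1 then - 2 * r else if k = 0 then q - r else - p - r)"

lemma R3_sides:
  assumes tp: "tangle_pair D D' 3 s b \<tau> 4 (R3_pos x) (R3_pos' y)"
    and c: "three_crossings D s b x" and c': "three_crossings D' s b y"
  defines "p \<equiv> sgnb (b 0)" and "q \<equiv> sgnb (b 1)" and "r \<equiv> sgnb (b 2)"
  shows "three_strands D D' s b \<tau> (R3_pos x) x R3_left (R3_pot p q r) (R3_mean p q r)"
    and "three_strands D' D s b \<tau> (R3_pos' y) y R3_left' (R3_pot' p q r) (R3_mean' p q r)"
proof -
  interpret T: tangle_pair D D' 3 s b \<tau> 4 "R3_pos x" "R3_pos' y" by (rule tp)
  have lst: "strand_marks 3 4 s P = (\<lambda>(k, i). s k (P (4 * k + i))) ` ({0, 1, 2} \<times> {0, 1, 2, 3})" for P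
    unfolding strand_marks_image lessThan_three lessThan_four by (rule refl)
  show "three_strands D D' s b \<tau> (R3_pos x) x R3_left (R3_pot p q r) (R3_mean p q r)"
  proof (intro three_strands.intro three_strands_axioms.intro T.tangle_axioms c, unfold all_pairs_below_three all_below_three)
    have "T.marks - crossing_points D \<subseteq> {s 0 (-1), s 0 1, s 1 (-1), s 1 1, s 2 (-1), s 2 1}"
      using c unfolding lst by (auto simp: R3_pos_def three_crossings_def crossing_data_def)
    then show "\<forall>p \<in> T.marks - crossing_points D. \<exists>k < 3. p = s k (-1) \<or> p = s k 1"
      unfolding ex_below_three by blast
  qed (simp_all add: strand_end_def R3_pos_def R3_left_def R3_pot_def R3_mean_def p_def q_def r_def R3_arcs_def)
  show "three_strands D' D s b \<tau> (R3_pos' y) y R3_left' (R3_pot' p q r) (R3_mean' p q r)"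
  proof (intro three_strands.intro three_strands_axioms.intro T.after.tangle_axioms c', unfold all_pairs_below_three all_below_three)
    have "T.after.marks - crossing_points D' \<subseteq> {s 0 (-1), s 0 1, s 1 (-1), s 1 1, s 2 (-1), s 2 1}"
      using c' unfolding lst by (auto simp: R3_pos'_def three_crossings_def crossing_data_def)
    then show "\<forall>p \<in> T.after.marks - crossing_points D'. \<exists>k < 3. p = s k (-1) \<or> p = s k 1"
      unfolding ex_below_three by blast
  qed (simp_all add: strand_end_def R3_pos'_def R3_left'_def R3_pot'_def R3_mean'_def p_def q_def r_def R3_arcs_def)
qed


lemma R3_value_after_cong:
  assumes "\<And>r. r \<in> set TL_diagrams \<Longrightarrow> W r = W' r"
  shows "R3_value_after d W t1 t2 t3 = R3_value_after d W' t1 t2 t3"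
  using assms by (simp add: R3_value_after_def TL_diagrams_def)

text \<open>
  The weights may change with the diagram, as crossings move. Since the strands keep their directions, the same shape of a
  smoothing is oriented at corresponding crossings, so that the relation for the weights by shape is the one of the
  Yang-Baxter relation.
\<close>

lemma bracket_R3:
  fixes d :: "'r::comm_ring_1"
  assumes D: "is_flat_diagram D" "is_flat_diagram D'" and move: "flat_R3 D D' s x y" and K0: "\<K> 0 = 1"
    and far_w: "\<And>z. z \<in> crossings D - box \<Longrightarrow> \<alpha>' z = \<alpha> z \<and> \<beta>' z = \<beta> z"
    and near_w: "\<And>k l. k < l \<Longrightarrow> l < 3 \<Longrightarrow>
      \<alpha>' (crossing_at D' s y k l) = \<alpha> (crossing_at D s x k l) \<and> \<beta>' (crossing_at D' s y k l) = \<beta> (crossing_at D s x k l)"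
  defines "a \<equiv> \<lambda>k l. smoothing_weight \<alpha> \<beta> (crossing_at D s x k l) (eps D (s k (x k l)) = 1)"
  assumes rel: "a 0 1 True * a 0 2 True * a 1 2 False + a 0 1 False * a 0 2 True * a 1 2 True +
      a 0 1 False * a 0 2 True * a 1 2 False * d + a 0 1 False * a 0 2 False * a 1 2 False =
      a 0 1 True * a 0 2 False * a 1 2 True"
  shows "d * bracket \<alpha>' \<beta>' d \<K> D' = d * bracket \<alpha> \<beta> d \<K> D"
proof -
  obtain b \<tau> where tp: "tangle_pair D D' 3 s b \<tau> 4 (R3_pos x) (R3_pos' y)"
    and c: "three_crossings D s b x" "three_crossings D' s b y"
    by (rule R3_data[OF D move])
  interpret T: tangle_pair D D' 3 s b \<tau> 4 "R3_pos x" "R3_pos' y" by (rule tp)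
  interpret T': tangle_pair D' D 3 s b \<tau> 4 "R3_pos' y" "R3_pos x" ..
  define \<theta> \<theta>' where "\<theta> = R3_pot (sgnb (b 0)) (sgnb (b 1)) (sgnb (b 2))"
    and "\<theta>' = R3_pot' (sgnb (b 0)) (sgnb (b 1)) (sgnb (b 2))"
  interpret A: three_strands D D' s b \<tau> "R3_pos x" x R3_left \<theta> "R3_mean (sgnb (b 0)) (sgnb (b 1)) (sgnb (b 2))"
    unfolding \<theta>_def by (rule R3_sides(1)[OF tp c])
  interpret B: three_strands D' D s b \<tau> "R3_pos' y" y R3_left' \<theta>' "R3_mean' (sgnb (b 0)) (sgnb (b 1)) (sgnb (b 2))"
    unfolding \<theta>'_def by (rule R3_sides(2)[OF tp c])
  let ?\<kappa> = "\<lambda>h. d * \<K> (nat h div 4)"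
  have N: "T.N = 24" by simp
  have outer: "T.e n = T.after.e n \<and> \<theta> n = \<theta>' n" if "n < 24" "wire R3_arcs n = n" for n
    using R3_outer[OF that] by (auto simp: strand_end_def R3_pos_def R3_pos'_def \<theta>_def \<theta>'_def R3_pot_def R3_pot'_def)
  have Outer: "B.Outer = A.Outer"
  proof -
    have "T.after.e ` {n. n < 24 \<and> wire R3_arcs n = n} = T.e ` {n. n < 24 \<and> wire R3_arcs n = n}"
      by (rule image_cong[OF refl]) (use outer in auto)
    then show ?thesis using T.outer_set[of R3_arcs] T'.outer_set[of R3_arcs] unfolding N T.far_points by simp
  qed
  \<comment> \<open>The marks common to both sides: the end points of the strands, and the crossing points outside.\<close>
  define M where "M = (crossing_points D - T.K) \<union> {s 0 (-1), s 0 1, s 1 (-1), s 1 1, s 2 (-1), s 2 1}"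
  have OM: "A.Outer \<subseteq> M \<times> UNIV"
  proof -
    have "T.e n \<in> M \<times> UNIV" if "n < 24" "wire R3_arcs n = n" for n
      using R3_outer[OF that] by (auto simp: strand_end_def R3_pos_def M_def)
    then have "T.e ` {n. n < 24 \<and> wire R3_arcs n = n} \<subseteq> M \<times> UNIV" by blast
    moreover have "(crossing_points D - T.K) \<times> UNIV \<subseteq> M \<times> UNIV" unfolding M_def by blast
    ultimately show ?thesis using T.outer_set[of R3_arcs] unfolding N by blast
  qed
  have end_marks: "{s 0 (-1), s 0 1, s 1 (-1), s 1 1, s 2 (-1), s 2 1} \<subseteq> strand_marks 3 4 s P"
    if "P = R3_pos x \<or> P = R3_pos' y" for P
    using that unfolding strand_marks_image lessThan_three lessThan_four by (auto simp: R3_pos_def R3_pos'_def)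
  have MM: "M \<subseteq> T.all_marks" "M \<subseteq> T.after.all_marks"
    using end_marks[of "R3_pos x"] end_marks[of "R3_pos' y"]
    unfolding M_def T.all_marks_def T.after.all_marks_def T.far_points by blast+
  have sysA: "loop_system A.Outer (arc_map T.all_marks) (rewire T.e 24 r (mark_join D S))"
    if r: "r \<in> set TL_diagrams" and S: "S \<inter> A.Z = {}" for r S
  proof -
    have "\<exists>t1 t2 t3. contracts_to 24 R3_arcs (R3_before t1 t2 t3) r []"
      using r contracts_R3_before(1-4,7) unfolding TL_diagrams_def by auto
    then obtain t1 t2 t3 where t: "contracts_to 24 R3_arcs (R3_before t1 t2 t3) r []" by blast
    obtain T where T: "T \<subseteq> A.Z" "((A.z 0 1 \<in> T) = (b 0 \<noteq> b 1)) = t1" "((A.z 0 2 \<in> T) = (b 0 \<noteq> b 2)) = t2"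
      "((A.z 1 2 \<in> T) = (b 1 \<noteq> b 2)) = t3" by (rule select_states[OF A.Z_distinct])
    have eq: "R3_before t1 t2 t3 = smooth t1 (R3_left 0 1) (R3_left 0 1 + 1) (R3_left 1 0) (R3_left 1 0 + 1) @
     smooth t2 (R3_left 0 2) (R3_left 0 2 + 1) (R3_left 2 0) (R3_left 2 0 + 1) @
     smooth t3 (R3_left 1 2) (R3_left 1 2 + 1) (R3_left 2 1) (R3_left 2 1 + 1) @ R3_marks"
      by (simp add: R3_before_def R3_left_def)
    show ?thesis
      by (rule A.contraction(2)[OF S T(1)]; unfold T(2-4) eq[symmetric]) (rule R3_labels(1) t)+
  qed
  have valA: "loops_eval ?\<kappa> (T.all_marks \<times> UNIV) (arc_map T.all_marks) (mark_join D (S \<union> T)) (T.pot \<theta>) =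
      R3_value_before d (A.side_value ?\<kappa> S) ((A.z 0 1 \<in> T) = (b 0 \<noteq> b 1)) ((A.z 0 2 \<in> T) = (b 0 \<noteq> b 2)) ((A.z 1 2 \<in> T) = (b 1 \<noteq> b 2))"
    if S: "S \<subseteq> crossings D - box" and T: "T \<subseteq> A.Z" for S T
  proof (rule R3_value_before)
    have eq: "R3_before t1 t2 t3 = smooth t1 (R3_left 0 1) (R3_left 0 1 + 1) (R3_left 1 0) (R3_left 1 0 + 1) @
     smooth t2 (R3_left 0 2) (R3_left 0 2 + 1) (R3_left 2 0) (R3_left 2 0 + 1) @
     smooth t3 (R3_left 1 2) (R3_left 1 2 + 1) (R3_left 2 1) (R3_left 2 1 + 1) @ R3_marks" for t1 t2 t3
      by (simp add: R3_before_def R3_left_def)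
    have SZ: "S \<inter> A.Z = {}" using S A.Z_box by blast
    fix r :: "(nat \<times> nat) list" and cyc :: "nat list"
    assume chk: "contracts_to 24 R3_arcs (R3_before ((A.z 0 1 \<in> T) = (b 0 \<noteq> b 1)) ((A.z 0 2 \<in> T) = (b 0 \<noteq> b 2))
      ((A.z 1 2 \<in> T) = (b 1 \<noteq> b 2))) r cyc"
    show "loops_eval ?\<kappa> (T.all_marks \<times> UNIV) (arc_map T.all_marks) (mark_join D (S \<union> T)) (T.pot \<theta>) =
      d ^ (if cyc = [] then 0 else 1) * A.side_value ?\<kappa> S r"
      using A.contraction(1)[OF SZ T, unfolded eq[symmetric], OF R3_labels(1) chk, of ?\<kappa>] by (simp add: K0)
  qed
  have valB: "loops_eval ?\<kappa> (T.after.all_marks \<times> UNIV) (arc_map T.after.all_marks) (mark_join D' (S \<union> T)) (T.after.pot \<theta>') =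
      R3_value_after d (A.side_value ?\<kappa> S) ((B.z 0 1 \<in> T) = (b 0 \<noteq> b 1)) ((B.z 0 2 \<in> T) = (b 0 \<noteq> b 2)) ((B.z 1 2 \<in> T) = (b 1 \<noteq> b 2))"
    if S: "S \<subseteq> crossings D' - box" and T: "T \<subseteq> B.Z" for S T
  proof -
    have eq: "R3_after t1 t2 t3 = smooth t1 (R3_left' 0 1) (R3_left' 0 1 + 1) (R3_left' 1 0) (R3_left' 1 0 + 1) @
     smooth t2 (R3_left' 0 2) (R3_left' 0 2 + 1) (R3_left' 2 0) (R3_left' 2 0 + 1) @
     smooth t3 (R3_left' 1 2) (R3_left' 1 2 + 1) (R3_left' 2 1) (R3_left' 2 1 + 1) @ R3_marks" for t1 t2 t3
      by (simp add: R3_after_def R3_left'_def)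
    have SZ: "S \<inter> B.Z = {}" "S \<inter> A.Z = {}" using S A.Z_box B.Z_box T.far_crossings by blast+
    have 1: "loops_eval ?\<kappa> (T.after.all_marks \<times> UNIV) (arc_map T.after.all_marks) (mark_join D' (S \<union> T)) (T.after.pot \<theta>') =
      R3_value_after d (B.side_value ?\<kappa> S) ((B.z 0 1 \<in> T) = (b 0 \<noteq> b 1)) ((B.z 0 2 \<in> T) = (b 0 \<noteq> b 2)) ((B.z 1 2 \<in> T) = (b 1 \<noteq> b 2))"
    proof (rule R3_value_after)
      fix r :: "(nat \<times> nat) list" and cyc :: "nat list"
      assume chk: "contracts_to 24 R3_arcs (R3_after ((B.z 0 1 \<in> T) = (b 0 \<noteq> b 1)) ((B.z 0 2 \<in> T) = (b 0 \<noteq> b 2))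
        ((B.z 1 2 \<in> T) = (b 1 \<noteq> b 2))) r cyc"
      show "loops_eval ?\<kappa> (T.after.all_marks \<times> UNIV) (arc_map T.after.all_marks) (mark_join D' (S \<union> T)) (T.after.pot \<theta>') =
        d ^ (if cyc = [] then 0 else 1) * B.side_value ?\<kappa> S r"
        using B.contraction(1)[OF SZ(1) T, unfolded eq[symmetric], OF R3_labels(2) chk, of ?\<kappa>] by (simp add: K0)
    qed
    \<comment> \<open>Only the arcs matter here, so any state will do; the one that is the identity tangle has no closed loop.\<close>
    have sysB: "\<exists>j. loop_system B.Outer (arc_map T.after.all_marks) j"
    proof -
      obtain T' where T': "T' \<subseteq> B.Z" "((B.z 0 1 \<in> T') = (b 0 \<noteq> b 1)) = True" "((B.z 0 2 \<in> T') = (b 0 \<noteq> b 2)) = True"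
        "((B.z 1 2 \<in> T') = (b 1 \<noteq> b 2)) = True" by (rule select_states[OF B.Z_distinct])
      have "loop_system B.Outer (arc_map T.after.all_marks) (rewire T.after.e 24 TL_1 (mark_join D' S))"
        by (rule B.contraction(2)[OF SZ(1) T'(1)]; unfold T'(2-4) eq[symmetric]) (rule R3_labels(2) contracts_R3_after(1))+
      then show ?thesis by blast
    qed
    have 2: "B.side_value ?\<kappa> S r = A.side_value ?\<kappa> S r" if r: "r \<in> set TL_diagrams" for r
      unfolding A.side_value_def B.side_value_def
    proof (rule T.compare[of R3_arcs \<theta> \<theta>' r S ?\<kappa>, unfolded N])
      show "T.e n = T.after.e n \<and> \<theta> n = \<theta>' n \<and> wire r n < 24 \<and> wire R3_arcs (wire r n) = wire r n"
        if "n < 24" "wire R3_arcs n = n" for n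
        using outer[OF that] TL_outer[OF r that] by blast
      show sys: "loop_system A.Outer (arc_map T.all_marks) (rewire T.e 24 r (mark_join D S))" by (rule sysA[OF r SZ(2)])
      fix p assume p: "p \<in> A.Outer"
      have "arc_map M p = arc_map T.all_marks p"
        by (rule arc_subset[OF T.all_marks_marking MM(1) OM _ p]) (rule loop_system.a_in[OF sys])
      moreover have "arc_map M p = arc_map T.after.all_marks p"
      proof -
        obtain j where j: "loop_system B.Outer (arc_map T.after.all_marks) j" using sysB by blast
        show ?thesis
          by (rule arc_subset[OF T.after.all_marks_marking MM(2) OM _ p]) (rule loop_system.a_in[OF j, unfolded Outer])
      qed
      ultimately show "arc_map T.after.all_marks p = arc_map T.all_marks p" by simp
    qed
    show ?thesis unfolding 1 by (rule R3_value_after_cong) (rule 2)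
  qed
  \<comment> \<open>Strand \<open>k\<close> passes upward, so the sign is positive exactly for antiparallel strands.\<close>
  have f: "(b k \<noteq> b l) = (eps D (s k (x k l)) = 1)" if "k < l" "l < 3" for k l
    using A.cross(3)[OF that] by (cases "b k"; cases "b l") simp_all
  have sw: "smoothing_weight \<alpha> \<beta> (A.z k l) (b k \<noteq> b l) = a k l"
    "smoothing_weight \<alpha>' \<beta>' (B.z k l) (b k \<noteq> b l) = a k l" if "k < l" "l < 3" for k l
    using near_w[OF that] unfolding f[OF that] a_def by (auto simp: smoothing_weight_def fun_eq_iff)
  have less: "(0::nat) < 1" "(1::nat) < 3" "(0::nat) < 2" "(2::nat) < 3" "(1::nat) < 2" by simp_all
  note sws = sw[OF less(1,2)] sw[OF less(3,4)] sw[OF less(5,4)]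
  have Y: "(\<Sum>t1\<in>UNIV. \<Sum>t2\<in>UNIV. \<Sum>t3\<in>UNIV. a 0 1 t1 * a 0 2 t2 * a 1 2 t3 * R3_value_before d W t1 t2 t3) =
    (\<Sum>t1\<in>UNIV. \<Sum>t2\<in>UNIV. \<Sum>t3\<in>UNIV. a 0 1 t1 * a 0 2 t2 * a 1 2 t3 * R3_value_after d W t1 t2 t3)" for W
    by (rule R3_identity[OF rel refl refl refl refl refl refl])
  have wt: "weight \<alpha>' \<beta>' (crossings D - box) S = weight \<alpha> \<beta> (crossings D - box) S" for S
    by (rule weight_cong) (use far_w in auto)
  have "d * bracket \<alpha>' \<beta>' d \<K> D' = (\<Sum>S\<in>Pow (crossings D - box). weight \<alpha> \<beta> (crossings D - box) S *
    d ^ card (unmarked (ncomp D) T.all_marks) *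
    (\<Sum>t1\<in>UNIV. \<Sum>t2\<in>UNIV. \<Sum>t3\<in>UNIV. a 0 1 t1 * a 0 2 t2 * a 1 2 t3 * R3_value_after d (A.side_value ?\<kappa> S) t1 t2 t3))"
    using B.bracket_local[of \<K> d "\<lambda>S. R3_value_after d (A.side_value ?\<kappa> S)" \<alpha>' \<beta>', OF K0 valB]
    unfolding T.far_crossings sws wt T.unmarked_eq .
  moreover have "d * bracket \<alpha> \<beta> d \<K> D = (\<Sum>S\<in>Pow (crossings D - box). weight \<alpha> \<beta> (crossings D - box) S *
    d ^ card (unmarked (ncomp D) T.all_marks) *
    (\<Sum>t1\<in>UNIV. \<Sum>t2\<in>UNIV. \<Sum>t3\<in>UNIV. a 0 1 t1 * a 0 2 t2 * a 1 2 t3 * R3_value_before d (A.side_value ?\<kappa> S) t1 t2 t3))"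
    using A.bracket_local[of \<K> d "\<lambda>S. R3_value_before d (A.side_value ?\<kappa> S)" \<alpha> \<beta>, OF K0 valA]
    unfolding sws .
  ultimately show ?thesis unfolding Y by simp
qed

section \<open>The arrow polynomial as a state sum\<close>

subsection \<open>Crossing signs\<close>

lemma link_flat: "is_link_diagram D \<Longrightarrow> is_flat_diagram D"
  by (simp add: is_link_diagram_def)

lemma over_crossing: "is_link_diagram D \<Longrightarrow> p \<in> over D \<Longrightarrow> p \<in> crossing_points D"
  by (auto simp: is_link_diagram_def)

lemma crossing_sign_over:
  assumes D: "is_link_diagram D" and p: "p \<in> over D"
  shows "crossing_sign D (pt D p) = eps D p"
proof -
  have cp: "p \<in> circle_points D" "pt D p \<in> crossings D"
    using over_crossing[OF D p] by (auto simp: crossing_points_def)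
  have "\<exists>!q. q \<in> fiber D (pt D p) \<and> q \<in> over D" using D cp(2) by (simp add: is_link_diagram_def)
  moreover have "p \<in> fiber D (pt D p) \<and> p \<in> over D" using cp(1) p by (simp add: fiber_def)
  ultimately have "over_point D (pt D p) = p" unfolding over_point_def by (rule the1_equality)
  then show ?thesis by (simp add: crossing_sign_def eps_def)
qed

lemma over_obtain:
  assumes "is_link_diagram D" "z \<in> crossings D" obtains p where "p \<in> over D" "pt D p = z"
proof -
  have "\<exists>!q. q \<in> fiber D z \<and> q \<in> over D" using assms by (simp add: is_link_diagram_def)
  then obtain q where "q \<in> fiber D z" "q \<in> over D" by blast
  then show ?thesis using that by (auto simp: fiber_def)
qed

lemma crossing_sign_cases: "crossing_sign D z = 1 \<or> crossing_sign D z = - 1"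
  by (simp add: crossing_sign_def Let_def)

lemma finite_crossings: "is_flat_diagram D \<Longrightarrow> finite (crossings D)"
  by (auto simp: is_flat_diagram_def generic_def intro: finite_subset)

lemma far_crossing_sign:
  assumes lm: "local_move D D' m s" and D: "is_link_diagram D" "is_link_diagram D'"
    and over: "over D' - strand_points m s = over D - strand_points m s" and z: "z \<in> crossings D - box"
  shows "crossing_sign D' z = crossing_sign D z"
proof -
  interpret local_move D D' m s by (rule lm)
  obtain p where p: "p \<in> over D" "pt D p = z" using over_obtain[OF D(1)] z by blast
  then have pK: "p \<notin> K" using on[of p] z by auto
  have far_p: "p \<in> crossing_points D - K" using over_crossing[OF D(1) p(1)] pK by simp
  have "p \<in> over D'" using over p(1) pK by blast
  then show ?thesis
    using crossing_sign_over[OF D(1) p(1)] crossing_sign_over[OF D(2), of p] far(2,5)[OF far_p] p(2) by simp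
qed

subsection \<open>Powers of the variable\<close>

lemma A_pow_mult: "A_pow j * A_pow k = A_pow (j + k)"
  by (simp add: A_pow_def mult_single)

lemma A_pow_0: "A_pow 0 = 1"
  by (simp add: A_pow_def)

lemma A_pow_power: "A_pow j ^ n = A_pow (j * int n)"
  by (induction n) (simp_all add: A_pow_0 A_pow_mult algebra_simps)

lemma loop_value_nonzero: "loop_value \<noteq> 0"
proof
  assume "loop_value = 0"
  then have "Poly_Mapping.lookup (Poly_Mapping.lookup loop_value 0) 2 = 0" by simp
  then show False by (simp add: loop_value_def A_pow_def lookup_minus lookup_single)
qed

lemma loop_value_cancel: "loop_value * p = loop_value * q \<Longrightarrow> p = q"
  using loop_value_nonzero by simp

lemma neg_A3_powi: "neg_A3_powi k = (-1) ^ nat \<bar>k\<bar> * A_pow (3 * k)"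
  by (auto simp: neg_A3_powi_def power_minus[of "A_pow _"] A_pow_power)

lemma neg_A3_powi_step:
  assumes "\<sigma> = 1 \<or> \<sigma> = - 1"
  shows "neg_A3_powi (k - \<sigma>) * (- A_pow (3 * \<sigma>)) = neg_A3_powi k"
proof -
  have "odd (nat \<bar>k - \<sigma>\<bar>) \<longleftrightarrow> even (nat \<bar>k\<bar>)" using assms by (auto simp: even_nat_iff)
  then show ?thesis
    by (cases "even (nat \<bar>k\<bar>)") (simp_all add: neg_A3_powi A_pow_mult algebra_simps)
qed

text \<open>
  The weights are those of \<open>E\<close> and the states those of \<open>D\<close>. The two are separated because the crossings of a diagram before
  a move can also be weighted with the signs after it.
\<close>

abbreviation arrow_bracket :: "link_diagram \<Rightarrow> link_diagram \<Rightarrow> arrow_poly" where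
  "arrow_bracket E D \<equiv> bracket (\<lambda>z. A_pow (crossing_sign E z)) (\<lambda>z. A_pow (- crossing_sign E z)) loop_value K_var D"

lemma arrow_polynomial_bracket: "arrow_polynomial D = arrow_bracket D D"
proof -
  have "state_weight D S = weight (\<lambda>z. A_pow (crossing_sign D z)) (\<lambda>z. A_pow (- crossing_sign D z)) (crossings D) S" for S
    unfolding state_weight_def weight_def by (rule prod.cong) auto
  then show ?thesis by (simp add: arrow_polynomial_def bracket_def state_vars_def)
qed

lemma K_var_0: "K_var 0 = 1"
  by (simp add: K_var_def)

lemma arrow_bracket_cong:
  "(\<And>z. z \<in> crossings D \<Longrightarrow> crossing_sign E z = crossing_sign E' z) \<Longrightarrow> arrow_bracket E D = arrow_bracket E' D"
  by (rule bracket_cong) simp_all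

lemma writhe_cong:
  "crossings D' = crossings D \<Longrightarrow> (\<And>z. z \<in> crossings D \<Longrightarrow> crossing_sign D' z = crossing_sign D z) \<Longrightarrow> writhe D' = writhe D"
  unfolding writhe_def by (rule sum.cong) auto

section \<open>Invariance of the arrow polynomial\<close>

lemma planar_isotopy_invariant:
  assumes D: "is_link_diagram D" "is_link_diagram D'" and move: "planar_isotopy D D'"
  shows "arrow_polynomial D' = arrow_polynomial D" "writhe D' = writhe D"
proof -
  obtain \<Phi> where \<Phi>: "flat_planar_isotopy D D' \<Phi>" "over D' = {p \<in> circle_points D'. \<Phi> p \<in> over D}"
    using move by (auto simp: planar_isotopy_def)
  obtain h where h: "bij h" "crossings D' = h ` crossings D"
    "\<And>p. p \<in> circle_points D' \<Longrightarrow> pt D' p = h (pt D (\<Phi> p))"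
    and \<Phi>_bij: "bij_betw \<Phi> (crossing_points D') (crossing_points D)"
    and data: "\<And>p. p \<in> crossing_points D' \<Longrightarrow> succ (crossing_points D) (\<Phi> p) = \<Phi> (succ (crossing_points D') p)"
    "\<And>p. p \<in> crossing_points D' \<Longrightarrow> partner D (\<Phi> p) = \<Phi> (partner D' p)"
    "\<And>p. p \<in> crossing_points D' \<Longrightarrow> eps D (\<Phi> p) = eps D' p"
    "card (unmarked (ncomp D') (crossing_points D')) = card (unmarked (ncomp D) (crossing_points D))"
    by (rule isotopy_data[OF D[THEN link_flat] \<Phi>(1)]) blast
  have inj: "inj_on h (crossings D)" using h(1) by (meson bij_def inj_on_subset subset_UNIV)
  have sign: "crossing_sign D' (h z) = crossing_sign D z" if z: "z \<in> crossings D" for z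
  proof -
    have "h z \<in> crossings D'" using z h(2) by simp
    then obtain p where p: "p \<in> over D'" "pt D' p = h z" by (rule over_obtain[OF D(2)])
    have cp: "p \<in> crossing_points D'" by (rule over_crossing[OF D(2) p(1)])
    have "p \<in> circle_points D'" "\<Phi> p \<in> over D" using p(1) \<Phi>(2) by auto
    then have "pt D (\<Phi> p) = z" using h(3)[of p] p(2) bij_is_inj[OF h(1)] by (auto dest: injD)
    then show ?thesis
      using crossing_sign_over[OF D(2) p(1)] crossing_sign_over[OF D(1) \<open>\<Phi> p \<in> over D\<close>] data(3)[OF cp] p(2) by simp
  qed
  have "loop_value * arrow_bracket D' D' = loop_value * arrow_bracket D D"
    by (rule bracket_iso[where K = K_var, OF D[THEN link_flat] K_var_0 \<Phi>_bij data(1-3) inj h(2) _ data(4)])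
      (use h(3) sign in \<open>auto simp: crossing_points_def\<close>)
  then show "arrow_polynomial D' = arrow_polynomial D"
    unfolding arrow_polynomial_bracket by (rule loop_value_cancel)
  show "writhe D' = writhe D"
    unfolding writhe_def h(2) sum.reindex[OF inj] o_def by (rule sum.cong[OF refl]) (rule sign)
qed

lemma detour_invariant:
  assumes D: "is_link_diagram D" "is_link_diagram D'" and move: "detour D D'"
  shows "arrow_polynomial D' = arrow_polynomial D" "writhe D' = writhe D"
proof -
  have fd: "flat_detour D D'" "over D' = over D" using move by (auto simp: detour_def)
  have cr: "crossings D' = crossings D" using fd(1) by (simp add: flat_detour_def)
  note data = detour_data[OF D[THEN link_flat] fd(1)]
  have sign: "crossing_sign D' z = crossing_sign D z" if z: "z \<in> crossings D" for z
  proof -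
    obtain p where p: "p \<in> over D" "pt D p = z" by (rule over_obtain[OF D(1) z])
    then show ?thesis
      using crossing_sign_over[OF D(1) p(1)] crossing_sign_over[OF D(2), of p] fd(2)
        data(3)[OF over_crossing[OF D(1) p(1)]] by simp
  qed
  have "loop_value * arrow_bracket D' D' = loop_value * arrow_bracket D' D"
    by (rule bracket_detour[where K = K_var, OF D[THEN link_flat] fd(1) K_var_0])
  also have "arrow_bracket D' D = arrow_bracket D D" by (rule arrow_bracket_cong) (rule sign)
  finally show "arrow_polynomial D' = arrow_polynomial D"
    unfolding arrow_polynomial_bracket by (rule loop_value_cancel)
  show "writhe D' = writhe D" by (rule writhe_cong[OF cr sign])
qed

text \<open>
  A kink multiplies the polynomial by \<open>- A_pow (3 * \<sigma>)\<close> and adds its sign \<open>\<sigma>\<close> to the writhe.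
\<close>

lemma R1_invariant:
  assumes D: "is_link_diagram D" "is_link_diagram D'" and move: "R1 D D'"
  shows "normalized_arrow_polynomial D' = normalized_arrow_polynomial D"
proof -
  obtain s u v where fl: "flat_R1 D D' s u v"
    and ov: "over D' = insert (s 0 u) (over D) \<or> over D' = insert (s 0 v) (over D)"
    using move by (auto simp: R1_def)
  define z \<sigma> where "z = pt D' (s 0 u)" and "\<sigma> = crossing_sign D' z"
  obtain b \<tau> where tp: "tangle_pair D D' 1 s b \<tau> 2 (\<lambda>n. [u, v] ! n) (\<lambda>n. [u, v] ! n)"
    and z: "z \<in> box" "crossings D' = insert z (crossings D)" "crossings D \<inter> box = {}"
    using R1_data[OF D[THEN link_flat] fl] unfolding z_def by metis
  interpret T: tangle_pair D D' 1 s b \<tau> 2 "\<lambda>n. [u, v] ! n" "\<lambda>n. [u, v] ! n" by (rule tp)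
  have uv: "s 0 u \<in> T.K" "s 0 v \<in> T.K"
    using strand_point[of 0 1 u s] strand_point[of 0 1 v s] T.P_mem[of 0 0] T.P_mem[of 0 1] by auto
  have "over D' - T.K = over D - T.K" using ov uv by auto
  then have sign: "crossing_sign D' y = crossing_sign D y" if "y \<in> crossings D" for y
    using far_crossing_sign[OF T.local_move_axioms D] that z(3) by blast
  have \<sigma>: "\<sigma> = 1 \<or> \<sigma> = - 1" unfolding \<sigma>_def by (rule crossing_sign_cases)
  \<comment> \<open>One of the two terms of the product with the loop value is minus the weight of the disoriented smoothing.\<close>
  have factor: "A_pow \<sigma> * loop_value + A_pow (- \<sigma>) = - A_pow (3 * \<sigma>)"
    using \<sigma> by (auto simp: loop_value_def right_diff_distrib A_pow_mult)
  have "loop_value * arrow_bracket D' D' = - A_pow (3 * \<sigma>) * (loop_value * arrow_bracket D' D)"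
    using bracket_R1[where K = K_var, OF D[THEN link_flat] fl K_var_0, of loop_value
        "\<lambda>z. A_pow (crossing_sign D' z)" "\<lambda>z. A_pow (- crossing_sign D' z)"]
    unfolding z_def[symmetric] \<sigma>_def[symmetric] factor .
  also have "arrow_bracket D' D = arrow_bracket D D" by (rule arrow_bracket_cong) (rule sign)
  finally have "loop_value * arrow_bracket D' D' = loop_value * (- A_pow (3 * \<sigma>) * arrow_bracket D D)"
    by (simp add: mult_ac)
  then have a: "arrow_polynomial D' = - A_pow (3 * \<sigma>) * arrow_polynomial D"
    unfolding arrow_polynomial_bracket by (rule loop_value_cancel)
  have zn: "z \<notin> crossings D" using z by blast
  have "writhe D' = \<sigma> + (\<Sum>y\<in>crossings D. crossing_sign D' y)"
    using finite_crossings[OF link_flat[OF D(1)]] zn by (simp add: writhe_def z(2) \<sigma>_def)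
  also have "(\<Sum>y\<in>crossings D. crossing_sign D' y) = writhe D"
    unfolding writhe_def by (rule sum.cong[OF refl]) (rule sign)
  finally have w: "- writhe D' = - writhe D - \<sigma>" by simp
  show ?thesis
    unfolding normalized_arrow_polynomial_def a w mult.assoc[symmetric] neg_A3_powi_step[OF \<sigma>] by (rule refl)
qed

text \<open>
  One of the strands is over at both crossings, so the crossing signs are opposite and the weights cancel.
\<close>

lemma R2_invariant:
  assumes D: "is_link_diagram D" "is_link_diagram D'" and move: "R2 D D'"
  shows "arrow_polynomial D' = arrow_polynomial D" "writhe D' = writhe D"
proof -
  obtain s u v k where fl: "flat_R2 D D' s u v" and k: "k < (2::nat)" and ov: "over D' = {s k u, s k v} \<union> over D"
    using move by (auto simp: R2_def)
  define zu zv where "zu = pt D' (s 0 u)" and "zv = pt D' (s 0 v)"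
  obtain b \<tau> where tp: "tangle_pair D D' 2 s b \<tau> 2 (\<lambda>n. [u, v, u, v] ! n) (\<lambda>n. [u, v, u, v] ! n)"
    and pa: "partner D' (s 0 u) = s 1 u" "partner D' (s 0 v) = s 1 v"
    and ep: "eps D' (s 0 u) = - (sgnb (b 0) * sgnb (b 1))" "eps D' (s 1 u) = sgnb (b 0) * sgnb (b 1)"
    "eps D' (s 1 v) = - (sgnb (b 0) * sgnb (b 1))" "eps D' (s 0 v) = sgnb (b 0) * sgnb (b 1)"
    and CP: "s 0 u \<in> crossing_points D'" "s 0 v \<in> crossing_points D'"
    and z: "zu \<noteq> zv" "crossings D' = {zu, zv} \<union> crossings D" "crossings D \<inter> box = {}" "zu \<in> box" "zv \<in> box"
    using R2_data[OF D[THEN link_flat] fl] unfolding zu_def zv_def by metis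
  interpret T: tangle_pair D D' 2 s b \<tau> 2 "\<lambda>n. [u, v, u, v] ! n" "\<lambda>n. [u, v, u, v] ! n" by (rule tp)
  have uv: "s k u \<in> T.K" "s k v \<in> T.K"
    using strand_point[OF k, of u s] strand_point[OF k, of v s] T.P_mem[OF k, of 0] T.P_mem[OF k, of 1] k
    by (auto simp: less_two_iff)
  have "over D' - T.K = over D - T.K" using ov uv by auto
  then have sign: "crossing_sign D' y = crossing_sign D y" if "y \<in> crossings D" for y
    using far_crossing_sign[OF T.local_move_axioms D] that z(3) by blast
  define \<sigma> where "\<sigma> = crossing_sign D' zu"
  have pts: "pt D' (s k u) = zu" "pt D' (s k v) = zv"
    using k T.D'.partner(3)[OF CP(1)] T.D'.partner(3)[OF CP(2)] by (auto simp: less_two_iff pa zu_def zv_def)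
  have "s k u \<in> over D'" "s k v \<in> over D'" using ov by auto
  then have "crossing_sign D' zu = eps D' (s k u)" "crossing_sign D' zv = eps D' (s k v)"
    using crossing_sign_over[OF D(2)] pts by metis+
  then have \<sigma>': "crossing_sign D' zv = - \<sigma>" using k ep by (auto simp: \<sigma>_def less_two_iff)
  have \<sigma>: "\<sigma> = 1 \<or> \<sigma> = - 1" unfolding \<sigma>_def by (rule crossing_sign_cases)
  have "loop_value * arrow_bracket D' D' = loop_value * arrow_bracket D' D"
    by (rule bracket_R2[where K = K_var, OF D[THEN link_flat] fl K_var_0];
        use \<sigma> in \<open>auto simp: zu_def[symmetric] zv_def[symmetric] \<sigma>' \<sigma>_def[symmetric] A_pow_mult A_pow_0 loop_value_def\<close>)
  also have "arrow_bracket D' D = arrow_bracket D D" by (rule arrow_bracket_cong) (rule sign)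
  finally show "arrow_polynomial D' = arrow_polynomial D"
    unfolding arrow_polynomial_bracket by (rule loop_value_cancel)
  have "writhe D' = (\<Sum>y\<in>crossings D. crossing_sign D' y)"
    using finite_crossings[OF link_flat[OF D(1)]] z \<sigma>'
    unfolding writhe_def z(2) by (subst sum.union_disjoint) (auto simp: \<sigma>_def)
  also have "\<dots> = writhe D" unfolding writhe_def by (rule sum.cong[OF refl]) (rule sign)
  finally show "writhe D' = writhe D" .
qed

lemma crossing_sign_strands:
  assumes D: "is_link_diagram D" and c: "crossing_data D s b x k l"
    and over: "s k (x k l) \<in> over D \<longleftrightarrow> h l < h k" "s l (x k l) \<in> over D \<longleftrightarrow> h k < h l" and ne: "h k \<noteq> (h l :: nat)"
  shows "crossing_sign D (crossing_at D s x k l) = (if h l < h k then - (sgnb (b k) * sgnb (b l)) else sgnb (b k) * sgnb (b l))"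
proof (cases "h l < h k")
  case True
  then show ?thesis using crossing_sign_over[OF D, of "s k (x k l)"] over c
    by (simp add: crossing_data_def crossing_at_def)
next
  case False
  then have "s l (x k l) \<in> over D" using over(2) ne by simp
  then show ?thesis using crossing_sign_over[OF D, of "s l (x k l)"] c False
    by (simp add: crossing_data_def crossing_at_def)
qed

lemma sum_split_box:
  assumes "finite C" "C \<inter> box = {z1, z2, z3}" "z1 \<noteq> z2" "z1 \<noteq> z3" "z2 \<noteq> z3"
  shows "sum f C = sum f (C - box) + (f z1 + f z2 + f z3 :: int)"
proof -
  have "sum f C = sum f (C - box) + sum f (C \<inter> box)"
    using sum.Int_Diff[OF assms(1), of f box] by simp
  then show ?thesis using assms(3-5) unfolding assms(2) by simp
qed

text \<open>
  The weight of a smoothing shape is independent of the directions of the strands: reversing one of them exchanges the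
  oriented with the disoriented smoothing and changes the sign of the crossing. So it depends only on which strand is
  over, and the relation required for the third move is checked for the possible orders of the heights. It would fail if
  each strand were over exactly one other.
\<close>

lemma R3_invariant:
  assumes D: "is_link_diagram D" "is_link_diagram D'" and move: "R3 D D'"
  shows "arrow_polynomial D' = arrow_polynomial D" "writhe D' = writhe D"
proof -
  obtain s x y h where fl: "flat_R3 D D' s x y" and h: "inj_on (h :: nat \<Rightarrow> nat) {..<3}"
    and ov: "\<forall>l < 3. \<forall>k < l. (s k (x k l) \<in> over D \<longleftrightarrow> h l < h k) \<and> (s l (x k l) \<in> over D \<longleftrightarrow> h k < h l) \<and>
           (s k (y k l) \<in> over D' \<longleftrightarrow> h l < h k) \<and> (s l (y k l) \<in> over D' \<longleftrightarrow> h k < h l)"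
    and far_over: "over D' - strand_points 3 s = over D - strand_points 3 s"
    using move unfolding R3_def by (elim exE conjE) (rule that; assumption)
  obtain b \<tau> where tp: "tangle_pair D D' 3 s b \<tau> 4 (R3_pos x) (R3_pos' y)"
    and c: "three_crossings D s b x" "three_crossings D' s b y"
    by (rule R3_data[OF D[THEN link_flat] fl])
  interpret T: tangle_pair D D' 3 s b \<tau> 4 "R3_pos x" "R3_pos' y" by (rule tp)
  interpret A: three_strands D D' s b \<tau> "R3_pos x" x R3_left "R3_pot (sgnb (b 0)) (sgnb (b 1)) (sgnb (b 2))"
    "R3_mean (sgnb (b 0)) (sgnb (b 1)) (sgnb (b 2))" by (rule R3_sides(1)[OF tp c])
  interpret B: three_strands D' D s b \<tau> "R3_pos' y" y R3_left' "R3_pot' (sgnb (b 0)) (sgnb (b 1)) (sgnb (b 2))"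
    "R3_mean' (sgnb (b 0)) (sgnb (b 1)) (sgnb (b 2))" by (rule R3_sides(2)[OF tp c])
  have far: "crossing_sign D' z = crossing_sign D z" if "z \<in> crossings D - box" for z
    by (rule far_crossing_sign[OF T.local_move_axioms D far_over that])
  have cd: "crossing_data D s b x k l" "crossing_data D' s b y k l" if "k < l" "l < 3" for k l
    using c that pairs_below_three[of k l] by (auto simp: three_crossings_def)
  have hne: "h k \<noteq> h l" if "k < l" "l < 3" for k l
    using inj_onD[OF h, of k l] that by auto
  have sA: "crossing_sign D (A.z k l) = (if h l < h k then - (sgnb (b k) * sgnb (b l)) else sgnb (b k) * sgnb (b l))"
    and sB: "crossing_sign D' (B.z k l) = (if h l < h k then - (sgnb (b k) * sgnb (b l)) else sgnb (b k) * sgnb (b l))"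
    if kl: "k < l" "l < 3" for k l
    using crossing_sign_strands[OF D(1) cd(1)[OF kl] _ _ hne[OF kl]] crossing_sign_strands[OF D(2) cd(2)[OF kl] _ _ hne[OF kl]]
      ov kl by blast+
  have near: "crossing_sign D' (B.z k l) = crossing_sign D (A.z k l)" if "k < l" "l < 3" for k l
    using sA[OF that] sB[OF that] by simp
  let ?a = "\<lambda>k l. smoothing_weight (\<lambda>z. A_pow (crossing_sign D z)) (\<lambda>z. A_pow (- crossing_sign D z)) (A.z k l) (eps D (s k (x k l)) = 1)"
  \<comment> \<open>The weight by shape depends only on which strand is over.\<close>
  have a: "?a k l t = A_pow (if t = (h l < h k) then - 1 else 1)" if kl: "k < l" "l < 3" for k l t
    using cd(1)[OF kl] unfolding smoothing_weight_def sA[OF kl] crossing_data_def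
    by (cases t; cases "h l < h k"; cases "b k"; cases "b l") simp_all
  have less: "(0::nat) < 1" "(1::nat) < 3" "(0::nat) < 2" "(2::nat) < 3" "(1::nat) < 2" by simp_all
  note as = a[OF less(1,2)] a[OF less(3,4)] a[OF less(5,4)]
  have "loop_value * arrow_bracket D' D' = loop_value * arrow_bracket D D"
  proof (rule bracket_R3[where \<K> = K_var, OF D[THEN link_flat] fl K_var_0])
    show "?a 0 1 True * ?a 0 2 True * ?a 1 2 False + ?a 0 1 False * ?a 0 2 True * ?a 1 2 True +
      ?a 0 1 False * ?a 0 2 True * ?a 1 2 False * loop_value + ?a 0 1 False * ?a 0 2 False * ?a 1 2 False =
      ?a 0 1 True * ?a 0 2 False * ?a 1 2 True"
      unfolding as using hne[OF less(1,2)] hne[OF less(3,4)] hne[OF less(5,4)]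
      by (cases "h 1 < h 0"; cases "h 2 < h 0"; cases "h 2 < h 1")
        (simp_all add: A_pow_mult loop_value_def right_diff_distrib)
  qed (use far near in auto)
  then show "arrow_polynomial D' = arrow_polynomial D"
    unfolding arrow_polynomial_bracket by (rule loop_value_cancel)
  have "(\<Sum>z\<in>crossings D - box. crossing_sign D' z) = (\<Sum>z\<in>crossings D - box. crossing_sign D z)"
    by (rule sum.cong[OF refl]) (rule far)
  then show "writhe D' = writhe D"
    unfolding writhe_def sum_split_box[OF finite_crossings[OF link_flat[OF D(1)]] A.Z_box A.Z_distinct]
      sum_split_box[OF finite_crossings[OF link_flat[OF D(2)]] B.Z_box B.Z_distinct] T.far_crossings
    using near[OF less(1,2)] near[OF less(3,4)] near[OF less(5,4)] by simp
qed

section \<open>The specialization at one\<close>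

lemma poly_mapping_additive_induct [case_names zero single add]:
  fixes p :: "'a \<Rightarrow>\<^sub>0 'b::comm_monoid_add"
  assumes "P 0" "\<And>k v. P (Poly_Mapping.single k v)" "\<And>p q. P p \<Longrightarrow> P q \<Longrightarrow> P (p + q)"
  shows "P p"
proof (induction p rule: update_induct)
  case const
  show ?case by (rule assms(1))
next
  case (update f k v)
  have "Poly_Mapping.update k v f = f + Poly_Mapping.single k v"
    using update(1) by (intro poly_mapping_eqI) (auto simp: lookup_add lookup_single lookup_update in_keys_iff)
  then show ?case using assms(2,3) update by simp
qed

lemma laurent_at_one_support:
  assumes "finite S" "Poly_Mapping.keys c \<subseteq> S"
  shows "laurent_at_one c = (\<Sum>k\<in>S. Poly_Mapping.lookup c k)"
  unfolding laurent_at_one_def by (rule sum.mono_neutral_left[OF assms]) (simp add: in_keys_iff)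

lemma laurent_at_one_add: "laurent_at_one (a + b) = laurent_at_one a + laurent_at_one b"
proof -
  let ?S = "Poly_Mapping.keys a \<union> Poly_Mapping.keys b"
  have "laurent_at_one c = (\<Sum>k\<in>?S. Poly_Mapping.lookup c k)" if "c \<in> {a, b, a + b}" for c
    by (rule laurent_at_one_support) (use that keys_add[of a b] in auto)
  then show ?thesis by (simp add: lookup_add sum.distrib)
qed

lemma laurent_at_one_0: "laurent_at_one 0 = 0"
  by (simp add: laurent_at_one_def)

lemma laurent_at_one_single: "laurent_at_one (Poly_Mapping.single k v) = v"
  using laurent_at_one_support[of "{k}" "Poly_Mapping.single k v"] by simp

text \<open>Both sides are additive in each factor, so monomials suffice.\<close>

lemma laurent_at_one_mult: "laurent_at_one (a * b) = laurent_at_one a * laurent_at_one b"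
proof (induction a rule: poly_mapping_additive_induct)
  case (single k v)
  show ?case
    by (induction b rule: poly_mapping_additive_induct)
      (simp_all add: laurent_at_one_0 laurent_at_one_single laurent_at_one_add mult_single distrib_left)
qed (simp_all add: laurent_at_one_0 laurent_at_one_add distrib_right)

lemma lookup_at_A_one: "Poly_Mapping.lookup (at_A_one p) m = laurent_at_one (Poly_Mapping.lookup p m)"
  by (simp add: at_A_one_def map.rep_eq laurent_at_one_0 when_def)

lemma at_A_one_add: "at_A_one (p + q) = at_A_one p + at_A_one q"
  by (rule poly_mapping_eqI) (simp add: lookup_at_A_one lookup_add laurent_at_one_add)

lemma at_A_one_0: "at_A_one 0 = 0"
  by (rule poly_mapping_eqI) (simp add: lookup_at_A_one laurent_at_one_0)

lemma at_A_one_single: "at_A_one (Poly_Mapping.single m c) = Poly_Mapping.single m (laurent_at_one c)"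
  by (rule poly_mapping_eqI) (simp add: lookup_at_A_one lookup_single laurent_at_one_0 when_def)

lemma at_A_one_mult: "at_A_one (p * q) = at_A_one p * at_A_one q"
proof (induction p rule: poly_mapping_additive_induct)
  case (single k v)
  show ?case
    by (induction q rule: poly_mapping_additive_induct)
      (simp_all add: at_A_one_0 at_A_one_single at_A_one_add mult_single laurent_at_one_mult distrib_left)
qed (simp_all add: at_A_one_0 at_A_one_add distrib_right)

lemma at_A_one_A_pow: "at_A_one (A_pow k) = 1"
  by (simp add: A_pow_def at_A_one_single laurent_at_one_single)

lemma at_A_one_1: "at_A_one 1 = 1"
  using at_A_one_A_pow[of 0] by (simp add: A_pow_0)

lemma at_A_one_diff: "at_A_one (p - q) = at_A_one p - at_A_one q"
  using at_A_one_add[of "p - q" q] by (simp add: algebra_simps)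

lemma at_A_one_loop_value: "at_A_one loop_value = - 2"
  unfolding loop_value_def using at_A_one_diff[of 0 "A_pow 2"]
  by (simp add: at_A_one_diff at_A_one_A_pow at_A_one_0)

lemma at_A_one_sum: "at_A_one (sum f S) = (\<Sum>x\<in>S. at_A_one (f x))"
  by (induction S rule: infinite_finite_induct) (simp_all add: at_A_one_0 at_A_one_add)

lemma at_A_one_prod: "at_A_one (prod f S) = (\<Prod>x\<in>S. at_A_one (f x))"
  by (induction S rule: infinite_finite_induct) (simp_all add: at_A_one_1 at_A_one_mult)

lemma at_A_one_power: "at_A_one (p ^ n) = at_A_one p ^ n"
  by (induction n) (simp_all add: at_A_one_1 at_A_one_mult)

text \<open>
  At \<open>A = 1\<close> all weights are 1, so that the state sum no longer involves the crossing signs.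
\<close>

definition flat_bracket :: "('a) flat_diagram_scheme \<Rightarrow> ((nat \<Rightarrow>\<^sub>0 nat) \<Rightarrow>\<^sub>0 int)" where
  "flat_bracket D = bracket (\<lambda>_. 1) (\<lambda>_. 1) (- 2) (\<lambda>n. at_A_one (K_var n)) D"

lemma flat_arrow_polynomial_bracket: "flat_arrow_polynomial D = flat_bracket D"
  unfolding flat_arrow_polynomial_def arrow_polynomial_bracket flat_bracket_def bracket_def weight_def
  by (simp add: at_A_one_sum at_A_one_mult at_A_one_prod at_A_one_power at_A_one_loop_value at_A_one_A_pow if_distrib cong: if_cong)

subsection \<open>Forgetting the over and under information\<close>

lemma flat_select: "ncomp (flat D) = ncomp D" "curve (flat D) = curve D" "crossings (flat D) = crossings D"
  by (simp_all add: flat_def flat_diagram.truncate_def)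

lemma flat_points:
  "circle_points (flat D) = circle_points D" "pt (flat D) = pt D" "vel (flat D) = vel D"
  "fiber (flat D) = fiber D" "double_points (flat D) = double_points D"
  "crossing_points (flat D) = crossing_points D" "partner (flat D) = partner D" "next_point (flat D) = next_point D"
proof -
  show c: "circle_points (flat D) = circle_points D" by (simp add: circle_points_def flat_select)
  show p: "pt (flat D) = pt D" by (simp add: fun_eq_iff pt_def flat_select)
  show "vel (flat D) = vel D" by (simp add: fun_eq_iff vel_def flat_select)
  show f: "fiber (flat D) = fiber D" by (simp add: fun_eq_iff fiber_def c p)
  show "double_points (flat D) = double_points D" by (simp add: double_points_def f)
  show x: "crossing_points (flat D) = crossing_points D" by (simp add: crossing_points_def c p flat_select)
  show "partner (flat D) = partner D" by (simp add: fun_eq_iff partner_def c p)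
  show "next_point (flat D) = next_point D" by (simp add: fun_eq_iff next_point_def x)
qed

lemma flat_states:
  "arc_end (flat D) = arc_end D" "joined_end (flat D) S = joined_end D S" "leg (flat D) = leg D"
proof -
  show "arc_end (flat D) = arc_end D"
  proof
    fix x show "arc_end (flat D) x = arc_end D x" by (cases x; cases "snd x") (simp_all add: flat_points)
  qed
  show "joined_end (flat D) S = joined_end D S"
  proof
    fix x show "joined_end (flat D) S x = joined_end D S x" by (cases x) (simp add: flat_points)
  qed
  show "leg (flat D) = leg D"
  proof
    fix x show "leg (flat D) x = leg D x" by (cases x) (simp add: flat_points)
  qed
qed

lemma flat_loops: "loops (flat D) = loops D" "num_loops (flat D) = num_loops D" "loop_index (flat D) = loop_index D"
proof -
  have e: "ends (flat D) = ends D" by (simp add: ends_def flat_points)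
  have "same_loop (flat D) = same_loop D" by (simp add: fun_eq_iff same_loop_def e flat_states)
  then show l: "loops (flat D) = loops D" by (simp add: fun_eq_iff loops_def e)
  have "free_circles (flat D) = free_circles D" by (simp add: free_circles_def flat_points flat_select)
  then show "num_loops (flat D) = num_loops D" by (simp add: fun_eq_iff num_loops_def l)
  have "cusp (flat D) = cusp D" by (simp add: fun_eq_iff cusp_def flat_points flat_states)
  moreover have "step (flat D) = step D" by (simp add: fun_eq_iff step_def flat_states)
  ultimately have "cusp_word (flat D) = cusp_word D" by (intro ext) (simp add: cusp_word_def flat_states)
  then show "loop_index (flat D) = loop_index D" by (intro ext) (simp add: loop_index_def)
qed

lemma flat_bracket_flat: "flat_bracket (flat D) = flat_bracket D"
  by (simp add: flat_bracket_def bracket_def flat_loops flat_select)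

lemma K_at_one_0: "at_A_one (K_var 0) = 1"
  by (simp add: K_var_0 at_A_one_1)

lemma minus_two_cancel: "- 2 * p = - 2 * q \<Longrightarrow> p = q" for p q :: "(nat \<Rightarrow>\<^sub>0 nat) \<Rightarrow>\<^sub>0 int"
  by simp

text \<open>The factor of a kink is \<open>d + 1 = -1\<close>.\<close>

lemma flat_R1_invariant:
  assumes D: "is_flat_diagram D" "is_flat_diagram D'" and move: "flat_R1 D D' s u v"
  shows "flat_bracket D' = - flat_bracket D" "card (crossings D') = Suc (card (crossings D))"
proof -
  have "- 2 * flat_bracket D' = (1 * - 2 + 1) * (- 2 * flat_bracket D)"
    unfolding flat_bracket_def by (rule bracket_R1[where K = "\<lambda>n. at_A_one (K_var n)", OF D move K_at_one_0])
  then have "- 2 * flat_bracket D' = - 2 * (- flat_bracket D)" by simp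
  then show "flat_bracket D' = - flat_bracket D" by (rule minus_two_cancel)
  have "pt D' (s 0 u) \<notin> crossings D" "crossings D' = insert (pt D' (s 0 u)) (crossings D)"
    using R1_data[OF D move] by blast+
  then show "card (crossings D') = Suc (card (crossings D))" using finite_crossings[OF D(1)] by simp
qed

lemma flat_R2_invariant:
  assumes D: "is_flat_diagram D" "is_flat_diagram D'" and move: "flat_R2 D D' s u v"
  shows "flat_bracket D' = flat_bracket D" "card (crossings D') = card (crossings D) + 2"
proof -
  have "- 2 * flat_bracket D' = - 2 * flat_bracket D"
    unfolding flat_bracket_def by (rule bracket_R2[where K = "\<lambda>n. at_A_one (K_var n)", OF D move K_at_one_0]) simp_all
  then show "flat_bracket D' = flat_bracket D" by (rule minus_two_cancel)
  define zu zv where "zu = pt D' (s 0 u)" and "zv = pt D' (s 0 v)"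
  have "zu \<noteq> zv" "crossings D' = {zu, zv} \<union> crossings D" "crossings D \<inter> box = {}" "zu \<in> box" "zv \<in> box"
    unfolding zu_def zv_def by (rule R2_data[OF D move]; assumption)+
  then have "zu \<notin> crossings D" "zv \<notin> crossings D" "zu \<noteq> zv" "crossings D' = insert zu (insert zv (crossings D))" by auto
  then show "card (crossings D') = card (crossings D) + 2" using finite_crossings[OF D(1)] by simp
qed

lemma flat_R3_invariant:
  assumes D: "is_flat_diagram D" "is_flat_diagram D'" and move: "flat_R3 D D' s x y"
  shows "flat_bracket D' = flat_bracket D" "card (crossings D') = card (crossings D)"
proof -
  have "- 2 * flat_bracket D' = - 2 * flat_bracket D"
    unfolding flat_bracket_def
    by (rule bracket_R3[where \<K> = "\<lambda>n. at_A_one (K_var n)", OF D move K_at_one_0]) (simp_all add: smoothing_weight_def)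
  then show "flat_bracket D' = flat_bracket D" by (rule minus_two_cancel)
  obtain b \<tau> where tp: "tangle_pair D D' 3 s b \<tau> 4 (R3_pos x) (R3_pos' y)"
    and c: "three_crossings D s b x" "three_crossings D' s b y"
    by (rule R3_data[OF D move])
  interpret T: tangle_pair D D' 3 s b \<tau> 4 "R3_pos x" "R3_pos' y" by (rule tp)
  interpret A: three_strands D D' s b \<tau> "R3_pos x" x R3_left "R3_pot (sgnb (b 0)) (sgnb (b 1)) (sgnb (b 2))"
    "R3_mean (sgnb (b 0)) (sgnb (b 1)) (sgnb (b 2))" by (rule R3_sides(1)[OF tp c])
  interpret B: three_strands D' D s b \<tau> "R3_pos' y" y R3_left' "R3_pot' (sgnb (b 0)) (sgnb (b 1)) (sgnb (b 2))"
    "R3_mean' (sgnb (b 0)) (sgnb (b 1)) (sgnb (b 2))" by (rule R3_sides(2)[OF tp c])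
  have "int (card (crossings D')) = int (card (crossings D))"
    using sum_split_box[OF finite_crossings[OF D(1)] A.Z_box A.Z_distinct, of "\<lambda>_. 1"]
      sum_split_box[OF finite_crossings[OF D(2)] B.Z_box B.Z_distinct, of "\<lambda>_. 1"] T.far_crossings by simp
  then show "card (crossings D') = card (crossings D)" by simp
qed

lemma flat_planar_isotopy_invariant:
  assumes D: "is_flat_diagram D" "is_flat_diagram D'" and move: "flat_planar_isotopy D D' \<Phi>"
  shows "flat_bracket D' = flat_bracket D" "card (crossings D') = card (crossings D)"
proof -
  obtain h where h: "bij h" "crossings D' = h ` crossings D"
    "\<And>p. p \<in> circle_points D' \<Longrightarrow> pt D' p = h (pt D (\<Phi> p))"
    and \<Phi>_bij: "bij_betw \<Phi> (crossing_points D') (crossing_points D)"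
    and data: "\<And>p. p \<in> crossing_points D' \<Longrightarrow> succ (crossing_points D) (\<Phi> p) = \<Phi> (succ (crossing_points D') p)"
    "\<And>p. p \<in> crossing_points D' \<Longrightarrow> partner D (\<Phi> p) = \<Phi> (partner D' p)"
    "\<And>p. p \<in> crossing_points D' \<Longrightarrow> eps D (\<Phi> p) = eps D' p"
    "card (unmarked (ncomp D') (crossing_points D')) = card (unmarked (ncomp D) (crossing_points D))"
    by (rule isotopy_data[OF D move]) blast
  have inj: "inj_on h (crossings D)" using h(1) by (meson bij_def inj_on_subset subset_UNIV)
  have "- 2 * flat_bracket D' = - 2 * flat_bracket D"
    unfolding flat_bracket_def
    by (rule bracket_iso[where K = "\<lambda>n. at_A_one (K_var n)", OF D K_at_one_0 \<Phi>_bij data(1-3) inj h(2) _ data(4)])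
      (use h(3) in \<open>auto simp: crossing_points_def\<close>)
  then show "flat_bracket D' = flat_bracket D" by (rule minus_two_cancel)
  show "card (crossings D') = card (crossings D)" unfolding h(2) by (rule card_image[OF inj])
qed

lemma flat_detour_invariant:
  assumes D: "is_flat_diagram D" "is_flat_diagram D'" and move: "flat_detour D D'"
  shows "flat_bracket D' = flat_bracket D" "card (crossings D') = card (crossings D)"
proof -
  have "- 2 * flat_bracket D' = - 2 * flat_bracket D"
    unfolding flat_bracket_def by (rule bracket_detour[where K = "\<lambda>n. at_A_one (K_var n)", OF D move K_at_one_0])
  then show "flat_bracket D' = flat_bracket D" by (rule minus_two_cancel)
  show "card (crossings D') = card (crossings D)" using move by (simp add: flat_detour_def)
qed

section \<open>The variables that occur\<close>

lemma K_indices_add: "0 \<notin> K_indices p \<Longrightarrow> 0 \<notin> K_indices q \<Longrightarrow> 0 \<notin> K_indices (p + q)"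
  unfolding K_indices_def using keys_add[of p q] by blast

lemma K_indices_mult:
  assumes "0 \<notin> K_indices p" "0 \<notin> K_indices q" shows "0 \<notin> K_indices (p * q)"
proof
  assume "0 \<in> K_indices (p * q)"
  then obtain m where "m \<in> Poly_Mapping.keys (p * q)" "0 \<in> Poly_Mapping.keys m" by (auto simp: K_indices_def)
  moreover from this(1) obtain a b where "a \<in> Poly_Mapping.keys p" "b \<in> Poly_Mapping.keys q" "m = a + b"
    using keys_mult[of p q] by blast
  ultimately show False using assms keys_add[of a b] by (auto simp: K_indices_def)
qed

lemma K_indices_A_pow: "0 \<notin> K_indices (A_pow k)"
  by (simp add: K_indices_def A_pow_def)

lemma K_indices_1: "0 \<notin> K_indices 1"
  using K_indices_A_pow[of 0] by (simp add: A_pow_0)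

lemma K_indices_uminus: "K_indices (- p) = K_indices p"
  by (simp add: K_indices_def)

lemma K_indices_loop_value: "0 \<notin> K_indices loop_value"
  using K_indices_add[of "- A_pow 2" "- A_pow (-2)"] by (simp add: loop_value_def K_indices_uminus K_indices_A_pow)

lemma K_indices_K_var: "0 \<notin> K_indices (K_var n)"
  by (simp add: K_var_def K_indices_1) (simp add: K_indices_def)

lemma K_indices_prod: "(\<And>x. x \<in> S \<Longrightarrow> 0 \<notin> K_indices (f x)) \<Longrightarrow> 0 \<notin> K_indices (prod f S)"
  by (induction S rule: infinite_finite_induct) (simp_all add: K_indices_1 K_indices_mult)

lemma K_indices_power: "0 \<notin> K_indices p \<Longrightarrow> 0 \<notin> K_indices (p ^ n)"
  by (induction n) (simp_all add: K_indices_1 K_indices_mult)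

lemma K_indices_sum: "(\<And>x. x \<in> S \<Longrightarrow> 0 \<notin> K_indices (f x)) \<Longrightarrow> 0 \<notin> K_indices (sum f S)"
  by (induction S rule: infinite_finite_induct) (simp_all add: K_indices_def[of 0] K_indices_add)

lemma K_indices_arrow_polynomial: "finite (K_indices (arrow_polynomial D))" "0 \<notin> K_indices (arrow_polynomial D)"
proof -
  show "finite (K_indices (arrow_polynomial D))" by (simp add: K_indices_def)
  show "0 \<notin> K_indices (arrow_polynomial D)"
    unfolding arrow_polynomial_def state_weight_def state_vars_def
    by (intro K_indices_sum K_indices_mult K_indices_prod K_indices_power K_indices_A_pow K_indices_loop_value K_indices_K_var)
qed

section \<open>Invariance under isotopy\<close>

lemma equivclp_invariant:
  assumes "equivclp R x y" "\<And>x y. R x y \<Longrightarrow> f y = f x" shows "f x = f y"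
  using assms(1) by (induction rule: equivclp_induct) (use assms(2) in auto)

lemma regular_isotopic_invariant:
  assumes "regular_isotopic D D'" shows "arrow_polynomial D = arrow_polynomial D'"
  using assms unfolding regular_isotopic_def
proof (rule equivclp_invariant)
  fix D D' assume a: "is_link_diagram D \<and> is_link_diagram D' \<and> (planar_isotopy D D' \<or> detour D D' \<or> R2 D D' \<or> R3 D D')"
  then have D: "is_link_diagram D" "is_link_diagram D'" by auto
  from a show "arrow_polynomial D' = arrow_polynomial D"
    using planar_isotopy_invariant(1)[OF D] detour_invariant(1)[OF D] R2_invariant(1)[OF D] R3_invariant(1)[OF D] by blast
qed

lemma virtually_isotopic_invariant:
  assumes "virtually_isotopic D D'" shows "normalized_arrow_polynomial D = normalized_arrow_polynomial D'"
  using assms unfolding virtually_isotopic_def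
proof (rule equivclp_invariant)
  fix D D' assume a: "is_link_diagram D \<and> is_link_diagram D' \<and>
    (planar_isotopy D D' \<or> detour D D' \<or> R1 D D' \<or> R2 D D' \<or> R3 D D')"
  then have D: "is_link_diagram D" "is_link_diagram D'" by auto
  have "normalized_arrow_polynomial D' = normalized_arrow_polynomial D"
    if "arrow_polynomial D' = arrow_polynomial D" "writhe D' = writhe D"
    using that by (simp add: normalized_arrow_polynomial_def)
  with a show "normalized_arrow_polynomial D' = normalized_arrow_polynomial D"
    using planar_isotopy_invariant[OF D] detour_invariant[OF D] R1_invariant[OF D] R2_invariant[OF D] R3_invariant[OF D] by blast
qed

lemma flat_regular_isotopic_invariant:
  assumes "flat_regular_isotopic D D'" shows "flat_bracket D = flat_bracket D'"
  using assms unfolding flat_regular_isotopic_def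
proof (rule equivclp_invariant)
  fix D D' :: flat_diagram
  assume a: "is_flat_diagram D \<and> is_flat_diagram D' \<and> ((\<exists>\<Phi>. flat_planar_isotopy D D' \<Phi>) \<or> flat_detour D D' \<or>
      (\<exists>s u v. flat_R2 D D' s u v) \<or> (\<exists>s x y. flat_R3 D D' s x y))"
  then have D: "is_flat_diagram D" "is_flat_diagram D'" by auto
  from a show "flat_bracket D' = flat_bracket D"
    using flat_planar_isotopy_invariant(1)[OF D] flat_detour_invariant(1)[OF D] flat_R2_invariant(1)[OF D]
      flat_R3_invariant(1)[OF D] by blast
qed

lemma flat_isotopic_invariant:
  assumes "flat_isotopic D D'"
  shows "(-1) ^ card (crossings D) * flat_bracket D = (-1) ^ card (crossings D') * flat_bracket D'"
  using assms unfolding flat_isotopic_def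
proof (rule equivclp_invariant)
  let ?f = "\<lambda>D. (-1) ^ card (crossings D) * flat_bracket D"
  fix D D' :: flat_diagram
  assume a: "is_flat_diagram D \<and> is_flat_diagram D' \<and> ((\<exists>\<Phi>. flat_planar_isotopy D D' \<Phi>) \<or> flat_detour D D' \<or>
      (\<exists>s u v. flat_R1 D D' s u v) \<or> (\<exists>s u v. flat_R2 D D' s u v) \<or> (\<exists>s x y. flat_R3 D D' s x y))"
  then have D: "is_flat_diagram D" "is_flat_diagram D'" by auto
  have "?f D' = ?f D" if "flat_planar_isotopy D D' \<Phi>" for \<Phi> using flat_planar_isotopy_invariant[OF D that] by simp
  moreover have "?f D' = ?f D" if "flat_detour D D'" using flat_detour_invariant[OF D that] by simp
  moreover have "?f D' = ?f D" if "flat_R1 D D' s u v" for s u v using flat_R1_invariant[OF D that] by simp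
  moreover have "?f D' = ?f D" if "flat_R2 D D' s u v" for s u v using flat_R2_invariant[OF D that] by simp
  moreover have "?f D' = ?f D" if "flat_R3 D D' s x y" for s x y using flat_R3_invariant[OF D that] by simp
  ultimately show "?f D' = ?f D" using a by blast
qed

theorem theorem6:
  shows "(\<forall>D. is_link_diagram D \<longrightarrow>
            finite (K_indices (arrow_polynomial D)) \<and> 0 \<notin> K_indices (arrow_polynomial D)) \<and>
         (\<forall>D D'. is_link_diagram D \<and> is_link_diagram D' \<and> regular_isotopic D D' \<longrightarrow>
            arrow_polynomial D = arrow_polynomial D') \<and>
         (\<forall>D D'. is_link_diagram D \<and> is_link_diagram D' \<and> virtually_isotopic D D' \<longrightarrow>
            normalized_arrow_polynomial D = normalized_arrow_polynomial D') \<and>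
         (\<forall>D D'. is_link_diagram D \<and> is_link_diagram D' \<and>
            flat_regular_isotopic (flat D) (flat D') \<longrightarrow>
            flat_arrow_polynomial D = flat_arrow_polynomial D') \<and>
         (\<forall>D D'. is_link_diagram D \<and> is_link_diagram D' \<and>
            flat_isotopic (flat D) (flat D') \<longrightarrow>
            (-1) ^ card (crossings D) * flat_arrow_polynomial D =
            (-1) ^ card (crossings D') * flat_arrow_polynomial D')"
proof (intro conjI allI impI)
  fix D D'
  show "finite (K_indices (arrow_polynomial D))" "0 \<notin> K_indices (arrow_polynomial D)"
    by (rule K_indices_arrow_polynomial)+
  show "arrow_polynomial D = arrow_polynomial D'"
    if "is_link_diagram D \<and> is_link_diagram D' \<and> regular_isotopic D D'"
    using that by (blast intro: regular_isotopic_invariant)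
  show "normalized_arrow_polynomial D = normalized_arrow_polynomial D'"
    if "is_link_diagram D \<and> is_link_diagram D' \<and> virtually_isotopic D D'"
    using that by (blast intro: virtually_isotopic_invariant)
  show "flat_arrow_polynomial D = flat_arrow_polynomial D'"
    if "is_link_diagram D \<and> is_link_diagram D' \<and> flat_regular_isotopic (flat D) (flat D')"
    using that flat_regular_isotopic_invariant[of "flat D" "flat D'"]
    by (simp add: flat_bracket_flat flat_arrow_polynomial_bracket)
  show "(-1) ^ card (crossings D) * flat_arrow_polynomial D = (-1) ^ card (crossings D') * flat_arrow_polynomial D'"
    if "is_link_diagram D \<and> is_link_diagram D' \<and> flat_isotopic (flat D) (flat D')"
    using that flat_isotopic_invariant[of "flat D" "flat D'"]
    by (simp add: flat_bracket_flat flat_arrow_polynomial_bracket flat_select)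
qed

end
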